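(* Consider genuinely partially hyperbolic higher rank actions of finitely generated nilpotent groups $\mathcal{H}$ by automorphisms of a torus $\mathbb{T}^N$. Such actions exist: on any torus of even dimension $N\ge 6$ there are irreducible examples, while on any torus of odd dimension $N\ge 9$ there are examples and all of them are reducible. There are no examples on tori of dimension $N\le 5$ and $N=7$.
   Context: An action $\alpha$ of a finitely generated group $\mathcal{H}$ by automorphisms of $\mathbb{T}^N$ is given by a homomorphism $\mathcal{H}\to GL(N,\mathbb{Z})$, where $GL(N,\mathbb{Z})$ is the group of integer $N\times N$ matrices of determinant $\pm1$. The action is genuinely partially hyperbolic if it is ergodic with respect to Lebesgue measure but no element of the action is hyperbolic (Anosov, i.e. has no eigenvalue of absolute value $1$). The paper describes this as equivalent to the simultaneous existence of (1) an element of the action none of whose eigenvalues is a root of unity, and (2) an invariant linear foliation on which there is no exponential expansion/contraction for any element of the action. The action is higher rank if its image contains two elements $A,B$ such that $A^{k_1}B^{k_2}$ is ergodic (as a toral automorphism with respect to Lebesgue measure) for every $(k_1,k_2)\in\mathbb{Z}^2\setminus\{0\}$. The action is irreducible if it has no nontrivial proper invariant rational subspace of $\mathbb{R}^N$ (equivalently, no invariant subtorus of dimension strictly between $0$ and $N$); otherwise it is reducible. *)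

theory Defs
  imports "HOL-Analysis.Analysis" "HOL-Algebra.Generated_Groups"
begin

section \<open>Finitely generated nilpotent groups\<close>

definition finitely_generated_group :: "('a, 'b) monoid_scheme \<Rightarrow> bool" where
  "finitely_generated_group G \<longleftrightarrow>
     group G \<and> (\<exists>S. finite S \<and> S \<subseteq> carrier G \<and> generate G S = carrier G)"

primrec lower_central :: "('a, 'b) monoid_scheme \<Rightarrow> nat \<Rightarrow> 'a set" where
  "lower_central G 0 = carrier G"
| "lower_central G (Suc k) =
     generate G {x \<otimes>\<^bsub>G\<^esub> y \<otimes>\<^bsub>G\<^esub> inv\<^bsub>G\<^esub> x \<otimes>\<^bsub>G\<^esub> inv\<^bsub>G\<^esub> y | x y.
       x \<in> lower_central G k \<and> y \<in> carrier G}"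

definition nilpotent_group :: "('a, 'b) monoid_scheme \<Rightarrow> bool" where
  "nilpotent_group G \<longleftrightarrow> group G \<and> (\<exists>k. lower_central G k = {\<one>\<^bsub>G\<^esub>})"

section \<open>The group $GL(N,Z)$ and eigenvalues of integer matrices\<close>

definition GL_int :: "(int ^ 'n ^ 'n) monoid" where
  "GL_int = \<lparr>carrier = {A. det A = 1 \<or> det A = -1}, mult = (**), one = mat 1\<rparr>"

definition int_mat_eigenvalue :: "int ^ 'n ^ 'n \<Rightarrow> complex \<Rightarrow> bool" where
  "int_mat_eigenvalue A z \<longleftrightarrow>
     (\<exists>v :: complex ^ 'n. v \<noteq> 0 \<and> map_matrix of_int A *v v = z *s v)"

definition hyperbolic_mat :: "int ^ 'n ^ 'n \<Rightarrow> bool" where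
  "hyperbolic_mat A \<longleftrightarrow> (\<forall>z. int_mat_eigenvalue A z \<longrightarrow> norm z \<noteq> 1)"

section \<open>The torus and its automorphisms\<close>

text \<open>Points of the torus are cosets of the integer lattice in \<open>real ^ 'n\<close>.\<close>

definition torus_proj :: "real ^ 'n \<Rightarrow> (real ^ 'n) set" where
  "torus_proj x = {y. \<forall>i. y $ i - x $ i \<in> \<int>}"

definition torus :: "(real ^ 'n) set set" where
  "torus = range torus_proj"

text \<open>Normalized Lebesgue (Haar) measure: the image of Lebesgue measure on the half-open unit
  cube, on the quotient of the Borel sigma-algebra.\<close>

definition torus_measure :: "(real ^ 'n) set measure" where
  "torus_measure =
     distr (restrict_space lborel {x. \<forall>i. 0 \<le> x $ i \<and> x $ i < 1})
       (sigma torus {E. E \<subseteq> torus \<and> torus_proj -` E \<in> sets borel})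
       torus_proj"

text \<open>For \<open>A\<close> in \<open>GL_int\<close> the image of the coset of \<open>x\<close> under \<open>A\<close> is the coset of \<open>A x\<close>,
  so this is the induced map on the quotient.\<close>

definition toral_aut :: "int ^ 'n ^ 'n \<Rightarrow> (real ^ 'n) set \<Rightarrow> (real ^ 'n) set" where
  "toral_aut A E = (\<lambda>x. map_matrix of_int A *v x) ` E"

text \<open>Ergodicity of a family of measure-preserving maps. For a single automorphism the family
  is a singleton, for a group action it is the set of all maps of the action.\<close>

definition ergodic_family :: "'a measure \<Rightarrow> ('a \<Rightarrow> 'a) set \<Rightarrow> bool" where
  "ergodic_family M F \<longleftrightarrow>
     (\<forall>E \<in> sets M. (\<forall>T \<in> F. T -` E \<inter> space M = E) \<longrightarrow>
        emeasure M E = 0 \<or> emeasure M (space M - E) = 0)"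

definition ergodic_mat :: "int ^ 'n ^ 'n \<Rightarrow> bool" where
  "ergodic_mat A \<longleftrightarrow> ergodic_family torus_measure {toral_aut A}"

section \<open>Actions by toral automorphisms\<close>

definition toral_action :: "('h, 'b) monoid_scheme \<Rightarrow> ('h \<Rightarrow> int ^ 'n ^ 'n) \<Rightarrow> bool" where
  "toral_action H \<rho> \<longleftrightarrow> group H \<and> \<rho> \<in> hom H GL_int"

definition genuinely_partially_hyperbolic ::
    "('h, 'b) monoid_scheme \<Rightarrow> ('h \<Rightarrow> int ^ 'n ^ 'n) \<Rightarrow> bool" where
  "genuinely_partially_hyperbolic H \<rho> \<longleftrightarrow>
     ergodic_family torus_measure ((\<lambda>h. toral_aut (\<rho> h)) ` carrier H) \<and>
     (\<forall>h \<in> carrier H. \<not> hyperbolic_mat (\<rho> h))"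

definition higher_rank :: "('h, 'b) monoid_scheme \<Rightarrow> ('h \<Rightarrow> int ^ 'n ^ 'n) \<Rightarrow> bool" where
  "higher_rank H \<rho> \<longleftrightarrow>
     (\<exists>A \<in> \<rho> ` carrier H. \<exists>B \<in> \<rho> ` carrier H. \<forall>(k1 :: int) (k2 :: int). (k1, k2) \<noteq> (0, 0) \<longrightarrow>
        ergodic_mat ((A [^]\<^bsub>GL_int\<^esub> k1) \<otimes>\<^bsub>GL_int\<^esub> (B [^]\<^bsub>GL_int\<^esub> k2)))"

definition rational_subspace :: "(real ^ 'n) set \<Rightarrow> bool" where
  "rational_subspace V \<longleftrightarrow> (\<exists>S. (\<forall>v \<in> S. \<forall>i. v $ i \<in> \<rat>) \<and> V = span S)"

definition irreducible_action :: "('h, 'b) monoid_scheme \<Rightarrow> ('h \<Rightarrow> int ^ 'n ^ 'n) \<Rightarrow> bool" where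
  "irreducible_action H \<rho> \<longleftrightarrow>
     (\<forall>V. rational_subspace V \<and>
          (\<forall>h \<in> carrier H. (\<lambda>x. map_matrix of_int (\<rho> h) *v x) ` V \<subseteq> V) \<longrightarrow>
        V = {0} \<or> V = UNIV)"

definition gph_higher_rank_nilpotent_action ::
    "('h, 'b) monoid_scheme \<Rightarrow> ('h \<Rightarrow> int ^ 'n ^ 'n) \<Rightarrow> bool" where
  "gph_higher_rank_nilpotent_action H \<rho> \<longleftrightarrow>
     finitely_generated_group H \<and> nilpotent_group H \<and> toral_action H \<rho> \<and>
     genuinely_partially_hyperbolic H \<rho> \<and> higher_rank H \<rho>"

end

theory Submission
  imports Defs "Jordan_Normal_Form.Char_Poly" "Berlekamp_Zassenhaus.Factor_Bound"
begin

text \<open>Nonexistence. Split the rational representation into blocks whose commutant contains no nonzero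
  singular matrix. On such a block of a nilpotent group a fixed power of every element acts
  centrally; replace the two independent elements by such powers \<open>a\<close> and \<open>b\<close>. Since \<open>a b\<^sup>t\<close> has an
  eigenvalue of modulus one for every \<open>t\<close>, the pigeonhole principle gives a block on which \<open>a\<close> and \<open>b\<close> have a
  joint eigenvector with eigenvalues of modulus one. The minimal polynomial of the eigenvalue of \<open>a\<close> is
  reciprocal, so this block has even dimension. In dimension 2 or 4 the moduli of the eigenvalues of
  \<open>a\<^sup>k b\<^sup>l\<close> would be 1, \<open>r\<close> or \<open>1 / r\<close> for one function \<open>r\<close> of \<open>(k, l)\<close> that stays bounded along
  infinitely many pairs; as only finitely many integer polynomials have bounded roots and degree, some
  nontrivial \<open>a\<^sup>k b\<^sup>l\<close> would have the eigenvalue 1. All other blocks have dimension at least 2.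

  Ergodicity. The Fourier coefficients of an invariant set are constant along the orbits of the
  transposed matrix, and these orbits are infinite if no eigenvalue is a root of unity.

  Existence. In the number field of degree \<open>2 m\<close> generated by a root \<open>x\<close> of
  \<open>- x\<^sup>2 \<Prod>\<^bsub>1\<le>i<m\<^esub> (i\<^sup>2 - x\<^sup>2) = 1\<close> the elements \<open>x - c\<close> with \<open>\<bar>c\<bar> < m\<close> are units. At an imaginary
  root \<open>(1 - x) / (1 + x)\<close> and \<open>(2 - x) / (2 + x)\<close> have modulus one, and their logarithms at two real
  roots show that they are independent. In odd dimension one adds a pair of independent units of a
  cubic field.\<close>

section \<open>Block decomposition of sets of matrices\<close>

text \<open>For a noncommutative group eigenvectors of different elements do not match, and the
  eigenvalue of modulus one may move between blocks with the element. The Schur condition repairs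
  this: a matrix that commutes with a block and has one rational eigenvalue is scalar there, so a
  central commutator has finite order once one of its eigenvalues is a root of unity. Block
  triangular form is enough, since everything is read off from characteristic polynomials. The
  thresholds come from adding block sizes: one even block of size at least 6 and no block of size 1
  exclude 7, and 9 = 6 + 3, where 3 is the least degree of a number field with two independent
  units. In the construction W(x) = - x^2 prod (i^2 - x^2) vanishes at all integers c with |c| < m,
  so W - 1 equals -1 at these 2 m - 1 points. This yields irreducibility and makes each x - c a
  divisor of W = 1 in the field. As W depends only on x^2, the field has the automorphism x -> - x,
  which inverts (c - x) / (c + x); at an imaginary root it is complex conjugation, whence the
  modulus one.\<close>

lemma char_poly_four_block_lower_left_zero:
  fixes B :: "'a :: idom mat"
  assumes B: "B \<in> carrier_mat n n" and C: "C \<in> carrier_mat n m" and D: "D \<in> carrier_mat m m"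
  shows "char_poly (four_block_mat B C (0\<^sub>m m n) D) = char_poly B * char_poly D"
proof -
  have "char_poly_matrix (four_block_mat B C (0\<^sub>m m n) D) =
      four_block_mat (char_poly_matrix B) (map_mat (\<lambda>a. [:- a:]) C) (0\<^sub>m m n) (char_poly_matrix D)"
    by (rule eq_matI) (use B C D in \<open>auto simp: char_poly_matrix_def four_block_mat_def Let_def\<close>)
  then show ?thesis
    unfolding char_poly_def using B C D
    by (simp add: det_four_block_mat_lower_left_zero[where n = n and m = m])
qed

lemma mat_mult_sum_eq_one:
  fixes L1 :: "'a :: field mat"
  assumes [simp]: "L1 \<in> carrier_mat r n" "L2 \<in> carrier_mat (n - r) n"
    "K1 \<in> carrier_mat n r" "K2 \<in> carrier_mat n (n - r)"
  shows "K1 * L1 + K2 * L2 = 1\<^sub>m n \<Longrightarrow> Z \<in> carrier_mat n m \<Longrightarrow>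
    Z = K1 * (L1 * Z) + K2 * (L2 * Z)"
proof -
  assume s: "K1 * L1 + K2 * L2 = 1\<^sub>m n" and Z: "Z \<in> carrier_mat n m"
  have "Z = (K1 * L1 + K2 * L2) * Z" using s Z by simp
  also have "\<dots> = K1 * L1 * Z + K2 * L2 * Z"
    by (rule add_mult_distrib_mat[of _ n n]) (use Z in \<open>auto intro: mult_carrier_mat[of _ n r] mult_carrier_mat[of _ n "n - r"]\<close>)
  also have "\<dots> = K1 * (L1 * Z) + K2 * (L2 * Z)"
    using Z by (simp add: assoc_mult_mat[of _ n r _ n _ m] assoc_mult_mat[of _ n "n-r" _ n _ m])
  finally show ?thesis .
qed

text \<open>The conclusion of Schur's lemma taken as a definition: the commutant of \<open>S\<close>
  is a division ring. Irreducible sets have this property, but so does the set of all upper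
  triangular matrices. The advantage over irreducibility is that a failure produces a concrete
  nonzero singular matrix to split with.\<close>

definition schur_set :: "nat \<Rightarrow> 'a :: field mat set \<Rightarrow> bool" where
  "schur_set n S \<longleftrightarrow> (\<forall>X \<in> carrier_mat n n. (\<forall>Y\<in>S. X * Y = Y * X) \<longrightarrow> X = 0\<^sub>m n n \<or> det X \<noteq> 0)"

text \<open>Gauss-Jordan elimination: \<open>E * X\<close> is the reduced row echelon form,
  \<open>r\<close> is its rank and \<open>f\<close> gives the pivot columns. A nonzero singular
  \<open>X\<close> has rank strictly between 0 and \<open>n\<close>.\<close>

lemma singular_pivots:
  fixes X :: "'a :: field mat"
  assumes X: "X \<in> carrier_mat n n" and X0: "X \<noteq> 0\<^sub>m n n" and dX: "det X = 0"
  obtains E E' r f where "E \<in> carrier_mat n n" "E' \<in> carrier_mat n n" "E * E' = 1\<^sub>m n" "E' * E = 1\<^sub>m n"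
    "0 < r" "r < n" "\<forall>i<r. f i < n"
    "\<forall>i<r. \<forall>k<n. (E * X) $$ (k, f i) = (if k = i then 1 else 0)"
    "\<forall>i j. r \<le> i \<longrightarrow> i < n \<longrightarrow> j < n \<longrightarrow> (E * X) $$ (i, j) = 0"
proof -
  define T where "T = gauss_jordan_single X"
  note g = gauss_jordan_single[OF X T_def[symmetric]]
  have T: "T \<in> carrier_mat n n" by (rule g(2))
  obtain E E' where E: "T = E * X" "E \<in> carrier_mat n n" "E' \<in> carrier_mat n n"
    "E * E' = 1\<^sub>m n" "E' * E = 1\<^sub>m n" using g(4) by auto
  obtain f where f: "pivot_fun T f n" using g(3) T unfolding row_echelon_form_def by auto
  have dT: "dim_row T = n" using T by simp
  note p = pivot_funD[OF dT f]
  \<comment> \<open>The pivot function takes the value \<open>n\<close> on zero rows, so this counts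
    the nonzero rows; the disjunct \<open>i = n\<close> keeps the least element defined for full
    rank.\<close>
  define r where "r = (LEAST i. i = n \<or> f i = n)"
  have r: "r = n \<or> f r = n" unfolding r_def by (rule LeastI[of _ n]) simp
  have rn: "r \<le> n" unfolding r_def by (rule Least_le) simp
  have lt: "f i < n" if "i < r" for i
    using not_less_Least[of i "\<lambda>i. i = n \<or> f i = n"] that p(1)[of i] rn unfolding r_def[symmetric]
    by auto
  have ge: "f i = n" if "r \<le> i" "i < n" for i
    using that
  proof (induction i rule: dec_induct)
    case base then show ?case using r by auto
  next
    case (step i)
    then have "f i = n" by simp
    then show ?case using p(3)[of i] p(1)[of "Suc i"] step by auto
  qed
  have z: "T $$ (i, j) = 0" if "r \<le> i" "i < n" "j < n" for i j
    using p(2)[of i j] ge[of i] that by auto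
  have dEX: "det T = det E * det X" unfolding E(1) by (rule det_mult[OF E(2) X])
  \<comment> \<open>With \<open>n\<close> pivots the last row is nonzero, which makes the echelon
    form the identity and contradicts \<open>det X = 0\<close>.\<close>
  have "r \<noteq> n"
  proof
    assume "r = n"
    have "n \<noteq> 0" using X X0 by (auto intro!: eq_matI)
    have "row T (n - 1) \<noteq> 0\<^sub>v n" 
      using lt[of "n - 1"] \<open>r = n\<close> \<open>n \<noteq> 0\<close> pivot_fun_zero_row_iff[OF f T, of "n - 1"] by auto
    then have "T = 1\<^sub>m n" using row_echelon_form_imp_1_or_0_row[OF T g(3)] by auto
    then show False using dEX dX by simp
  qed
  have "r \<noteq> 0"
  proof
    assume "r = 0"
    then have "T = 0\<^sub>m n n" using z T by (intro eq_matI) auto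
    have "X = 1\<^sub>m n * X" using X by simp
    also have "\<dots> = E' * E * X" using E(5) by simp
    also have "\<dots> = E' * T" unfolding E(1) by (rule assoc_mult_mat[OF E(3) E(2) X])
    finally have "X = 0\<^sub>m n n" using \<open>T = 0\<^sub>m n n\<close> E(3) by simp
    then show False using X0 by simp
  qed
  show ?thesis
  proof (rule that[OF E(2-5)])
    show "0 < r" "r < n" using \<open>r \<noteq> 0\<close> \<open>r \<noteq> n\<close> rn by auto
    show "\<forall>i<r. \<forall>k<n. (E * X) $$ (k, f i) = (if k = i then 1 else 0)"
      using p(4,5) lt rn unfolding E(1)[symmetric] by auto
  qed (use lt z E(1) in auto)
qed

lemma mult_assoc_dim:
  "dim_col A = dim_row B \<Longrightarrow> dim_col B = dim_row C \<Longrightarrow> (A * B) * C = A * (B * C :: 'a :: semiring_0 mat)"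
  by (rule assoc_mult_mat[of _ "dim_row A" "dim_row B" _ "dim_row C" _ "dim_col C"]) auto

lemma mult_carrier_dim: "dim_row A = n \<Longrightarrow> dim_col B = m \<Longrightarrow> A * B \<in> carrier_mat n m"
  by (rule carrier_matI) simp_all

text \<open>The image of \<open>X\<close> is mapped into itself by every \<open>Y\<close> that
  commutes with \<open>X\<close>. In the coordinates given by \<open>E\<close> this image is spanned
  by the first \<open>r\<close> unit vectors, so all \<open>E * Y * E'\<close> are block upper
  triangular. \<open>L1\<close>, \<open>L2\<close> are the upper and lower rows of \<open>E\<close>,
  and \<open>K1\<close>, \<open>K2\<close> the left and right columns of its inverse
  \<open>E'\<close>.\<close>

lemma commuting_block_split:
  fixes X :: "'a :: field mat"
  assumes X: "X \<in> carrier_mat n n" and X0: "X \<noteq> 0\<^sub>m n n" and dX: "det X = 0"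
    and S: "S \<subseteq> carrier_mat n n" and XY: "\<And>Y. Y \<in> S \<Longrightarrow> X * Y = Y * X"
  obtains r L1 L2 K1 K2 where "0 < r" "r < n" "L1 \<in> carrier_mat r n" "L2 \<in> carrier_mat (n - r) n"
    "K1 \<in> carrier_mat n r" "K2 \<in> carrier_mat n (n - r)" "L1 * K1 = 1\<^sub>m r" "L2 * K2 = 1\<^sub>m (n - r)"
    "\<forall>Y\<in>S. char_poly Y = char_poly (L1 * Y * K1) * char_poly (L2 * Y * K2)"
    "\<forall>Y\<in>S. \<forall>Z\<in>S. (L1 * Y * K1) * (L1 * Z * K1) = L1 * (Y * Z) * K1"
    "\<forall>Y\<in>S. \<forall>Z\<in>S. (L2 * Y * K2) * (L2 * Z * K2) = L2 * (Y * Z) * K2"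
proof -
  obtain E E' r f where E: "E \<in> carrier_mat n n" "E' \<in> carrier_mat n n" "E * E' = 1\<^sub>m n" "E' * E = 1\<^sub>m n"
    and r: "0 < r" "r < n" and f: "\<forall>i<r. f i < n"
    and p: "\<forall>i<r. \<forall>k<n. (E * X) $$ (k, f i) = (if k = i then 1 else 0)"
    and z: "\<forall>i j. r \<le> i \<longrightarrow> i < n \<longrightarrow> j < n \<longrightarrow> (E * X) $$ (i, j) = 0"
    by (rule singular_pivots[OF X X0 dX]) (rule that)
  note f = f[rule_format] and p = p[rule_format] and z = z[rule_format]
  define L1 where "L1 = mat r n (\<lambda>(i, j). E $$ (i, j))"
  define L2 where "L2 = mat (n - r) n (\<lambda>(i, j). E $$ (i + r, j))"
  define K1 where "K1 = mat n r (\<lambda>(i, j). E' $$ (i, j))"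
  define K2 where "K2 = mat n (n - r) (\<lambda>(i, j). E' $$ (i, j + r))"
  have c[simp]: "L1 \<in> carrier_mat r n" "L2 \<in> carrier_mat (n - r) n"
    "K1 \<in> carrier_mat n r" "K2 \<in> carrier_mat n (n - r)"
    by (auto simp: L1_def L2_def K1_def K2_def)
  note dims[simp] = carrier_matD[OF c(1)] carrier_matD[OF c(2)] carrier_matD[OF c(3)] carrier_matD[OF c(4)] carrier_matD[OF X]
  have rows: "row L1 i = row E i" if "i < r" for i
    using that r E by (auto simp: L1_def)
  have rows2: "row L2 i = row E (i + r)" if "i < n - r" for i
    using that r E by (auto simp: L2_def)
  have cols: "col K1 i = col E' i" if "i < r" for i
    using that r E by (auto simp: K1_def)
  have cols2: "col K2 i = col E' (i + r)" if "i < n - r" for i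
    using that r E by (auto simp: K2_def)
  have EE: "row E i \<bullet> col E' j = (if i = j then 1 else 0)" if "i < n" "j < n" for i j
  proof -
    have "row E i \<bullet> col E' j = (E * E') $$ (i, j)" using that E(1,2) by simp
    then show ?thesis unfolding E(3) using that by simp
  qed
  have one: "L1 * K1 = 1\<^sub>m r" "L2 * K2 = 1\<^sub>m (n - r)"
    using r by (auto intro!: eq_matI simp: rows cols rows2 cols2 EE L1_def[THEN arg_cong[of _ _ dim_row]]
        c[THEN carrier_matD(1)] c[THEN carrier_matD(2)])
  have sum1: "K1 * L1 + K2 * L2 = 1\<^sub>m n"
  proof (rule eq_matI)
    fix i j assume ij: "i < dim_row (1\<^sub>m n :: 'a mat)" "j < dim_col (1\<^sub>m n :: 'a mat)"
    have "(K1 * L1 + K2 * L2) $$ (i, j) =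
        (\<Sum>k<r. E' $$ (i, k) * E $$ (k, j)) + (\<Sum>k<n-r. E' $$ (i, k + r) * E $$ (k + r, j))"
      using ij r by (simp add: K1_def K2_def L1_def L2_def scalar_prod_def lessThan_atLeast0)
    also have "(\<Sum>k<n-r. E' $$ (i, k + r) * E $$ (k + r, j)) = (\<Sum>k\<in>{r..<n}. E' $$ (i, k) * E $$ (k, j))"
      using r by (intro sum.reindex_bij_witness[of _ "\<lambda>k. k - r" "\<lambda>k. k + r"]) auto
    also have "(\<Sum>k<r. E' $$ (i, k) * E $$ (k, j)) + \<dots> = (\<Sum>k<n. E' $$ (i, k) * E $$ (k, j))"
      using r by (subst sum.union_disjoint[symmetric]) (auto intro!: sum.cong)
    also have "\<dots> = (E' * E) $$ (i, j)"
      using ij E(1,2) by (simp add: scalar_prod_def lessThan_atLeast0)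
    finally show "(K1 * L1 + K2 * L2) $$ (i, j) = (1\<^sub>m n :: 'a mat) $$ (i, j)" unfolding E(4) .
  qed (auto simp: c[THEN carrier_matD(1)] c[THEN carrier_matD(2)])
  note split = mat_mult_sum_eq_one[OF c sum1]
  have L2X: "L2 * X = 0\<^sub>m (n - r) n"
  proof (rule eq_matI)
    fix i j assume ij: "i < dim_row (0\<^sub>m (n - r) n :: 'a mat)" "j < dim_col (0\<^sub>m (n - r) n :: 'a mat)"
    have "(L2 * X) $$ (i, j) = (E * X) $$ (i + r, j)"
      using ij X E rows2[of i] by (simp add: c[THEN carrier_matD(1)])
    then show "(L2 * X) $$ (i, j) = (0\<^sub>m (n - r) n :: 'a mat) $$ (i, j)"
      using z[of "i + r" j] ij by simp
  qed (use X in \<open>auto simp: c[THEN carrier_matD(1)]\<close>)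
  have L1X: "(L1 * X) $$ (k, f i) = (if k = i then 1 else 0)" if "k < r" "i < r" for i k
    using that X E rows[of k] p[of i k] f[of i] r by (simp add: c[THEN carrier_matD(1)])
  \<comment> \<open>\<open>L2 * Y * X = L2 * X * Y = 0\<close> and \<open>X = K1 * (L1 * X)\<close>,
    so the product of \<open>L2 * Y * K1\<close> with \<open>L1 * X\<close> is zero. The pivot
    columns of \<open>L1 * X\<close> are the unit vectors, hence \<open>L2 * Y * K1\<close> itself
    is zero.\<close>
  have low: "L2 * Y * K1 = 0\<^sub>m (n - r) r" if Y: "Y \<in> S" for Y
  proof -
    have Yc: "Y \<in> carrier_mat n n" using S Y by auto
    note a[simp] = Yc X carrier_matD[OF Yc]
    define M where "M = L2 * Y * K1"
    have M: "M \<in> carrier_mat (n - r) r" unfolding M_def by (auto intro!: mult_carrier_dim)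
    have e1: "X = K1 * (L1 * X)"
    proof -
      have "K1 * (L1 * X) \<in> carrier_mat n n" by (auto intro!: mult_carrier_dim)
      then show ?thesis using split[OF X] unfolding L2X right_mult_zero_mat[OF c(4)] by simp
    qed
    have "M * (L1 * X) = L2 * Y * (K1 * (L1 * X))"
      unfolding M_def by (rule assoc_mult_mat) (auto intro!: mult_carrier_dim)
    also have "\<dots> = L2 * Y * X" using e1 by simp
    also have "\<dots> = L2 * (Y * X)" by (rule assoc_mult_mat) auto
    also have "\<dots> = L2 * (X * Y)" using XY[OF Y] by simp
    also have "\<dots> = L2 * X * Y" by (rule assoc_mult_mat[symmetric]) auto
    also have "\<dots> = 0\<^sub>m (n - r) n" unfolding L2X by (simp add: left_mult_zero_mat[OF Yc])
    finally have M0: "M * (L1 * X) = 0\<^sub>m (n - r) n" .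
    show ?thesis unfolding M_def[symmetric]
    proof (rule eq_matI)
      fix j i assume ij: "j < dim_row (0\<^sub>m (n - r) r :: 'a mat)" "i < dim_col (0\<^sub>m (n - r) r :: 'a mat)"
      have "(M * (L1 * X)) $$ (j, f i) = (\<Sum>k\<in>{0..<r}. M $$ (j, k) * (L1 * X) $$ (k, f i))"
        using ij M f[of i] by (simp add: scalar_prod_def carrier_matD[OF X] carrier_matD[OF c(1)] del: index_mult_mat)
         (simp add: carrier_matD[OF X] carrier_matD[OF c(1)] scalar_prod_def carrier_matD[OF M])
      also have "\<dots> = (\<Sum>k\<in>{0..<r}. if k = i then M $$ (j, k) else 0)"
        using ij by (intro sum.cong) (auto simp: L1X)
      also have "\<dots> = M $$ (j, i)" using ij by simp
      finally show "M $$ (j, i) = (0\<^sub>m (n - r) r :: 'a mat) $$ (j, i)" using M0 ij f[of i] by simp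
    qed (use M in auto)
  qed
  \<comment> \<open>Insert \<open>K1 * L1 + K2 * L2 = 1\<close> between \<open>Y\<close> and
    \<open>Z\<close>; the mixed term contains the lower left block of \<open>Z\<close> or of
    \<open>Y\<close> and vanishes.\<close>
  have mult1: "(L1 * Y * K1) * (L1 * Z * K1) = L1 * (Y * Z) * K1"
    and mult2: "(L2 * Y * K2) * (L2 * Z * K2) = L2 * (Y * Z) * K2" if "Y \<in> S" "Z \<in> S" for Y Z
  proof -
    have a[simp]: "Y \<in> carrier_mat n n" "Z \<in> carrier_mat n n" using S that by auto
    note b[simp] = carrier_matD[OF a(1)] carrier_matD[OF a(2)]
    note as = mult_assoc_dim
    have z1: "L2 * (Z * K1) = 0\<^sub>m (n - r) r"
      using low[OF that(2)] by (simp add: as)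
    have "Z * K1 = K1 * (L1 * (Z * K1)) + K2 * (L2 * (Z * K1))"
      by (rule split[of "Z * K1" r]) (auto intro!: mult_carrier_dim)
    moreover have "K1 * (L1 * (Z * K1)) \<in> carrier_mat n r" by (auto intro!: mult_carrier_dim)
    ultimately have s1: "K1 * (L1 * (Z * K1)) = Z * K1" unfolding z1 right_mult_zero_mat[OF c(4)] by simp
    show "(L1 * Y * K1) * (L1 * Z * K1) = L1 * (Y * Z) * K1"
      by (simp add: as s1)
    have t: "Z * K2 = K1 * (L1 * (Z * K2)) + K2 * (L2 * (Z * K2))"
      by (rule split[of "Z * K2" "n-r"]) (auto intro!: mult_carrier_dim)
    have "L2 * (Y * (Z * K2)) = L2 * Y * (K1 * (L1 * (Z * K2)) + K2 * (L2 * (Z * K2)))"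
      using t by (simp add: as)
    also have "\<dots> = L2 * Y * (K1 * (L1 * (Z * K2))) + L2 * Y * (K2 * (L2 * (Z * K2)))"
      by (rule mult_add_distrib_mat[of _ "n - r" n _ "n - r"]) (auto intro!: mult_carrier_dim)
    also have "L2 * Y * (K1 * (L1 * (Z * K2))) = (L2 * Y * K1) * (L1 * (Z * K2))"
      by (rule assoc_mult_mat[of _ "n-r" n _ r _ "n-r", symmetric]) (auto intro!: mult_carrier_dim)
    also have "\<dots> = 0\<^sub>m (n - r) (n - r)" unfolding low[OF that(1)]
      by (rule left_mult_zero_mat) (auto intro!: mult_carrier_dim)
    also have "0\<^sub>m (n - r) (n - r) + L2 * Y * (K2 * (L2 * (Z * K2))) = L2 * Y * (K2 * (L2 * (Z * K2)))"
      by (rule left_add_zero_mat) (auto intro!: mult_carrier_dim)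
    finally have "L2 * (Y * (Z * K2)) = L2 * Y * (K2 * (L2 * (Z * K2)))" .
    then show "(L2 * Y * K2) * (L2 * Z * K2) = L2 * (Y * Z) * K2"
      by (simp add: as)
  qed
  have cp: "char_poly Y = char_poly (L1 * Y * K1) * char_poly (L2 * Y * K2)" if Y: "Y \<in> S" for Y
  proof -
    have Yc: "Y \<in> carrier_mat n n" using S Y by auto
    have "E' * (E * Y * E') * E = (E' * E) * Y * (E' * E)"
      using E(1,2) Yc by (simp add: mult_assoc_dim)
    then have "similar_mat Y (E * Y * E')"
      by (intro similar_matI[of _ _ E' E n]) (use E Yc in auto)
    then have "char_poly Y = char_poly (E * Y * E')" by (rule char_poly_similar)
    also have "E * Y * E' = four_block_mat (L1 * Y * K1) (L1 * Y * K2) (0\<^sub>m (n - r) r) (L2 * Y * K2)"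
    proof -
      have EY: "E * Y * E' = four_block_mat (L1 * Y * K1) (L1 * Y * K2) (L2 * Y * K1) (L2 * Y * K2)"
      proof -
        have R1: "row (L1 * Y) i = row (E * Y) i" if "i < r" for i
          using that r E(1) Yc by (intro eq_vecI) (auto simp: rows)
        have R2: "row (L2 * Y) i = row (E * Y) (i + r)" if "i < n - r" for i
          using that r E(1) Yc by (intro eq_vecI) (auto simp: rows2)
        show ?thesis
        proof (rule eq_matI)
          fix i j assume ij: "i < dim_row (four_block_mat (L1 * Y * K1) (L1 * Y * K2) (L2 * Y * K1) (L2 * Y * K2))"
            "j < dim_col (four_block_mat (L1 * Y * K1) (L1 * Y * K2) (L2 * Y * K1) (L2 * Y * K2))"
          then have ij': "i < n" "j < n" using r by auto
          have c1: "col E' j = col K2 (j - r)" if "\<not> j < r" using cols2[of "j - r"] that ij' by simp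
          have c2: "row (E * Y) i = row (L2 * Y) (i - r)" if "\<not> i < r" using R2[of "i - r"] that ij' by simp
          have "(E * Y * E') $$ (i, j) = row (E * Y) i \<bullet> col E' j" using ij' E by simp
          also have "\<dots> = four_block_mat (L1 * Y * K1) (L1 * Y * K2) (L2 * Y * K1) (L2 * Y * K2) $$ (i, j)"
            using ij' ij by (cases "i < r"; cases "j < r") (simp_all add: R1[symmetric] c1 c2 cols[symmetric])
          finally show "(E * Y * E') $$ (i, j) = four_block_mat (L1 * Y * K1) (L1 * Y * K2) (L2 * Y * K1) (L2 * Y * K2) $$ (i, j)" .
        qed (use r E in auto)
      qed
      show ?thesis unfolding EY low[OF Y] ..
    qed
    also have "char_poly \<dots> = char_poly (L1 * Y * K1) * char_poly (L2 * Y * K2)"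
      by (rule char_poly_four_block_lower_left_zero) (use carrier_matD[OF Yc] in \<open>auto intro!: mult_carrier_dim\<close>)
    finally show ?thesis .
  qed
  show ?thesis
    by (rule that[of r L1 L2 K1 K2]) (use r one mult1 mult2 cp in auto)
qed

text \<open>A subquotient of the representation, encoded by matrices in place of subspaces:
  \<open>Y\<close> acts on it as \<open>L * Y * K\<close>. That this compression is multiplicative
  on \<open>S\<close> is demanded explicitly, since \<open>L * K = 1\<close> alone does not give
  it.\<close>

definition schur_block :: "nat \<Rightarrow> 'a :: field mat set \<Rightarrow> nat \<times> 'a mat \<times> 'a mat \<Rightarrow> bool" where
  "schur_block n S = (\<lambda>(d, L, K). 0 < d \<and> L \<in> carrier_mat d n \<and> K \<in> carrier_mat n d \<and> L * K = 1\<^sub>m d \<and>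
     schur_set d ((\<lambda>Y. L * Y * K) ` S) \<and>
     (\<forall>Y\<in>S. \<forall>Z\<in>S. (L * Y * K) * (L * Z * K) = L * (Y * Z) * K))"

text \<open>Transitivity: a subquotient of a subquotient is a subquotient.\<close>

lemma schur_block_lift:
  fixes L1 :: "'a :: field mat"
  assumes S: "S \<subseteq> carrier_mat n n" and L1: "L1 \<in> carrier_mat r n" and K1: "K1 \<in> carrier_mat n r"
    and one: "L1 * K1 = 1\<^sub>m r"
    and m: "\<And>Y Z. Y \<in> S \<Longrightarrow> Z \<in> S \<Longrightarrow> (L1 * Y * K1) * (L1 * Z * K1) = L1 * (Y * Z) * K1"
    and b: "schur_block r ((\<lambda>Y. L1 * Y * K1) ` S) (d, L, K)"
  shows "schur_block n S (d, L * L1, K1 * K)"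
    and "\<And>Y. Y \<in> carrier_mat n n \<Longrightarrow> (L * L1) * Y * (K1 * K) = L * (L1 * Y * K1) * K"
proof -
  have L: "L \<in> carrier_mat d r" and K: "K \<in> carrier_mat r d" and LK: "L * K = 1\<^sub>m d" 
    and sch: "schur_set d ((\<lambda>Y. L * Y * K) ` (\<lambda>Y. L1 * Y * K1) ` S)" and d: "0 < d"
    and mm: "\<And>Y Z. Y \<in> S \<Longrightarrow> Z \<in> S \<Longrightarrow> (L * (L1 * Y * K1) * K) * (L * (L1 * Z * K1) * K) = L * ((L1 * Y * K1) * (L1 * Z * K1)) * K"
    using b unfolding schur_block_def by auto
  show eq: "(L * L1) * Y * (K1 * K) = L * (L1 * Y * K1) * K" if "Y \<in> carrier_mat n n" for Y
  proof -
    have c: "L1 * Y \<in> carrier_mat r n" "K1 * K \<in> carrier_mat n d" "L1 * Y * K1 \<in> carrier_mat r r"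
      using that K L1 K1 by (auto intro!: mult_carrier_mat)
    have "(L * L1) * Y * (K1 * K) = L * (L1 * Y) * (K1 * K)"
      using assoc_mult_mat[OF L L1 that] by simp
    also have "\<dots> = L * ((L1 * Y) * (K1 * K))" by (rule assoc_mult_mat[OF L c(1,2)])
    also have "(L1 * Y) * (K1 * K) = L1 * Y * K1 * K" by (rule assoc_mult_mat[OF c(1) K1 K, symmetric])
    also have "L * (L1 * Y * K1 * K) = L * (L1 * Y * K1) * K" by (rule assoc_mult_mat[OF L c(3) K, symmetric])
    finally show ?thesis .
  qed
  have "(L * L1) * (K1 * K) = L * (L1 * K1) * K"
    using L K L1 K1 by (simp add: mult_assoc_dim)
  then have o: "(L * L1) * (K1 * K) = 1\<^sub>m d" using one L LK by simp
  have im: "(\<lambda>Y. (L * L1) * Y * (K1 * K)) ` S = (\<lambda>Y. L * Y * K) ` (\<lambda>Y. L1 * Y * K1) ` S"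
    unfolding image_image using S eq by (intro image_cong) auto
  have "(L * L1) * Y * (K1 * K) * ((L * L1) * Z * (K1 * K)) = (L * L1) * (Y * Z) * (K1 * K)"
    if "Y \<in> S" "Z \<in> S" for Y Z
  proof -
    have c: "Y \<in> carrier_mat n n" "Z \<in> carrier_mat n n" using that S by auto
    show ?thesis unfolding eq[OF c(1)] eq[OF c(2)] eq[OF mult_carrier_mat[OF c]] mm[OF that] m[OF that] ..
  qed
  then show "schur_block n S (d, L * L1, K1 * K)"
    unfolding schur_block_def using d o sch L K L1 K1 by (auto simp: im intro!: mult_carrier_mat)
qed

text \<open>Strong induction on \<open>n\<close>: either \<open>S\<close> has the Schur property, or
  a commuting singular matrix splits it into two smaller blocks. No complement of the invariant
  subspace is chosen, because the characteristic polynomial only sees the diagonal blocks.\<close>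

theorem schur_block_decomposition:
  fixes S :: "'a :: field mat set"
  assumes "S \<subseteq> carrier_mat n n"
  shows "\<exists>bs. (\<forall>b\<in>set bs. schur_block n S b) \<and> sum_list (map fst bs) = n \<and>
    (\<forall>Y\<in>S. char_poly Y = (\<Prod>(d, L, K) \<leftarrow> bs. char_poly (L * Y * K)))"
  using assms
proof (induction n arbitrary: S rule: less_induct)
  case (less n S)
  show ?case
  proof (cases "n = 0")
    case True
    have "char_poly Y = 1" if "Y \<in> S" for Y
      using that less.prems True by (auto simp: char_poly_def char_poly_matrix_def det_def)
    then show ?thesis using True by (intro exI[of _ "[]"]) auto
  next
    case n: False
    show ?thesis
    proof (cases "schur_set n S")
      case True
      have "(\<lambda>Y. 1\<^sub>m n * Y * 1\<^sub>m n) ` S = (\<lambda>Y. Y) ` S"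
        by (rule image_cong[OF refl]) (use less.prems in auto)
      moreover have "1\<^sub>m n * Y * 1\<^sub>m n = Y" if "Y \<in> S" for Y :: "'a mat"
        using that less.prems by auto
      moreover have "1\<^sub>m n * (Y * Z) * 1\<^sub>m n = Y * Z" if "Y \<in> S" "Z \<in> S" for Y Z
        using that less.prems by (auto intro!: mult_carrier_mat[of _ n n]
          simp: left_mult_one_mat[of _ n n] right_mult_one_mat[of _ n n] mult_carrier_mat[of _ n n _ n] subset_iff)
      ultimately have "schur_block n S (n, 1\<^sub>m n, 1\<^sub>m n)"
        unfolding schur_block_def using True n by auto
      then show ?thesis using less.prems
        by (intro exI[of _ "[(n, 1\<^sub>m n, 1\<^sub>m n)]"]) (auto dest!: subsetD)
    next
      case False
      then obtain X where X: "X \<in> carrier_mat n n" "\<And>Y. Y \<in> S \<Longrightarrow> X * Y = Y * X" "X \<noteq> 0\<^sub>m n n" "det X = 0"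
        unfolding schur_set_def by auto
      obtain r L1 L2 K1 K2 where r: "0 < r" "r < n" and L: "L1 \<in> carrier_mat r n" "L2 \<in> carrier_mat (n - r) n"
        and K: "K1 \<in> carrier_mat n r" "K2 \<in> carrier_mat n (n - r)" and o: "L1 * K1 = 1\<^sub>m r" "L2 * K2 = 1\<^sub>m (n - r)"
        and cp: "\<forall>Y\<in>S. char_poly Y = char_poly (L1 * Y * K1) * char_poly (L2 * Y * K2)"
        and m1: "\<forall>Y\<in>S. \<forall>Z\<in>S. (L1 * Y * K1) * (L1 * Z * K1) = L1 * (Y * Z) * K1"
        and m2: "\<forall>Y\<in>S. \<forall>Z\<in>S. (L2 * Y * K2) * (L2 * Z * K2) = L2 * (Y * Z) * K2"
        by (rule commuting_block_split[OF X(1,3,4) less.prems X(2)]) (assumption, rule that)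
      note cp = cp[rule_format] and m1 = m1[rule_format] and m2 = m2[rule_format]
      have sub: "(\<lambda>Y. L1 * Y * K1) ` S \<subseteq> carrier_mat r r" "(\<lambda>Y. L2 * Y * K2) ` S \<subseteq> carrier_mat (n - r) (n - r)"
        using less.prems L K mult_carrier_mat[OF mult_carrier_mat[OF L(1)] K(1)]
          mult_carrier_mat[OF mult_carrier_mat[OF L(2)] K(2)] by blast+
      obtain b1 where b1: "\<forall>b\<in>set b1. schur_block r ((\<lambda>Y. L1 * Y * K1) ` S) b" "sum_list (map fst b1) = r"
        "\<forall>Y\<in>(\<lambda>Y. L1 * Y * K1) ` S. char_poly Y = (\<Prod>(d, L, K) \<leftarrow> b1. char_poly (L * Y * K))"
        using less.IH[OF r(2) sub(1)] by (elim exE conjE) (rule that)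
      have nr: "n - r < n" using r by auto
      obtain b2 where b2: "\<forall>b\<in>set b2. schur_block (n - r) ((\<lambda>Y. L2 * Y * K2) ` S) b" "sum_list (map fst b2) = n - r"
        "\<forall>Y\<in>(\<lambda>Y. L2 * Y * K2) ` S. char_poly Y = (\<Prod>(d, L, K) \<leftarrow> b2. char_poly (L * Y * K))"
        using less.IH[OF nr sub(2)] by (elim exE conjE) (rule that)
      define c1 where "c1 = map (\<lambda>(d, L, K). (d, L * L1, K1 * K)) b1"
      define c2 where "c2 = map (\<lambda>(d, L, K). (d, L * L2, K2 * K)) b2"
      have l1: "schur_block r ((\<lambda>Y. L1 * Y * K1) ` S) (d, L, K) \<Longrightarrow> schur_block n S (d, L * L1, K1 * K)"
        "schur_block r ((\<lambda>Y. L1 * Y * K1) ` S) (d, L, K) \<Longrightarrow> Y \<in> carrier_mat n n \<Longrightarrow> (L * L1) * Y * (K1 * K) = L * (L1 * Y * K1) * K"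
        for d L K Y using schur_block_lift[OF less.prems L(1) K(1) o(1)] m1 by blast+
      have l2: "schur_block (n - r) ((\<lambda>Y. L2 * Y * K2) ` S) (d, L, K) \<Longrightarrow> schur_block n S (d, L * L2, K2 * K)"
        "schur_block (n - r) ((\<lambda>Y. L2 * Y * K2) ` S) (d, L, K) \<Longrightarrow> Y \<in> carrier_mat n n \<Longrightarrow> (L * L2) * Y * (K2 * K) = L * (L2 * Y * K2) * K"
        for d L K Y using schur_block_lift[OF less.prems L(2) K(2) o(2)] m2 by blast+
      have B1: "schur_block n S b" if bc: "b \<in> set c1" for b
      proof -
        obtain d L K where "b = (d, L * L1, K1 * K)" "(d, L, K) \<in> set b1"
          using bc unfolding c1_def by auto
        then show ?thesis using l1(1)[of d L K] b1(1) by simp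
      qed
      have B2: "schur_block n S b" if bc: "b \<in> set c2" for b
      proof -
        obtain d L K where "b = (d, L * L2, K2 * K)" "(d, L, K) \<in> set b2"
          using bc unfolding c2_def by auto
        then show ?thesis using l2(1)[of d L K] b2(1) by simp
      qed
      have "\<forall>b\<in>set (c1 @ c2). schur_block n S b" using B1 B2 by auto
      moreover have "map fst c1 = map fst b1" "map fst c2 = map fst b2"
        unfolding c1_def c2_def by (auto simp: case_prod_beta)
      then have "sum_list (map fst (c1 @ c2)) = n" using b1(2) b2(2) r by simp
      moreover have "char_poly Y = (\<Prod>(d, L, K) \<leftarrow> c1 @ c2. char_poly (L * Y * K))" if Y: "Y \<in> S" for Y
      proof -
        have Yc: "Y \<in> carrier_mat n n" using Y less.prems by auto
        have "(\<Prod>(d, L, K) \<leftarrow> c1. char_poly (L * Y * K)) = (\<Prod>(d, L, K) \<leftarrow> b1. char_poly (L * (L1 * Y * K1) * K))"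
          unfolding c1_def map_map
          by (rule arg_cong[of _ _ prod_list], rule map_cong[OF refl])
            (use l1(2)[OF _ Yc] b1(1) in \<open>auto simp: case_prod_beta comp_def\<close>)
        moreover have "(\<Prod>(d, L, K) \<leftarrow> c2. char_poly (L * Y * K)) = (\<Prod>(d, L, K) \<leftarrow> b2. char_poly (L * (L2 * Y * K2) * K))"
          unfolding c2_def map_map
          by (rule arg_cong[of _ _ prod_list], rule map_cong[OF refl])
            (use l2(2)[OF _ Yc] b2(1) in \<open>auto simp: case_prod_beta comp_def\<close>)
        ultimately show ?thesis using cp[OF Y] b1(3) b2(3) Y by simp
      qed
      ultimately show ?thesis by (intro exI[of _ "c1 @ c2"] conjI) auto
    qed
  qed
qed

section \<open>Commuting complex matrices\<close>

lemma char_poly_scalar_mat: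
  "char_poly (c \<cdot>\<^sub>m 1\<^sub>m d :: 'a :: comm_ring_1 mat) = [:- c, 1:] ^ d"
proof -
  have "char_poly (c \<cdot>\<^sub>m 1\<^sub>m d) = (\<Prod>a \<leftarrow> diag_mat (c \<cdot>\<^sub>m 1\<^sub>m d). [:- a, 1:])"
    by (rule char_poly_upper_triangular[of _ d]) (auto simp: upper_triangular_def)
  also have "diag_mat (c \<cdot>\<^sub>m 1\<^sub>m d) = replicate d c"
    by (auto simp: diag_mat_def intro!: nth_equalityI)
  finally show ?thesis by (simp add: prod_list_replicate)
qed

text \<open>\<open>M - k\<close> commutes with \<open>S\<close> and is singular, hence zero. The
  eigenvalue \<open>k\<close> has to lie in the ground field; over the rationals the lemma is
  applied with \<open>k = 1\<close>.\<close>

lemma schur_eigenvalue_scalar: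
  fixes M :: "'a :: field mat"
  assumes S: "S \<subseteq> carrier_mat d d" and sch: "schur_set d S" and Mc: "M \<in> carrier_mat d d"
    and comm: "\<And>Y. Y \<in> S \<Longrightarrow> M * Y = Y * M" and k: "poly (char_poly M) k = 0"
  shows "M = k \<cdot>\<^sub>m 1\<^sub>m d"
proof -
  have k: "det (char_matrix M k) = 0"
    using k eigenvalue_root_char_poly[OF Mc] eigenvalue_det[OF Mc] by simp
  have cm: "char_matrix M k = M + (- k) \<cdot>\<^sub>m 1\<^sub>m d" using Mc by (simp add: char_matrix_def)
  have cc: "char_matrix M k \<in> carrier_mat d d" using Mc cm by simp
  have "char_matrix M k * Y = Y * char_matrix M k" if Y: "Y \<in> S" for Y
  proof -
    have Yc: "Y \<in> carrier_mat d d" using S Y by auto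
    have "char_matrix M k * Y = M * Y + (- k) \<cdot>\<^sub>m 1\<^sub>m d * Y"
      unfolding cm by (rule add_mult_distrib_mat[of _ d d _ _ d]) (use Mc Yc in auto)
    also have "(- k) \<cdot>\<^sub>m 1\<^sub>m d * Y = (-k) \<cdot>\<^sub>m Y" using Yc by (simp add: mult_smult_assoc_mat[OF one_carrier_mat Yc])
    also have "\<dots> = Y * ((- k) \<cdot>\<^sub>m 1\<^sub>m d)" using Yc by (simp add: mult_smult_distrib[OF Yc one_carrier_mat])
    also have "M * Y = Y * M" by (rule comm[OF Y])
    also have "Y * M + Y * ((- k) \<cdot>\<^sub>m 1\<^sub>m d) = Y * char_matrix M k"
      unfolding cm by (rule mult_add_distrib_mat[of _ d d _ d, symmetric]) (use Mc Yc in auto)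
    finally show ?thesis .
  qed
  then have "char_matrix M k = 0\<^sub>m d d" using sch cc k unfolding schur_set_def by auto
  then have e: "(M + (- k) \<cdot>\<^sub>m 1\<^sub>m d) $$ (i, j) = (0\<^sub>m d d :: 'a mat) $$ (i, j)" for i j
    unfolding cm by simp
  have M: "M $$ (i, j) = (k \<cdot>\<^sub>m 1\<^sub>m d) $$ (i, j)" if "i < d" "j < d" for i j
    using e[of i j] that Mc by (auto split: if_splits)
  show ?thesis by (rule eq_matI) (use Mc M in auto)
qed

lemma schur_commuting_scalar:
  fixes S :: "complex mat set"
  assumes d: "0 < d" and S: "S \<subseteq> carrier_mat d d" and sch: "schur_set d S"
    and comm: "\<And>Y Z. Y \<in> S \<Longrightarrow> Z \<in> S \<Longrightarrow> Y * Z = Z * Y" and M: "M \<in> S"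
  shows "M = (M $$ (0, 0)) \<cdot>\<^sub>m 1\<^sub>m d"
proof -
  have Mc: "M \<in> carrier_mat d d" using S M by auto
  have "degree (char_poly M) = d" using degree_monic_char_poly[OF Mc] by simp
  then have "\<not> constant (poly (char_poly M))" using d by (simp add: constant_degree)
  then obtain k where k: "poly (char_poly M) k = 0" using fundamental_theorem_of_algebra by blast
  have Mk: "M = k \<cdot>\<^sub>m 1\<^sub>m d" by (rule schur_eigenvalue_scalar[OF S sch Mc comm[OF M] k])
  have "M $$ (0, 0) = k" unfolding Mk using d by simp
  with Mk show ?thesis by simp
qed

text \<open>A substitute for simultaneous triangularisation: over the complex numbers a commuting
  family acts on each Schur block by scalars, and these scalars are the joint eigenvalues as
  multiplicative functions of the matrix.\<close>

theorem commuting_characters: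
  fixes S :: "complex mat set"
  assumes S: "S \<subseteq> carrier_mat n n" and comm: "\<And>Y Z. Y \<in> S \<Longrightarrow> Z \<in> S \<Longrightarrow> Y * Z = Z * Y"
  shows "\<exists>cs :: (complex mat \<Rightarrow> complex) list. length cs = n \<and>
     (\<forall>\<theta>\<in>set cs. \<theta> (1\<^sub>m n) = 1 \<and> (\<forall>Y\<in>S. \<forall>Z\<in>S. \<theta> (Y * Z) = \<theta> Y * \<theta> Z)) \<and>
     (\<forall>Y\<in>S. char_poly Y = (\<Prod>\<theta> \<leftarrow> cs. [:- \<theta> Y, 1:]))"
proof -
  obtain bs where b: "\<forall>b\<in>set bs. schur_block n S b" and sl: "sum_list (map fst bs) = n"
    and cp: "\<forall>Y\<in>S. char_poly Y = (\<Prod>(d, L, K) \<leftarrow> bs. char_poly (L * Y * K))"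
    using schur_block_decomposition[OF S] by (elim exE conjE) (rule that)
  \<comment> \<open>The scalar by which \<open>Y\<close> acts is read off at the entry (0, 0). This
    makes sense for every matrix, so the value at the identity is 1 whether or not the identity
    belongs to \<open>S\<close>.\<close>
  define ch :: "nat \<times> complex mat \<times> complex mat \<Rightarrow> complex mat \<Rightarrow> complex"
    where "ch = (\<lambda>(d, L, K) Y. (L * Y * K) $$ (0, 0))"
  define cs where "cs = concat (map (\<lambda>b. replicate (fst b) (ch b)) bs)"
  have sc: "L * Y * K = ch (d, L, K) Y \<cdot>\<^sub>m 1\<^sub>m d" if bb: "(d, L, K) \<in> set bs" and Y: "Y \<in> S" for d L K Y
  proof -
    have sb: "0 < d" "L \<in> carrier_mat d n" "K \<in> carrier_mat n d"
      "schur_set d ((\<lambda>Y. L * Y * K) ` S)"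
      "\<forall>Y\<in>S. \<forall>Z\<in>S. (L * Y * K) * (L * Z * K) = L * (Y * Z) * K"
      using b bb unfolding schur_block_def by auto
    show ?thesis unfolding ch_def prod.case
    proof (rule schur_commuting_scalar[OF sb(1) _ sb(4)])
      show "(\<lambda>Y. L * Y * K) ` S \<subseteq> carrier_mat d d"
        using sb(2,3) by (auto intro!: mult_carrier_dim)
      show "L * Y * K \<in> (\<lambda>Y. L * Y * K) ` S" using Y by blast
      fix A B assume "A \<in> (\<lambda>Y. L * Y * K) ` S" "B \<in> (\<lambda>Y. L * Y * K) ` S"
      then obtain Y' Z' where "A = L * Y' * K" "B = L * Z' * K" "Y' \<in> S" "Z' \<in> S" by auto
      then show "A * B = B * A" using sb(5) comm[of Y' Z'] by simp
    qed
  qed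
  have chm: "\<theta> (1\<^sub>m n) = 1 \<and> (\<forall>Y\<in>S. \<forall>Z\<in>S. \<theta> (Y * Z) = \<theta> Y * \<theta> Z)" if x: "\<theta> \<in> set cs" for \<theta>
  proof -
    obtain d L K where bb: "(d, L, K) \<in> set bs" and ch: "\<theta> = ch (d, L, K)"
      using x unfolding cs_def by auto
    have sb: "0 < d" "L \<in> carrier_mat d n" "K \<in> carrier_mat n d" "L * K = 1\<^sub>m d"
      "\<forall>Y\<in>S. \<forall>Z\<in>S. (L * Y * K) * (L * Z * K) = L * (Y * Z) * K"
      using b bb unfolding schur_block_def by auto
    have "L * 1\<^sub>m n * K = 1\<^sub>m d" using sb(2-4) by simp
    then have "\<theta> (1\<^sub>m n) = 1" using sb(1) unfolding ch ch_def by simp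
    moreover have "\<theta> (Y * Z) = \<theta> Y * \<theta> Z" if YZ: "Y \<in> S" "Z \<in> S" for Y Z
    proof -
      have "\<theta> (Y * Z) = ((L * Y * K) * (L * Z * K)) $$ (0, 0)"
        using sb(5) YZ unfolding ch ch_def by simp
      also have "\<dots> = ((\<theta> Y \<cdot>\<^sub>m 1\<^sub>m d) * (\<theta> Z \<cdot>\<^sub>m 1\<^sub>m d)) $$ (0, 0)"
        using sc[OF bb YZ(1)] sc[OF bb YZ(2)] unfolding ch by simp
      also have "\<dots> = \<theta> Y * \<theta> Z" using sb(1) by (simp add: mult_smult_assoc_mat[of _ d d])
      finally show ?thesis .
    qed
    ultimately show ?thesis by blast
  qed
  have "char_poly Y = (\<Prod>\<theta> \<leftarrow> cs. [:- \<theta> Y, 1:])" if Y: "Y \<in> S" for Y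
  proof -
    have "char_poly (L * Y * K) = [:- ch (d, L, K) Y, 1:] ^ d" if bb: "(d, L, K) \<in> set bs" for d L K
      unfolding sc[OF bb Y] char_poly_scalar_mat ..
    then have "(\<Prod>(d, L, K) \<leftarrow> bs. char_poly (L * Y * K)) = (\<Prod>b \<leftarrow> bs. [:- ch b Y, 1:] ^ fst b)"
      by (intro arg_cong[of _ _ prod_list] map_cong) auto
    also have "\<dots> = (\<Prod>\<theta> \<leftarrow> cs. [:- \<theta> Y, 1:])"
      unfolding cs_def by (induction bs) (auto simp: prod_list_replicate)
    finally show ?thesis using cp Y by simp
  qed
  moreover have "length cs = n" unfolding cs_def length_concat map_map sl[symmetric]
    by (simp add: comp_def)
  ultimately show ?thesis using chm by blast
qed

section \<open>Rational polynomials with a root on the unit circle\<close>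

lemma cnj_of_rat [simp]: "cnj (of_rat r) = of_rat r"
  by (cases r) (simp add: of_rat_rat)

abbreviation rat_poly :: "rat poly \<Rightarrow> complex poly" where "rat_poly \<equiv> map_poly of_rat"

lemma rat_poly_mult: "rat_poly (p * q) = rat_poly p * rat_poly q"
proof -
  interpret h: map_poly_comm_ring_hom "of_rat :: rat \<Rightarrow> complex" ..
  show ?thesis by (rule h.hom_mult)
qed

lemma rat_poly_add: "rat_poly (p + q) = rat_poly p + rat_poly q"
proof -
  interpret h: map_poly_comm_ring_hom "of_rat :: rat \<Rightarrow> complex" ..
  show ?thesis by (rule h.hom_add)
qed

lemma cnj_poly_rat: "poly (rat_poly q) (cnj z) = cnj (poly (rat_poly q) z)"
  by (induction q) (auto simp: of_rat_hom.map_poly_pCons_hom)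

lemma irreducible_degree_pos:
  fixes q :: "'a :: field poly"
  assumes "irreducible q"
  shows "degree q > 0"
proof -
  have "q \<noteq> 0" "\<not> is_unit q" using assms unfolding irreducible_def by auto
  then show ?thesis using is_unit_iff_degree[of q] by auto
qed

lemma irreducible_bezout:
  fixes q r :: "rat poly"
  assumes "irreducible q" "\<not> q dvd r"
  shows "\<exists>u v. u * q + v * r = 1"
proof -
  have "coprime q r" using assms by (simp add: irreducible_imp_prime_elem prime_elem_imp_coprime)
  then show ?thesis using bezout_coefficients_fst_snd[of q r] by (auto simp: coprime_iff_gcd_eq_1)
qed

text \<open>Otherwise a Bezout identity over the rationals, evaluated at the common complex root,
  would read 0 = 1.\<close>

lemma irreducible_dvd_common_root:
  fixes q r :: "rat poly"
  assumes "irreducible q" "poly (rat_poly q) z = 0" "poly (rat_poly r) z = 0"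
  shows "q dvd r"
proof (rule ccontr)
  assume "\<not> q dvd r"
  then obtain u v where "u * q + v * r = 1" using irreducible_bezout assms(1) by blast
  then have "rat_poly (u * q + v * r) = 1" by simp
  then have "rat_poly u * rat_poly q + rat_poly v * rat_poly r = 1"
    by (simp add: rat_poly_add rat_poly_mult)
  then have "poly (rat_poly u * rat_poly q + rat_poly v * rat_poly r) z = 1" by simp
  then show False using assms(2,3) by simp
qed

lemma irreducible_rational_root:
  fixes q :: "rat poly"
  assumes "irreducible q" "poly (rat_poly q) z = 0" "poly q a = 0"
  shows "z = of_rat a"
proof -
  have "q dvd [:- a, 1:]"
    by (rule irreducible_dvd_common_root[OF assms(1), of "of_rat a"]) (use assms(3) in \<open>simp_all add: of_rat_minus\<close>)
  then obtain s where s: "[:- a, 1:] = q * s" by (auto elim: dvdE)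
  have "rat_poly [:- a, 1:] = rat_poly q * rat_poly s" unfolding s by (rule rat_poly_mult)
  then have "poly (rat_poly [:- a, 1:]) z = 0" using assms(2) by simp
  then show ?thesis by (simp add: of_rat_hom.map_poly_pCons_hom of_rat_minus)
qed

text \<open>On the unit circle the inverse of \<open>z\<close> is its conjugate, again a root of
  \<open>q\<close>, so \<open>z\<close> is also a root of the reflected polynomial and
  \<open>q\<close> divides it. Comparing degrees leaves a constant factor, which evaluation at 1
  shows to be 1; evaluation at -1 then decides the parity of the degree. The assumption
  \<open>z\<^sup>2 \<noteq> 1\<close> keeps these two values of \<open>q\<close> away from
  0.\<close>

lemma even_degree_of_unit_circle_root:
  fixes q :: "rat poly"
  assumes q: "irreducible q" and root: "poly (rat_poly q) z = 0" and z: "norm z = 1" "z\<^sup>2 \<noteq> 1"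
  shows "even (degree q)"
proof -
  have z0: "z \<noteq> 0" using z by auto
  have "z * cnj z = 1" using z(1) by (simp add: complex_norm_square[symmetric])
  then have inv: "inverse z = cnj z" using z0 by (simp add: field_simps)
  have nz: "poly q 1 \<noteq> 0" "poly q (- 1) \<noteq> 0"
    using irreducible_rational_root[OF q root] z(2) by (auto simp: of_rat_minus)
  define r where "r = reflect_poly q"
  have "rat_poly r = reflect_poly (rat_poly q)"
    unfolding r_def by (rule poly_eqI) (simp add: coeff_reflect_poly coeff_map_poly)
  then have "poly (rat_poly r) z = 0"
    using poly_reflect_poly_nz[OF z0, of "rat_poly q"] unfolding inv cnj_poly_rat root by simp
  then have "q dvd r" by (rule irreducible_dvd_common_root[OF q root])
  then obtain s where s: "r = q * s" by (auto elim: dvdE)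
  have "r \<noteq> 0" using q unfolding r_def by auto
  have "degree r = degree q + degree s" unfolding s by (rule degree_mult_eq) (use s \<open>r \<noteq> 0\<close> in auto)
  moreover have "degree r \<le> degree q" unfolding r_def by (rule degree_reflect_poly_le)
  ultimately have "degree s = 0" by simp
  then obtain c where c: "s = [:c:]" by (metis degree_eq_zeroE)
  have "poly r 1 = poly q 1" unfolding r_def by (simp add: poly_reflect_poly_nz)
  then have "c = 1" using nz(1) unfolding s c by simp
  moreover have "poly r (- 1) = (- 1) ^ degree q * poly q (- 1)"
    unfolding r_def by (simp add: poly_reflect_poly_nz)
  ultimately have "((- 1) ^ degree q :: rat) = 1" using nz(2) unfolding s c by simp
  then show ?thesis by (cases "even (degree q)") auto
qed

lemma even_degree_of_irreducible_factors:
  fixes f :: "rat poly"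
  assumes "f \<noteq> 0" "\<And>q. irreducible q \<Longrightarrow> q dvd f \<Longrightarrow> even (degree q)"
  shows "even (degree f)"
  using assms
proof (induction "degree f" arbitrary: f rule: less_induct)
  case (less f)
  show ?case
  proof (cases "degree f = 0")
    case False
    then have "\<not> is_unit f" by (auto simp: is_unit_iff_degree less.prems(1))
    then obtain q where q: "q dvd f" "prime q" using prime_divisor_exists less.prems(1) by blast
    then have irr: "irreducible q" by (intro prime_elem_imp_irreducible prime_imp_prime_elem)
    obtain g where g: "f = q * g" using q(1) by (auto elim: dvdE)
    have dq: "degree q > 0" by (rule irreducible_degree_pos[OF irr])
    have dg: "degree f = degree q + degree g" unfolding g by (rule degree_mult_eq) (use g less.prems in auto)
    have "even (degree g)"
      by (rule less.hyps) (use dq dg g less.prems in auto)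
    then show ?thesis using less.prems(2)[OF irr q(1)] dg by simp
  qed simp
qed

section \<open>Polynomials of matrices\<close>


text \<open>The value \<open>p(A)\<close>, computed by Horner's scheme. The size \<open>n\<close> is
  an argument because the identity matrix depends on it.\<close>

definition mat_of_poly :: "nat \<Rightarrow> 'a :: comm_ring_1 mat \<Rightarrow> 'a poly \<Rightarrow> 'a mat" where
  "mat_of_poly n A p = fold_coeffs (\<lambda>a M. a \<cdot>\<^sub>m 1\<^sub>m n + A * M) p (0\<^sub>m n n)"

context
  fixes A :: "'a :: comm_ring_1 mat" and n :: nat
  assumes A: "A \<in> carrier_mat n n"
begin

lemma mat_of_poly_0: "mat_of_poly n A 0 = 0\<^sub>m n n"
  by (simp add: mat_of_poly_def)

lemma mat_of_poly_pCons: "mat_of_poly n A (pCons a p) = a \<cdot>\<^sub>m 1\<^sub>m n + A * mat_of_poly n A p"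
proof (cases "a = 0 \<and> p = 0")
  case True
  then show ?thesis using A by (auto simp: mat_of_poly_def)
next
  case False
  then show ?thesis
    by (cases "p = 0") (auto simp: mat_of_poly_def fold_coeffs_pCons_not_0_0_eq)
qed

lemma mat_of_poly_dim [simp]: "dim_row (mat_of_poly n A p) = n" "dim_col (mat_of_poly n A p) = n"
  using A by (induction p) (auto simp: mat_of_poly_0 mat_of_poly_pCons)

lemma mat_of_poly_closed [simp]: "mat_of_poly n A p \<in> carrier_mat n n"
  by (rule carrier_matI) simp_all

lemma mat_of_poly_add: "mat_of_poly n A (p + q) = mat_of_poly n A p + mat_of_poly n A q"
proof (induction p arbitrary: q)
  case 0
  then show ?case by (simp add: mat_of_poly_0)
next
  case (pCons a p)
  obtain b q' where q: "q = pCons b q'" by (cases q)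
  have d: "A * (mat_of_poly n A p + mat_of_poly n A q') = A * mat_of_poly n A p + A * mat_of_poly n A q'"
    by (rule mult_add_distrib_mat[OF A mat_of_poly_closed mat_of_poly_closed])
  show ?case unfolding q add_pCons mat_of_poly_pCons pCons.IH d
    by (rule eq_matI) (use A in \<open>auto simp: algebra_simps\<close>)
qed

lemma mat_of_poly_smult: "mat_of_poly n A (Polynomial.smult c p) = c \<cdot>\<^sub>m mat_of_poly n A p"
proof (induction p)
  case 0
  then show ?case by (simp add: mat_of_poly_0)
next
  case (pCons a p)
  have d: "A * (c \<cdot>\<^sub>m mat_of_poly n A p) = c \<cdot>\<^sub>m (A * mat_of_poly n A p)"
    by (rule mult_smult_distrib[OF A mat_of_poly_closed])
  show ?case unfolding smult_pCons mat_of_poly_pCons pCons.IH d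
    by (rule eq_matI) (use A in \<open>auto simp: algebra_simps\<close>)
qed

lemma mat_of_poly_mult: "mat_of_poly n A (p * q) = mat_of_poly n A p * mat_of_poly n A q"
proof (induction p)
  case 0
  then show ?case by (simp add: mat_of_poly_0)
next
  case (pCons a p)
  have "mat_of_poly n A (pCons a p * q) = a \<cdot>\<^sub>m mat_of_poly n A q + A * (mat_of_poly n A p * mat_of_poly n A q)"
    unfolding mult_pCons_left mat_of_poly_add mat_of_poly_smult mat_of_poly_pCons pCons.IH
    by (rule eq_matI) (use A in auto)
  also have "A * (mat_of_poly n A p * mat_of_poly n A q) = A * mat_of_poly n A p * mat_of_poly n A q"
    using A by (simp add: mult_assoc_dim)
  also have "a \<cdot>\<^sub>m mat_of_poly n A q = (a \<cdot>\<^sub>m 1\<^sub>m n) * mat_of_poly n A q"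
    by (simp add: mult_smult_assoc_mat[OF one_carrier_mat mat_of_poly_closed])
  also have "(a \<cdot>\<^sub>m 1\<^sub>m n) * mat_of_poly n A q + A * mat_of_poly n A p * mat_of_poly n A q =
      mat_of_poly n A (pCons a p) * mat_of_poly n A q"
    unfolding mat_of_poly_pCons
    by (rule add_mult_distrib_mat[of _ n n _ _ n, symmetric]) (use A in \<open>auto intro!: mult_carrier_dim\<close>)
  finally show ?case .
qed

lemma mat_of_poly_1: "mat_of_poly n A 1 = 1\<^sub>m n"
  unfolding one_pCons mat_of_poly_pCons mat_of_poly_0 right_mult_zero_mat[OF A]
  by (rule eq_matI) simp_all

lemma mat_of_poly_commute:
  assumes Y: "Y \<in> carrier_mat n n" and AY: "A * Y = Y * A"
  shows "mat_of_poly n A p * Y = Y * mat_of_poly n A p"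
proof (induction p)
  case 0
  then show ?case using Y by (simp add: mat_of_poly_0)
next
  case (pCons a p)
  have "mat_of_poly n A (pCons a p) * Y = (a \<cdot>\<^sub>m 1\<^sub>m n) * Y + A * mat_of_poly n A p * Y"
    unfolding mat_of_poly_pCons
    by (rule add_mult_distrib_mat[of _ n n _ _ n]) (use A Y in \<open>auto intro!: mult_carrier_dim\<close>)
  also have "A * mat_of_poly n A p * Y = A * (Y * mat_of_poly n A p)"
    unfolding pCons.IH[symmetric] using A Y by (simp add: mult_assoc_dim)
  also have "\<dots> = A * Y * mat_of_poly n A p" using A Y by (simp add: mult_assoc_dim)
  also have "\<dots> = Y * (A * mat_of_poly n A p)" unfolding AY using A Y by (simp add: mult_assoc_dim)
  also have "(a \<cdot>\<^sub>m 1\<^sub>m n) * Y = Y * (a \<cdot>\<^sub>m 1\<^sub>m n)"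
    using Y by (simp add: mult_smult_assoc_mat[OF one_carrier_mat Y] mult_smult_distrib[OF Y one_carrier_mat])
  also have "Y * (a \<cdot>\<^sub>m 1\<^sub>m n) + Y * (A * mat_of_poly n A p) = Y * mat_of_poly n A (pCons a p)"
    unfolding mat_of_poly_pCons
    by (rule mult_add_distrib_mat[of _ n n _ n, symmetric]) (use A Y in \<open>auto intro!: mult_carrier_dim\<close>)
  finally show ?case .
qed

lemma mat_of_poly_eigenvector:
  assumes v: "v \<in> carrier_vec n" and Av: "A *\<^sub>v v = z \<cdot>\<^sub>v v"
  shows "mat_of_poly n A p *\<^sub>v v = poly p z \<cdot>\<^sub>v v"
proof (induction p)
  case 0
  then show ?case using v by (auto simp: mat_of_poly_0)
next
  case (pCons a p)
  have "mat_of_poly n A (pCons a p) *\<^sub>v v = (a \<cdot>\<^sub>m 1\<^sub>m n) *\<^sub>v v + (A * mat_of_poly n A p) *\<^sub>v v"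
    unfolding mat_of_poly_pCons
    by (rule add_mult_distrib_mat_vec[of _ n n]) (use A v in \<open>auto intro!: mult_carrier_dim\<close>)
  also have "(A * mat_of_poly n A p) *\<^sub>v v = A *\<^sub>v (poly p z \<cdot>\<^sub>v v)"
    unfolding pCons.IH[symmetric] by (rule assoc_mult_mat_vec[of _ n n _ n]) (use A v in auto)
  also have "\<dots> = poly p z \<cdot>\<^sub>v (z \<cdot>\<^sub>v v)"
    unfolding Av[symmetric] by (rule eq_vecI) (use A v in auto)
  also have "(a \<cdot>\<^sub>m 1\<^sub>m n) *\<^sub>v v = a \<cdot>\<^sub>v v"
    using v by (intro eq_vecI) (auto simp: scalar_prod_def if_distrib if_distribR sum.delta cong: if_cong)
  finally show ?case using v by (simp add: smult_smult_assoc add_smult_distrib_vec[symmetric] algebra_simps)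
qed

end

text \<open>Change of scalars: polynomials of an integer or rational matrix can be studied over a
  larger field.\<close>

lemma (in comm_ring_hom) mat_of_poly_hom:
  assumes "A \<in> carrier_mat n n"
  shows "mat_of_poly n (mat\<^sub>h A) (map_poly hom p) = mat\<^sub>h (mat_of_poly n A p)"
proof (induction p)
  case 0
  then show ?case using assms by (auto simp: mat_of_poly_0[OF assms] mat_of_poly_0[OF map_carrier_mat[THEN iffD2, OF assms]])
next
  case (pCons a p)
  have h: "mat\<^sub>h A \<in> carrier_mat n n" using assms by simp
  have "mat\<^sub>h (A * mat_of_poly n A p) = mat\<^sub>h A * mat\<^sub>h (mat_of_poly n A p)"
    by (rule mat_hom_mult[OF assms mat_of_poly_closed[OF assms]])
  then have m: "hom ((A * mat_of_poly n A p) $$ (i, j)) = (mat\<^sub>h A * mat\<^sub>h (mat_of_poly n A p)) $$ (i, j)"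
    if "i < n" "j < n" for i j
    using that assms by (metis (no_types, lifting) carrier_matD(1) carrier_matD(2) index_map_mat(1) index_mult_mat(2) index_mult_mat(3) mat_of_poly_dim(2))
  show ?case
    unfolding map_poly_pCons_hom mat_of_poly_pCons[OF assms] mat_of_poly_pCons[OF h] pCons.IH
    by (rule eq_matI) (use assms m in \<open>auto simp: hom_distribs mat_of_poly_dim[OF assms] simp del: index_mult_mat(1)\<close>)
qed

text \<open>\<open>A\<close> generates a field inside the commutant, so its characteristic
  polynomial is a power of the minimal polynomial of \<open>z\<close>. For the parity it is enough
  that every irreducible factor vanishes at \<open>z\<close>, because each of them then has even
  degree.\<close>

lemma even_dim_of_unit_circle_eigenvalue:
  fixes A :: "rat mat"
  assumes A: "A \<in> carrier_mat n n" and S: "S \<subseteq> carrier_mat n n" and sch: "schur_set n S"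
    and comm: "\<And>Y. Y \<in> S \<Longrightarrow> A * Y = Y * A"
    and root: "poly (rat_poly (char_poly A)) z = 0" and z: "norm z = 1" "z\<^sup>2 \<noteq> 1"
  shows "even n"
proof -
  let ?C = "map_mat of_rat A :: complex mat"
  have C: "?C \<in> carrier_mat n n" using A by simp
  note cp = of_rat_hom.char_poly_hom[OF A, where 'a = complex]
  have deg: "degree (char_poly A) = n" and nz: "char_poly A \<noteq> 0"
    using degree_monic_char_poly[OF A] by auto
  \<comment> \<open>\<open>q\<close> shares a root with the characteristic polynomial, so
    \<open>q(A)\<close> is singular; it commutes with \<open>S\<close>, hence is zero. Applied to an
    eigenvector for \<open>z\<close> this gives \<open>q(z) = 0\<close>.\<close>
  have vanish: "poly (rat_poly q) z = 0" if q: "irreducible q" "q dvd char_poly A" for q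
  proof -
    have dq: "degree q > 0" by (rule irreducible_degree_pos[OF q(1)])
    then have "\<not> constant (poly (rat_poly q))" by (simp add: constant_degree)
    then obtain m where m: "poly (rat_poly q) m = 0" using fundamental_theorem_of_algebra by blast
    obtain g where g: "char_poly A = q * g" using q(2) by (auto elim: dvdE)
    have "poly (rat_poly (char_poly A)) m = 0" unfolding g by (simp add: m rat_poly_mult)
    then have "eigenvalue ?C m" using eigenvalue_root_char_poly[OF C] cp by simp
    then obtain v where v: "v \<in> carrier_vec n" "v \<noteq> 0\<^sub>v n" "?C *\<^sub>v v = m \<cdot>\<^sub>v v"
      using C unfolding eigenvalue_def eigenvector_def by auto
    have "mat_of_poly n ?C (rat_poly q) *\<^sub>v v = 0\<^sub>v n"
      using mat_of_poly_eigenvector[OF C v(1,3), of "rat_poly q"] m v(1) by auto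
    then have "det (mat_of_poly n ?C (rat_poly q)) = 0"
      using det_0_iff_vec_prod_zero[OF mat_of_poly_closed[OF C]] v by blast
    then have "det (mat_of_poly n A q) = 0"
      unfolding of_rat_hom.mat_of_poly_hom[OF A] by simp
    moreover have "mat_of_poly n A q * Y = Y * mat_of_poly n A q" if "Y \<in> S" for Y
      by (rule mat_of_poly_commute[OF A _ comm[OF that]]) (use that S in auto)
    ultimately have z: "mat_of_poly n A q = 0\<^sub>m n n"
      using sch mat_of_poly_closed[OF A, of q] unfolding schur_set_def by auto
    have "eigenvalue ?C z" using eigenvalue_root_char_poly[OF C] cp root by simp
    then obtain w where w: "w \<in> carrier_vec n" "w \<noteq> 0\<^sub>v n" "?C *\<^sub>v w = z \<cdot>\<^sub>v w"
      using C unfolding eigenvalue_def eigenvector_def by auto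
    have "map_mat of_rat (0\<^sub>m n n) = (0\<^sub>m n n :: complex mat)" by (rule eq_matI) auto
    then have "mat_of_poly n ?C (rat_poly q) = 0\<^sub>m n n"
      unfolding of_rat_hom.mat_of_poly_hom[OF A] z by simp
    moreover have "0\<^sub>m n n *\<^sub>v w = 0\<^sub>v n" using w(1) by (intro eq_vecI) auto
    ultimately have e: "poly (rat_poly q) z \<cdot>\<^sub>v w = 0\<^sub>v n"
      using mat_of_poly_eigenvector[OF C w(1,3), of "rat_poly q"] w(1) by auto
    have "\<exists>i<n. vec_index w i \<noteq> 0"
    proof (rule ccontr)
      assume "\<not> (\<exists>i<n. vec_index w i \<noteq> 0)"
      then have "w = 0\<^sub>v n" using w(1) by (intro eq_vecI) auto
      then show False using w(2) by simp
    qed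
    then obtain i where i: "i < n" "vec_index w i \<noteq> 0" by blast
    have "vec_index (poly (rat_poly q) z \<cdot>\<^sub>v w) i = 0" unfolding e using i by simp
    then have "poly (rat_poly q) z * vec_index w i = 0" using i(1) w(1) by simp
    then show ?thesis using i(2) by (metis mult_eq_0_iff)
  qed
  have "even (degree (char_poly A))"
  proof (rule even_degree_of_irreducible_factors[OF nz])
    fix q assume q: "irreducible q" "q dvd char_poly A"
    show "even (degree q)" by (rule even_degree_of_unit_circle_root[OF q(1) vanish[OF q] z])
  qed
  then show ?thesis unfolding deg .
qed

section \<open>Bounded characteristic polynomials\<close>

text \<open>Gauss's lemma. The normalised integral factors have leading coefficients with product 1,
  and the positive scaling factor excludes the value -1.\<close>

lemma monic_rat_factor_int:
  fixes p :: "int poly"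
  assumes "map_poly rat_of_int p = g * h" "monic p" "monic g" "monic h"
  shows "\<exists>g' h'. g = map_poly rat_of_int g' \<and> h = map_poly rat_of_int h' \<and> monic g' \<and> monic h'"
proof -
  obtain r rg where r: "rat_to_normalized_int_poly g = (r, rg)" by (cases "rat_to_normalized_int_poly g")
  obtain s sh where s: "rat_to_normalized_int_poly h = (s, sh)" by (cases "rat_to_normalized_int_poly h")
  have p0: "p \<noteq> 0" using assms(2) by auto
  have cp: "content p = 1"
  proof -
    have "content p dvd lead_coeff p" by (rule content_dvd_coeff)
    then show ?thesis using assms(2) content_ge_0_int[of p] by (simp add: zdvd1_eq)
  qed
  have p: "p = rg * sh" by (rule rat_to_int_factor_content_1[OF cp assms(1) r s p0])
  note g = rat_to_normalized_int_poly[OF r] and h = rat_to_normalized_int_poly[OF s]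
  have "lead_coeff rg * lead_coeff sh = 1"
    using assms(2) unfolding p by (simp add: lead_coeff_mult)
  moreover have lg: "r * of_int (lead_coeff rg) = 1"
    using arg_cong[OF g(1), of lead_coeff] assms(3) g(2) by (simp add: of_int_hom.degree_map_poly_hom)
  moreover have lh: "s * of_int (lead_coeff sh) = 1"
    using arg_cong[OF h(1), of lead_coeff] assms(4) h(2) by (simp add: of_int_hom.degree_map_poly_hom)
  moreover have "lead_coeff rg > 0"
  proof -
    have "rat_of_int (lead_coeff rg) = 1 / r" using lg g(2) by (simp add: field_simps)
    then have "rat_of_int (lead_coeff rg) > 0" using g(2) by simp
    then show ?thesis by simp
  qed
  ultimately have l: "lead_coeff rg = 1" "lead_coeff sh = 1" by (auto simp: zmult_eq_1_iff)
  then have "r = 1" "s = 1" using lg lh by auto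
  then show ?thesis using g(1) h(1) l by (intro exI[of _ rg] exI[of _ sh]) auto
qed

text \<open>Multiplication by \<open>X - z\<close> enlarges the largest coefficient at most by the
  factor \<open>1 + C\<close>.\<close>

lemma coeff_prod_linear_bound:
  fixes zs :: "complex list"
  assumes "\<And>z. z \<in> set zs \<Longrightarrow> norm z \<le> C" "C \<ge> 0"
  shows "norm (Polynomial.coeff (\<Prod>z\<leftarrow>zs. [:- z, 1:]) i) \<le> (1 + C) ^ length zs"
  using assms
proof (induction zs arbitrary: i)
  case Nil
  then show ?case by (cases "i = 0") auto
next
  case (Cons z zs)
  let ?p = "\<Prod>z\<leftarrow>zs. [:- z, 1:]"
  have IH: "norm (Polynomial.coeff ?p j) \<le> (1 + C) ^ length zs" for j
    using Cons by auto
  have "Polynomial.coeff ([:- z, 1:] * ?p) i = - z * Polynomial.coeff ?p i + (case i of 0 \<Rightarrow> 0 | Suc j \<Rightarrow> Polynomial.coeff ?p j)"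
    by (simp add: coeff_pCons split: nat.splits)
  also have "norm \<dots> \<le> norm (- z * Polynomial.coeff ?p i) + norm (case i of 0 \<Rightarrow> 0 | Suc j \<Rightarrow> Polynomial.coeff ?p j)"
    by (rule norm_triangle_ineq)
  also have "norm (- z * Polynomial.coeff ?p i) \<le> C * (1 + C) ^ length zs"
    unfolding norm_mult norm_minus_cancel by (intro mult_mono IH) (use Cons.prems in auto)
  also have "norm (case i of 0 \<Rightarrow> 0 | Suc j \<Rightarrow> Polynomial.coeff ?p j) \<le> (1 + C) ^ length zs"
    using IH Cons.prems(2) by (auto split: nat.splits)
  finally show ?case by (simp add: algebra_simps)
qed

lemma finite_bounded_int_polys:
  "finite {p :: int poly. degree p \<le> n \<and> (\<forall>i. \<bar>real_of_int (Polynomial.coeff p i)\<bar> \<le> B)}"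
proof -
  let ?S = "{p :: int poly. degree p \<le> n \<and> (\<forall>i. \<bar>real_of_int (Polynomial.coeff p i)\<bar> \<le> B)}"
  let ?f = "\<lambda>p :: int poly. map (Polynomial.coeff p) [0..<Suc n]"
  have "\<bar>c\<bar> \<le> \<lfloor>B\<rfloor>" if "\<bar>real_of_int c\<bar> \<le> B" for c :: int
    using that by (simp add: le_floor_iff)
  then have "?f ` ?S \<subseteq> {xs. set xs \<subseteq> {-\<lfloor>B\<rfloor>..\<lfloor>B\<rfloor>} \<and> length xs = Suc n}"
    by (auto simp: abs_le_iff) (smt (verit))+
  then have "finite (?f ` ?S)" by (rule finite_subset) (rule finite_lists_length_eq, simp)
  moreover have "inj_on ?f ?S"
  proof (rule inj_onI)
    fix p q assume p: "p \<in> ?S" and q: "q \<in> ?S" and eq: "?f p = ?f q"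
    have "Polynomial.coeff p i = Polynomial.coeff q i" for i
    proof (cases "i \<le> n")
      case True
      then have "i \<in> set [0..<Suc n]" by auto
      then show ?thesis using eq unfolding map_eq_conv by blast
    next
      case False
      then show ?thesis using p q by (auto simp: coeff_eq_0)
    qed
    then show "p = q" by (rule poly_eqI)
  qed
  ultimately show ?thesis by (rule finite_imageD)
qed

lemma poly_prod_linear_eq_0_iff:
  fixes zs :: "'a :: field list"
  shows "poly (\<Prod>z\<leftarrow>zs. [:- z, 1:]) x = 0 \<longleftrightarrow> x \<in> set zs"
  by (induction zs) auto

text \<open>Dividing the equations leaves a nontrivial power of \<open>y\<close> equal to 1. In the
  applications \<open>x\<close> and \<open>y\<close> are the moduli of a joint eigenvalue of
  \<open>a\<close> and \<open>b\<close>, and the equations come from \<open>a b^s\<close> and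
  \<open>a b^t\<close>.\<close>

lemma norm_one_of_two_powers:
  fixes x y :: real
  assumes "x > 0" "y > 0" "x * y ^ s = 1" "x * y ^ t = 1" "s \<noteq> t"
  shows "x = 1 \<and> y = 1"
proof -
  have "x * y ^ s = x * y ^ t" using assms(3,4) by simp
  then have "y ^ s = y ^ t" using assms(1) by simp
  have "\<not> y > 1" using power_inject_exp[of y s t] \<open>y ^ s = y ^ t\<close> assms(5) by auto
  moreover have "inverse y ^ s = inverse y ^ t" using \<open>y ^ s = y ^ t\<close> by (simp add: power_inverse)
  then have "\<not> inverse y > 1" using power_inject_exp[of "inverse y" s t] assms(5) by auto
  then have "\<not> y < 1" using assms(2) one_less_inverse[of y] by auto
  ultimately have "y = 1" by simp
  then show ?thesis using assms(3) by simp
qed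

text \<open>On the logarithmic scale \<open>k ln u + t ln v\<close> comes within
  \<open>|ln u|\<close> of 0 for every \<open>t\<close>, if \<open>k\<close> is the rounded value of
  \<open>- t ln v / ln u\<close>; the component \<open>t\<close> makes these pairs distinct. If
  \<open>u = 1\<close>, the powers of \<open>u\<close> alone will do.\<close>

lemma exists_near_unit_powers:
  fixes u v :: real
  assumes u: "u > 0" and v: "v > 0"
  shows "\<exists>(s :: nat \<Rightarrow> int \<times> int) C. inj s \<and> C \<ge> 1 \<and>
     (\<forall>t. u powi fst (s t) * v powi snd (s t) \<le> C \<and> inverse (u powi fst (s t) * v powi snd (s t)) \<le> C)"
proof (cases "u = 1")
  case True
  then show ?thesis
    by (intro exI[of _ "\<lambda>t. (int t, 0)"] exI[of _ 1]) (auto intro!: injI)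
next
  case False
  define a where "a = ln u"
  define b where "b = ln v"
  have a0: "a \<noteq> 0" using False u unfolding a_def by simp
  define k where "k t = - \<lfloor>real t * b / a\<rfloor>" for t :: nat
  have bd: "\<bar>k t * a + t * b\<bar> \<le> \<bar>a\<bar>" for t
  proof -
    define x where "x = real t * b / a"
    have "k t * a + t * b = a * (x - \<lfloor>x\<rfloor>)" using a0 unfolding k_def x_def by (simp add: algebra_simps)
    also have "\<bar>\<dots>\<bar> \<le> \<bar>a\<bar> * 1" unfolding abs_mult
      by (rule mult_left_mono) (use floor_correct[of x] in \<open>auto simp: abs_le_iff\<close>, linarith+)
    finally show ?thesis by simp
  qed
  have eq: "u powi k t * v powi int t = exp (k t * a + t * b)" for t
  proof -
    have "u powi k t = exp (k t * a)" "v powi int t = exp (t * b)"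
      using u v powr_real_of_int'[of u "k t"] powr_real_of_int'[of v "int t"]
      unfolding a_def b_def by (simp_all add: powr_def)
    then show ?thesis by (simp add: exp_add)
  qed
  show ?thesis
  proof (intro exI[of _ "\<lambda>t. (k t, int t)"] exI[of _ "exp \<bar>a\<bar>"] conjI allI)
    show "inj (\<lambda>t. (k t, int t))" by (auto intro!: injI)
    show "exp \<bar>a\<bar> \<ge> 1" by simp
    fix t
    show "u powi fst (k t, int t) * v powi snd (k t, int t) \<le> exp \<bar>a\<bar>"
      unfolding fst_conv snd_conv eq using bd[of t] by simp
    show "inverse (u powi fst (k t, int t) * v powi snd (k t, int t)) \<le> exp \<bar>a\<bar>"
      unfolding fst_conv snd_conv eq exp_minus[symmetric] using bd[of t] by simp
  qed
qed

text \<open>The members of \<open>ps\<close> are the values of the characters at \<open>a\<close>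
  and \<open>b\<close>, and \<open>p0\<close> is a neutral one, with both moduli 1. Complex
  conjugation produces a second neutral pair, and since the product of all moduli is 1, lists of
  length 2 or 4 leave at most one free modulus and its inverse.\<close>

lemma neutral_pair_length:
  fixes ps :: "(complex \<times> complex) list" and P :: "int \<Rightarrow> int \<Rightarrow> int poly"
  defines "z \<equiv> \<lambda>k l p. fst p powi k * snd p powi l"
  assumes P: "\<And>k l. map_poly of_int (P k l) = (\<Prod>p\<leftarrow>ps. [:- z k l p, 1:])"
    and nz: "\<And>p. p \<in> set ps \<Longrightarrow> fst p \<noteq> 0 \<and> snd p \<noteq> 0"
    and ne: "\<And>k l p. (k, l) \<noteq> (0, 0) \<Longrightarrow> p \<in> set ps \<Longrightarrow> z k l p \<noteq> 1"
    and p0: "p0 \<in> set ps" and n1: "norm (fst p0) = 1" "norm (snd p0) = 1"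
  shows "length ps \<noteq> 2 \<and> length ps \<noteq> 4"
proof (rule ccontr)
  assume neg: "\<not> ?thesis"
  define n where "n = length ps"
  have n: "n = 2 \<or> n = 4" using neg unfolding n_def by auto
  define w where "w k l i = z k l (ps ! i)" for k l i
  have roots: "poly (map_poly of_int (P k l)) x = 0 \<longleftrightarrow> (\<exists>i<n. x = w k l i)" for k l x
    unfolding P poly_prod_linear_eq_0_iff[of "map (z k l) ps", unfolded map_map comp_def]
    unfolding in_set_conv_nth by (auto simp: w_def n_def)
  have nw: "norm (w k l i) = norm (fst (ps ! i)) powi k * norm (snd (ps ! i)) powi l" for k l i
    by (simp add: w_def z_def norm_mult norm_power_int)
  \<comment> \<open>The constant coefficients of \<open>P k l\<close> and
    \<open>P (- k) (- l)\<close> are integers with product 1, hence each is 1 or -1.\<close>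
  have prod1: "(\<Prod>i<n. norm (w k l i)) = 1" for k l
  proof -
    have P0: "of_int (Polynomial.coeff (P k l) 0) = (\<Prod>i<n. - w k l i)" for k l
    proof -
      have "of_int (Polynomial.coeff (P k l) 0) = poly (map_poly of_int (P k l)) (0 :: complex)"
        by (simp add: poly_0_coeff_0 coeff_map_poly)
      also have "\<dots> = (\<Prod>p\<leftarrow>ps. - z k l p)" unfolding P by (induction ps) auto
      also have "\<dots> = (\<Prod>i<n. - w k l i)"
        unfolding w_def n_def prod.list_conv_set_nth by (simp add: atLeast0LessThan)
      finally show ?thesis .
    qed
    have "of_int (Polynomial.coeff (P k l) 0 * Polynomial.coeff (P (- k) (- l)) 0) = (\<Prod>i<n. - w k l i * - w (- k) (- l) i)"
      unfolding of_int_mult P0 prod.distrib ..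
    also have "\<dots> = (\<Prod>i<n. 1)"
      by (rule prod.cong[OF refl]) (use nz in \<open>auto simp: w_def z_def n_def power_int_minus field_simps\<close>)
    finally have "Polynomial.coeff (P k l) 0 * Polynomial.coeff (P (- k) (- l)) 0 = 1"
      by (metis of_int_eq_1_iff prod.neutral_const)
    then have "\<bar>Polynomial.coeff (P k l) 0\<bar> = 1" using abs_zmult_eq_1 by (metis abs_1)
    then have "norm (of_int (Polynomial.coeff (P k l) 0) :: complex) = 1" by (simp flip: of_int_abs)
    then show ?thesis unfolding P0 by (simp add: prod_norm[symmetric])
  qed
  obtain i0 where i0: "i0 < n" "ps ! i0 = p0" using p0 unfolding in_set_conv_nth n_def by auto
  have nw0: "norm (w k l i0) = 1" for k l using n1 unfolding nw i0(2) by simp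
  define h where "h t = w 1 (int t) i0" for t :: nat
  \<comment> \<open>\<open>P\<close> has real coefficients, so the conjugate of a root is a root. It
    cannot have the index \<open>i0\<close> itself: then \<open>h t\<close> would be real of modulus
    one, hence of square 1, against \<open>ne\<close> for the exponents 2 and
    \<open>2 * t\<close>.\<close>
  have "\<exists>i<n. i \<noteq> i0 \<and> cnj (h t) = w 1 (int t) i" for t
  proof -
    have cr: "poly (map_poly of_int q) (cnj x) = cnj (poly (map_poly of_int q) x)" for q :: "int poly" and x
      by (induction q) (auto simp: of_int_hom.map_poly_pCons_hom)
    have "poly (map_poly of_int (P 1 (int t))) (h t) = 0" unfolding roots h_def using i0 by auto
    then have "poly (map_poly of_int (P 1 (int t))) (cnj (h t)) = 0" unfolding cr by simp
    then obtain i where i: "i < n" "cnj (h t) = w 1 (int t) i" unfolding roots by auto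
    have "i \<noteq> i0"
    proof
      assume "i = i0"
      then have "cnj (h t) = h t" using i unfolding h_def by simp
      moreover have "h t * cnj (h t) = 1"
        using nw0[of 1 "int t"] unfolding h_def by (simp add: complex_norm_square[symmetric])
      ultimately have "h t * h t = 1" by simp
      moreover have "h t * h t = z 2 (2 * int t) p0"
        using nz[OF p0] unfolding h_def w_def i0(2) z_def
        by (simp add: power_int_add power_int_mult[symmetric] power2_eq_square mult.commute[of 2] power_int_mult mult_ac)
      ultimately show False using ne[of 2 "2 * int t" p0] p0 by simp
    qed
    with i show ?thesis by blast
  qed
  then obtain j where j: "\<And>t. j t < n \<and> j t \<noteq> i0 \<and> cnj (h t) = w 1 (int t) (j t)" by metis
  \<comment> \<open>The index of the conjugate may depend on \<open>t\<close>, but two values of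
    \<open>t\<close> share one. At this index the moduli for \<open>a b^s\<close> and
    \<open>a b^t\<close> are both 1.\<close>
  have "\<not> inj j"
  proof
    assume "inj j"
    moreover have "finite (range j)" by (rule finite_subset[of _ "{..<n}"]) (use j in auto)
    ultimately show False using finite_imageD infinite_UNIV_nat by blast
  qed
  then obtain s t where st: "s \<noteq> t" "j s = j t" unfolding inj_def by blast
  define i1 where "i1 = j s"
  have i1: "i1 < n" "i1 \<noteq> i0" using j unfolding i1_def by auto
  have nj: "norm (w 1 (int t) (j t)) = 1" for t
    using j[of t] nw0[of 1 "int t"] unfolding h_def by (metis complex_mod_cnj)
  have "norm (fst (ps ! i1)) = 1 \<and> norm (snd (ps ! i1)) = 1"
  proof (rule norm_one_of_two_powers[OF _ _ _ _ st(1)])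
    show "norm (fst (ps ! i1)) * norm (snd (ps ! i1)) ^ s = 1" using nj[of s] unfolding nw i1_def by simp
    show "norm (fst (ps ! i1)) * norm (snd (ps ! i1)) ^ t = 1" using nj[of t] unfolding nw i1_def st(2) by simp
  qed (use nz[of "ps ! i1"] i1 n_def in auto)
  then have nw1: "norm (w k l i1) = 1" for k l unfolding nw by simp
  \<comment> \<open>The index \<open>r\<close> must not depend on \<open>k\<close> and
    \<open>l\<close>. For \<open>n = 2\<close> a neutral index serves; for \<open>n = 4\<close> the
    two remaining moduli are inverse to each other.\<close>
  have "\<exists>r<n. \<forall>k l. \<forall>i<n. norm (w k l i) \<in> {1, norm (w k l r), inverse (norm (w k l r))}"
  proof (cases "n = 2")
    case True
    then have "i = i0 \<or> i = i1" if "i < n" for i using that i0 i1 by linarith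
    then show ?thesis using i0 nw0 nw1 by (intro exI[of _ i0]) fastforce
  next
    case False
    then have n4: "n = 4" using n by simp
    have "card ({..<n} - {i0, i1}) = 2" using i0 i1 n4 by (simp add: card_Diff_subset)
    then obtain i2 i3 where i23: "{..<n} - {i0, i1} = {i2, i3}" "i2 \<noteq> i3" unfolding card_2_iff by blast
    have all: "{..<n} = {i0, i1, i2, i3}" using i23 i0 i1 by auto
    have d: "i0 \<notin> {i1, i2, i3}" "i1 \<notin> {i2, i3}" using i23 i1 by auto
    have "norm (w k l i2) * norm (w k l i3) = 1" for k l
      using prod1[of k l] d i23(2) unfolding all by (simp add: nw0 nw1)
    then have "norm (w k l i3) = inverse (norm (w k l i2))" for k l
      by (metis inverse_unique)
    moreover have "i = i0 \<or> i = i1 \<or> i = i2 \<or> i = i3" if "i < n" for i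
      using that all by (metis insertE lessThan_iff singletonD)
    moreover have "i2 < n" using all by blast
    ultimately show ?thesis using nw0 nw1 by (intro exI[of _ i2]) (metis insertI1 insertI2)
  qed
  then obtain r where r: "r < n" "\<And>k l i. i < n \<Longrightarrow> norm (w k l i) \<in> {1, norm (w k l r), inverse (norm (w k l r))}"
    by blast
  obtain s C where s: "inj (s :: nat \<Rightarrow> int \<times> int)" "C \<ge> 1"
    "\<And>t. norm (w (fst (s t)) (snd (s t)) r) \<le> C \<and> inverse (norm (w (fst (s t)) (snd (s t)) r)) \<le> C"
    using exists_near_unit_powers[of "norm (fst (ps ! r))" "norm (snd (ps ! r))"] nz[of "ps ! r"] r(1)
    unfolding nw n_def by auto
  define Q where "Q t = P (fst (s t)) (snd (s t))" for t
  have wb: "norm (w (fst (s t)) (snd (s t)) i) \<le> C" if "i < n" for t i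
    using r(2)[OF that, of "fst (s t)" "snd (s t)"] s(2) s(3)[of t] by auto
  let ?F = "{p :: int poly. degree p \<le> n \<and> (\<forall>i. \<bar>real_of_int (Polynomial.coeff p i)\<bar> \<le> (1 + C) ^ n)}"
  have QF: "Q t \<in> ?F \<and> Q t \<noteq> 0" for t
  proof -
    let ?zs = "map (z (fst (s t)) (snd (s t))) ps"
    have e: "map_poly of_int (Q t) = (\<Prod>x\<leftarrow>?zs. [:- x, 1:])"
      unfolding Q_def P map_map comp_def ..
    have b: "norm x \<le> C" if x: "x \<in> set ?zs" for x
    proof -
      obtain i where "i < n" "x = w (fst (s t)) (snd (s t)) i"
        using x unfolding in_set_conv_nth by (auto simp: w_def n_def)
      then show ?thesis using wb by simp
    qed
    have "norm (Polynomial.coeff (map_poly of_int (Q t)) i :: complex) \<le> (1 + C) ^ n" for i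
      using coeff_prod_linear_bound[of ?zs C i, OF b] s(2) unfolding e n_def by simp
    then have "\<bar>real_of_int (Polynomial.coeff (Q t) i)\<bar> \<le> (1 + C) ^ n" for i by (simp add: coeff_map_poly)
    moreover have "degree (Q t) = n"
    proof -
      have "degree (map_poly of_int (Q t) :: complex poly) = n"
        unfolding e n_def by (subst degree_linear_factors) simp
      then show ?thesis by (simp add: of_int_hom.degree_map_poly_hom)
    qed
    moreover have "Q t \<noteq> 0" using calculation(2) n by auto
    ultimately show ?thesis by auto
  qed
  \<comment> \<open>Along the infinitely many pairs \<open>s t\<close> all roots are bounded by
    \<open>C\<close>, so only finitely many polynomials \<open>Q t\<close>, and hence finitely many
    roots, occur. Two pairs with the same value at \<open>i0\<close> have a difference at which the
    neutral character is 1.\<close>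
  let ?R = "\<Union>p\<in>?F - {0}. {x :: complex. poly (map_poly of_int p) x = 0}"
  have "finite ?R"
    by (intro finite_UN_I finite_Diff finite_bounded_int_polys poly_roots_finite) auto
  moreover have "w (fst (s t)) (snd (s t)) i0 \<in> ?R" for t
    using QF[of t] i0 roots unfolding Q_def by blast
  ultimately have "\<not> inj (\<lambda>t. w (fst (s t)) (snd (s t)) i0)"
    using finite_imageD[of "\<lambda>t. w (fst (s t)) (snd (s t)) i0" UNIV] infinite_UNIV_nat
    by (meson finite_subset image_subsetI)
  then obtain t t' where tt: "t \<noteq> t'" "w (fst (s t)) (snd (s t)) i0 = w (fst (s t')) (snd (s t')) i0"
    unfolding inj_def by blast
  define k l where "k = fst (s t) - fst (s t')" and "l = snd (s t) - snd (s t')"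
  have "(k, l) \<noteq> (0, 0)"
    using s(1) tt(1) unfolding k_def l_def inj_def by (auto simp: prod_eq_iff)
  moreover have "z k l p0 = 1"
    using tt(2) nz[OF p0] unfolding w_def z_def i0(2) k_def l_def
    by (simp add: power_int_diff field_simps)
  ultimately show False using ne p0 by blast
qed

section \<open>Central powers in Schur representations of nilpotent groups\<close>

context group
begin

lemma inv_cancel_left: "x \<in> carrier G \<Longrightarrow> y \<in> carrier G \<Longrightarrow> x \<otimes> (inv x \<otimes> y) = y"
  "x \<in> carrier G \<Longrightarrow> y \<in> carrier G \<Longrightarrow> inv x \<otimes> (x \<otimes> y) = y"
  by (simp_all add: m_assoc[symmetric])

lemmas group_word = m_assoc inv_mult_group inv_cancel_left

text \<open>For normal \<open>N\<close> the preimage of the centre of \<open>G / N\<close>, written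
  with commutators to avoid the quotient group. Its iterates form the upper central series modulo
  \<open>N\<close>.\<close>

definition central_mod :: "'a set \<Rightarrow> 'a set" where
  "central_mod N = {g \<in> carrier G. \<forall>h\<in>carrier G. g \<otimes> h \<otimes> inv g \<otimes> inv h \<in> N}"

lemma central_modD:
  assumes "g \<in> central_mod N"
  shows "g \<in> carrier G" "h \<in> carrier G \<Longrightarrow> g \<otimes> h \<otimes> inv g \<otimes> inv h \<in> N"
  using assms unfolding central_mod_def by blast+

lemma normal_central_mod:
  assumes N: "N \<lhd> G"
  shows "central_mod N \<lhd> G"
proof -
  have sN: "subgroup N G" using N by (simp add: normal_imp_subgroup)
  have cj: "x \<otimes> y \<otimes> inv x \<in> N" if "x \<in> carrier G" "y \<in> N" for x y
    using N that normal_invE(2) by blast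
  show ?thesis
  proof (rule normal_invI)
    show "subgroup (central_mod N) G"
    proof (rule subgroupI)
      show "central_mod N \<subseteq> carrier G" unfolding central_mod_def by auto
      have "\<one> \<in> central_mod N" unfolding central_mod_def using subgroup.one_closed[OF sN] by simp
      then show "central_mod N \<noteq> {}" by auto
    next
      fix a assume a: "a \<in> central_mod N"
      show "inv a \<in> central_mod N" unfolding central_mod_def
      proof (intro CollectI conjI ballI)
        show "inv a \<in> carrier G" using a unfolding central_mod_def by simp
        fix h assume h: "h \<in> carrier G"
        have ac: "a \<in> carrier G" and c: "a \<otimes> h \<otimes> inv a \<otimes> inv h \<in> N" using a h unfolding central_mod_def by auto
        have "inv a \<otimes> inv (a \<otimes> h \<otimes> inv a \<otimes> inv h) \<otimes> inv (inv a) \<in> N"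
          using cj[of "inv a"] subgroup.m_inv_closed[OF sN c] ac by simp
        moreover have "inv a \<otimes> inv (a \<otimes> h \<otimes> inv a \<otimes> inv h) \<otimes> inv (inv a) = inv a \<otimes> h \<otimes> inv (inv a) \<otimes> inv h"
          using ac h by (simp add: group_word)
        ultimately show "inv a \<otimes> h \<otimes> inv (inv a) \<otimes> inv h \<in> N" by simp
      qed
    next
      fix a b assume a: "a \<in> central_mod N" and b: "b \<in> central_mod N"
      show "a \<otimes> b \<in> central_mod N" unfolding central_mod_def
      proof (intro CollectI conjI ballI)
        show "a \<otimes> b \<in> carrier G" using a b unfolding central_mod_def by simp
        fix h assume h: "h \<in> carrier G"
        have ab: "a \<in> carrier G" "b \<in> carrier G" and c: "a \<otimes> h \<otimes> inv a \<otimes> inv h \<in> N" "b \<otimes> h \<otimes> inv b \<otimes> inv h \<in> N"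
          using a b h unfolding central_mod_def by auto
        have "a \<otimes> (b \<otimes> h \<otimes> inv b \<otimes> inv h) \<otimes> inv a \<otimes> (a \<otimes> h \<otimes> inv a \<otimes> inv h) \<in> N"
          by (rule subgroup.m_closed[OF sN cj[OF ab(1) c(2)] c(1)])
        moreover have "a \<otimes> (b \<otimes> h \<otimes> inv b \<otimes> inv h) \<otimes> inv a \<otimes> (a \<otimes> h \<otimes> inv a \<otimes> inv h) = a \<otimes> b \<otimes> h \<otimes> inv (a \<otimes> b) \<otimes> inv h"
          using ab h by (simp add: group_word)
        ultimately show "a \<otimes> b \<otimes> h \<otimes> inv (a \<otimes> b) \<otimes> inv h \<in> N" by simp
      qed
    qed
  next
    fix x a assume x: "x \<in> carrier G" and a: "a \<in> central_mod N"
    show "x \<otimes> a \<otimes> inv x \<in> central_mod N" unfolding central_mod_def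
    proof (intro CollectI conjI ballI)
      show "x \<otimes> a \<otimes> inv x \<in> carrier G" using a x unfolding central_mod_def by simp
      fix h assume h: "h \<in> carrier G"
      have ac: "a \<in> carrier G" and c: "a \<otimes> (inv x \<otimes> h \<otimes> x) \<otimes> inv a \<otimes> inv (inv x \<otimes> h \<otimes> x) \<in> N"
        using a h x unfolding central_mod_def by auto
      have "x \<otimes> (a \<otimes> (inv x \<otimes> h \<otimes> x) \<otimes> inv a \<otimes> inv (inv x \<otimes> h \<otimes> x)) \<otimes> inv x \<in> N"
        by (rule cj[OF x c])
      moreover have "x \<otimes> (a \<otimes> (inv x \<otimes> h \<otimes> x) \<otimes> inv a \<otimes> inv (inv x \<otimes> h \<otimes> x)) \<otimes> inv x =
          x \<otimes> a \<otimes> inv x \<otimes> h \<otimes> inv (x \<otimes> a \<otimes> inv x) \<otimes> inv h"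
        using ac h x by (simp add: group_word)
      ultimately show "x \<otimes> a \<otimes> inv x \<otimes> h \<otimes> inv (x \<otimes> a \<otimes> inv x) \<otimes> inv h \<in> N" by simp
    qed
  qed
qed

lemma subset_central_mod:
  assumes N: "N \<lhd> G"
  shows "N \<subseteq> central_mod N"
proof
  fix a assume a: "a \<in> N"
  have sN: "subgroup N G" using N by (simp add: normal_imp_subgroup)
  have ac: "a \<in> carrier G" by (rule subgroup.mem_carrier[OF sN a])
  have "a \<otimes> h \<otimes> inv a \<otimes> inv h \<in> N" if h: "h \<in> carrier G" for h
  proof -
    have "a \<otimes> (h \<otimes> inv a \<otimes> inv h) \<in> N"
      by (rule subgroup.m_closed[OF sN a normal_invE(2)[OF N h subgroup.m_inv_closed[OF sN a]]])
    then show ?thesis using ac h by (simp add: group_word)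
  qed
  then show "a \<in> central_mod N" using ac unfolding central_mod_def by simp
qed

text \<open>Modulo \<open>N\<close> the commutator with \<open>h\<close> is multiplicative along the
  powers of \<open>g\<close>, because \<open>c\<close> is central there. The error terms are
  conjugates of elements of \<open>N\<close> and commutators of \<open>c\<close> with powers of
  \<open>g\<close>, collected in \<open>z\<close>.\<close>

lemma commutator_pow:
  assumes N: "N \<lhd> G" and g: "g \<in> carrier G" and h: "h \<in> carrier G"
    and c: "c = g \<otimes> h \<otimes> inv g \<otimes> inv h" and cc: "c \<in> central_mod N"
  shows "\<exists>z\<in>N. g [^] (k :: nat) \<otimes> h \<otimes> inv (g [^] k) \<otimes> inv h = z \<otimes> c [^] k"
proof (induction k)
  have sN: "subgroup N G" using N by (simp add: normal_imp_subgroup)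
  case 0
  show ?case using h subgroup.one_closed[OF sN] by (intro bexI[of _ \<one>]) auto
next
  have sN: "subgroup N G" using N by (simp add: normal_imp_subgroup)
  have cG: "c \<in> carrier G" using c g h by simp
  case (Suc k)
  then obtain z where z: "z \<in> N" "g [^] k \<otimes> h \<otimes> inv (g [^] k) \<otimes> inv h = z \<otimes> c [^] k" by blast
  have zG: "z \<in> carrier G" by (rule subgroup.mem_carrier[OF sN z(1)])
  define x where "x = g [^] k"
  have x: "x \<in> carrier G" unfolding x_def using g by simp
  have "inv (c \<otimes> x \<otimes> inv c \<otimes> inv x) \<in> N"
    by (rule subgroup.m_inv_closed[OF sN central_modD(2)[OF cc x]])
  then have "inv (c \<otimes> x \<otimes> inv c \<otimes> inv x) \<otimes> (c \<otimes> z \<otimes> inv c) \<in> N"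
    by (rule subgroup.m_closed[OF sN _ normal_invE(2)[OF N cG z(1)]])
  moreover have "g [^] Suc k \<otimes> h \<otimes> inv (g [^] Suc k) \<otimes> inv h =
      inv (c \<otimes> x \<otimes> inv c \<otimes> inv x) \<otimes> (c \<otimes> z \<otimes> inv c) \<otimes> c [^] Suc k"
  proof -
    have "g [^] Suc k \<otimes> h \<otimes> inv (g [^] Suc k) \<otimes> inv h = x \<otimes> c \<otimes> inv x \<otimes> (x \<otimes> h \<otimes> inv x \<otimes> inv h)"
      unfolding c using g h x by (simp add: group_word flip: x_def)
    also have "\<dots> = x \<otimes> c \<otimes> inv x \<otimes> (z \<otimes> c [^] k)" using z(2) unfolding x_def by simp
    also have "\<dots> = inv (c \<otimes> x \<otimes> inv c \<otimes> inv x) \<otimes> (c \<otimes> z \<otimes> inv c) \<otimes> (c \<otimes> c [^] k)"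
      using cG x zG by (simp add: group_word)
    also have "c \<otimes> c [^] k = c [^] Suc k" using cG by (simp add: nat_pow_comm[of c k 1, simplified])
    finally show ?thesis .
  qed
  ultimately show ?case by blast
qed

lemma iterated_central_mod_normal: "N \<lhd> G \<Longrightarrow> (central_mod ^^ i) N \<lhd> G"
  by (induction i) (auto intro: normal_central_mod)

text \<open>If the power \<open>M\<close> moves the second term of the upper central series into the
  first, it moves every term into the one below. For \<open>g\<close> in a higher term the
  commutator of \<open>g^M\<close> with \<open>h\<close> is the \<open>M\<close>-th power of the
  commutator of \<open>g\<close> with \<open>h\<close>, up to an element of a lower term, and this
  power is controlled by induction.\<close>

lemma central_mod_pow_descent:
  assumes N: "N \<lhd> G" and base: "\<And>g. g \<in> (central_mod ^^ 2) N \<Longrightarrow> g [^] (M :: nat) \<in> central_mod N"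
  shows "g \<in> (central_mod ^^ Suc (Suc i)) N \<Longrightarrow> g [^] M \<in> (central_mod ^^ Suc i) N"
proof (induction i arbitrary: g)
  case 0
  then show ?case using base by (simp add: numeral_2_eq_2)
next
  case (Suc i)
  let ?Z = "(central_mod ^^ Suc i) N"
  have nZ: "?Z \<lhd> G" by (rule iterated_central_mod_normal[OF N])
  have sZ: "subgroup ?Z G" using nZ by (simp add: normal_imp_subgroup)
  have g2: "g \<in> central_mod ((central_mod ^^ Suc (Suc i)) N)"
    using Suc.prems by (simp only: funpow.simps comp_def)
  note g = central_modD(1)[OF g2]
  have "g [^] M \<otimes> h \<otimes> inv (g [^] M) \<otimes> inv h \<in> ?Z" if h: "h \<in> carrier G" for h
  proof -
    define c where "c = g \<otimes> h \<otimes> inv g \<otimes> inv h"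
    have c: "c \<in> (central_mod ^^ Suc (Suc i)) N"
      unfolding c_def by (rule central_modD(2)[OF g2 h])
    have "c [^] M \<in> ?Z" by (rule Suc.IH[OF c])
    moreover obtain z where "z \<in> ?Z" "g [^] M \<otimes> h \<otimes> inv (g [^] M) \<otimes> inv h = z \<otimes> c [^] M"
      using commutator_pow[OF nZ g h c_def, of M] c[unfolded funpow.simps(2)[of "Suc i"] comp_def] by blast
    ultimately show ?thesis using subgroup.m_closed[OF sZ] by simp
  qed
  then have "g [^] M \<in> central_mod ?Z" using g unfolding central_mod_def by blast
  then show ?case by (simp only: funpow.simps comp_def)
qed

lemma central_mod_pow:
  assumes N: "N \<lhd> G" and base: "\<And>g. g \<in> (central_mod ^^ 2) N \<Longrightarrow> g [^] (M :: nat) \<in> central_mod N"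
  shows "g \<in> (central_mod ^^ Suc i) N \<Longrightarrow> g [^] (M ^ i) \<in> central_mod N"
proof (induction i arbitrary: g)
  case 0
  then have "g \<in> central_mod N" by simp
  then show ?case using central_modD(1) by simp
next
  case (Suc i)
  have "g \<in> central_mod ((central_mod ^^ Suc i) N)"
    using Suc.prems by (simp only: funpow.simps comp_def)
  note g = central_modD(1)[OF this]
  have "(g [^] M) [^] (M ^ i) \<in> central_mod N"
    by (rule Suc.IH) (rule central_mod_pow_descent[OF N base Suc.prems])
  then show ?case using g by (simp add: nat_pow_pow)
qed

text \<open>The usual comparison of the two central series: the lower one reaches the trivial group
  at step \<open>c\<close>, and counting back from there it stays inside the upper one modulo
  \<open>N\<close>.\<close>

lemma lower_central_subset_central_mod:
  assumes N: "N \<lhd> G" and c: "lower_central G c = {\<one>}" and j: "j \<le> c"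
  shows "lower_central G (c - j) \<subseteq> (central_mod ^^ j) N"
  using j
proof (induction j)
  case 0
  then show ?case using c subgroup.one_closed[OF normal_imp_subgroup[OF N]] by simp
next
  case (Suc j)
  have lc: "lower_central G k \<subseteq> carrier G" for k
    by (induction k) (auto intro!: generate_incl)
  have e: "c - j = Suc (c - Suc j)" using Suc.prems by simp
  have "x \<otimes> y \<otimes> inv x \<otimes> inv y \<in> (central_mod ^^ j) N" if "x \<in> lower_central G (c - Suc j)" "y \<in> carrier G" for x y
  proof -
    have "x \<otimes> y \<otimes> inv x \<otimes> inv y \<in> lower_central G (c - j)"
      unfolding e lower_central.simps by (rule generate.incl) (use that in blast)
    then show ?thesis using Suc by auto
  qed
  then show ?case using lc unfolding funpow.simps comp_def central_mod_def by auto
qed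

lemma nilpotent_power_central:
  assumes N: "N \<lhd> G" and base: "\<And>g. g \<in> (central_mod ^^ 2) N \<Longrightarrow> g [^] (M :: nat) \<in> central_mod N"
    and c: "lower_central G c = {\<one>}" and g: "g \<in> carrier G"
  shows "g [^] (M ^ c) \<in> central_mod N"
proof (rule central_mod_pow[OF N base])
  have "carrier G \<subseteq> (central_mod ^^ c) N"
    using lower_central_subset_central_mod[OF N c, of c] by simp
  then show "g \<in> (central_mod ^^ Suc c) N"
    using g subset_central_mod[OF iterated_central_mod_normal[OF N, of c]] by auto
qed

end

section \<open>Linear representations and their central elements\<close>

locale linear_rep = group G for G (structure) +
  fixes R :: "'a \<Rightarrow> 'f :: field mat" and n :: nat
  assumes R_carrier [simp]: "x \<in> carrier G \<Longrightarrow> R x \<in> carrier_mat n n"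
    and R_mult: "x \<in> carrier G \<Longrightarrow> y \<in> carrier G \<Longrightarrow> R (x \<otimes> y) = R x * R y"
    and R_one: "R \<one> = 1\<^sub>m n"
begin

lemma R_dim [simp]: "x \<in> carrier G \<Longrightarrow> dim_row (R x) = n" "x \<in> carrier G \<Longrightarrow> dim_col (R x) = n"
  using carrier_matD[OF R_carrier] by auto

lemma R_inv: "x \<in> carrier G \<Longrightarrow> R x * R (inv x) = 1\<^sub>m n" "x \<in> carrier G \<Longrightarrow> R (inv x) * R x = 1\<^sub>m n"
  by (simp_all add: R_mult[symmetric] R_one)

definition rep_kernel :: "'a set" where "rep_kernel = {g \<in> carrier G. R g = 1\<^sub>m n}"

lemma normal_rep_kernel: "rep_kernel \<lhd> G"
proof (rule normal_invI)
  show "subgroup rep_kernel G"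
  proof (rule subgroupI)
    show "rep_kernel \<noteq> {}" using R_one unfolding rep_kernel_def by auto
    fix a assume a: "a \<in> rep_kernel"
    then have "R (inv a) = 1\<^sub>m n" using R_inv(1)[of a] unfolding rep_kernel_def by simp
    then show "inv a \<in> rep_kernel" using a unfolding rep_kernel_def by simp
  qed (auto simp: rep_kernel_def R_mult)
  fix x a assume x: "x \<in> carrier G" and a: "a \<in> rep_kernel"
  then show "x \<otimes> a \<otimes> inv x \<in> rep_kernel" by (simp add: rep_kernel_def R_mult R_inv)
qed

text \<open>The commutator \<open>c\<close> satisfies \<open>R g * R h = R c * (R h * R g)\<close>,
  where the last factor is invertible. This turns the central series into statements about the
  commutant.\<close>

lemma central_mod_rep_kernel:
  "g \<in> central_mod rep_kernel \<longleftrightarrow> g \<in> carrier G \<and> (\<forall>h\<in>carrier G. R g * R h = R h * R g)"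
proof -
  have "g \<otimes> h \<otimes> inv g \<otimes> inv h \<in> rep_kernel \<longleftrightarrow> R g * R h = R h * R g"
    if g: "g \<in> carrier G" and h: "h \<in> carrier G" for h
  proof -
    define c where "c = g \<otimes> h \<otimes> inv g \<otimes> inv h"
    have c: "c \<in> carrier G" and gh: "g \<otimes> h = c \<otimes> (h \<otimes> g)" unfolding c_def using g h by (simp_all add: group_word)
    have e: "R g * R h = R c * (R h * R g)" using gh c g h by (simp add: R_mult[symmetric])
    show ?thesis unfolding c_def[symmetric]
    proof
      assume "c \<in> rep_kernel"
      then have "R c = 1\<^sub>m n" by (simp add: rep_kernel_def)
      then show "R g * R h = R h * R g" using e g h by (simp add: left_mult_one_mat' )
    next
      assume comm: "R g * R h = R h * R g"
      have hg: "R (h \<otimes> g) = R c * R (h \<otimes> g)" using e comm g h by (simp add: R_mult)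
      have "R c = R c * (R (h \<otimes> g) * R (inv (h \<otimes> g)))"
        using c g h R_inv(1)[of "h \<otimes> g"] right_mult_one_mat[OF R_carrier[OF c]] by simp
      also have "\<dots> = R c * R (h \<otimes> g) * R (inv (h \<otimes> g))" using c g h by (simp add: mult_assoc_dim)
      also have "\<dots> = 1\<^sub>m n" unfolding hg[symmetric] using R_inv(1)[of "h \<otimes> g"] g h by simp
      finally show "c \<in> rep_kernel" using c by (simp add: rep_kernel_def)
    qed
  qed
  then show ?thesis unfolding central_mod_def by blast
qed

end

lemma poly_prod_characters_root:
  "\<theta> \<in> set cs \<Longrightarrow> poly (\<Prod>\<theta> \<leftarrow> cs. [:- \<theta> Y, 1:]) (\<theta> Y) = (0 :: 'a :: comm_ring_1)"
  by (induction cs) auto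

lemma map_of_rat_mult:
  assumes "A \<in> carrier_mat n n" "B \<in> carrier_mat n n"
  shows "(map_mat of_rat (A * B) :: complex mat) = map_mat of_rat A * map_mat of_rat B"
  by (rule of_rat_hom.mat_hom_mult[OF assms])

lemma (in linear_rep) char_poly_conj:
  assumes "x \<in> carrier G" "g \<in> carrier G"
  shows "char_poly (R (g \<otimes> x \<otimes> inv g)) = char_poly (R x)"
proof (rule char_poly_similar, rule similar_matI[of _ _ "R g" "R (inv g)" n])
  show "R (g \<otimes> x \<otimes> inv g) = R g * R x * R (inv g)" using assms by (simp add: R_mult)
qed (use assms R_inv in auto)

locale schur_rep = linear_rep G R n for G (structure) and R :: "'a \<Rightarrow> rat mat" and n +
  assumes schur: "schur_set n (R ` carrier G)" and n_pos: "n > 0"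
begin

text \<open>Conjugation by \<open>g\<close> turns \<open>h\<close> into \<open>c h\<close> and, as
  \<open>c\<close> acts centrally, \<open>c^k h\<close> into \<open>c^(k+1) h\<close>, so all
  \<open>R (c^k h)\<close> have one characteristic polynomial, of degree \<open>n\<close>. Its roots
  include \<open>\<theta>(c)^k \<theta>(h)\<close> for every joint character, and among
  \<open>k = 0, ..., n\<close> two values coincide. Hence \<open>\<theta>(c)\<close> is a root of
  unity of order at most \<open>n\<close>. The bound \<open>N\<close> is kept apart from
  \<open>n\<close> so that one exponent serves all blocks.\<close>

lemma central_commutator_power:
  assumes c: "c \<in> central_mod rep_kernel" and g: "g \<in> carrier G" and h: "h \<in> carrier G"
    and ch: "g \<otimes> h \<otimes> inv g = c \<otimes> h" and nN: "n \<le> N"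
  shows "R (c [^] (fact N :: nat)) = 1\<^sub>m n"
proof -
  let ?Z = "central_mod rep_kernel"
  let ?C = "\<lambda>x. map_mat of_rat (R x) :: complex mat"
  note zc = central_mod_rep_kernel
  have sZ: "subgroup ?Z G" by (rule normal_imp_subgroup[OF normal_central_mod[OF normal_rep_kernel]])
  have cG: "c \<in> carrier G" using c zc by blast
  have cpow: "c [^] (k :: nat) \<in> ?Z" for k
    by (induction k) (use c subgroup.one_closed[OF sZ] subgroup.m_closed[OF sZ] in auto)
  \<comment> \<open>A set with commuting images, just large enough for the characters to be
    multiplicative on powers of \<open>c\<close> times \<open>h\<close> and to be nonzero at
    \<open>h\<close>.\<close>
  define T where "T = ?Z \<union> {z \<otimes> h | z. z \<in> ?Z} \<union> {inv h}"
  have TG: "x \<in> carrier G" if "x \<in> T" for x using that h zc unfolding T_def by auto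
  have Rcomm: "R x * R y = R y * R x" if "x \<in> T" "y \<in> T" for x y
  proof -
    have zz: "R z * R u = R u * R z" if "z \<in> ?Z" "u \<in> carrier G" for z u using that zc by blast
    have hh: "R (z \<otimes> h) * R u = R u * R (z \<otimes> h)" if z: "z \<in> ?Z" and u: "u \<in> carrier G" and hu: "R h * R u = R u * R h" for z u
    proof -
      have zG: "z \<in> carrier G" using z zc by blast
      have "R (z \<otimes> h) * R u = R z * (R h * R u)" using zG h u by (simp add: R_mult mult_assoc_dim)
      also have "\<dots> = R z * R u * R h" unfolding hu using zG h u by (simp add: mult_assoc_dim)
      also have "\<dots> = R u * R (z \<otimes> h)" unfolding zz[OF z u] using zG h u by (simp add: R_mult mult_assoc_dim)
      finally show ?thesis .
    qed
    have hi: "R h * R (inv h) = R (inv h) * R h" using R_inv h by simp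
    have hz: "R h * R (z \<otimes> h) = R (z \<otimes> h) * R h" if z: "z \<in> ?Z" for z
      using hh[OF z h] by simp
    from that consider "x \<in> ?Z" | "y \<in> ?Z" | z where "x = z \<otimes> h" "z \<in> ?Z" "y \<notin> ?Z" | "x = inv h" "y \<notin> ?Z"
      unfolding T_def by auto
    then show ?thesis
    proof cases
      case 1 then show ?thesis using zz TG that by blast
    next
      case 2 then show ?thesis using zz[of y x] TG that by simp
    next
      case 3
      then have "(\<exists>w\<in>?Z. y = w \<otimes> h) \<or> y = inv h" using that(2) unfolding T_def by auto
      then have "R h * R y = R y * R h" using hz hi by auto
      then show ?thesis using hh[OF 3(2)] 3(1) TG that by simp
    next
      case 4
      then have "(\<exists>w\<in>?Z. y = w \<otimes> h) \<or> y = inv h" using that(2) unfolding T_def by auto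
      then show ?thesis using hh[of _ "inv h"] hi h 4 by auto
    qed
  qed
  have cm: "?C x * ?C y = ?C (x \<otimes> y)" if "x \<in> carrier G" "y \<in> carrier G" for x y
    using that by (simp add: R_mult map_of_rat_mult[where n = n])
  have "?C ` T \<subseteq> carrier_mat n n" using TG by auto
  moreover have "Y * Z = Z * Y" if "Y \<in> ?C ` T" "Z \<in> ?C ` T" for Y Z
    using that Rcomm TG by (auto simp: map_of_rat_mult[where n = n, symmetric])
  ultimately obtain cs where cs: "length cs = n"
    "\<forall>\<theta>\<in>set cs. \<theta> (1\<^sub>m n) = 1 \<and> (\<forall>Y\<in>?C ` T. \<forall>Z\<in>?C ` T. \<theta> (Y * Z) = \<theta> Y * \<theta> Z)"
    "\<forall>Y\<in>?C ` T. char_poly Y = (\<Prod>\<theta> \<leftarrow> cs. [:- \<theta> Y, 1:])"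
    using commuting_characters[of "?C ` T" n] by blast
  have hT: "h \<in> T" "inv h \<in> T" and cT: "c [^] (k :: nat) \<in> T" "c [^] k \<otimes> h \<in> T" for k
    unfolding T_def using h cpow[of 0] cpow by force+
  have cp: "char_poly (R (c [^] k \<otimes> h)) = char_poly (R h)" for k :: nat
  proof (induction k)
    case 0 then show ?case using h by simp
  next
    case (Suc k)
    have ck: "c [^] k \<in> carrier G" using cG by simp
    have "char_poly (R (c [^] k \<otimes> h)) = char_poly (R (g \<otimes> (c [^] k \<otimes> h) \<otimes> inv g))"
      by (rule char_poly_conj[symmetric]) (use ck h g in auto)
    also have "R (g \<otimes> (c [^] k \<otimes> h) \<otimes> inv g) = (R g * R (c [^] k)) * (R h * R (inv g))"
      using ck h g by (simp add: R_mult mult_assoc_dim)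
    also have "R g * R (c [^] k) = R (c [^] k) * R g" using cpow[of k] zc g by simp
    also have "(R (c [^] k) * R g) * (R h * R (inv g)) = R (c [^] k \<otimes> (g \<otimes> h \<otimes> inv g))"
      using ck h g by (simp add: R_mult mult_assoc_dim)
    also have "c [^] k \<otimes> (g \<otimes> h \<otimes> inv g) = c [^] Suc k \<otimes> h" unfolding ch using cG h by (simp add: m_assoc)
    finally show ?case using Suc by simp
  qed
  have g1: "\<theta> (?C c) ^ fact N = 1 \<and> (\<forall>k. \<theta> (?C (c [^] (k :: nat))) = \<theta> (?C c) ^ k)" if th: "\<theta> \<in> set cs" for \<theta>
  proof -
    have mult: "\<theta> (?C (x \<otimes> y)) = \<theta> (?C x) * \<theta> (?C y)" if "x \<in> T" "y \<in> T" for x y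
      using cs(2) th that TG by (simp add: cm[symmetric])
    have one: "\<theta> (?C \<one>) = 1" using cs(2) th by (simp add: R_one of_rat_hom.mat_hom_one)
    have pw: "\<theta> (?C (c [^] k)) = \<theta> (?C c) ^ k" for k :: nat
    proof (induction k)
      case 0 then show ?case using one by simp
    next
      case (Suc k)
      have "c [^] Suc k = c [^] k \<otimes> c" by simp
      then show ?case using mult[OF cT(1)[of k] cT(1)[of 1]] Suc cG by simp
    qed
    have nzh: "\<theta> (?C h) \<noteq> 0" using mult[OF hT] one h by auto
    have "inv c \<in> T" using c subgroup.m_inv_closed[OF sZ] unfolding T_def by simp
    then have nzc: "\<theta> (?C c) \<noteq> 0" using mult[OF cT(1)[of 1], of "inv c"] one cG by auto
    let ?p = "rat_poly (char_poly (R h))"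
    have "poly ?p (\<theta> (?C c) ^ k * \<theta> (?C h)) = 0" for k
    proof -
      have kG: "c [^] k \<otimes> h \<in> carrier G" using cG h by simp
      have "?p = char_poly (?C (c [^] k \<otimes> h))"
        unfolding cp[of k, symmetric] of_rat_hom.char_poly_hom[OF R_carrier[OF kG]] ..
      also have "\<dots> = (\<Prod>\<theta> \<leftarrow> cs. [:- \<theta> (?C (c [^] k \<otimes> h)), 1:])" using cs(3) cT(2) by blast
      finally have "poly ?p (\<theta> (?C (c [^] k \<otimes> h))) = 0"
        using poly_prod_characters_root[OF th] by simp
      then show ?thesis using mult[OF cT(1) hT(1)] pw by simp
    qed
    then have sub: "(\<lambda>k. \<theta> (?C c) ^ k * \<theta> (?C h)) ` {..n} \<subseteq> {x. poly ?p x = 0}" by auto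
    have dp: "degree ?p = n" "?p \<noteq> 0"
      using degree_monic_char_poly[OF R_carrier[OF h]] n_pos by (auto simp: of_rat_hom.degree_map_poly_hom)
    have "card {x. poly ?p x = 0} \<le> n" using card_poly_roots_bound[OF dp(2)] dp(1) by simp
    then have "card ((\<lambda>k. \<theta> (?C c) ^ k * \<theta> (?C h)) ` {..n}) \<le> n"
      using card_mono[OF poly_roots_finite[OF dp(2)] sub] by simp
    then have "\<not> inj_on (\<lambda>k. \<theta> (?C c) ^ k * \<theta> (?C h)) {..n}"
      using card_image[of "\<lambda>k. \<theta> (?C c) ^ k * \<theta> (?C h)" "{..n}"] by auto
    then obtain i j where ij: "i < j" "j \<le> n" "\<theta> (?C c) ^ i = \<theta> (?C c) ^ j"
      using nzh unfolding inj_on_def by (auto, metis nat_neq_iff)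
    have "\<theta> (?C c) ^ j = \<theta> (?C c) ^ i * \<theta> (?C c) ^ (j - i)" using ij(1) by (simp flip: power_add)
    then have "\<theta> (?C c) ^ (j - i) = 1" using ij(3) nzc by simp
    moreover have "(j - i) dvd fact N" using ij(1,2) nN by (intro dvd_fact) auto
    ultimately have "\<theta> (?C c) ^ fact N = 1" by (auto simp: dvd_def power_mult)
    with pw show ?thesis by blast
  qed
  let ?M = "R (c [^] (fact N :: nat))"
  have MG: "c [^] (fact N :: nat) \<in> carrier G" using cG by simp
  have Mc: "?M \<in> carrier_mat n n" by (rule R_carrier[OF MG])
  obtain \<theta> where th: "\<theta> \<in> set cs" using cs(1) n_pos by (cases cs) auto
  have "char_poly (?C (c [^] (fact N :: nat))) = (\<Prod>\<theta> \<leftarrow> cs. [:- \<theta> (?C (c [^] (fact N :: nat))), 1:])"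
    using cs(3) cT(1) by blast
  then have "poly (char_poly (?C (c [^] (fact N :: nat)))) (\<theta> (?C (c [^] (fact N :: nat)))) = 0"
    using poly_prod_characters_root[OF th] by simp
  \<comment> \<open>The eigenvalue is now the rational number 1, so the Schur property over the
    rationals applies although the characters are complex.\<close>
  then have "poly (rat_poly (char_poly ?M)) (of_rat 1) = 0"
    using g1[OF th] by (simp add: of_rat_hom.char_poly_hom[OF Mc])
  then have "poly (char_poly ?M) 1 = 0" unfolding of_rat_hom.poly_map_poly by simp
  then have "?M = 1 \<cdot>\<^sub>m 1\<^sub>m n"
  proof (rule schur_eigenvalue_scalar[OF _ schur Mc, rotated 2])
    show "R ` carrier G \<subseteq> carrier_mat n n" by auto
    fix Y assume "Y \<in> R ` carrier G"
    then show "?M * Y = Y * ?M" using cpow[of "fact N"] zc by auto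
  qed
  also have "1 \<cdot>\<^sub>m 1\<^sub>m n = (1\<^sub>m n :: rat mat)" by (rule eq_matI) auto
  finally show ?thesis .
qed

text \<open>\<open>central_commutator_power\<close> is the passage from the second to the first term
  of the upper central series modulo the kernel; one such passage for each step of the nilpotency
  class gives the exponent \<open>fact N ^ l\<close>.\<close>

lemma power_central:
  assumes nil: "lower_central G l = {\<one>}" and nN: "n \<le> N" and g: "g \<in> carrier G" and h: "h \<in> carrier G"
  shows "R (g [^] (fact N ^ l :: nat)) * R h = R h * R (g [^] (fact N ^ l :: nat))"
proof -
  have "g [^] (fact N ^ l :: nat) \<in> central_mod rep_kernel"
  proof (rule nilpotent_power_central[OF normal_rep_kernel _ nil g])
    fix g assume g2: "g \<in> (central_mod ^^ 2) rep_kernel"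
    then have g2: "g \<in> central_mod (central_mod rep_kernel)" by (simp add: numeral_2_eq_2)
    then have g: "g \<in> carrier G" by (simp add: central_mod_def)
    have sK: "subgroup rep_kernel G" by (rule normal_imp_subgroup[OF normal_rep_kernel])
    have "g [^] (fact N :: nat) \<otimes> h \<otimes> inv (g [^] (fact N :: nat)) \<otimes> inv h \<in> rep_kernel" if h: "h \<in> carrier G" for h
    proof -
      define c where "c = g \<otimes> h \<otimes> inv g \<otimes> inv h"
      have c: "c \<in> central_mod rep_kernel" using g2 h unfolding c_def central_mod_def by blast
      have "R (c [^] (fact N :: nat)) = 1\<^sub>m n"
        by (rule central_commutator_power[OF c g h _ nN]) (use g h in \<open>simp add: c_def group_word\<close>)
      then have "c [^] (fact N :: nat) \<in> rep_kernel" using g h unfolding rep_kernel_def c_def by simp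
      moreover obtain z where "z \<in> rep_kernel" "g [^] (fact N :: nat) \<otimes> h \<otimes> inv (g [^] (fact N :: nat)) \<otimes> inv h = z \<otimes> c [^] (fact N :: nat)"
        using commutator_pow[OF normal_rep_kernel g h c_def c] by blast
      ultimately show ?thesis using subgroup.m_closed[OF sK] by simp
    qed
    then show "g [^] (fact N :: nat) \<in> central_mod rep_kernel" using g by (simp add: central_mod_def)
  qed
  then show ?thesis using central_mod_rep_kernel h by blast
qed

end

section \<open>Neutral blocks\<close>

context schur_rep
begin

abbreviation "rep_center \<equiv> central_mod rep_kernel"

lemma subgroup_rep_center: "subgroup rep_center G"
  by (rule normal_imp_subgroup[OF normal_central_mod[OF normal_rep_kernel]])

text \<open>The joint eigenvalues as functions on the group, where the products and powers of
  \<open>a\<close> and \<open>b\<close> are formed.\<close>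

lemma central_characters:
  "\<exists>cs :: ('a \<Rightarrow> complex) list. length cs = n \<and>
     (\<forall>\<theta>\<in>set cs. \<theta> \<one> = 1 \<and> (\<forall>x\<in>rep_center. \<forall>y\<in>rep_center. \<theta> (x \<otimes> y) = \<theta> x * \<theta> y)) \<and>
     (\<forall>x\<in>rep_center. rat_poly (char_poly (R x)) = (\<Prod>\<theta> \<leftarrow> cs. [:- \<theta> x, 1:]))"
proof -
  let ?C = "\<lambda>x. map_mat of_rat (R x) :: complex mat"
  have ZG: "x \<in> carrier G" if "x \<in> rep_center" for x using that central_modD(1) by blast
  have sub: "?C ` rep_center \<subseteq> carrier_mat n n" using ZG by auto
  have "Y * Z = Z * Y" if YZ: "Y \<in> ?C ` rep_center" "Z \<in> ?C ` rep_center" for Y Z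
  proof -
    obtain x y where xy: "Y = ?C x" "Z = ?C y" "x \<in> rep_center" "y \<in> rep_center" using YZ by blast
    have "R x * R y = R y * R x" using xy(3) ZG[OF xy(4)] central_mod_rep_kernel by blast
    then show ?thesis unfolding xy
      using map_of_rat_mult[OF R_carrier[OF ZG[OF xy(3)]] R_carrier[OF ZG[OF xy(4)]]]
        map_of_rat_mult[OF R_carrier[OF ZG[OF xy(4)]] R_carrier[OF ZG[OF xy(3)]]] by simp
  qed
  then obtain cs where cs: "length cs = n"
    "\<forall>\<theta>\<in>set cs. \<theta> (1\<^sub>m n) = 1 \<and> (\<forall>Y\<in>?C ` rep_center. \<forall>Z\<in>?C ` rep_center. \<theta> (Y * Z) = \<theta> Y * \<theta> Z)"
    "\<forall>Y\<in>?C ` rep_center. char_poly Y = (\<Prod>\<theta> \<leftarrow> cs. [:- \<theta> Y, 1:])"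
    using commuting_characters[OF sub] by blast
  let ?cs = "map (\<lambda>\<theta> x. \<theta> (?C x)) cs"
  show ?thesis
  proof (intro exI[of _ ?cs] conjI ballI)
    show "length ?cs = n" using cs(1) by simp
  next
    fix \<theta> assume "\<theta> \<in> set ?cs"
    then obtain t where t: "t \<in> set cs" "\<theta> = (\<lambda>x. t (?C x))" by auto
    show "\<theta> \<one> = 1" using cs(2) t by (simp add: R_one of_rat_hom.mat_hom_one)
    fix x y assume xy: "x \<in> rep_center" "y \<in> rep_center"
    have "?C (x \<otimes> y) = ?C x * ?C y"
      using map_of_rat_mult[OF R_carrier[OF ZG[OF xy(1)]] R_carrier[OF ZG[OF xy(2)]]] R_mult ZG xy by simp
    then show "\<theta> (x \<otimes> y) = \<theta> x * \<theta> y" using cs(2) t xy by simp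
  next
    fix x assume x: "x \<in> rep_center"
    have "rat_poly (char_poly (R x)) = char_poly (?C x)"
      by (rule of_rat_hom.char_poly_hom[symmetric, OF R_carrier[OF ZG[OF x]]])
    also have "\<dots> = (\<Prod>\<theta> \<leftarrow> cs. [:- \<theta> (?C x), 1:])" using cs(3) x by blast
    also have "\<dots> = (\<Prod>\<theta> \<leftarrow> ?cs. [:- \<theta> x, 1:])" by (simp add: comp_def)
    finally show "rat_poly (char_poly (R x)) = (\<Prod>\<theta> \<leftarrow> ?cs. [:- \<theta> x, 1:])" .
  qed
qed

lemma character_int_pow:
  fixes \<theta> :: "'a \<Rightarrow> complex"
  assumes one: "\<theta> \<one> = 1" and mult: "\<forall>x\<in>rep_center. \<forall>y\<in>rep_center. \<theta> (x \<otimes> y) = \<theta> x * \<theta> y"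
    and a: "a \<in> rep_center"
  shows "\<theta> a \<noteq> 0" "\<theta> (a [^] (k :: int)) = \<theta> a powi k" "a [^] (k :: int) \<in> rep_center"
    "\<theta> (a [^] (m :: nat)) = \<theta> a ^ m"
proof -
  note sZ = subgroup_rep_center
  have aG: "a \<in> carrier G" using a central_modD(1) by blast
  have ia: "inv a \<in> rep_center" by (rule subgroup.m_inv_closed[OF sZ a])
  have i1: "\<theta> a * \<theta> (inv a) = 1" using mult a ia one aG by (metis r_inv)
  then show nz: "\<theta> a \<noteq> 0" by auto
  have np: "x [^] (m :: nat) \<in> rep_center \<and> \<theta> (x [^] m) = \<theta> x ^ m" if "x \<in> rep_center" for x m
  proof (induction m)
    case 0
    then show ?case using one subgroup.one_closed[OF sZ] by simp
  next
    case (Suc m)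
    then show ?case using that mult subgroup.m_closed[OF sZ] by simp
  qed
  then show "\<theta> (a [^] (m :: nat)) = \<theta> a ^ m" using a by blast
  have "a [^] k \<in> rep_center \<and> \<theta> (a [^] k) = \<theta> a powi k"
  proof (cases "k \<ge> 0")
    case True
    then obtain m where k: "k = int m" using nonneg_int_cases by blast
    show ?thesis unfolding k using np[OF a] by (simp add: int_pow_int)
  next
    case False
    then have k: "k = - int m" if "m = nat (- k)" for m using that by simp
    define m where "m = nat (- k)"
    note k = k[OF m_def]
    have "a [^] k = inv a [^] m" unfolding k using aG by (simp add: int_pow_neg_int nat_pow_inv)
    moreover have "\<theta> (inv a) = inverse (\<theta> a)" using i1 by (metis inverse_unique)
    ultimately show ?thesis using np[OF ia] unfolding k by (simp add: power_int_minus power_inverse)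
  qed
  then show "\<theta> (a [^] k) = \<theta> a powi k" "a [^] k \<in> rep_center" by auto
qed

text \<open>On a one-dimensional block the values at \<open>a\<close> and its inverse are integers
  with product 1, so \<open>a^2\<close> would have the eigenvalue 1. The second claim combines the
  parity result for unit circle eigenvalues with \<open>neutral_pair_length\<close>, both for the
  same character.\<close>

lemma neutral_block_dim:
  fixes cs :: "('a \<Rightarrow> complex) list"
  assumes cs: "length cs = n"
    "\<forall>\<theta>\<in>set cs. \<theta> \<one> = 1 \<and> (\<forall>x\<in>rep_center. \<forall>y\<in>rep_center. \<theta> (x \<otimes> y) = \<theta> x * \<theta> y)"
    "\<forall>x\<in>rep_center. rat_poly (char_poly (R x)) = (\<Prod>\<theta> \<leftarrow> cs. [:- \<theta> x, 1:])"
    and int: "\<And>x. x \<in> carrier G \<Longrightarrow> \<exists>p :: int poly. char_poly (R x) = map_poly of_int p"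
    and ab: "a \<in> rep_center" "b \<in> rep_center"
    and ne: "\<And>(k :: int) (l :: int). (k, l) \<noteq> (0, 0) \<Longrightarrow> poly (char_poly (R (a [^] k \<otimes> b [^] l))) 1 \<noteq> 0"
  shows "n \<noteq> 1"
    and "\<theta> \<in> set cs \<Longrightarrow> norm (\<theta> a) = 1 \<Longrightarrow> norm (\<theta> b) = 1 \<Longrightarrow> even n \<and> n \<noteq> 2 \<and> n \<noteq> 4"
proof -
  have sZ: "subgroup rep_center G" by (rule subgroup_rep_center)
  have ZG: "x \<in> carrier G" if "x \<in> rep_center" for x using that central_modD(1) by blast
  have ip: "\<theta> (a [^] k) = \<theta> a powi k" "\<theta> (b [^] k) = \<theta> b powi k" "\<theta> a \<noteq> 0" "\<theta> b \<noteq> 0"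
    "a [^] k \<in> rep_center" "b [^] k \<in> rep_center"
    if "\<theta> \<in> set cs" for \<theta> and k :: int
    using character_int_pow[of \<theta>] cs(2) ab that by auto
  have cne: "cs \<noteq> []" using cs(1) n_pos by auto
  then have hd: "hd cs \<in> set cs" by simp
  have pc: "a [^] k \<otimes> b [^] l \<in> rep_center" for k l :: int
    by (rule subgroup.m_closed[OF sZ ip(5)[OF hd] ip(6)[OF hd]])
  have chi: "\<theta> (a [^] k \<otimes> b [^] l) = \<theta> a powi k * \<theta> b powi l" if th: "\<theta> \<in> set cs" for \<theta> and k l :: int
  proof -
    have "\<forall>x\<in>rep_center. \<forall>y\<in>rep_center. \<theta> (x \<otimes> y) = \<theta> x * \<theta> y" using cs(2) th by blast
    then show ?thesis using ip[OF th] by simp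
  qed
  have nee: "\<theta> a powi k * \<theta> b powi l \<noteq> 1" if th: "\<theta> \<in> set cs" and kl: "(k, l) \<noteq> (0, 0)" for \<theta> and k l :: int
  proof
    assume one: "\<theta> a powi k * \<theta> b powi l = 1"
    let ?x = "a [^] k \<otimes> b [^] l"
    have "poly (rat_poly (char_poly (R ?x))) (\<theta> ?x) = 0"
      using cs(3) pc[of k l] poly_prod_characters_root[OF th, of ?x] by simp
    then have "poly (rat_poly (char_poly (R ?x))) (of_rat 1) = 0" unfolding chi[OF th] one by simp
    then show False using ne[OF kl] unfolding of_rat_hom.poly_map_poly by simp
  qed
  have rp: "rat_poly (map_poly of_int p) = map_poly of_int p" for p :: "int poly"
    by (rule poly_eqI) (simp add: coeff_map_poly)
  show "n \<noteq> 1"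
  proof
    assume "n = 1"
    then obtain \<theta> where csn: "cs = [\<theta>]" using cs(1) by (cases cs) auto
    then have th: "\<theta> \<in> set cs" by simp
    have "\<exists>i :: int. \<theta> x = of_int i" if x: "x \<in> rep_center" for x
    proof -
      obtain p :: "int poly" where p: "char_poly (R x) = map_poly of_int p" using int[OF ZG[OF x]] by blast
      have "rat_poly (char_poly (R x)) = [:- \<theta> x, 1:]" using cs(3) x unfolding csn by simp
      then have "Polynomial.coeff (map_poly of_int p) 0 = - \<theta> x" unfolding p rp by simp
      then have "of_int (Polynomial.coeff p 0) = - \<theta> x" by (simp add: coeff_map_poly)
      then have "\<theta> x = of_int (- Polynomial.coeff p 0)" by simp
      then show ?thesis by blast
    qed
    then obtain i j :: int where i: "\<theta> a = of_int i" "\<theta> (a [^] (- 1 :: int)) = of_int j"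
      using ab(1) ip(5)[OF th] by blast
    have "\<theta> a * \<theta> (a [^] (- 1 :: int)) = 1" using ip(1,3)[OF th] by (simp add: power_int_minus)
    then have "i * j = 1" unfolding i by (metis of_int_eq_1_iff of_int_mult)
    then have "i * i = 1" using zmult_eq_1_iff by fastforce
    then have "\<theta> a powi 2 * \<theta> b powi 0 = 1" unfolding i by (simp add: power2_eq_square flip: of_int_mult)
    then show False using nee[OF th, of 2 0] by simp
  qed
  assume th: "\<theta> \<in> set cs" and n1: "norm (\<theta> a) = 1" "norm (\<theta> b) = 1"
  have "even n"
  proof (rule even_dim_of_unit_circle_eigenvalue[OF R_carrier[OF ZG[OF ab(1)]] _ schur])
    show "R ` carrier G \<subseteq> carrier_mat n n" by auto
    show "R a * Y = Y * R a" if "Y \<in> R ` carrier G" for Y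
      using that ab(1) central_mod_rep_kernel by blast
    show "poly (rat_poly (char_poly (R a))) (\<theta> a) = 0"
      using cs(3) ab(1) poly_prod_characters_root[OF th, of a] by simp
    show "norm (\<theta> a) = 1" by (rule n1)
    show "(\<theta> a)\<^sup>2 \<noteq> 1" using nee[OF th, of 2 0] by simp
  qed
  moreover
  define ps where "ps = map (\<lambda>\<theta>. (\<theta> a, \<theta> b)) cs"
  have "\<exists>P :: int \<Rightarrow> int \<Rightarrow> int poly. \<forall>k l. char_poly (R (a [^] k \<otimes> b [^] l)) = map_poly of_int (P k l)"
    by (intro choice allI) (rule int[OF ZG[OF pc]])
  then obtain P :: "int \<Rightarrow> int \<Rightarrow> int poly" where P: "\<And>k l. char_poly (R (a [^] k \<otimes> b [^] l)) = map_poly of_int (P k l)"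
    by blast
  have "length ps \<noteq> 2 \<and> length ps \<noteq> 4"
  proof (rule neutral_pair_length[where P = P and ?p0.0 = "(\<theta> a, \<theta> b)"])
    fix k l
    have "map_poly of_int (P k l) = rat_poly (char_poly (R (a [^] k \<otimes> b [^] l)))" unfolding P rp ..
    also have "\<dots> = (\<Prod>\<theta> \<leftarrow> cs. [:- \<theta> (a [^] k \<otimes> b [^] l), 1:])" using cs(3) pc by blast
    also have "\<dots> = (\<Prod>p \<leftarrow> ps. [:- (fst p powi k * snd p powi l), 1:])"
      unfolding ps_def map_map by (intro arg_cong[of _ _ prod_list] map_cong) (auto simp: chi)
    finally show "map_poly of_int (P k l) = (\<Prod>p \<leftarrow> ps. [:- (fst p powi k * snd p powi l), 1:])" .
  qed (use th n1 ip nee in \<open>auto simp: ps_def\<close>)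
  ultimately show "even n \<and> n \<noteq> 2 \<and> n \<noteq> 4" unfolding ps_def using cs(1) by simp
qed

end

section \<open>From the blocks back to the whole representation\<close>

lemma monic_prod_list:
  fixes fs :: "'a :: idom poly list"
  assumes "\<And>f. f \<in> set fs \<Longrightarrow> monic f"
  shows "monic (prod_list fs)"
  using assms by (induction fs) (auto simp: lead_coeff_mult)

lemma monic_prod_list_factor_int:
  fixes p :: "int poly"
  assumes p: "map_poly rat_of_int p = prod_list fs" "monic p" and m: "\<And>f. f \<in> set fs \<Longrightarrow> monic f"
    and f: "f \<in> set fs"
  shows "\<exists>f' :: int poly. f = map_poly of_int f'"
proof -
  obtain xs ys where fs: "fs = xs @ f # ys" using f by (meson split_list)
  have "map_poly rat_of_int p = f * prod_list (xs @ ys)" unfolding p(1) fs by (simp add: mult_ac)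
  moreover have "monic (prod_list (xs @ ys))" by (rule monic_prod_list) (use m fs in auto)
  ultimately show ?thesis using monic_rat_factor_int[of p f] p(2) m[OF f] by blast
qed

context linear_rep
begin

lemma block_schur_rep:
  fixes L :: "'f mat"
  assumes "schur_block n (R ` carrier G) (d, L, K)"
  shows "linear_rep G (\<lambda>x. L * R x * K) d" "schur_set d ((\<lambda>x. L * R x * K) ` carrier G)" "0 < d"
proof -
  have b: "0 < d" "L \<in> carrier_mat d n" "K \<in> carrier_mat n d" "L * K = 1\<^sub>m d"
    "schur_set d ((\<lambda>Y. L * Y * K) ` (R ` carrier G))"
    "\<And>x y. x \<in> carrier G \<Longrightarrow> y \<in> carrier G \<Longrightarrow> (L * R x * K) * (L * R y * K) = L * (R x * R y) * K"
    using assms unfolding schur_block_def by auto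
  show "linear_rep G (\<lambda>x. L * R x * K) d"
    by unfold_locales (use b in \<open>auto simp: R_mult R_one intro!: mult_carrier_dim\<close>)
  show "schur_set d ((\<lambda>x. L * R x * K) ` carrier G)" using b(5) by (simp add: image_image)
  show "0 < d" by (rule b(1))
qed

end

lemma rat_poly_prod_list: "rat_poly (prod_list fs) = prod_list (map rat_poly fs)"
  by (induction fs) (auto simp: rat_poly_mult)

text \<open>The algebraic content of the dynamics: ergodicity enters as the absence of the
  eigenvalue 1, and the failure of hyperbolicity as an eigenvalue of modulus one, which may be a
  different one for each element.\<close>

locale int_nilpotent_rep = linear_rep G R n for G (structure) and R :: "'a \<Rightarrow> rat mat" and n +
  fixes l :: nat and a b :: 'a
  assumes nilpotent: "lower_central G l = {\<one>}"
    and integral: "x \<in> carrier G \<Longrightarrow> \<exists>M :: int mat. R x = map_mat of_int M"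
    and a: "a \<in> carrier G" and b: "b \<in> carrier G"
    and no_eigenvalue_1: "(k, m) \<noteq> (0, 0) \<Longrightarrow> poly (char_poly (R (a [^] (k :: int) \<otimes> b [^] (m :: int)))) 1 \<noteq> 0"
    and unit_circle: "x \<in> carrier G \<Longrightarrow> \<exists>z. norm z = 1 \<and> poly (rat_poly (char_poly (R x))) z = 0"
begin

lemma neutral_schur_block:
  assumes bs: "\<forall>b\<in>set bs. schur_block n (R ` carrier G) b" "sum_list (map fst bs) = n"
    "\<forall>Y\<in>R ` carrier G. char_poly Y = (\<Prod>(d, L, K) \<leftarrow> bs. char_poly (L * Y * K))"
  shows "(\<forall>b\<in>set bs. fst b \<ge> 2) \<and> (\<exists>b\<in>set bs. even (fst b) \<and> fst b \<ge> 6)"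
proof -
  \<comment> \<open>One exponent for all blocks: every block has size at most \<open>n\<close>, and
    the nilpotency class is that of the group.\<close>
  define e where "e = (fact n ^ l :: nat)"
  define a' b' where "a' = a [^] e" and "b' = b [^] e"
  have abG: "a' \<in> carrier G" "b' \<in> carrier G" unfolding a'_def b'_def using a b by auto
  have e0: "e > 0" unfolding e_def by simp
  define RB :: "nat \<times> rat mat \<times> rat mat \<Rightarrow> 'a \<Rightarrow> rat mat" where "RB = (\<lambda>(d, L, K) x. L * R x * K)"
  have sr: "schur_rep G (RB \<beta>) (fst \<beta>)" if bb: "\<beta> \<in> set bs" for \<beta>
  proof -
    obtain d L K where be: "\<beta> = (d, L, K)" by (cases \<beta>)
    note x = block_schur_rep[of d L K] 
    have sb: "schur_block n (R ` carrier G) (d, L, K)" using bs(1) bb be by auto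
    show ?thesis unfolding be RB_def schur_rep_def schur_rep_axioms_def using x[OF sb] by simp
  qed
  have dn: "fst \<beta> \<le> n" if "\<beta> \<in> set bs" for \<beta>
    using that bs(2) member_le_sum_list[of "fst \<beta>" "map fst bs"] by auto
  have cp: "char_poly (R x) = prod_list (map (\<lambda>\<beta>. char_poly (RB \<beta> x)) bs)" if "x \<in> carrier G" for x
  proof -
    have "char_poly (R x) = (\<Prod>(d, L, K) \<leftarrow> bs. char_poly (L * R x * K))" using bs(3) that by blast
    also have "\<dots> = prod_list (map (\<lambda>\<beta>. char_poly (RB \<beta> x)) bs)"
      by (intro arg_cong[of _ _ prod_list] map_cong) (auto simp: RB_def)
    finally show ?thesis .
  qed
  have intB: "\<exists>p :: int poly. char_poly (RB \<beta> x) = map_poly of_int p" if bb: "\<beta> \<in> set bs" and x: "x \<in> carrier G" for \<beta> x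
  proof -
    obtain M :: "int mat" where M: "R x = map_mat of_int M" using integral[OF x] by blast
    have Mc: "M \<in> carrier_mat n n" using R_carrier[OF x] unfolding M by simp
    have e: "map_poly rat_of_int (char_poly M) = prod_list (map (\<lambda>\<beta>. char_poly (RB \<beta> x)) bs)"
      unfolding cp[OF x, symmetric] M by (rule of_int_hom.char_poly_hom[OF Mc, symmetric])
    have m: "monic f" if fx: "f \<in> set (map (\<lambda>\<beta>. char_poly (RB \<beta> x)) bs)" for f
    proof -
      obtain \<gamma> where g: "\<gamma> \<in> set bs" "f = char_poly (RB \<gamma> x)" using fx by auto
      interpret C: schur_rep G "RB \<gamma>" "fst \<gamma>" by (rule sr[OF g(1)])
      show ?thesis using degree_monic_char_poly[OF C.R_carrier[OF x]] g(2) by simp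
    qed
    show ?thesis
      by (rule monic_prod_list_factor_int[OF e _ m]) (use degree_monic_char_poly[OF Mc] bb in auto)
  qed
  have neB: "poly (char_poly (RB \<beta> (a' [^] k \<otimes> b' [^] m))) 1 \<noteq> 0" if bb: "\<beta> \<in> set bs" and km: "(k, m) \<noteq> (0, 0)" for \<beta> and k m :: int
  proof
    assume z: "poly (char_poly (RB \<beta> (a' [^] k \<otimes> b' [^] m))) 1 = 0"
    have G: "a' [^] k \<otimes> b' [^] m \<in> carrier G" using abG by simp
    have "poly (char_poly (R (a' [^] k \<otimes> b' [^] m))) 1 = 0"
      unfolding cp[OF G] poly_prod_list using z bb by (simp add: prod_list_zero_iff)
    moreover have "a' [^] k \<otimes> b' [^] m = a [^] (int e * k) \<otimes> b [^] (int e * m)"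
      unfolding a'_def b'_def using a b by (simp add: int_pow_pow flip: int_pow_int)
    moreover have "(int e * k, int e * m) \<noteq> (0, 0)" using km e0 by auto
    ultimately show False using no_eigenvalue_1 by metis
  qed
  have zB: "x \<in> schur_rep.rep_center G (RB \<beta>) (fst \<beta>)" if bb: "\<beta> \<in> set bs" and x: "x \<in> {a', b'}" for \<beta> x
  proof -
    interpret B: schur_rep G "RB \<beta>" "fst \<beta>" by (rule sr[OF bb])
    show ?thesis unfolding B.central_mod_rep_kernel
      using x abG B.power_central[OF nilpotent dn[OF bb]] a b unfolding a'_def b'_def e_def by auto
  qed
  have "\<forall>\<beta>\<in>set bs. \<exists>cs :: ('a \<Rightarrow> complex) list. length cs = fst \<beta> \<and>
     (\<forall>\<theta>\<in>set cs. \<theta> \<one> = 1 \<and> (\<forall>x\<in>schur_rep.rep_center G (RB \<beta>) (fst \<beta>). \<forall>y\<in>schur_rep.rep_center G (RB \<beta>) (fst \<beta>). \<theta> (x \<otimes> y) = \<theta> x * \<theta> y)) \<and>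
     (\<forall>x\<in>schur_rep.rep_center G (RB \<beta>) (fst \<beta>). rat_poly (char_poly (RB \<beta> x)) = (\<Prod>\<theta> \<leftarrow> cs. [:- \<theta> x, 1:]))"
    using schur_rep.central_characters[OF sr] by blast
  then obtain cs :: "nat \<times> rat mat \<times> rat mat \<Rightarrow> ('a \<Rightarrow> complex) list" where
    cs: "\<And>\<beta>. \<beta> \<in> set bs \<Longrightarrow> length (cs \<beta>) = fst \<beta>"
      "\<And>\<beta>. \<beta> \<in> set bs \<Longrightarrow> \<forall>\<theta>\<in>set (cs \<beta>). \<theta> \<one> = 1 \<and> (\<forall>x\<in>schur_rep.rep_center G (RB \<beta>) (fst \<beta>). \<forall>y\<in>schur_rep.rep_center G (RB \<beta>) (fst \<beta>). \<theta> (x \<otimes> y) = \<theta> x * \<theta> y)"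
      "\<And>\<beta>. \<beta> \<in> set bs \<Longrightarrow> \<forall>x\<in>schur_rep.rep_center G (RB \<beta>) (fst \<beta>). rat_poly (char_poly (RB \<beta> x)) = (\<Prod>\<theta> \<leftarrow> cs \<beta>. [:- \<theta> x, 1:])"
    by metis
  have nb: "fst \<beta> \<noteq> 1" "\<theta> \<in> set (cs \<beta>) \<Longrightarrow> norm (\<theta> a') = 1 \<Longrightarrow> norm (\<theta> b') = 1 \<Longrightarrow> even (fst \<beta>) \<and> fst \<beta> \<noteq> 2 \<and> fst \<beta> \<noteq> 4"
    if bb: "\<beta> \<in> set bs" for \<beta> \<theta>
  proof -
    have z: "a' \<in> schur_rep.rep_center G (RB \<beta>) (fst \<beta>)" "b' \<in> schur_rep.rep_center G (RB \<beta>) (fst \<beta>)"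
      using zB[OF bb] by auto
    note nb = schur_rep.neutral_block_dim[OF sr[OF bb] cs(1)[OF bb] cs(2)[OF bb] cs(3)[OF bb] intB[OF bb] z neB[OF bb]]
    show "fst \<beta> \<noteq> 1" by (rule nb(1))
    show "\<theta> \<in> set (cs \<beta>) \<Longrightarrow> norm (\<theta> a') = 1 \<Longrightarrow> norm (\<theta> b') = 1 \<Longrightarrow> even (fst \<beta>) \<and> fst \<beta> \<noteq> 2 \<and> fst \<beta> \<noteq> 4"
      by (rule nb(2))
  qed
  have two: "fst \<beta> \<ge> 2" if bb: "\<beta> \<in> set bs" for \<beta>
  proof -
    have "fst \<beta> \<noteq> 1" by (rule nb(1)[OF bb])
    moreover have "fst \<beta> > 0" using schur_rep.n_pos[OF sr[OF bb]] .
    ultimately show ?thesis by linarith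
  qed
  \<comment> \<open>For each \<open>t\<close> the eigenvalue of modulus one of
    \<open>a' b'^t\<close> belongs to some block and some character. These finitely many pairs are
    the pigeonholes.\<close>
  have "\<exists>p\<in>Sigma (set bs) (\<lambda>\<beta>. set (cs \<beta>)). norm (snd p a') * norm (snd p b') ^ t = 1" for t :: nat
  proof -
    let ?x = "a' \<otimes> b' [^] t"
    have xG: "?x \<in> carrier G" using abG by simp
    obtain z where z: "norm z = 1" "poly (rat_poly (char_poly (R ?x))) z = 0" using unit_circle[OF xG] by blast
    then have "\<exists>\<beta>\<in>set bs. poly (rat_poly (char_poly (RB \<beta> ?x))) z = 0"
      unfolding cp[OF xG] rat_poly_prod_list poly_prod_list by (auto simp: prod_list_zero_iff)
    then obtain \<beta> where b1: "\<beta> \<in> set bs" "poly (rat_poly (char_poly (RB \<beta> ?x))) z = 0" by blast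
    interpret B: schur_rep G "RB \<beta>" "fst \<beta>" by (rule sr[OF b1(1)])
    have zc: "a' \<in> B.rep_center" "b' \<in> B.rep_center" using zB[OF b1(1)] by auto
    have bt: "b' [^] t \<in> B.rep_center"
      using B.character_int_pow(3)[of "\<lambda>_. 1" b' "int t"] zc(2) by (simp add: int_pow_int)
    have xc: "?x \<in> B.rep_center" using subgroup.m_closed[OF B.subgroup_rep_center zc(1) bt] .
    have "poly (\<Prod>\<theta> \<leftarrow> cs \<beta>. [:- \<theta> ?x, 1:]) z = 0" using cs(3)[OF b1(1)] xc b1(2) by metis
    then obtain \<theta> where th: "\<theta> \<in> set (cs \<beta>)" "z = \<theta> ?x"
      unfolding poly_prod_list by (auto simp: prod_list_zero_iff)
    have t12: "\<theta> \<one> = 1" "\<forall>x\<in>B.rep_center. \<forall>y\<in>B.rep_center. \<theta> (x \<otimes> y) = \<theta> x * \<theta> y"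
      using cs(2)[OF b1(1)] th(1) by auto
    have "\<theta> ?x = \<theta> a' * \<theta> b' ^ t"
      using B.character_int_pow(4)[OF t12 zc(2), of t] t12(2) zc(1) bt by simp
    then have "norm (\<theta> a') * norm (\<theta> b') ^ t = 1" using z(1) th(2) by (simp add: norm_mult norm_power)
    then show ?thesis using b1(1) th(1) by (intro bexI[of _ "(\<beta>, \<theta>)"]) auto
  qed
  then obtain f where f: "\<And>t :: nat. f t \<in> Sigma (set bs) (\<lambda>\<beta>. set (cs \<beta>)) \<and> norm (snd (f t) a') * norm (snd (f t) b') ^ t = 1"
    by metis
  have "\<not> inj f"
  proof
    assume "inj f"
    moreover have "finite (range f)"
      by (rule finite_subset[of _ "Sigma (set bs) (\<lambda>\<beta>. set (cs \<beta>))"])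
        (use f in blast, auto)
    ultimately show False using finite_imageD infinite_UNIV_nat by blast
  qed
  then obtain s t where st: "s \<noteq> t" "f s = f t" unfolding inj_def by blast
  obtain \<beta> \<theta> where bt: "f s = (\<beta>, \<theta>)" "\<beta> \<in> set bs" "\<theta> \<in> set (cs \<beta>)" using f[of s] by (cases "f s") auto
  interpret B: schur_rep G "RB \<beta>" "fst \<beta>" by (rule sr[OF bt(2)])
  have nz: "\<theta> a' \<noteq> 0" "\<theta> b' \<noteq> 0"
    using B.character_int_pow(1)[of \<theta>] cs(2)[OF bt(2)] bt(3) zB[OF bt(2)] by auto
  \<comment> \<open>A pair that occurs for two exponents has modulus one at \<open>a'\<close> and at
    \<open>b'\<close> separately.\<close>
  have n1: "norm (\<theta> a') = 1 \<and> norm (\<theta> b') = 1"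
    by (rule norm_one_of_two_powers[OF _ _ _ _ st(1)]) (use nz f[of s] f[of t] bt(1) st(2) in auto)
  have "even (fst \<beta>) \<and> fst \<beta> \<noteq> 2 \<and> fst \<beta> \<noteq> 4"
    using nb(2)[OF bt(2,3)] n1 by blast
  moreover have "m \<ge> 2 \<Longrightarrow> even m \<and> m \<noteq> 2 \<and> m \<noteq> 4 \<Longrightarrow> m \<ge> 6" for m :: nat
    by presburger
  ultimately show ?thesis using two bt(2) by blast
qed

text \<open>In dimension 7 an even block of size at least 6 has size 6, and the rest would be a
  block of size 1. A representation with the Schur property is its own only block, and the neutral
  block is always even.\<close>

theorem neutral_dimension:
  shows "n \<ge> 6" "n \<noteq> 7" "schur_set n (R ` carrier G) \<Longrightarrow> even n"
proof -
  have sub: "R ` carrier G \<subseteq> carrier_mat n n" by auto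
  obtain bs where bs: "\<forall>b\<in>set bs. schur_block n (R ` carrier G) b" "sum_list (map fst bs) = n"
    "\<forall>Y\<in>R ` carrier G. char_poly Y = (\<Prod>(d, L, K) \<leftarrow> bs. char_poly (L * Y * K))"
    using schur_block_decomposition[OF sub] by (elim exE conjE) (rule that)
  note nb = neutral_schur_block[OF bs]
  then obtain \<beta> where be: "\<beta> \<in> set bs" "even (fst \<beta>)" "fst \<beta> \<ge> 6" by blast
  have split: "n = fst \<beta> + sum_list (map fst (remove1 \<beta> bs))"
    using bs(2) sum_list_map_remove1[OF be(1), of fst] by simp
  show n6: "n \<ge> 6" using split be(3) by simp
  show "n \<noteq> 7"
  proof
    assume "n = 7"
    moreover have "fst \<beta> \<noteq> 7" using be(2) by auto
    ultimately have s1: "sum_list (map fst (remove1 \<beta> bs)) = 1" using split be(3) by linarith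
    then obtain x xs where x: "remove1 \<beta> bs = x # xs" by (cases "remove1 \<beta> bs") auto
    then have "x \<in> set bs" by (metis list.set_intros(1) notin_set_remove1)
    then show False using nb s1 x by auto
  qed
  assume sch: "schur_set n (R ` carrier G)"
  have one: "1\<^sub>m n * R x * 1\<^sub>m n = R x" if "x \<in> carrier G" for x using R_carrier[OF that] by simp
  have one2: "1\<^sub>m n * (R x * R y) * 1\<^sub>m n = R x * R y" if "x \<in> carrier G" "y \<in> carrier G" for x y
    using one[of "x \<otimes> y"] that by (simp add: R_mult)
  have im: "(\<lambda>Y. 1\<^sub>m n * Y * 1\<^sub>m n) ` R ` carrier G = R ` carrier G"
    unfolding image_image by (rule image_cong[OF refl one])
  have "schur_block n (R ` carrier G) (n, 1\<^sub>m n, 1\<^sub>m n)"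
    unfolding schur_block_def prod.case im using n6 sch by (auto simp: one one2)
  then show "even n"
    using neutral_schur_block[of "[(n, 1\<^sub>m n, 1\<^sub>m n)]"] by (auto simp: one)
qed

end

section \<open>The torus\<close>

definition unit_cube :: "(real ^ 'n :: finite) set" where
  "unit_cube = {x. \<forall>i. 0 \<le> vec_nth x i \<and> vec_nth x i < 1}"

definition int_vec :: "real ^ 'n :: finite \<Rightarrow> bool" where
  "int_vec z \<longleftrightarrow> (\<forall>i. vec_nth z i \<in> \<int>)"

text \<open>The preimages under \<open>torus_proj\<close> of sets of points of the torus; with them
  ergodicity is discussed in real space.\<close>

definition periodic_set :: "(real ^ 'n :: finite) set \<Rightarrow> bool" where
  "periodic_set U \<longleftrightarrow> (\<forall>x y. x \<in> U \<longrightarrow> int_vec (y - x) \<longrightarrow> y \<in> U)"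

definition real_mat :: "int ^ 'n :: finite ^ 'n \<Rightarrow> real ^ 'n ^ 'n" where
  "real_mat A = map_matrix of_int A"

lemma real_mat_mult: "real_mat (A ** B) = real_mat A ** real_mat B"
  by (simp add: real_mat_def map_matrix_def matrix_matrix_mult_def Finite_Cartesian_Product.vec_eq_iff)

lemma real_mat_one: "real_mat (Finite_Cartesian_Product.mat 1) = Finite_Cartesian_Product.mat 1"
  by (simp add: real_mat_def map_matrix_def Finite_Cartesian_Product.mat_def Finite_Cartesian_Product.vec_eq_iff)

lemma int_vec_real_mat: "int_vec z \<Longrightarrow> int_vec (real_mat A *v z)"
  by (auto simp: int_vec_def real_mat_def map_matrix_def matrix_vector_mult_def intro!: Ints_sum Ints_mult)

lemma int_vec_simps [simp]: "int_vec 0" "int_vec z \<Longrightarrow> int_vec (- z)"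
  by (auto simp: int_vec_def)

lemma int_vec_diff_commute: "int_vec (x - y) \<longleftrightarrow> int_vec (y - x)"
  using int_vec_simps(2)[of "x - y"] int_vec_simps(2)[of "y - x"] by auto

lemma int_vec_add: "int_vec x \<Longrightarrow> int_vec y \<Longrightarrow> int_vec (x + y)"
  by (auto simp: int_vec_def)

lemma torus_proj_altdef: "torus_proj x = {y. int_vec (y - x)}"
  by (simp add: torus_proj_def int_vec_def)

lemma torus_proj_eq_iff: "torus_proj x = torus_proj y \<longleftrightarrow> int_vec (x - y)"
proof
  assume "torus_proj x = torus_proj y"
  then have "x \<in> torus_proj y" using int_vec_simps(1) by (auto simp: torus_proj_altdef)
  then show "int_vec (x - y)" by (simp add: torus_proj_altdef)
next
  assume xy: "int_vec (x - y)"
  have "int_vec (z - x) \<longleftrightarrow> int_vec (z - y)" for z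
    using int_vec_add[OF xy, of "z - x"] int_vec_add[of "z - y" "y - x"] xy int_vec_diff_commute[of x y]
    by (auto simp: algebra_simps)
  then show "torus_proj x = torus_proj y" by (simp add: torus_proj_altdef)
qed

text \<open>The image of a coset is a full coset because the inverse matrix is integral as
  well.\<close>

lemma toral_aut_torus_proj:
  assumes "A ** B = Finite_Cartesian_Product.mat 1" "B ** A = Finite_Cartesian_Product.mat 1"
  shows "toral_aut A (torus_proj x) = torus_proj (real_mat A *v x)"
proof (intro equalityI subsetI)
  fix y assume "y \<in> toral_aut A (torus_proj x)"
  then obtain z where z: "int_vec (z - x)" "y = real_mat A *v z"
    by (auto simp: toral_aut_def torus_proj_altdef real_mat_def)
  then show "y \<in> torus_proj (real_mat A *v x)"
    using int_vec_real_mat[OF z(1), of A] by (simp add: torus_proj_altdef matrix_vector_mult_diff_distrib)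
next
  fix y assume "y \<in> torus_proj (real_mat A *v x)"
  then have y: "int_vec (y - real_mat A *v x)" by (simp add: torus_proj_altdef)
  have "int_vec (real_mat B *v (y - real_mat A *v x))" by (rule int_vec_real_mat[OF y])
  moreover have "real_mat B *v (y - real_mat A *v x) = real_mat B *v y - x"
    using assms(2) by (simp add: matrix_vector_mult_diff_distrib matrix_vector_mul_assoc real_mat_mult[symmetric] real_mat_one)
  ultimately have "real_mat B *v y \<in> torus_proj x" by (simp add: torus_proj_altdef)
  moreover have "y = real_mat A *v (real_mat B *v y)"
    using assms(1) by (simp add: matrix_vector_mul_assoc real_mat_mult[symmetric] real_mat_one)
  ultimately show "y \<in> toral_aut A (torus_proj x)" unfolding toral_aut_def real_mat_def by blast
qed

definition torus_sets :: "(real ^ 'n :: finite) set set set" where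
  "torus_sets = {E. E \<subseteq> torus \<and> torus_proj -` E \<in> sets borel}"

text \<open>The family that generates the sigma algebra of \<open>torus_measure\<close> is itself a
  sigma algebra, so the measurable sets are explicit.\<close>

lemma sigma_algebra_torus_sets: "sigma_algebra torus torus_sets"
  unfolding sigma_algebra_iff2
proof (intro conjI ballI allI impI)
  fix s :: "(real ^ 'n) set set" assume s: "s \<in> torus_sets"
  have "torus_proj -` (torus - s) = UNIV - torus_proj -` s" by (auto simp: torus_def)
  then show "torus - s \<in> torus_sets" using s by (auto simp: torus_sets_def)
next
  fix A :: "nat \<Rightarrow> (real ^ 'n) set set" assume "range A \<subseteq> torus_sets"
  then show "\<Union> (range A) \<in> torus_sets" by (auto simp: torus_sets_def vimage_UN)
qed (auto simp: torus_sets_def)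

lemma unit_cube_borel [measurable]: "unit_cube \<in> sets borel"
proof -
  have "unit_cube = (\<Inter>i. {x :: real ^ 'n. 0 \<le> vec_nth x i} \<inter> {x. vec_nth x i < 1})"
    by (auto simp: unit_cube_def)
  also have "\<dots> \<in> sets borel"
    by (intro sets.countable_INT'' sets.Int borel_closed borel_open closed_Collect_le open_Collect_less continuous_intros) auto
  finally show ?thesis .
qed

lemma sets_torus_measure: "sets torus_measure = torus_sets"
  unfolding torus_measure_def sets_distr torus_sets_def[symmetric]
  by (rule sigma_algebra.sets_measure_of_eq[OF sigma_algebra_torus_sets])

lemma space_torus_measure: "space torus_measure = torus"
  unfolding torus_measure_def space_distr torus_sets_def[symmetric]
  by (rule sigma_algebra.space_measure_of_eq[OF sigma_algebra_torus_sets])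

lemma emeasure_torus_measure:
  assumes "E \<in> torus_sets"
  shows "emeasure torus_measure E = emeasure lborel (torus_proj -` E \<inter> unit_cube)"
proof -
  have sp: "space (restrict_space lborel unit_cube) = (unit_cube :: (real ^ 'n) set)"
    by (simp add: space_restrict_space)
  have m: "torus_proj \<in> measurable (restrict_space lborel unit_cube) (sigma torus torus_sets)"
  proof (rule measurable_measure_of)
    show "torus_sets \<subseteq> Pow torus" by (auto simp: torus_sets_def)
    show "torus_proj \<in> space (restrict_space lborel unit_cube) \<rightarrow> torus" by (auto simp: torus_def)
    fix y :: "(real ^ 'n) set set" assume "y \<in> torus_sets"
    then have "torus_proj -` y \<in> sets borel" by (simp add: torus_sets_def)
    then show "torus_proj -` y \<inter> space (restrict_space lborel unit_cube) \<in> sets (restrict_space lborel unit_cube)"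
      unfolding sp sets_restrict_space by (auto simp: Int_commute)
  qed
  have "emeasure torus_measure E = emeasure (restrict_space lborel unit_cube) (torus_proj -` E \<inter> unit_cube)"
    unfolding torus_measure_def torus_sets_def[symmetric] unit_cube_def[symmetric]
    by (subst emeasure_distr[OF m]) (use assms sigma_algebra.sets_measure_of_eq[OF sigma_algebra_torus_sets] sp in auto)
  also have "\<dots> = emeasure lborel (torus_proj -` E \<inter> unit_cube)"
    by (rule emeasure_restrict_space) auto
  finally show ?thesis .
qed

text \<open>Preimages under \<open>torus_proj\<close> identify the measurable sets of the torus with
  the periodic Borel sets and respect the action; the measure becomes the Lebesgue measure of the
  part in the unit cube.\<close>

lemma ergodic_mat_iff:
  fixes A :: "int ^ 'n :: finite ^ 'n"
  assumes AB: "A ** B = Finite_Cartesian_Product.mat 1" "B ** A = Finite_Cartesian_Product.mat 1"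
  shows "ergodic_mat A \<longleftrightarrow> (\<forall>U\<in>sets borel. periodic_set U \<longrightarrow> (\<forall>x. real_mat A *v x \<in> U \<longleftrightarrow> x \<in> U) \<longrightarrow>
     emeasure lborel (U \<inter> unit_cube) = 0 \<or> emeasure lborel (unit_cube - U) = 0)"
proof
  assume erg: "ergodic_mat A"
  show "\<forall>U\<in>sets borel. periodic_set U \<longrightarrow> (\<forall>x. real_mat A *v x \<in> U \<longleftrightarrow> x \<in> U) \<longrightarrow>
     emeasure lborel (U \<inter> unit_cube) = 0 \<or> emeasure lborel (unit_cube - U) = 0"
  proof (intro ballI impI)
    fix U :: "(real ^ 'n) set" assume U: "U \<in> sets borel" "periodic_set U" "\<forall>x. real_mat A *v x \<in> U \<longleftrightarrow> x \<in> U"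
    define E where "E = torus_proj ` U"
    have pE: "torus_proj -` E = U"
    proof (intro equalityI subsetI)
      fix x assume "x \<in> torus_proj -` E"
      then obtain u where "u \<in> U" "int_vec (x - u)" unfolding E_def by (auto simp: torus_proj_eq_iff)
      then show "x \<in> U" using U(2) unfolding periodic_set_def by blast
    qed (auto simp: E_def)
    have E: "E \<in> torus_sets" using U(1) pE by (auto simp: torus_sets_def E_def torus_def)
    have inv: "toral_aut A -` E \<inter> torus = E"
    proof (intro equalityI subsetI)
      fix e assume e: "e \<in> toral_aut A -` E \<inter> torus"
      then obtain x where x: "e = torus_proj x" by (auto simp: torus_def)
      have "torus_proj (real_mat A *v x) \<in> E" using e x toral_aut_torus_proj[OF AB] by auto
      then have "real_mat A *v x \<in> U" using pE by auto
      then have "x \<in> U" using U(3) by blast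
      then show "e \<in> E" unfolding E_def x by blast
    next
      fix e assume "e \<in> E"
      then obtain x where x: "e = torus_proj x" "x \<in> U" unfolding E_def by blast
      then have "real_mat A *v x \<in> U" using U(3) by blast
      then have "toral_aut A e \<in> E" unfolding x(1) toral_aut_torus_proj[OF AB] E_def by blast
      then show "e \<in> toral_aut A -` E \<inter> torus" using x(1) by (auto simp: torus_def)
    qed
    have "emeasure torus_measure E = 0 \<or> emeasure torus_measure (torus - E) = 0"
      using erg E inv unfolding ergodic_mat_def ergodic_family_def by (simp add: sets_torus_measure space_torus_measure)
    moreover have "torus - E \<in> torus_sets"
      using sets.compl_sets[of E torus_measure] E by (simp add: sets_torus_measure space_torus_measure)
    moreover have "torus_proj -` (torus - E) \<inter> unit_cube = unit_cube - U" using pE by (auto simp: torus_def)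
    ultimately show "emeasure lborel (U \<inter> unit_cube) = 0 \<or> emeasure lborel (unit_cube - U) = 0"
      using E pE by (simp add: emeasure_torus_measure)
  qed
next
  assume r: "\<forall>U\<in>sets borel. periodic_set U \<longrightarrow> (\<forall>x. real_mat A *v x \<in> U \<longleftrightarrow> x \<in> U) \<longrightarrow>
     emeasure lborel (U \<inter> unit_cube) = 0 \<or> emeasure lborel (unit_cube - U) = 0"
  show "ergodic_mat A" unfolding ergodic_mat_def ergodic_family_def
  proof (intro ballI impI)
    fix E assume E': "E \<in> sets torus_measure" and i: "\<forall>T\<in>{toral_aut A}. T -` E \<inter> space torus_measure = E"
    have E: "E \<in> torus_sets" using E' by (simp add: sets_torus_measure)
    have i: "toral_aut A -` E \<inter> torus = E" using i by (simp add: space_torus_measure)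
    define U where "U = torus_proj -` E"
    have U: "U \<in> sets borel" using E by (simp add: torus_sets_def U_def)
    have "periodic_set U" unfolding periodic_set_def U_def
      using torus_proj_eq_iff by (metis vimage_eq)
    moreover have "\<forall>x. real_mat A *v x \<in> U \<longleftrightarrow> x \<in> U"
    proof
      fix x :: "real ^ 'n"
      have "torus_proj x \<in> torus" by (simp add: torus_def)
      then have "torus_proj x \<in> E \<longleftrightarrow> toral_aut A (torus_proj x) \<in> E" using i by blast
      then show "real_mat A *v x \<in> U \<longleftrightarrow> x \<in> U" unfolding U_def by (simp add: toral_aut_torus_proj[OF AB])
    qed
    ultimately have "emeasure lborel (U \<inter> unit_cube) = 0 \<or> emeasure lborel (unit_cube - U) = 0" using r U by blast
    moreover have "torus - E \<in> torus_sets"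
      using sets.compl_sets[of E torus_measure] E by (simp add: sets_torus_measure space_torus_measure)
    moreover have "torus_proj -` (torus - E) \<inter> unit_cube = unit_cube - U" by (auto simp: torus_def U_def)
    ultimately show "emeasure torus_measure E = 0 \<or> emeasure torus_measure (space torus_measure - E) = 0"
      using E by (simp add: emeasure_torus_measure space_torus_measure U_def)
  qed
qed

section \<open>Characters of the torus\<close>

definition pairing :: "int ^ 'n :: finite \<Rightarrow> real ^ 'n \<Rightarrow> real" where
  "pairing q x = (\<Sum>i\<in>UNIV. of_int (vec_nth q i) * vec_nth x i)"

lemma pairing_add: "pairing (p + q) x = pairing p x + pairing q x" "pairing q (x + y) = pairing q x + pairing q y"
  by (simp_all add: pairing_def algebra_simps sum.distrib)

lemma pairing_diff: "pairing (p - q) x = pairing p x - pairing q x" "pairing q (x - y) = pairing q x - pairing q y"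
  by (simp_all add: pairing_def algebra_simps sum_subtractf)

lemma pairing_zero [simp]: "pairing 0 x = 0" "pairing q 0 = 0"
  by (simp_all add: pairing_def)

lemma pairing_int_vec: "int_vec z \<Longrightarrow> pairing q z \<in> \<int>"
  by (auto simp: pairing_def int_vec_def intro!: Ints_sum Ints_mult)

lemma pairing_real_mat:
  "pairing q (real_mat A *v x) = pairing (Finite_Cartesian_Product.transpose A *v q) x"
proof -
  have "pairing q (real_mat A *v x) = (\<Sum>i\<in>UNIV. \<Sum>j\<in>UNIV. of_int (vec_nth q i) * (of_int (vec_nth (vec_nth A i) j) * vec_nth x j))"
    by (simp add: pairing_def real_mat_def map_matrix_def matrix_vector_mult_def sum_distrib_left)
  also have "\<dots> = (\<Sum>j\<in>UNIV. \<Sum>i\<in>UNIV. of_int (vec_nth q i) * (of_int (vec_nth (vec_nth A i) j) * vec_nth x j))"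
    by (rule sum.swap)
  also have "\<dots> = pairing (Finite_Cartesian_Product.transpose A *v q) x"
    by (simp add: pairing_def matrix_vector_mult_def Finite_Cartesian_Product.transpose_def sum_distrib_right sum_distrib_left mult_ac)
  finally show ?thesis .
qed

lemma continuous_pairing [continuous_intros]: "continuous_on S (pairing q)"
  unfolding pairing_def by (intro continuous_intros)

text \<open>The point \<open>x\<close> is interior to the cube, so the part of \<open>W\<close> in
  the open cube is a nonempty open subset of \<open>S\<close>.\<close>

lemma open_positive_measure:
  fixes W :: "(real ^ 'n :: finite) set"
  assumes "open W" "x \<in> W" "\<And>i. 0 < vec_nth x i \<and> vec_nth x i < 1" "W \<inter> unit_cube \<subseteq> S" "S \<in> sets borel"
  shows "emeasure lborel S \<noteq> 0"
proof
  assume "emeasure lborel S = 0"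
  then have nS: "S \<in> null_sets lborel" using assms(5) by (auto simp: null_sets_def)
  let ?O = "(\<Inter>i. {x :: real ^ 'n. 0 < vec_nth x i} \<inter> {x. vec_nth x i < 1}) \<inter> W"
  have o: "open ?O"
    by (auto intro!: open_Int open_INT open_Collect_less continuous_intros assms(1))
  have "x \<in> ?O" using assms(2,3) by auto
  then have "\<not> negligible ?O" using open_not_negligible[OF o] by blast
  moreover have "?O \<subseteq> S" using assms(4) by (auto simp: unit_cube_def less_imp_le)
  then have "?O \<in> null_sets lborel"
    by (intro null_sets_subset[OF nS]) (use borel_open[OF o] in auto)
  then have "negligible ?O" unfolding negligible_iff_null_sets by (rule null_sets_completionI)
  ultimately show False by simp
qed

text \<open>If \<open>q\<close> is fixed by the transposed matrix, \<open>pairing q x\<close> modulo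
  1 is an invariant function on the torus. The set \<open>U\<close> where it is within 1/4 of an
  integer is invariant, and both \<open>U\<close> and its complement have positive measure, the
  latter because it contains the open set \<open>W\<close> around the half-integers.\<close>

lemma ergodic_mat_no_fixed_covector:
  fixes A :: "int ^ 'n :: finite ^ 'n"
  assumes AB: "A ** B = Finite_Cartesian_Product.mat 1" "B ** A = Finite_Cartesian_Product.mat 1"
    and erg: "ergodic_mat A" and fq: "Finite_Cartesian_Product.transpose A *v q = q"
  shows "q = 0"
proof (rule ccontr)
  assume "q \<noteq> 0"
  then obtain i0 where i0: "vec_nth q i0 \<noteq> 0" by (metis Finite_Cartesian_Product.vec_eq_iff zero_index)
  define U where "U = (\<Union>k :: int. {x. \<bar>pairing q x - of_int k\<bar> < 1/4})"
  define W where "W = (\<Union>k :: int. {x. \<bar>pairing q x - 1/2 - of_int k\<bar> < 1/4})"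
  have oU: "open U" and oW: "open W" unfolding U_def W_def
    by (intro open_UN ballI open_Collect_less continuous_intros)+
  have UW: "W \<inter> U = {}"
  proof (rule ccontr)
    assume "W \<inter> U \<noteq> {}"
    then obtain x and k l :: int where "\<bar>pairing q x - of_int k\<bar> < 1/4" "\<bar>pairing q x - 1/2 - of_int l\<bar> < 1/4"
      unfolding U_def W_def by blast
    then have "real_of_int k - real_of_int l > 0" "real_of_int k - real_of_int l < 1" by linarith+
    then have "0 < real_of_int (k - l)" "real_of_int (k - l) < 1" by simp_all
    then have "0 < k - l" "k - l < 1" by (simp_all only: of_int_0_less_iff of_int_less_1_iff)
    then show False by simp
  qed
  have "periodic_set U" unfolding periodic_set_def
  proof (intro allI impI)
    fix x y assume x: "x \<in> U" and xy: "int_vec (y - x)"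
    obtain k :: int where k: "\<bar>pairing q x - of_int k\<bar> < 1/4" using x unfolding U_def by blast
    obtain l :: int where "pairing q (y - x) = of_int l" using pairing_int_vec[OF xy] by (auto elim: Ints_cases)
    then have "pairing q y - of_int (k + l) = pairing q x - of_int k" by (simp add: pairing_diff)
    then have "\<bar>pairing q y - of_int (k + l)\<bar> < 1/4" using k by (simp only:)
    then show "y \<in> U" unfolding U_def by blast
  qed
  moreover have "pairing q (real_mat A *v x) = pairing q x" for x unfolding pairing_real_mat fq ..
  then have "\<forall>x. real_mat A *v x \<in> U \<longleftrightarrow> x \<in> U" unfolding U_def by simp
  ultimately have dich: "emeasure lborel (U \<inter> unit_cube) = 0 \<or> emeasure lborel (unit_cube - U) = 0"
    using erg borel_open[OF oU] unfolding ergodic_mat_iff[OF AB] by blast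
  define s where "s = (\<Sum>i\<in>UNIV. \<bar>real_of_int (vec_nth q i)\<bar>)"
  \<comment> \<open>Chosen so that the point with all coordinates \<open>\<epsilon>\<close> lies in
    the open cube and has pairing at most 1/8 in absolute value.\<close>
  define \<epsilon> where "\<epsilon> = 1 / (8 * (1 + s))"
  have s0: "s \<ge> 0" unfolding s_def by (intro sum_nonneg) auto
  have ep: "\<epsilon> > 0" "\<epsilon> < 1" "\<epsilon> * s \<le> 1/8" using s0 unfolding \<epsilon>_def by (auto simp: field_simps)
  define x where "x = (vec_lambda (\<lambda>i. \<epsilon>) :: real ^ 'n)"
  have "\<bar>pairing q x\<bar> \<le> (\<Sum>i\<in>UNIV. \<bar>real_of_int (vec_nth q i) * \<epsilon>\<bar>)"
    unfolding pairing_def x_def by (simp add: sum_abs)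
  also have "\<dots> = \<epsilon> * s" unfolding s_def using ep(1) by (simp add: abs_mult sum_distrib_left mult.commute)
  finally have "x \<in> U" unfolding U_def using ep(3) by (intro UN_I[of 0]) auto
  then have n1: "emeasure lborel (U \<inter> unit_cube) \<noteq> 0"
    by (intro open_positive_measure[OF oU, of x]) (use ep oU in \<open>auto simp: x_def\<close>)
  \<comment> \<open>The coordinate \<open>i0\<close> alone contributes 1/2 or -1/2 to the pairing,
    the others together at most 1/8 in absolute value.\<close>
  define y where "y = (vec_lambda (\<lambda>i. if i = i0 then 1 / (2 * \<bar>real_of_int (vec_nth q i0)\<bar>) else \<epsilon>) :: real ^ 'n)"
  have q1: "\<bar>real_of_int (vec_nth q i0)\<bar> \<ge> 1" using i0 by linarith
  have "pairing q y = of_int (vec_nth q i0) / (2 * \<bar>real_of_int (vec_nth q i0)\<bar>) + (\<Sum>i\<in>UNIV - {i0}. of_int (vec_nth q i) * \<epsilon>)"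
    unfolding pairing_def y_def by (subst sum.remove[of _ i0]) (auto intro!: sum.cong)
  moreover have "\<bar>\<Sum>i\<in>UNIV - {i0}. real_of_int (vec_nth q i) * \<epsilon>\<bar> \<le> 1/8"
  proof -
    have "\<bar>\<Sum>i\<in>UNIV - {i0}. real_of_int (vec_nth q i) * \<epsilon>\<bar> \<le> (\<Sum>i\<in>UNIV - {i0}. \<bar>real_of_int (vec_nth q i) * \<epsilon>\<bar>)"
      by (rule sum_abs)
    also have "\<dots> \<le> (\<Sum>i\<in>UNIV. \<bar>real_of_int (vec_nth q i) * \<epsilon>\<bar>)" by (rule sum_mono2) auto
    also have "\<dots> = \<epsilon> * s" unfolding s_def using ep(1) by (simp add: abs_mult sum_distrib_left mult.commute)
    finally show ?thesis using ep(3) by linarith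
  qed
  moreover have "of_int (vec_nth q i0) / (2 * \<bar>real_of_int (vec_nth q i0)\<bar>) \<in> {1/2, -1/2 :: real}"
    using i0 by (cases "vec_nth q i0 > 0") auto
  ultimately have "y \<in> W" unfolding W_def
    by (intro UN_I[of "if vec_nth q i0 > 0 then 0 else -1"]) (use i0 in \<open>auto split: if_splits\<close>)
  then have n2: "emeasure lborel (unit_cube - U) \<noteq> 0"
  proof (rule open_positive_measure[OF oW])
    show "0 < vec_nth y i \<and> vec_nth y i < 1" for i
      using ep q1 unfolding y_def by (auto simp: field_simps)
    show "W \<inter> unit_cube \<subseteq> unit_cube - U" using UW by blast
    show "unit_cube - U \<in> sets borel" using oU by auto
  qed
  show False using dich n1 n2 by blast
qed

section \<open>Exponentials on the unit cube\<close>

definition fchar :: "int ^ 'n :: finite \<Rightarrow> real ^ 'n \<Rightarrow> complex" where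
  "fchar q x = cis (2 * pi * pairing q x)"

definition cube_measure :: "(real ^ 'n :: finite) measure" where
  "cube_measure = density lborel (indicator unit_cube)"

lemma fchar_0 [simp]: "fchar 0 x = 1"
  by (simp add: fchar_def)

lemma fchar_add: "fchar (p + q) x = fchar p x * fchar q x"
  by (simp add: fchar_def pairing_add algebra_simps cis_mult)

lemma fchar_diff: "fchar (p - q) x = fchar p x * cnj (fchar q x)"
  by (simp add: fchar_def pairing_diff algebra_simps cis_mult cis_cnj)

lemma norm_fchar [simp]: "norm (fchar q x) = 1"
  by (simp add: fchar_def)

lemma fchar_measurable [measurable]: "fchar q \<in> borel_measurable borel"
proof -
  have "continuous_on UNIV (fchar q)" unfolding fchar_def by (intro continuous_intros)
  then show ?thesis by (rule borel_measurable_continuous_onI)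
qed

lemma sets_cube_measure [simp, measurable_cong]: "sets cube_measure = sets borel"
  by (simp add: cube_measure_def)

lemma space_cube_measure [simp]: "space cube_measure = UNIV"
  by (simp add: cube_measure_def)

lemma emeasure_cube_measure: "S \<in> sets borel \<Longrightarrow> emeasure cube_measure S = emeasure lborel (S \<inter> unit_cube)"
  unfolding cube_measure_def
  by (subst emeasure_density) (auto simp: indicator_inter_arith[symmetric] Int_commute nn_integral_indicator[symmetric] simp del: nn_integral_indicator)

text \<open>The exponential is a product of exponentials of one variable, and the factor of a
  coordinate where \<open>q\<close> is nonzero integrates to 0 over a period. The product formula is
  applied to the product of the measures \<open>interval_measure\<close>, of which
  \<open>lborel\<close> is by definition an image.\<close>

lemma fchar_cube_integral:
  fixes q :: "int ^ 'n :: finite"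
  assumes "q \<noteq> 0"
  shows "(\<integral>x. fchar q x \<partial>cube_measure) = 0"
proof -
  let ?M = "\<lambda>b :: real ^ 'n. interval_measure (\<lambda>x :: real. x)"
  interpret P: product_sigma_finite ?M
    by (rule product_sigma_finite.intro) (simp add: lborel_eq_real[symmetric] lborel.sigma_finite_measure_axioms)
  define qr :: "real ^ 'n" where "qr = vec_lambda (\<lambda>i. of_int (vec_nth q i))"
  define f :: "real ^ 'n \<Rightarrow> real \<Rightarrow> complex" where
    "f b t = indicator {0..<1} t *\<^sub>R cis (2 * pi * (inner qr b * t))" for b t
  have fint: "integrable lborel (f b)" for b
    unfolding f_def by (rule integrableI_bounded_set_indicator[where B = 1])
        (auto intro!: borel_measurable_continuous_onI continuous_intros)
  have nth: "vec_nth x i = inner x (axis i 1)" for x :: "real ^ 'n" and i by (simp add: inner_axis)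
  have cube: "x \<in> unit_cube \<longleftrightarrow> (\<forall>b\<in>Basis. 0 \<le> inner x b \<and> inner x b < 1)" for x :: "real ^ 'n"
    unfolding unit_cube_def Basis_vec_def by (auto simp: nth)
  have pr: "pairing q x = inner qr x" for x by (simp add: pairing_def qr_def inner_vec_def)
  have prod: "indicator unit_cube x *\<^sub>R fchar q x = (\<Prod>b\<in>Basis. f b (inner x b))" for x :: "real ^ 'n"
  proof (cases "x \<in> unit_cube")
    case True
    then have i: "indicator {0..<1} (inner x b) = (1 :: real)" if "b \<in> Basis" for b using that cube by auto
    have "fchar q x = exp (\<Sum>b\<in>Basis. \<i> * complex_of_real (2 * pi * (inner qr b * inner x b)))"
      unfolding fchar_def cis_conv_exp pr euclidean_inner[of qr x] by (simp add: sum_distrib_left)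
    also have "\<dots> = (\<Prod>b\<in>Basis. cis (2 * pi * (inner qr b * inner x b)))"
      by (simp add: exp_sum cis_conv_exp)
    also have "\<dots> = (\<Prod>b\<in>Basis. f b (inner x b))"
      by (rule prod.cong[OF refl]) (simp add: f_def i)
    finally show ?thesis using True by simp
  next
    case False
    then obtain b where "b \<in> Basis" "\<not> (0 \<le> inner x b \<and> inner x b < 1)" using cube by blast
    then have "f b (inner x b) = 0" by (auto simp: f_def)
    then have "(\<Prod>b\<in>Basis. f b (inner x b)) = 0" using \<open>b \<in> Basis\<close> by (intro prod_zero) auto
    then show ?thesis using False by simp
  qed
  obtain i where i: "vec_nth q i \<noteq> 0" using assms by (metis Finite_Cartesian_Product.vec_eq_iff zero_index)
  define m where "m = 2 * pi * real_of_int (vec_nth q i)"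
  have m0: "m \<noteq> 0" using i unfolding m_def by simp
  have zero: "(\<integral>t. f (axis i 1) t \<partial>lborel) = 0"
  proof -
    \<comment> \<open>The fundamental theorem is stated for closed intervals, the cube is half-open;
      the endpoint 1 is a null set.\<close>
    have "(\<integral>t. f (axis i 1) t \<partial>lborel) = (\<integral>t. indicator {0..1} t *\<^sub>R cis (m * t) \<partial>lborel)"
    proof (rule integral_cong_AE)
      have "AE t in lborel. t \<noteq> (1 :: real)" by (rule AE_lborel_singleton)
      then show "AE t in lborel. f (axis i 1) t = indicator {0..1} t *\<^sub>R cis (m * t)"
        by eventually_elim (auto simp: f_def m_def qr_def inner_axis indicator_def mult_ac)
      show "f (axis i 1) \<in> borel_measurable lborel" using fint by (rule borel_measurable_integrable)
      have "continuous_on UNIV (\<lambda>t. cis (m * t))" by (intro continuous_intros)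
      then have "(\<lambda>t. cis (m * t)) \<in> borel_measurable lborel" by (simp add: borel_measurable_continuous_onI)
      then show "(\<lambda>t. indicator {0..1} t *\<^sub>R cis (m * t)) \<in> borel_measurable lborel" by measurable
    qed
    also have "\<dots> = cis (m * 1) / (\<i> * m) - cis (m * 0) / (\<i> * m)"
    proof (rule integral_FTC_Icc)
      fix t :: real
      have "((\<lambda>z. exp (\<i> * of_real m * z) / (\<i> * of_real m)) has_field_derivative exp (\<i> * of_real m * of_real t)) (at (of_real t))"
        using m0 by (auto intro!: derivative_eq_intros)
      then have "((\<lambda>t. exp (\<i> * of_real m * of_real t) / (\<i> * of_real m)) has_vector_derivative exp (\<i> * of_real m * of_real t)) (at t within {0..1})"
        by (rule has_vector_derivative_real_field)
      then show "((\<lambda>t. cis (m * t) / (\<i> * m)) has_vector_derivative cis (m * t)) (at t within {0..1})"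
        by (simp add: cis_conv_exp mult.assoc)
    next
      show "continuous_on {0..1} (\<lambda>t. cis (m * t))" by (intro continuous_intros)
    qed simp
    also have "cis (m * 1) = 1" unfolding m_def by (simp add: cis_multiple_2pi)
    finally show ?thesis by simp
  qed
  have "(\<integral>x. fchar q x \<partial>cube_measure) = (\<integral>x. indicator unit_cube x *\<^sub>R fchar q x \<partial>lborel)"
    unfolding cube_measure_def ennreal_indicator[symmetric]
    by (rule integral_density) auto
  also have "\<dots> = (\<integral>x. (\<Prod>b\<in>Basis. f b (inner x b)) \<partial>(lborel :: (real ^ 'n) measure))"
    unfolding prod ..
  also have "\<dots> = (\<integral>x. (\<Prod>b\<in>Basis. f b (x b)) \<partial>(Pi\<^sub>M Basis ?M))"
    unfolding lborel_def
  proof (subst integral_distr)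
    show "(\<lambda>f. \<Sum>b\<in>Basis. f b *\<^sub>R b) \<in> measurable (Pi\<^sub>M Basis ?M) (borel :: (real ^ 'n) measure)"
      by measurable
    have "f b \<in> borel_measurable borel" for b using borel_measurable_integrable[OF fint[of b]] by simp
    then show "(\<lambda>x. \<Prod>b\<in>Basis. f b (inner x b)) \<in> borel_measurable (borel :: (real ^ 'n) measure)"
      by measurable
    show "(\<integral>x. (\<Prod>b\<in>Basis. f b (inner (\<Sum>b\<in>Basis. x b *\<^sub>R b) b)) \<partial>(Pi\<^sub>M Basis ?M)) = (\<integral>x. (\<Prod>b\<in>Basis. f b (x b)) \<partial>(Pi\<^sub>M Basis ?M))"
      by (intro Bochner_Integration.integral_cong prod.cong refl) simp
  qed
  also have "\<dots> = (\<Prod>b\<in>Basis. integral\<^sup>L (?M b) (f b))"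
    by (rule P.product_integral_prod) (use fint in \<open>simp_all add: lborel_eq_real[symmetric]\<close>)
  also have "\<dots> = 0"
    by (rule prod_zero) (use zero in \<open>auto simp: lborel_eq_real[symmetric] intro!: bexI[of _ "axis i 1"]\<close>)
  finally show ?thesis .
qed

lemma emeasure_unit_cube: "emeasure lborel (unit_cube :: (real ^ 'n :: finite) set) = 1"
proof (rule antisym)
  let ?u = "vec_lambda (\<lambda>i. 1) :: real ^ 'n"
  have p: "prod ((\<bullet>) (?u - 0)) Basis = 1" "\<And>b. b \<in> Basis \<Longrightarrow> 0 \<bullet> b \<le> ?u \<bullet> b"
    by (auto simp: Basis_vec_def inner_axis intro!: prod.neutral)
  then have 1: "emeasure lborel (cbox 0 ?u) = 1" "emeasure lborel (box 0 ?u) = 1"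
    by (simp_all add: emeasure_lborel_cbox emeasure_lborel_box)
  have "unit_cube \<subseteq> cbox 0 ?u" "box 0 ?u \<subseteq> unit_cube"
    by (auto simp: unit_cube_def mem_box_cart less_imp_le)
  then show "emeasure lborel (unit_cube :: (real ^ 'n) set) \<le> 1" "1 \<le> emeasure lborel (unit_cube :: (real ^ 'n) set)"
    using emeasure_mono[of unit_cube "cbox 0 ?u" lborel]
      emeasure_mono[of "box 0 ?u" unit_cube lborel] 1 by auto
qed

lemma finite_measure_cube_measure: "finite_measure cube_measure"
  by (rule finite_measureI) (simp add: emeasure_cube_measure emeasure_unit_cube)

lemma measure_cube_measure_UNIV: "measure cube_measure UNIV = 1"
  by (simp add: measure_def emeasure_cube_measure emeasure_unit_cube)

section \<open>Measures on the cube are determined by their Fourier coefficients\<close>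

definition trig_poly :: "(real ^ 'n :: finite \<Rightarrow> complex) \<Rightarrow> bool" where
  "trig_poly f \<longleftrightarrow> (\<exists>ps. \<forall>x. f x = (\<Sum>(a, q) \<leftarrow> ps. a * fchar q x))"

lemma trig_poly_fchar: "trig_poly (\<lambda>x. a * fchar q x)"
  unfolding trig_poly_def by (intro exI[of _ "[(a, q)]"]) simp

lemma trig_poly_const: "trig_poly (\<lambda>x. c)"
  using trig_poly_fchar[of c 0] by simp

lemma trig_poly_add:
  assumes "trig_poly f" "trig_poly g" shows "trig_poly (\<lambda>x. f x + g x)"
proof -
  obtain ps qs where "\<And>x. f x = (\<Sum>(a, q) \<leftarrow> ps. a * fchar q x)" "\<And>x. g x = (\<Sum>(a, q) \<leftarrow> qs. a * fchar q x)"
    using assms unfolding trig_poly_def by blast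
  then show ?thesis unfolding trig_poly_def by (intro exI[of _ "ps @ qs"]) simp
qed

lemma trig_poly_sum: "(\<And>i. i \<in> I \<Longrightarrow> trig_poly (f i)) \<Longrightarrow> trig_poly (\<lambda>x. \<Sum>i\<in>I. f i x)"
  by (induction I rule: infinite_finite_induct) (auto intro: trig_poly_const trig_poly_add)

lemma trig_poly_mult_fchar:
  assumes "trig_poly f" shows "trig_poly (\<lambda>x. (a * fchar q x) * f x)"
proof -
  obtain ps where "\<And>x. f x = (\<Sum>(a, q) \<leftarrow> ps. a * fchar q x)" using assms unfolding trig_poly_def by blast
  moreover have "(a * fchar q x) * (\<Sum>(a, q) \<leftarrow> ps. a * fchar q x) = (\<Sum>(a, q) \<leftarrow> map (\<lambda>(b, p). (a * b, q + p)) ps. a * fchar q x)" for x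
    by (induction ps) (auto simp: algebra_simps fchar_add)
  ultimately show ?thesis unfolding trig_poly_def by (intro exI[of _ "map (\<lambda>(b, p). (a * b, q + p)) ps"]) simp
qed

lemma trig_poly_mult:
  assumes "trig_poly f" "trig_poly g" shows "trig_poly (\<lambda>x. f x * g x)"
proof -
  obtain ps where ps: "\<And>x. f x = (\<Sum>(a, q) \<leftarrow> ps. a * fchar q x)" using assms unfolding trig_poly_def by blast
  have "trig_poly (\<lambda>x. (\<Sum>(a, q) \<leftarrow> ps. a * fchar q x) * g x)"
  proof (induction ps)
    case Nil
    then show ?case by (simp add: trig_poly_const)
  next
    case (Cons p ps)
    obtain a q where "p = (a, q)" by (cases p)
    then show ?case
      using trig_poly_add[OF trig_poly_mult_fchar[OF assms(2), of a q] Cons] by (simp add: algebra_simps)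
  qed
  then show ?thesis by (simp add: ps)
qed

text \<open>Realises the torus as a product of circles in complex space. Real polynomials on this
  space pull back to trigonometric polynomials, so Stone-Weierstrass on the compact image yields the
  density of the latter.\<close>

definition torus_embedding :: "real ^ 'n :: finite \<Rightarrow> complex ^ 'n" where
  "torus_embedding x = vec_lambda (\<lambda>i. cis (2 * pi * vec_nth x i))"

lemma continuous_torus_embedding: "continuous_on S torus_embedding"
  unfolding torus_embedding_def by (intro continuous_intros)

lemma trig_poly_coordinate:
  "trig_poly (\<lambda>x. complex_of_real (inner (vec_nth (torus_embedding x) i) u))"
proof -
  have fc: "fchar (axis i k) x = cis (2 * pi * of_int k * vec_nth x i)" for k x
    by (simp add: fchar_def pairing_def axis_def if_distrib if_distribR sum.delta mult.assoc cong: if_cong)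
  have "complex_of_real (inner (vec_nth (torus_embedding x) i) u) =
     (cnj u / 2) * fchar (axis i 1) x + (u / 2) * fchar (axis i (- 1)) x" for x
    unfolding fc torus_embedding_def
    by (simp add: complex_eq_iff inner_complex_def field_simps)
  then have e: "(\<lambda>x. complex_of_real (inner (vec_nth (torus_embedding x) i) u)) =
     (\<lambda>x. (cnj u / 2) * fchar (axis i 1) x + (u / 2) * fchar (axis i (- 1)) x)" by (rule ext)
  show ?thesis unfolding e by (intro trig_poly_add trig_poly_fchar)
qed

lemma trig_poly_polynomial:
  "real_polynomial_function p \<Longrightarrow> trig_poly (\<lambda>x. complex_of_real (p (torus_embedding x)))"
proof (induction p rule: real_polynomial_function.induct)
  case (linear f)
  interpret bounded_linear f by fact
  have h: "f z = (\<Sum>b\<in>Basis. inner z b * f b)" for z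
    using sum[of "\<lambda>b. inner z b *\<^sub>R b" Basis] by (simp add: euclidean_representation scaleR)
  have e: "complex_of_real (f (torus_embedding x)) = (\<Sum>b\<in>Basis. of_real (f b) * complex_of_real (inner (torus_embedding x) b))" for x
    by (subst h[of "torus_embedding x"]) (simp add: mult.commute)
  have "trig_poly (\<lambda>x. of_real (f b) * complex_of_real (inner (torus_embedding x) b))" if b: "b \<in> Basis" for b
  proof -
    obtain i u where "b = axis i u" using b unfolding Basis_vec_def by auto
    then show ?thesis by (simp add: inner_axis trig_poly_mult trig_poly_const trig_poly_coordinate)
  qed
  then show ?case unfolding e by (rule trig_poly_sum)
next
  case (add f g)
  then show ?case using trig_poly_add by simp
next
  case (mult f g)
  then show ?case using trig_poly_mult by simp
qed (simp add: trig_poly_const)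

text \<open>By \<open>orth\<close> only terms of frequency 0 contribute, so all such measures agree
  on trigonometric polynomials up to their total mass.\<close>

lemma trig_poly_integral:
  assumes fin: "finite_measure M" and sM: "sets M = sets borel"
    and orth: "\<And>q. q \<noteq> 0 \<Longrightarrow> (\<integral>x. fchar q x \<partial>M) = 0"
  shows "(\<integral>x. (\<Sum>(a, q) \<leftarrow> ps. a * fchar q x) \<partial>M) = of_real (measure M UNIV) * (\<Sum>(a, q) \<leftarrow> ps. if q = 0 then a else 0)"
    and "integrable M (\<lambda>x. \<Sum>(a, q) \<leftarrow> ps. a * fchar q x)"
proof -
  have spM: "space M = UNIV" using sets_eq_imp_space_eq[OF sM] by simp
  interpret finite_measure M by (rule fin)
  have "fchar q \<in> borel_measurable M" for q using fchar_measurable by (simp add: measurable_cong_sets[OF sM refl])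
  then have i: "integrable M (fchar q)" for q by (intro integrable_const_bound[where B = 1]) auto
  have I: "(\<integral>x. fchar q x \<partial>M) = (if q = 0 then of_real (measure M UNIV) else 0)" for q
    using orth by (simp add: fchar_0[abs_def] spM scaleR_conv_of_real)
  show "integrable M (\<lambda>x. \<Sum>(a, q) \<leftarrow> ps. a * fchar q x)"
    by (induction ps) (auto simp: i)
  then show "(\<integral>x. (\<Sum>(a, q) \<leftarrow> ps. a * fchar q x) \<partial>M) = of_real (measure M UNIV) * (\<Sum>(a, q) \<leftarrow> ps. if q = 0 then a else 0)"
  proof (induction ps)
    case (Cons p ps)
    obtain a q where p: "p = (a, q)" by (cases p)
    have j: "integrable M (\<lambda>x. \<Sum>(a, q) \<leftarrow> ps. a * fchar q x)" by (induction ps) (auto simp: i)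
    have "(\<integral>x. a * fchar q x + (\<Sum>(a, q) \<leftarrow> ps. a * fchar q x) \<partial>M) = a * (\<integral>x. fchar q x \<partial>M) + (\<integral>x. (\<Sum>(a, q) \<leftarrow> ps. a * fchar q x) \<partial>M)"
      using i j by simp
    then show ?case unfolding p using Cons.IH[OF j] by (simp add: I algebra_simps)
  qed simp
qed

lemma continuous_integral_eq:
  fixes M :: "(real ^ 'n :: finite) measure" and g :: "complex ^ 'n \<Rightarrow> real"
  assumes fin: "finite_measure M" and sM: "sets M = sets borel" and cube: "AE x in M. x \<in> unit_cube"
    and orth: "\<And>q. q \<noteq> 0 \<Longrightarrow> (\<integral>x. fchar q x \<partial>M) = 0" and g: "continuous_on UNIV g"
  shows "(\<integral>x. g (torus_embedding x) \<partial>M) = measure M UNIV * (\<integral>x. g (torus_embedding x) \<partial>cube_measure)"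
proof -
  let ?K = "torus_embedding ` cbox 0 (vec_lambda (\<lambda>i. 1) :: real ^ 'n)"
  have K: "compact ?K" by (intro compact_continuous_image continuous_torus_embedding compact_cbox)
  have QK: "torus_embedding x \<in> ?K" if "x \<in> unit_cube" for x :: "real ^ 'n"
    using that by (intro imageI) (auto simp: unit_cube_def mem_box_cart less_imp_le)
  interpret C: finite_measure "cube_measure :: (real ^ 'n) measure" by (rule finite_measure_cube_measure)
  have cubeC: "AE x in cube_measure. x \<in> unit_cube"
    unfolding cube_measure_def by (subst AE_density) (auto simp: indicator_def)
  have gK: "continuous_on ?K g" using g continuous_on_subset by blast
  obtain B where B: "\<And>z. z \<in> ?K \<Longrightarrow> norm (g z) \<le> B"
    using compact_imp_bounded[OF compact_continuous_image[OF gK K]] unfolding bounded_iff by auto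
  define c where "c = measure M UNIV"
  have c0: "c \<ge> 0" unfolding c_def by simp
  \<comment> \<open>Stated for an arbitrary measure \<open>N\<close>, since the same approximating
    polynomial is compared with \<open>M\<close> and with \<open>cube_measure\<close>.\<close>
  have key: "\<bar>(\<integral>x. g (torus_embedding x) \<partial>N) - measure N UNIV * Re s\<bar> \<le> measure N UNIV * e"
    if fN: "finite_measure N" and sN: "sets N = sets borel" and cN: "AE x in N. x \<in> unit_cube"
      and oN: "\<And>q. q \<noteq> 0 \<Longrightarrow> (\<integral>x. fchar q x \<partial>N) = 0"
      and p: "\<And>z. z \<in> ?K \<Longrightarrow> \<bar>g z - p z\<bar> < e"
      and ps: "\<And>x. complex_of_real (p (torus_embedding x)) = (\<Sum>(a, q) \<leftarrow> ps. a * fchar q x)"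
      and s: "s = (\<Sum>(a, q) \<leftarrow> ps. if q = 0 then a else 0)" and e: "e > 0"
    for N :: "(real ^ 'n) measure" and p e ps s
  proof -
    interpret N: finite_measure N by (rule fN)
    have spN: "space N = UNIV" using sets_eq_imp_space_eq[OF sN] by simp
    note T = trig_poly_integral[OF fN sN oN, of ps]
    have ip: "integrable N (\<lambda>x. p (torus_embedding x))"
      using T(2) unfolding ps[symmetric] complex_of_real_integrable_eq .
    have "(\<integral>x. complex_of_real (p (torus_embedding x)) \<partial>N) = of_real (measure N UNIV) * s"
      using T(1) unfolding ps[symmetric] s .
    then have pe: "(\<integral>x. p (torus_embedding x) \<partial>N) = measure N UNIV * Re s"
      unfolding integral_complex_of_real using arg_cong[of _ _ Re] by (metis Re_complex_of_real scaleR_complex.simps(1) scaleR_conv_of_real)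
    have gm: "(\<lambda>x. g (torus_embedding x)) \<in> borel_measurable N"
    proof -
      have "continuous_on UNIV (\<lambda>x. g (torus_embedding x))"
        by (rule continuous_on_compose2[OF g continuous_torus_embedding]) auto
      then show ?thesis
        using borel_measurable_continuous_onI measurable_cong_sets[OF sN refl] by blast
    qed
    have ig: "integrable N (\<lambda>x. g (torus_embedding x))"
    proof (rule N.integrable_const_bound[where B = B, OF _ gm])
      show "AE x in N. norm (g (torus_embedding x)) \<le> B" using cN by eventually_elim (rule B[OF QK])
    qed
    have "\<bar>(\<integral>x. g (torus_embedding x) \<partial>N) - (\<integral>x. p (torus_embedding x) \<partial>N)\<bar> = \<bar>\<integral>x. g (torus_embedding x) - p (torus_embedding x) \<partial>N\<bar>"
      using ig ip by simp
    also have "\<dots> \<le> (\<integral>x. \<bar>g (torus_embedding x) - p (torus_embedding x)\<bar> \<partial>N)" by (rule integral_abs_bound)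
    also have "\<dots> \<le> (\<integral>x. e \<partial>N)"
    proof (rule integral_mono_AE)
      show "integrable N (\<lambda>x. \<bar>g (torus_embedding x) - p (torus_embedding x)\<bar>)" using ig ip by simp
      show "AE x in N. \<bar>g (torus_embedding x) - p (torus_embedding x)\<bar> \<le> e"
        using cN by eventually_elim (use p QK in \<open>auto intro: less_imp_le\<close>)
    qed simp
    also have "\<dots> = measure N UNIV * e" by (simp add: spN)
    finally show ?thesis unfolding pe .
  qed
  have "\<bar>(\<integral>x. g (torus_embedding x) \<partial>M) - c * (\<integral>x. g (torus_embedding x) \<partial>cube_measure)\<bar> \<le> 2 * c * e" if e: "e > 0" for e
  proof -
    obtain p where p: "real_polynomial_function p" "\<And>z. z \<in> ?K \<Longrightarrow> \<bar>g z - p z\<bar> < e"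
      using Stone_Weierstrass_real_polynomial_function[OF K gK e] by blast
    obtain ps where ps: "\<And>x. complex_of_real (p (torus_embedding x)) = (\<Sum>(a, q) \<leftarrow> ps. a * fchar q x)"
      using trig_poly_polynomial[OF p(1)] unfolding trig_poly_def by blast
    define s where "s = (\<Sum>(a, q) \<leftarrow> ps. if q = 0 then a else 0)"
    have 1: "\<bar>(\<integral>x. g (torus_embedding x) \<partial>M) - c * Re s\<bar> \<le> c * e"
      unfolding c_def by (rule key[OF fin sM cube orth p(2) ps s_def e])
    have 2: "\<bar>(\<integral>x. g (torus_embedding x) \<partial>cube_measure) - Re s\<bar> \<le> e"
      using key[OF C.finite_measure_axioms sets_cube_measure cubeC fchar_cube_integral p(2) ps s_def e]
      by (simp add: measure_cube_measure_UNIV)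
    have "\<bar>c * (\<integral>x. g (torus_embedding x) \<partial>cube_measure) - c * Re s\<bar> \<le> c * e"
      unfolding right_diff_distrib[symmetric] abs_mult using 2 c0 by (simp add: mult_left_mono)
    then show ?thesis using 1 by linarith
  qed
  note bd = this
  have "\<bar>(\<integral>x. g (torus_embedding x) \<partial>M) - c * (\<integral>x. g (torus_embedding x) \<partial>cube_measure)\<bar> \<le> 0"
  proof (rule field_le_epsilon)
    fix e :: real assume e: "e > 0"
    \<comment> \<open>The summand 1 in \<open>2 * c + 1\<close> keeps the denominator positive when
      \<open>M\<close> has mass 0.\<close>
    have "\<bar>(\<integral>x. g (torus_embedding x) \<partial>M) - c * (\<integral>x. g (torus_embedding x) \<partial>cube_measure)\<bar> \<le> 2 * c * (e / (2 * c + 1))"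
      by (rule bd) (use e c0 in auto)
    also have "\<dots> \<le> e" using e c0 by (simp add: field_simps)
    finally show "\<bar>(\<integral>x. g (torus_embedding x) \<partial>M) - c * (\<integral>x. g (torus_embedding x) \<partial>cube_measure)\<bar> \<le> 0 + e" by simp
  qed
  then show ?thesis unfolding c_def by simp
qed

text \<open>An arc of the circle is cut out by a half plane: it consists of the points whose angular
  distance from the midpoint \<open>pi * (a + b)\<close> is less than the half length
  \<open>pi * (b - a)\<close>, and the cosine decreases with this distance up to
  \<open>pi\<close>.\<close>

lemma arc_cos:
  fixes a b x :: real
  assumes "0 \<le> a" "a < b" "b \<le> 1" "0 \<le> x" "x < 1"
  shows "cos (pi * (b - a)) < cos (2 * pi * x - pi * (a + b)) \<longleftrightarrow> a < x \<and> x < b"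
proof -
  define t where "t = \<bar>2 * pi * x - pi * (a + b)\<bar>"
  define w where "w = pi * (b - a)"
  have w: "0 < w" "w \<le> pi" unfolding w_def using assms by (auto simp: mult_le_cancel_left1)
  have ct: "cos (2 * pi * x - pi * (a + b)) = cos t" unfolding t_def by simp
  have "2 * pi * x - pi * (a + b) < w \<longleftrightarrow> x < b"
  proof -
    have "w - (2 * pi * x - pi * (a + b)) = 2 * pi * (b - x)" unfolding w_def by (simp add: algebra_simps)
    then show ?thesis by (metis diff_gt_0_iff_gt mult_pos_pos pi_gt_zero zero_less_mult_pos zero_less_numeral)
  qed
  moreover have "- w < 2 * pi * x - pi * (a + b) \<longleftrightarrow> a < x"
  proof -
    have "(2 * pi * x - pi * (a + b)) - (- w) = 2 * pi * (x - a)" unfolding w_def by (simp add: algebra_simps)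
    then show ?thesis by (metis diff_gt_0_iff_gt mult_pos_pos pi_gt_zero zero_less_mult_pos zero_less_numeral)
  qed
  ultimately have iff: "t < w \<longleftrightarrow> a < x \<and> x < b" unfolding t_def abs_less_iff by linarith
  have "cos w < cos t \<longleftrightarrow> t < w"
  proof (cases "t \<le> pi")
    case True
    then show ?thesis using w by (intro cos_mono_less_eq) (auto simp: t_def)
  next
    \<comment> \<open>Beyond half a turn the distance is measured the other way round; as
      \<open>x\<close> lies in the unit interval, it is still at least the half length
      \<open>w\<close>.\<close>
    case False
    have "2 * pi * x - pi * (a + b) \<le> 2 * pi - w"
    proof -
      have "2 * pi - w - (2 * pi * x - pi * (a + b)) = 2 * pi * (1 - x) + 2 * pi * a" unfolding w_def by (simp add: algebra_simps)
      moreover have "\<dots> \<ge> 0" using assms by (intro add_nonneg_nonneg mult_nonneg_nonneg) auto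
      ultimately show ?thesis by linarith
    qed
    moreover have "- (2 * pi * x - pi * (a + b)) \<le> 2 * pi - w"
    proof -
      have "2 * pi - w + (2 * pi * x - pi * (a + b)) = 2 * pi * (1 - b) + 2 * pi * x" unfolding w_def by (simp add: algebra_simps)
      moreover have "\<dots> \<ge> 0" using assms by (intro add_nonneg_nonneg mult_nonneg_nonneg) auto
      ultimately show ?thesis by linarith
    qed
    ultimately have t2: "t \<le> 2 * pi - w" unfolding t_def by linarith
    have "cos t = cos (2 * pi - t)" by simp
    also have "\<dots> \<le> cos w" by (rule cos_monotone_0_pi_le) (use t2 w False in auto)
    finally show ?thesis using False w by auto
  qed
  then show ?thesis using iff ct unfolding w_def by simp
qed

text \<open>On the cube the continuous function \<open>h i\<close> is positive exactly where the
  \<open>i\<close>-th coordinate lies in its interval. Hence \<open>G k\<close> tends to the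
  indicator of the box, and dominated convergence carries the identity over from continuous
  functions.\<close>

lemma box_measure_eq:
  fixes M :: "(real ^ 'n :: finite) measure"
  assumes fin: "finite_measure M" and sM: "sets M = sets borel" and cube: "AE x in M. x \<in> unit_cube"
    and orth: "\<And>q. q \<noteq> 0 \<Longrightarrow> (\<integral>x. fchar q x \<partial>M) = 0"
    and ab: "\<And>i. 0 \<le> vec_nth a i \<and> vec_nth a i < vec_nth b i \<and> vec_nth b i \<le> 1"
  shows "measure M (box a b) = measure M UNIV * measure cube_measure (box a b)"
proof -
  define h :: "'n \<Rightarrow> complex ^ 'n \<Rightarrow> real" where
    "h i z = max 0 (Re (vec_nth z i * cnj (cis (pi * (vec_nth a i + vec_nth b i)))) - cos (pi * (vec_nth b i - vec_nth a i)))" for i z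
  define G where "G k z = min 1 (real k * (\<Prod>i\<in>UNIV. h i z))" for k z
  have contG: "continuous_on UNIV (G k)" for k
    unfolding G_def h_def by (intro continuous_intros continuous_on_min continuous_on_max)
  have h0: "h i z \<ge> 0" for i z unfolding h_def by simp
  have hpos: "0 < h i (torus_embedding x) \<longleftrightarrow> vec_nth a i < vec_nth x i \<and> vec_nth x i < vec_nth b i" if "x \<in> unit_cube" for x i
  proof -
    have "vec_nth (torus_embedding x) i * cnj (cis (pi * (vec_nth a i + vec_nth b i))) = cis (2 * pi * vec_nth x i - pi * (vec_nth a i + vec_nth b i))"
      unfolding torus_embedding_def by (simp add: cis_mult cis_cnj)
    then have "0 < h i (torus_embedding x) \<longleftrightarrow> cos (pi * (vec_nth b i - vec_nth a i)) < cos (2 * pi * vec_nth x i - pi * (vec_nth a i + vec_nth b i))"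
      unfolding h_def by auto
    also have "\<dots> \<longleftrightarrow> vec_nth a i < vec_nth x i \<and> vec_nth x i < vec_nth b i"
      by (rule arc_cos) (use ab[of i] that in \<open>auto simp: unit_cube_def\<close>)
    finally show ?thesis .
  qed
  have lim: "(\<lambda>k. G k (torus_embedding x)) \<longlonglongrightarrow> indicator (box a b) x" if x: "x \<in> unit_cube" for x
  proof (cases "x \<in> box a b")
    case True
    define p where "p = (\<Prod>i\<in>UNIV. h i (torus_embedding x))"
    have p: "p > 0" unfolding p_def by (rule prod_pos) (use True hpos[OF x] in \<open>auto simp: mem_box_cart\<close>)
    obtain k0 :: nat where k0: "real k0 > 1 / p" using reals_Archimedean2 by blast
    have "eventually (\<lambda>k. G k (torus_embedding x) = 1) sequentially"
      unfolding eventually_sequentially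
    proof (intro exI[of _ k0] allI impI)
      fix k assume "k \<ge> k0"
      then have "real k > 1 / p" using k0 by linarith
      then have "real k * p \<ge> 1" using p by (simp add: field_simps)
      then show "G k (torus_embedding x) = 1" unfolding G_def p_def[symmetric] by simp
    qed
    then show ?thesis using True by (simp add: tendsto_eventually)
  next
    case False
    then obtain i where "\<not> (vec_nth a i < vec_nth x i \<and> vec_nth x i < vec_nth b i)" by (auto simp: mem_box_cart)
    then have "h i (torus_embedding x) = 0" using hpos[OF x, of i] h0[of i "torus_embedding x"] by linarith
    then have p0: "(\<Prod>i\<in>UNIV. h i (torus_embedding x)) = 0" by (intro prod_zero) auto
    show ?thesis unfolding G_def p0 using False by simp
  qed
  have conv: "(\<lambda>k. \<integral>x. G k (torus_embedding x) \<partial>N) \<longlonglongrightarrow> measure N (box a b)"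
    if fN: "finite_measure N" and sN: "sets N = sets borel" and cN: "AE x in N. x \<in> unit_cube"
    for N :: "(real ^ 'n) measure"
  proof -
    interpret finite_measure N by (rule fN)
    have m: "f \<in> borel_measurable N \<longleftrightarrow> f \<in> borel_measurable borel" for f :: "real ^ 'n \<Rightarrow> real"
      by (simp add: measurable_cong_sets[OF sN refl])
    have "(\<lambda>k. \<integral>x. G k (torus_embedding x) \<partial>N) \<longlonglongrightarrow> (\<integral>x. indicator (box a b) x \<partial>N)"
    proof (rule integral_dominated_convergence[where w = "\<lambda>_. 1"])
      show "indicator (box a b) \<in> borel_measurable N" by (rule borel_measurable_indicator) (simp add: sN)
      show "(\<lambda>x. G k (torus_embedding x)) \<in> borel_measurable N" for k unfolding m
        by (rule borel_measurable_continuous_onI) (rule continuous_on_compose2[OF contG continuous_torus_embedding], auto)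
      show "AE x in N. (\<lambda>k. G k (torus_embedding x)) \<longlonglongrightarrow> indicator (box a b) x"
        using cN by eventually_elim (rule lim)
      have "0 \<le> real k * (\<Prod>i\<in>UNIV. h i z)" for z k
        by (intro mult_nonneg_nonneg prod_nonneg) (simp_all add: h0)
      then have "0 \<le> G k z" "G k z \<le> 1" for z k unfolding G_def by simp_all
      then show "AE x in N. norm (G k (torus_embedding x)) \<le> 1" for k
        by (intro AE_I2) simp
    qed simp
    then show ?thesis by (simp add: sN)
  qed
  have l1: "(\<lambda>k. \<integral>x. G k (torus_embedding x) \<partial>M) \<longlonglongrightarrow> measure M (box a b)" by (rule conv[OF fin sM cube])
  have l2: "(\<lambda>k. measure M UNIV * (\<integral>x. G k (torus_embedding x) \<partial>cube_measure)) \<longlonglongrightarrow> measure M UNIV * measure cube_measure (box a b)"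
  proof (intro tendsto_mult tendsto_const conv finite_measure_cube_measure sets_cube_measure)
    show "AE x in cube_measure. x \<in> unit_cube"
      unfolding cube_measure_def by (subst AE_density) (auto simp: indicator_def)
  qed
  have "(\<integral>x. G k (torus_embedding x) \<partial>M) = measure M UNIV * (\<integral>x. G k (torus_embedding x) \<partial>cube_measure)" for k
    by (rule continuous_integral_eq[OF fin sM cube orth contG])
  then show ?thesis using LIMSEQ_unique[OF l1] l2 by simp
qed

lemma AE_cube_measure: "AE x in cube_measure. x \<in> unit_cube"
  unfolding cube_measure_def by (subst AE_density) (auto simp: indicator_def)

text \<open>Boxes generate the Borel sets and are stable under intersection, so boxes suffice.
  \<open>box_measure_eq\<close> covers those inside the cube. The open cube is one of them and has
  full measure on both sides, so neither measure charges its complement, and any box may be cut down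
  to it.\<close>

theorem fourier_uniqueness:
  fixes M :: "(real ^ 'n :: finite) measure"
  assumes fin: "finite_measure M" and sM: "sets M = sets borel" and cube: "AE x in M. x \<in> unit_cube"
    and orth: "\<And>q. q \<noteq> 0 \<Longrightarrow> (\<integral>x. fchar q x \<partial>M) = 0"
  shows "M = scale_measure (ennreal (measure M UNIV)) cube_measure"
proof -
  interpret M: finite_measure M by (rule fin)
  interpret C: finite_measure "cube_measure :: (real ^ 'n) measure" by (rule finite_measure_cube_measure)
  define c where "c = measure M UNIV"
  let ?u = "vec_lambda (\<lambda>i. 1) :: real ^ 'n"
  note bm = box_measure_eq[OF fin sM cube orth, folded c_def]
  have bC: "measure cube_measure (box 0 ?u) = 1"
  proof -
    have "box 0 ?u \<inter> unit_cube = box 0 ?u" by (auto simp: unit_cube_def mem_box_cart less_imp_le)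
    moreover have "prod ((\<bullet>) (?u - 0)) Basis = 1" "\<And>b. b \<in> Basis \<Longrightarrow> 0 \<bullet> b \<le> ?u \<bullet> b"
      by (auto simp: Basis_vec_def inner_axis intro!: prod.neutral)
    ultimately show ?thesis by (simp add: measure_def emeasure_cube_measure emeasure_lborel_box)
  qed
  have bM: "measure M (box 0 ?u) = c" using bm[of 0 ?u] bC by simp
  have full: "measure N (box a b) = measure N (box a b \<inter> box 0 ?u)"
    if fN: "finite_measure N" and sN: "sets N = sets borel" and e: "measure N (box 0 ?u) = measure N UNIV"
    for N :: "(real ^ 'n) measure" and a b
  proof -
    interpret finite_measure N by (rule fN)
    have "measure N (UNIV - box 0 ?u) = 0"
      using finite_measure_Diff[of UNIV "box 0 ?u"] e sN by simp
    then have "measure N (box a b - box 0 ?u) = 0"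
      using finite_measure_mono[of "box a b - box 0 ?u" "UNIV - box 0 ?u"] sN
      by (simp add: measure_le_0_iff Diff_mono)
    then show ?thesis using finite_measure_Diff'[of "box a b" "box 0 ?u"] sN by simp
  qed
  have meq: "measure M (box a b) = c * measure cube_measure (box a b)" for a b
  proof -
    define a' b' :: "real ^ 'n" where "a' = vec_lambda (\<lambda>i. max (vec_nth a i) 0)" and "b' = vec_lambda (\<lambda>i. min (vec_nth b i) 1)"
    have i: "box a b \<inter> box 0 ?u = box a' b'" unfolding a'_def b'_def by (auto simp: mem_box_cart)
    have "measure M (box a' b') = c * measure cube_measure (box a' b')"
    proof (cases "\<forall>i. vec_nth a' i < vec_nth b' i")
      case True
      then show ?thesis by (intro bm) (auto simp: a'_def b'_def)
    next
      case False
      then obtain i where i: "\<not> vec_nth a' i < vec_nth b' i" by blast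
      have "x \<notin> box a' b'" for x
        using order_less_trans[of "vec_nth a' i" "vec_nth x i" "vec_nth b' i"] i unfolding mem_box_cart by blast
      then have "box a' b' = {}" by blast
      then show ?thesis by simp
    qed
    then show ?thesis
      using full[OF fin sM, of a b] full[OF finite_measure_cube_measure sets_cube_measure, of a b]
        bM bC unfolding i c_def measure_cube_measure_UNIV by simp
  qed
  have c0: "c \<ge> 0" unfolding c_def by simp
  show ?thesis
    unfolding c_def[symmetric]
  proof (rule measure_eqI_generator_eq[where E = "range (\<lambda>(a, b). box a b)" and \<Omega> = UNIV
        and A = "\<lambda>i. box (- (real i *\<^sub>R One)) (real i *\<^sub>R One)"])
    show "Int_stable (range (\<lambda>(a, b :: real ^ 'n). box a b))"
      unfolding Int_stable_def by (auto simp: box_Int_box)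
    have "sets (borel :: (real ^ 'n) measure) = sigma_sets UNIV (range (\<lambda>(a, b). box a b))"
      unfolding borel_eq_box by (rule sets_measure_of) auto
    then show "sets M = sigma_sets UNIV (range (\<lambda>(a, b). box a b))"
      "sets (scale_measure (ennreal c) cube_measure) = sigma_sets UNIV (range (\<lambda>(a, b :: real ^ 'n). box a b))"
      using sM by simp_all
    fix X :: "(real ^ 'n) set" assume "X \<in> range (\<lambda>(a, b). box a b)"
    then obtain a b where X: "X = box a b" by auto
    show "emeasure M X = emeasure (scale_measure (ennreal c) cube_measure) X"
      unfolding X using c0
      by (simp add: M.emeasure_eq_measure C.emeasure_eq_measure meq ennreal_mult)
  qed (auto simp: UN_box_eq_UNIV M.emeasure_eq_measure)
qed

section \<open>Ergodicity of toral automorphisms\<close>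

definition frac_vec :: "real ^ 'n :: finite \<Rightarrow> real ^ 'n" where
  "frac_vec y = vec_lambda (\<lambda>i. frac (vec_nth y i))"

lemma frac_vec_cube: "frac_vec y \<in> unit_cube"
  by (simp add: frac_vec_def unit_cube_def frac_lt_1)

lemma int_vec_frac_vec: "int_vec (frac_vec y - y)"
  by (simp add: int_vec_def frac_vec_def frac_def)

lemma fchar_periodic: "int_vec (y - x) \<Longrightarrow> fchar q y = fchar q x"
proof -
  assume "int_vec (y - x)"
  then obtain k :: int where "pairing q (y - x) = of_int k" using pairing_int_vec by (metis Ints_cases)
  then have "pairing q y = pairing q x + of_int k" by (simp add: pairing_diff)
  then have "fchar q y = fchar q x * cis (2 * pi * of_int k)"
    by (simp add: fchar_def cis_mult algebra_simps)
  then show ?thesis by (simp add: cis_multiple_2pi)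
qed

lemma frac_vec_measurable [measurable]: "frac_vec \<in> borel_measurable borel"
proof (subst borel_measurable_euclidean_space, intro ballI)
  fix b :: "real ^ 'n" assume "b \<in> Basis"
  then obtain i where b: "b = axis i 1" by (auto simp: Basis_vec_def)
  have "(\<lambda>x :: real ^ 'n. vec_nth x i) \<in> borel_measurable borel"
    by (intro borel_measurable_continuous_onI continuous_intros)
  then show "(\<lambda>x. frac_vec x \<bullet> b) \<in> borel_measurable borel"
    unfolding b frac_vec_def by (simp add: inner_axis frac_def)
qed

text \<open>By \<open>free\<close> the frequencies on an orbit are pairwise distinct, and infinitely
  many equal nonzero Fourier coefficients contradict Bessel's inequality. A set whose only nonzero
  coefficient is the constant one has measure 0 or 1.\<close>

theorem ergodic_matI:
  fixes A :: "int ^ 'n :: finite ^ 'n"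
  assumes AB: "A ** B = Finite_Cartesian_Product.mat 1" "B ** A = Finite_Cartesian_Product.mat 1"
    and free: "\<And>j q. j > 0 \<Longrightarrow> ((\<lambda>q. Finite_Cartesian_Product.transpose A *v q) ^^ j) q = q \<Longrightarrow> q = 0"
  shows "ergodic_mat A"
  unfolding ergodic_mat_iff[OF AB]
proof (intro ballI impI)
  fix U :: "(real ^ 'n) set"
  assume U: "U \<in> sets borel" and per: "periodic_set U" and inv: "\<forall>x. real_mat A *v x \<in> U \<longleftrightarrow> x \<in> U"
  define T where "T = (\<lambda>q. Finite_Cartesian_Product.transpose A *v q)"
  interpret C: finite_measure "cube_measure :: (real ^ 'n) measure" by (rule finite_measure_cube_measure)
  have injT: "inj T"
  proof (rule injI)
    fix p q assume "T p = T q"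
    then have "Finite_Cartesian_Product.transpose B *v T p = Finite_Cartesian_Product.transpose B *v T q" by simp
    moreover have "Finite_Cartesian_Product.transpose B *v T r = r" for r
      unfolding T_def matrix_vector_mul_assoc matrix_transpose_mul[symmetric] AB(1) by (simp add: transpose_mat)
    ultimately show "p = q" by simp
  qed
  have T0: "T 0 = 0" unfolding T_def by simp
  define g :: "real ^ 'n \<Rightarrow> real ^ 'n" where "g x = frac_vec (real_mat A *v x)" for x
  have gm: "g \<in> borel_measurable borel"
  proof -
    have "(\<lambda>x. real_mat A *v x) \<in> borel_measurable borel"
      by (intro borel_measurable_continuous_onI matrix_vector_mult_linear_continuous_on)
    then show ?thesis unfolding g_def by measurable
  qed
  have gmc: "g \<in> measurable cube_measure borel" using gm by (simp add: measurable_cong_sets[OF sets_cube_measure refl])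
  have fg: "fchar q (g x) = fchar (T q) x" for q x
    unfolding g_def T_def fchar_periodic[OF int_vec_frac_vec] by (simp only: fchar_def pairing_real_mat)
  have Ug: "g x \<in> U \<longleftrightarrow> x \<in> U" for x
  proof -
    have "g x \<in> U \<longleftrightarrow> real_mat A *v x \<in> U"
      using per int_vec_frac_vec[of "real_mat A *v x"] int_vec_diff_commute unfolding g_def periodic_set_def by blast
    then show ?thesis using inv by blast
  qed
  \<comment> \<open>Invariance of the measure is another instance of Fourier uniqueness: composition
    with \<open>g\<close> replaces the frequency \<open>q\<close> by \<open>T q\<close>, which is
    nonzero because \<open>T\<close> is injective.\<close>
  have pres: "distr cube_measure borel g = cube_measure"
  proof -
    let ?D = "distr cube_measure borel g"
    have m1: "measure ?D UNIV = 1"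
      by (subst measure_distr[OF gmc]) (simp_all add: measure_cube_measure_UNIV)
    have "?D = scale_measure (ennreal (measure ?D UNIV)) cube_measure"
    proof (rule fourier_uniqueness)
      show "finite_measure ?D" by (rule C.finite_measure_distr[OF gmc])
      show "AE x in ?D. x \<in> unit_cube"
        by (subst AE_distr_iff[OF gmc]) (auto simp: g_def frac_vec_cube)
      fix q :: "int ^ 'n" assume "q \<noteq> 0"
      then have "T q \<noteq> 0" using injT T0 by (metis injD)
      then show "(\<integral>x. fchar q x \<partial>?D) = 0"
        by (subst integral_distr[OF gmc]) (simp_all add: fg fchar_cube_integral)
    qed simp
    then show ?thesis unfolding m1 by simp
  qed
  define c where "c q = (\<integral>x. indicator U x *\<^sub>R fchar q x \<partial>cube_measure)" for q
  have mU: "(\<lambda>x. indicator U x *\<^sub>R fchar q x) \<in> borel_measurable borel" for q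
    using U by measurable
  have iU: "integrable cube_measure (\<lambda>x. indicator U x *\<^sub>R fchar q x)" for q
    by (rule C.integrable_const_bound[where B = 1])
      (use mU in \<open>auto simp: indicator_def measurable_cong_sets[OF sets_cube_measure refl]\<close>)
  have cT: "c (T q) = c q" for q
  proof -
    have "c q = (\<integral>x. indicator U x *\<^sub>R fchar q x \<partial>(distr cube_measure borel g))" unfolding pres c_def ..
    also have "\<dots> = (\<integral>x. indicator U (g x) *\<^sub>R fchar q (g x) \<partial>cube_measure)" by (rule integral_distr[OF gmc mU])
    also have "\<dots> = c (T q)" unfolding c_def fg by (simp add: indicator_def Ug)
    finally show ?thesis by simp
  qed
  have c0: "c q = 0" if q: "q \<noteq> 0" for q
  proof (rule ccontr)
    assume nz: "c q \<noteq> 0"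
    define Q where "Q j = (T ^^ j) q" for j
    have cQ: "c (Q j) = c q" for j unfolding Q_def by (induction j) (simp_all add: cT)
    have Q0: "Q j \<noteq> 0" for j
    proof (induction j)
      case (Suc j)
      then show ?case using injT T0 unfolding Q_def by (metis funpow.simps(2) injD o_apply)
    qed (simp add: Q_def q)
    have injQ: "Q i \<noteq> Q j" if "i < j" for i j
    proof
      assume e: "Q i = Q j"
      have "Q j = (T ^^ (j - i)) (Q i)" unfolding Q_def using that by (simp flip: funpow_add comp_apply[of "T ^^ (j - i)"])
      then have "(T ^^ (j - i)) (Q i) = Q i" using e by simp
      moreover have "j - i > 0" using that by simp
      ultimately have "Q i = 0" using free[of "j - i" "Q i", folded T_def] by blast
      then show False using Q0[of i] by simp
    qed
    then have injQ': "Q i = Q j \<longleftrightarrow> i = j" for i j by (metis nat_neq_iff)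
    \<comment> \<open>Bessel's inequality for \<open>N\<close> orthonormal exponentials with equal
      coefficients. Their sum \<open>S\<close> has integral \<open>N * c q\<close> over
      \<open>U\<close>, which is estimated through \<open>|S| <= t / 2 + |S|^2 / (2 t)\<close> with
      the optimal \<open>t = sqrt N\<close>.\<close>
    have bound: "real N * (norm (c q))\<^sup>2 \<le> 1" if N: "N > 0" for N :: nat
    proof -
      define S where "S x = (\<Sum>j<N. fchar (Q j) x)" for x
      have ifc: "integrable cube_measure (fchar p)" for p :: "int ^ 'n"
        by (rule C.integrable_const_bound[where B = 1]) (auto simp: measurable_cong_sets[OF sets_cube_measure refl] fchar_measurable)
      have "(\<integral>x. indicator U x *\<^sub>R S x \<partial>cube_measure) = (\<Sum>j<N. c (Q j))"
        unfolding S_def c_def scaleR_sum_right by (rule Bochner_Integration.integral_sum[OF iU])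
      then have Nc: "(\<integral>x. indicator U x *\<^sub>R S x \<partial>cube_measure) = of_nat N * c q" by (simp add: cQ)
      have iS: "integrable cube_measure (\<lambda>x. indicator U x *\<^sub>R S x)"
        unfolding S_def scaleR_sum_right by (rule Bochner_Integration.integrable_sum[OF iU])
      have SS: "complex_of_real ((norm (S x))\<^sup>2) = (\<Sum>i<N. \<Sum>j<N. fchar (Q i - Q j) x)" for x
        unfolding S_def complex_norm_square fchar_diff cnj_sum sum_product ..
      have "integrable cube_measure (\<lambda>x. complex_of_real ((norm (S x))\<^sup>2))"
        unfolding SS by (intro Bochner_Integration.integrable_sum ifc)
      then have i2: "integrable cube_measure (\<lambda>x. (norm (S x))\<^sup>2)" unfolding complex_of_real_integrable_eq .
      have "(\<integral>x. complex_of_real ((norm (S x))\<^sup>2) \<partial>cube_measure) = (\<Sum>i<N. \<Sum>j<N. (\<integral>x. fchar (Q i - Q j) x \<partial>cube_measure))"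
        unfolding SS by (subst Bochner_Integration.integral_sum, intro Bochner_Integration.integrable_sum ifc)
          (intro sum.cong refl Bochner_Integration.integral_sum ifc)
      also have "\<dots> = (\<Sum>i<N. \<Sum>j<N. if i = j then 1 else 0)"
      proof (intro sum.cong refl)
        fix i j
        show "(\<integral>x. fchar (Q i - Q j) x \<partial>cube_measure) = (if i = j then 1 else 0)"
        proof (cases "i = j")
          case True
          then show ?thesis by (simp add: fchar_0[abs_def] measure_cube_measure_UNIV)
        next
          case False
          then show ?thesis using injQ'[of i j] by (simp add: fchar_cube_integral)
        qed
      qed
      also have "\<dots> = of_nat N" by simp
      finally have S2: "(\<integral>x. (norm (S x))\<^sup>2 \<partial>cube_measure) = real N"
        unfolding integral_complex_of_real by (metis of_real_eq_iff of_real_of_nat_eq)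
      define t where "t = sqrt (real N)"
      have t: "t > 0" "t * t = real N" unfolding t_def using N by auto
      have pt: "norm (indicator U x *\<^sub>R S x) \<le> t / 2 + (norm (S x))\<^sup>2 / (2 * t)" for x
      proof -
        have "norm (indicator U x *\<^sub>R S x) \<le> norm (S x)" by (simp add: indicator_def)
        also have "\<dots> \<le> t / 2 + (norm (S x))\<^sup>2 / (2 * t)"
        proof -
          have "0 \<le> (t - norm (S x))\<^sup>2" by simp
          then have "2 * t * norm (S x) \<le> t * t + (norm (S x))\<^sup>2" by (simp add: power2_eq_square algebra_simps)
          then show ?thesis using t(1) by (simp add: field_simps power2_eq_square)
        qed
        finally show ?thesis .
      qed
      have "norm (of_nat N * c q) \<le> (\<integral>x. norm (indicator U x *\<^sub>R S x) \<partial>cube_measure)"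
        unfolding Nc[symmetric] by (rule integral_norm_bound)
      also have "\<dots> \<le> (\<integral>x. t / 2 + (norm (S x))\<^sup>2 / (2 * t) \<partial>cube_measure)"
      proof (rule integral_mono)
        show "integrable cube_measure (\<lambda>x. norm (indicator U x *\<^sub>R S x))" by (rule integrable_norm[OF iS])
        show "integrable cube_measure (\<lambda>x. t / 2 + (norm (S x))\<^sup>2 / (2 * t))" using i2 by simp
      qed (rule pt)
      also have "\<dots> = t / 2 + real N / (2 * t)"
        using i2 by (simp add: S2 measure_cube_measure_UNIV)
      also have "\<dots> = t" using t by (simp add: field_simps)
      finally have "real N * norm (c q) \<le> t" by (simp add: norm_mult)
      then have "(real N * norm (c q))\<^sup>2 \<le> t\<^sup>2" by (intro power_mono) auto
      then have "real N * (real N * (norm (c q))\<^sup>2) \<le> real N * 1" using t(2) by (simp add: power2_eq_square mult_ac)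
      then show ?thesis using N by (subst (asm) mult_le_cancel_left_pos) auto
    qed
    obtain N :: nat where N: "real N > 1 / (norm (c q))\<^sup>2" using reals_Archimedean2 by blast
    have "(norm (c q))\<^sup>2 > 0" using nz by simp
    then have "real N * (norm (c q))\<^sup>2 > 1" "N > 0" using N by (auto simp: field_simps intro!: Nat.gr0I)
    then show False using bound[of N] by linarith
  qed
  \<comment> \<open>The restriction of the cube measure to \<open>U\<close> has no nonconstant
    Fourier coefficients, hence is the cube measure times its mass \<open>m\<close>. Evaluated at
    \<open>U\<close> this reads \<open>m = m * m\<close>.\<close>
  define M where "M = density cube_measure (\<lambda>x. ennreal (indicator U x))"
  have UC: "U \<in> sets cube_measure" using U by simp
  have eM: "emeasure M S = emeasure cube_measure (S \<inter> U)" if "S \<in> sets borel" for S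
    unfolding M_def ennreal_indicator using that UC
    by (subst emeasure_density) (auto simp: indicator_inter_arith[symmetric] Int_commute nn_integral_indicator[symmetric] simp del: nn_integral_indicator)
  define m where "m = measure cube_measure U"
  have mM: "measure M UNIV = m" unfolding m_def measure_def by (simp add: eM)
  have "M = scale_measure (ennreal (measure M UNIV)) cube_measure"
  proof (rule fourier_uniqueness)
    show "finite_measure M" by (rule finite_measureI) (use eM[of UNIV] in \<open>simp add: M_def\<close>)
    show "sets M = sets borel" by (simp add: M_def)
    show "AE x in M. x \<in> unit_cube" unfolding M_def using AE_cube_measure U
      by (subst AE_density) auto
    fix q :: "int ^ 'n" assume q: "q \<noteq> 0"
    have "(\<integral>x. fchar q x \<partial>M) = c q" unfolding M_def c_def
      by (rule integral_density) (use U in \<open>auto simp: measurable_cong_sets[OF sets_cube_measure refl] fchar_measurable\<close>)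
    then show "(\<integral>x. fchar q x \<partial>M) = 0" using c0[OF q] by simp
  qed
  then have "emeasure M U = ennreal m * emeasure cube_measure U" unfolding mM by (metis emeasure_scale_measure)
  then have "ennreal m = ennreal (m * m)"
    using eM[OF U] C.emeasure_eq_measure[of U] unfolding m_def by (simp add: ennreal_mult)
  then have "m = m * m" unfolding m_def by simp
  then have "m = 0 \<or> m = 1" by simp
  then show "emeasure lborel (U \<inter> unit_cube) = 0 \<or> emeasure lborel (unit_cube - U) = 0"
  proof
    assume "m = 0"
    then show ?thesis using C.emeasure_eq_measure[of U] emeasure_cube_measure[OF U] unfolding m_def by simp
  next
    assume "m = 1"
    then have "measure cube_measure (UNIV - U) = 0"
      using C.finite_measure_Diff[of UNIV U] U unfolding m_def by (simp add: measure_cube_measure_UNIV)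
    moreover have "(UNIV - U) \<inter> unit_cube = unit_cube - U" by blast
    ultimately show ?thesis using C.emeasure_eq_measure[of "UNIV - U"] emeasure_cube_measure[of "UNIV - U"] U by auto
  qed
qed

section \<open>Matrices indexed by a finite type\<close>

text \<open>Matrices indexed by a type and matrices of numerical size are both in use. Any
  enumeration of the index type translates between them, so an arbitrary one is chosen.\<close>

definition ix :: "nat \<Rightarrow> 'n :: finite" where
  "ix = (SOME f. bij_betw f {0..<CARD('n)} UNIV)"

lemma bij_ix: "bij_betw (ix :: nat \<Rightarrow> 'n :: finite) {0..<CARD('n)} UNIV"
  unfolding ix_def by (rule someI_ex[OF ex_bij_betw_nat_finite[OF finite]])

lemma sum_ix: "(\<Sum>k\<in>(UNIV :: 'n :: finite set). f k) = (\<Sum>k\<in>{0..<CARD('n)}. f (ix k))"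
  by (rule sum.reindex_bij_betw[OF bij_ix, symmetric])

definition xi :: "'n :: finite \<Rightarrow> nat" where "xi = inv_into {0..<CARD('n)} ix"

lemma ix_xi [simp]: "ix (xi i) = (i :: 'n :: finite)"
  unfolding xi_def by (rule bij_betw_inv_into_right[OF bij_ix]) simp

lemma xi_ix [simp]: "k < CARD('n) \<Longrightarrow> xi (ix k :: 'n :: finite) = k"
  unfolding xi_def by (rule bij_betw_inv_into_left[OF bij_ix]) simp

lemma xi_less [simp]: "xi (i :: 'n :: finite) < CARD('n)"
  using bij_betw_apply[OF bij_betw_inv_into[OF bij_ix], of i] unfolding xi_def by simp

definition jmat :: "'a ^ 'n :: finite ^ 'n \<Rightarrow> 'a mat" where
  "jmat A = mat CARD('n) CARD('n) (\<lambda>(i, j). vec_nth (vec_nth A (ix i)) (ix j))"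

definition jvec :: "'a ^ 'n :: finite \<Rightarrow> 'a Matrix.vec" where
  "jvec v = Matrix.vec CARD('n) (\<lambda>i. vec_nth v (ix i))"

definition hmat :: "'a mat \<Rightarrow> 'a ^ 'n :: finite ^ 'n" where
  "hmat M = vec_lambda (\<lambda>i. vec_lambda (\<lambda>j. M $$ (xi i, xi j)))"

definition hvec :: "'a Matrix.vec \<Rightarrow> 'a ^ 'n :: finite" where
  "hvec v = vec_lambda (\<lambda>i. vec_index v (xi i))"

lemma map_matrix_nth: "vec_nth (vec_nth (map_matrix f A) i) j = f (vec_nth (vec_nth A i) j)"
  by (simp add: map_matrix_def)

lemma map_matrix_inj: "inj f \<Longrightarrow> map_matrix f A = map_matrix f B \<longleftrightarrow> A = B"
  by (auto simp: Finite_Cartesian_Product.vec_eq_iff map_matrix_nth inj_eq)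

lemma jmat_carrier [simp]: "jmat (A :: 'a ^ 'n :: finite ^ 'n) \<in> carrier_mat CARD('n) CARD('n)"
  by (simp add: jmat_def)

lemma jmat_dim [simp]: "dim_row (jmat (A :: 'a ^ 'n :: finite ^ 'n)) = CARD('n)" "dim_col (jmat A) = CARD('n)"
  by (simp_all add: jmat_def)

lemma jvec_carrier [simp]: "jvec (v :: 'a ^ 'n :: finite) \<in> carrier_vec CARD('n)"
  by (simp add: jvec_def)

lemma jmat_hmat [simp]: "M \<in> carrier_mat CARD('n) CARD('n) \<Longrightarrow> jmat (hmat M :: 'a ^ 'n :: finite ^ 'n) = M"
  by (rule eq_matI) (auto simp: jmat_def hmat_def)

lemma jvec_hvec [simp]: "v \<in> carrier_vec CARD('n) \<Longrightarrow> jvec (hvec v :: 'a ^ 'n :: finite) = v"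
  by (rule eq_vecI) (auto simp: jvec_def hvec_def)

lemma hmat_jmat [simp]: "hmat (jmat A) = (A :: 'a ^ 'n :: finite ^ 'n)"
  by (simp add: jmat_def hmat_def Finite_Cartesian_Product.vec_eq_iff)

lemma hvec_jvec [simp]: "hvec (jvec v) = (v :: 'a ^ 'n :: finite)"
  by (simp add: jvec_def hvec_def Finite_Cartesian_Product.vec_eq_iff)

lemma jmat_mult: "jmat (A ** B) = jmat A * jmat (B :: 'a :: semiring_1 ^ 'n :: finite ^ 'n)"
  by (rule eq_matI) (auto simp: jmat_def matrix_matrix_mult_def scalar_prod_def sum_ix)

lemma jmat_one: "jmat (Finite_Cartesian_Product.mat 1 :: 'a :: semiring_1 ^ 'n :: finite ^ 'n) = 1\<^sub>m CARD('n)"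
proof (rule eq_matI)
  fix i j assume "i < dim_row (1\<^sub>m CARD('n) :: 'a mat)" "j < dim_col (1\<^sub>m CARD('n) :: 'a mat)"
  then have ij: "i < CARD('n)" "j < CARD('n)" by auto
  have "(ix i :: 'n) = ix j \<longleftrightarrow> i = j"
    using ij xi_ix[where 'n = 'n] by metis
  then show "jmat (Finite_Cartesian_Product.mat 1 :: 'a ^ 'n ^ 'n) $$ (i, j) = (1\<^sub>m CARD('n) :: 'a mat) $$ (i, j)"
    using ij by (simp add: jmat_def Finite_Cartesian_Product.mat_def)
qed (auto simp: jmat_def)

lemma jvec_mult: "jvec (A *v v) = jmat A *\<^sub>v jvec (v :: 'a :: semiring_1 ^ 'n :: finite)"
  by (rule eq_vecI) (auto simp: jmat_def jvec_def matrix_vector_mult_def scalar_prod_def sum_ix)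

lemma jmat_transpose: "jmat (Finite_Cartesian_Product.transpose A) = transpose_mat (jmat (A :: 'a ^ 'n :: finite ^ 'n))"
  by (rule eq_matI) (auto simp: jmat_def Finite_Cartesian_Product.transpose_def)

lemma jmat_map: "jmat (map_matrix f A) = map_mat f (jmat (A :: 'a ^ 'n :: finite ^ 'n))"
  by (rule eq_matI) (auto simp: jmat_def map_matrix_def)

lemma jvec_smult: "jvec (z *s v) = z \<cdot>\<^sub>v jvec (v :: 'a :: semiring_1 ^ 'n :: finite)"
  by (rule eq_vecI) (auto simp: jvec_def)

lemma jvec_inj: "jvec v = jvec w \<longleftrightarrow> v = (w :: 'a ^ 'n :: finite)"
  by (metis hvec_jvec)

lemma jmat_inj: "jmat v = jmat w \<longleftrightarrow> v = (w :: 'a ^ 'n :: finite ^ 'n)"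
  by (metis hmat_jmat)

lemma jvec_0: "jvec (0 :: 'a :: zero ^ 'n :: finite) = 0\<^sub>v CARD('n)"
  by (rule eq_vecI) (auto simp: jvec_def)

section \<open>The group of integer matrices of determinant plus or minus one\<close>

lemma det_mat_1_int: "Determinants.det (Finite_Cartesian_Product.mat 1 :: int ^ 'n :: finite ^ 'n) = 1"
  by (rule det_I)

lemma monoid_GL_int: "monoid (GL_int :: (int ^ 'n :: finite ^ 'n) monoid)"
  by (rule monoidI) (auto simp: GL_int_def det_mul det_mat_1_int matrix_mul_assoc)

lemma GL_int_simps [simp]:
  "mult GL_int A B = A ** B" "one GL_int = Finite_Cartesian_Product.mat 1"
  "A \<in> carrier GL_int \<longleftrightarrow> Determinants.det A = 1 \<or> Determinants.det A = -1"
  by (simp_all add: GL_int_def)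

text \<open>For the image of the neutral element: \<open>GL_int\<close> is treated as a monoid,
  where a multiplicative map need not preserve the unit. The idempotent is cancelled over the reals,
  where it is invertible.\<close>

lemma idempotent_GL_int:
  fixes A :: "int ^ 'n :: finite ^ 'n"
  assumes "A ** A = A" "Determinants.det A = 1 \<or> Determinants.det A = -1"
  shows "A = Finite_Cartesian_Product.mat 1"
proof -
  let ?r = "map_matrix real_of_int :: int ^ 'n ^ 'n \<Rightarrow> real ^ 'n ^ 'n"
  have mm: "?r (X ** Y) = ?r X ** ?r Y" for X Y
    by (simp add: map_matrix_def matrix_matrix_mult_def Finite_Cartesian_Product.vec_eq_iff)
  have "Determinants.det (?r A) = of_int (Determinants.det A)"
    unfolding Determinants.det_def by (simp add: map_matrix_def)
  then have "Determinants.det (?r A) \<noteq> 0" using assms(2) by auto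
  then obtain B where B: "B ** ?r A = Finite_Cartesian_Product.mat 1"
    using invertible_det_nz[of "?r A"] unfolding invertible_def by blast
  have "?r A = B ** (?r A ** ?r A)" using B by (simp add: matrix_mul_assoc)
  also have "\<dots> = Finite_Cartesian_Product.mat 1" using B mm[of A A] assms(1) by simp
  also have "\<dots> = ?r (Finite_Cartesian_Product.mat 1)"
    by (simp add: map_matrix_def Finite_Cartesian_Product.mat_def Finite_Cartesian_Product.vec_eq_iff)
  finally show ?thesis by (subst (asm) map_matrix_inj) (auto intro: injI)
qed

lemma toral_action_one:
  assumes "toral_action H \<rho>"
  shows "\<rho> \<one>\<^bsub>H\<^esub> = Finite_Cartesian_Product.mat 1"
proof -
  interpret group H using assms by (simp add: toral_action_def)
  have hm: "\<rho> (x \<otimes>\<^bsub>H\<^esub> y) = \<rho> x ** \<rho> y" "\<rho> x \<in> carrier GL_int" if "x \<in> carrier H" "y \<in> carrier H" for x y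
    using assms that unfolding toral_action_def hom_def by auto
  show ?thesis
    by (rule idempotent_GL_int) (use hm[of "\<one>\<^bsub>H\<^esub>" "\<one>\<^bsub>H\<^esub>"] in auto)
qed

lemma toral_action_int_pow:
  assumes act: "toral_action H \<rho>" and x: "x \<in> carrier H"
  shows "\<rho> (x [^]\<^bsub>H\<^esub> (k :: int)) = \<rho> x [^]\<^bsub>GL_int\<^esub> k"
proof -
  interpret group H using act by (simp add: toral_action_def)
  interpret M: monoid GL_int by (rule monoid_GL_int)
  have hm: "\<rho> (x \<otimes>\<^bsub>H\<^esub> y) = \<rho> x ** \<rho> y" and hc: "\<rho> x \<in> carrier GL_int" if "x \<in> carrier H" "y \<in> carrier H" for x y
    using act that unfolding toral_action_def hom_def by auto
  note o = toral_action_one[OF act]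
  have np: "\<rho> (x [^]\<^bsub>H\<^esub> m) = \<rho> x [^]\<^bsub>GL_int\<^esub> m" for m :: nat
    by (induction m) (use x in \<open>auto simp: o hm\<close>)
  have iv: "\<rho> (inv\<^bsub>H\<^esub> y) = inv\<^bsub>GL_int\<^esub> (\<rho> y)" if y: "y \<in> carrier H" for y
  proof (rule M.inv_unique'[of "\<rho> y" "\<rho> (inv\<^bsub>H\<^esub> y)"])
    show "\<rho> y \<in> carrier GL_int" "\<rho> (inv\<^bsub>H\<^esub> y) \<in> carrier GL_int" using hc y by auto
    show "\<rho> y \<otimes>\<^bsub>GL_int\<^esub> \<rho> (inv\<^bsub>H\<^esub> y) = \<one>\<^bsub>GL_int\<^esub>" using hm[of y "inv\<^bsub>H\<^esub> y"] y o by simp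
    show "\<rho> (inv\<^bsub>H\<^esub> y) \<otimes>\<^bsub>GL_int\<^esub> \<rho> y = \<one>\<^bsub>GL_int\<^esub>" using hm[of "inv\<^bsub>H\<^esub> y" y] y o by simp
  qed
  show ?thesis
  proof (cases k rule: int_cases2)
    case (nonneg m)
    then show ?thesis using np by (simp add: int_pow_int)
  next
    case (nonpos m)
    have i: "\<rho> (inv\<^bsub>H\<^esub> (x [^]\<^bsub>H\<^esub> m)) = inv\<^bsub>GL_int\<^esub> (\<rho> x [^]\<^bsub>GL_int\<^esub> m)"
      using iv[of "x [^]\<^bsub>H\<^esub> m"] np[of m] x by simp
    show ?thesis
    proof (cases "m = 0")
      case True
      then show ?thesis unfolding nonpos by (simp add: o int_pow_def2)
    next
      case False
      then show ?thesis unfolding nonpos using i by (simp add: int_pow_def2)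
    qed
  qed
qed

section \<open>Nonexistence\<close>

lemma common_denominator:
  fixes F :: "rat set"
  assumes "finite F"
  shows "\<exists>D :: int. D > 0 \<and> (\<forall>x\<in>F. \<exists>k :: int. of_int D * x = of_int k)"
  using assms
proof (induction F rule: finite_induct)
  case empty
  then show ?case by (intro exI[of _ 1]) auto
next
  case (insert x F)
  then obtain D :: int where D: "D > 0" "\<forall>x\<in>F. \<exists>k :: int. of_int D * x = of_int k" by blast
  obtain p q where q: "quotient_of x = (p, q)" by (cases "quotient_of x")
  have q0: "q > 0" and x: "x = of_int p / of_int q"
    using quotient_of_denom_pos[OF q] quotient_of_div[OF q] by auto
  have h: "\<exists>k :: int. of_int (D * q) * y = of_int k" if yx: "y \<in> insert x F" for y
  proof (cases "y = x")
    case True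
    then have "of_int (D * q) * y = of_int (D * p)" using x q0 by simp
    then show ?thesis by blast
  next
    case False
    then obtain k :: int where "of_int D * y = of_int k" using yx D(2) by blast
    then have "of_int (D * q) * y = of_int (q * k)" by simp
    then show ?thesis by blast
  qed
  show ?case
  proof (rule exI[of _ "D * q"], intro conjI ballI)
    show "D * q > 0" using D(1) q0 by simp
  qed (rule h)
qed

text \<open>The vector is multiplied by a common denominator of its entries.\<close>

lemma rat_fixed_vector_int:
  fixes A :: "int ^ 'n :: finite ^ 'n" and v :: "rat ^ 'n"
  assumes "map_matrix of_int A *v v = v" "v \<noteq> 0"
  shows "\<exists>q. q \<noteq> 0 \<and> A *v q = q"
proof -
  obtain D :: int where D: "D > 0" "\<forall>x\<in>range (vec_nth v). \<exists>k :: int. of_int D * x = of_int k"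
    using common_denominator[of "range (vec_nth v)"] by auto
  then have "\<forall>i. \<exists>k :: int. of_int D * vec_nth v i = of_int k" by blast
  then obtain f where f: "\<And>i. of_int D * vec_nth v i = of_int (f i)" by metis
  define q where "q = vec_lambda f"
  obtain i where i: "vec_nth v i \<noteq> 0" using assms(2) by (auto simp: Finite_Cartesian_Product.vec_eq_iff)
  then have "f i \<noteq> 0" using f[of i] D(1) by auto
  then have "q \<noteq> 0" unfolding q_def by (auto simp: Finite_Cartesian_Product.vec_eq_iff)
  moreover have "A *v q = q"
  proof -
    have "rat_of_int (\<Sum>j\<in>UNIV. vec_nth (vec_nth A i) j * f j) = of_int (f i)" for i
    proof -
      have "rat_of_int (\<Sum>j\<in>UNIV. vec_nth (vec_nth A i) j * f j) =
          (\<Sum>j\<in>UNIV. of_int (vec_nth (vec_nth A i) j) * (of_int D * vec_nth v j))"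
        by (simp add: f)
      also have "\<dots> = of_int D * vec_nth (map_matrix of_int A *v v) i"
        by (simp add: matrix_vector_mult_def map_matrix_def sum_distrib_left mult_ac)
      finally show ?thesis unfolding assms(1) f .
    qed
    then show ?thesis unfolding q_def matrix_vector_mult_def
      by (simp add: Finite_Cartesian_Product.vec_eq_iff del: of_int_sum of_int_mult)
  qed
  ultimately show ?thesis by blast
qed

lemma hyperbolic_mat_char_poly:
  fixes A :: "int ^ 'n :: finite ^ 'n"
  assumes "\<not> hyperbolic_mat A"
  shows "\<exists>z. norm z = 1 \<and> poly (rat_poly (char_poly (map_mat of_int (jmat A)))) z = 0"
proof -
  obtain z and v :: "complex ^ 'n" where z: "norm z = 1" "v \<noteq> 0" "map_matrix of_int A *v v = z *s v"
    using assms unfolding hyperbolic_mat_def int_mat_eigenvalue_def by auto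
  let ?C = "map_mat of_int (jmat A) :: complex mat"
  have C: "?C \<in> carrier_mat CARD('n) CARD('n)" by simp
  have "?C *\<^sub>v jvec v = z \<cdot>\<^sub>v jvec v"
    using arg_cong[OF z(3), of jvec] by (simp add: jvec_mult jmat_map jvec_smult)
  moreover have "jvec v \<noteq> 0\<^sub>v CARD('n)" using z(2) jvec_inj[of v 0] by (simp add: jvec_0)
  ultimately have "eigenvector ?C (jvec v) z" unfolding eigenvector_def by simp
  then have "eigenvalue ?C z" unfolding eigenvalue_def by blast
  then have "poly (char_poly ?C) z = 0" using eigenvalue_root_char_poly[OF C] by simp
  moreover have "?C = map_mat of_rat (map_mat of_int (jmat A))" by (rule eq_matI) auto
  then have "char_poly ?C = rat_poly (char_poly (map_mat of_int (jmat A)))"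
    by (simp only: of_rat_hom.char_poly_hom[of "map_mat of_int (jmat A)" "CARD('n)"] map_carrier_mat jmat_carrier)
  ultimately have "poly (rat_poly (char_poly (map_mat of_int (jmat A)))) z = 0" by simp
  then show ?thesis using z(1) by blast
qed

text \<open>The image of a singular matrix \<open>X\<close> of the commutant is spanned by the
  rational columns of \<open>X\<close> and is invariant, so irreducibility makes it zero or
  everything. The first is excluded by \<open>X\<close> being nonzero, the second by its
  kernel.\<close>

lemma irreducible_action_schur:
  fixes \<rho> :: "'h \<Rightarrow> int ^ 'n :: finite ^ 'n"
  assumes irr: "irreducible_action H \<rho>"
  shows "schur_set CARD('n) ((\<lambda>x. map_mat of_int (jmat (\<rho> x)) :: rat mat) ` carrier H)"
  unfolding schur_set_def
proof (intro ballI impI)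
  fix X :: "rat mat" assume X: "X \<in> carrier_mat CARD('n) CARD('n)"
    and comm: "\<forall>Y\<in>(\<lambda>x. map_mat of_int (jmat (\<rho> x)) :: rat mat) ` carrier H. X * Y = Y * X"
  show "X = 0\<^sub>m CARD('n) CARD('n) \<or> Determinant.det X \<noteq> 0"
  proof (rule ccontr)
    assume "\<not> (X = 0\<^sub>m CARD('n) CARD('n) \<or> Determinant.det X \<noteq> 0)"
    then have X0: "X \<noteq> 0\<^sub>m CARD('n) CARD('n)" and dX: "Determinant.det X = 0" by auto
    define Xq :: "rat ^ 'n ^ 'n" where "Xq = hmat X"
    define Xr :: "real ^ 'n ^ 'n" where "Xr = map_matrix of_rat Xq"
    define V where "V = range (\<lambda>x. Xr *v x)"
    have mm: "map_matrix of_rat (P ** Q) = (map_matrix of_rat P ** map_matrix of_rat Q :: real ^ 'n ^ 'n)" for P Q :: "rat ^ 'n ^ 'n"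
      by (simp add: map_matrix_def matrix_matrix_mult_def Finite_Cartesian_Product.vec_eq_iff of_rat_sum of_rat_mult)
    have "rational_subspace V" unfolding rational_subspace_def
    proof (intro exI[of _ "columns Xr"] conjI ballI allI)
      fix v i assume "v \<in> columns Xr"
      then show "vec_nth v i \<in> \<rat>" unfolding columns_def column_def Xr_def map_matrix_def by auto
    next
      show "V = Real_Vector_Spaces.span (columns Xr)"
      proof (intro equalityI subsetI)
        fix v assume "v \<in> V"
        then obtain x where v: "v = Xr *v x" unfolding V_def by blast
        show "v \<in> Real_Vector_Spaces.span (columns Xr)" unfolding v matrix_mult_sum
          unfolding scalar_mult_eq_scaleR
          by (intro span_sum span_scale span_base) (auto simp: columns_def)
      next
        fix v assume v: "v \<in> Real_Vector_Spaces.span (columns Xr)"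
        have sV: "subspace V" unfolding V_def
          by (rule linear_subspace_image[OF matrix_vector_mul_linear subspace_UNIV])
        have "columns Xr \<subseteq> V"
        proof
          fix u assume "u \<in> columns Xr"
          then obtain i where "u = column i Xr" unfolding columns_def by blast
          then have "u = Xr *v axis i 1" by (simp add: matrix_vector_mult_basis)
          then show "u \<in> V" unfolding V_def by blast
        qed
        then show "v \<in> V" using span_minimal[OF _ sV] v by blast
      qed
    qed
    moreover have "(\<lambda>x. map_matrix of_int (\<rho> h) *v x) ` V \<subseteq> V" if h: "h \<in> carrier H" for h
    proof -
      let ?q = "map_matrix of_int (\<rho> h) :: rat ^ 'n ^ 'n"
      have "jmat (Xq ** ?q) = jmat (?q ** Xq)"
        using comm h X unfolding Xq_def by (simp add: jmat_mult jmat_map)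
      then have "Xq ** ?q = ?q ** Xq" by (simp add: jmat_inj)
      then have "map_matrix of_rat (Xq ** ?q) = (map_matrix of_rat (?q ** Xq) :: real ^ 'n ^ 'n)" by simp
      moreover have "map_matrix of_rat ?q = (map_matrix of_int (\<rho> h) :: real ^ 'n ^ 'n)"
        by (simp add: map_matrix_def Finite_Cartesian_Product.vec_eq_iff)
      ultimately have "map_matrix of_int (\<rho> h) ** Xr = Xr ** map_matrix of_int (\<rho> h)"
        unfolding mm Xr_def by simp
      then have "map_matrix of_int (\<rho> h) *v (Xr *v x) = Xr *v (map_matrix of_int (\<rho> h) *v x)" for x
        by (simp add: matrix_vector_mul_assoc)
      then show ?thesis unfolding V_def by auto
    qed
    ultimately have "V = {0} \<or> V = UNIV" using irr unfolding irreducible_action_def by blast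
    then show False
    proof
      assume "V = {0}"
      then have "Xr *v x = 0" for x unfolding V_def by blast
      then have "Xr = 0" by (simp add: matrix_eq)
      then have "Xq = 0" unfolding Xr_def by (simp add: map_matrix_def Finite_Cartesian_Product.vec_eq_iff)
      then have "jmat Xq = 0\<^sub>m CARD('n) CARD('n)" by (intro eq_matI) (auto simp: jmat_def)
      then show False using X0 X unfolding Xq_def by simp
    next
      assume "V = UNIV"
      then have "surj (\<lambda>x. Xr *v x)" unfolding V_def by simp
      then have inj: "inj (\<lambda>x. Xr *v x)" 
        using matrix_right_invertible_surjective matrix_left_right_inverse matrix_left_invertible_injective by metis
      obtain v where v: "v \<in> carrier_vec CARD('n)" "v \<noteq> 0\<^sub>v CARD('n)" "X *\<^sub>v v = 0\<^sub>v CARD('n)"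
        using det_0_iff_vec_prod_zero[OF X] dX by blast
      define w :: "rat ^ 'n" where "w = hvec v"
      define wr :: "real ^ 'n" where "wr = vec_lambda (\<lambda>i. of_rat (vec_nth w i))"
      have "jvec (Xq *v w) = jvec (0 :: rat ^ 'n)" using v X unfolding Xq_def w_def by (simp add: jvec_mult jvec_0)
      then have Xw: "Xq *v w = 0" by (simp add: jvec_inj)
      have "Xr *v wr = vec_lambda (\<lambda>i. of_rat (vec_nth (Xq *v w) i))"
        unfolding Xr_def wr_def
        by (simp add: map_matrix_def matrix_vector_mult_def Finite_Cartesian_Product.vec_eq_iff of_rat_sum of_rat_mult)
      then have "Xr *v wr = Xr *v 0" unfolding Xw by (simp add: Finite_Cartesian_Product.vec_eq_iff)
      then have "wr = 0" using inj unfolding inj_def by blast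
      then have "w = 0" unfolding wr_def by (simp add: Finite_Cartesian_Product.vec_eq_iff)
      then have "jvec w = 0\<^sub>v CARD('n)" by (simp add: jvec_0)
      then show False using v unfolding w_def by simp
    qed
  qed
qed

theorem gph_action_dimension:
  fixes \<rho> :: "'h \<Rightarrow> int ^ 'n :: finite ^ 'n"
  assumes gph: "gph_higher_rank_nilpotent_action H \<rho>"
  shows "CARD('n) \<ge> 6" "CARD('n) \<noteq> 7" "irreducible_action H \<rho> \<Longrightarrow> even CARD('n)"
proof -
  have act: "toral_action H \<rho>" and nil: "nilpotent_group H"
    and nh: "\<And>h. h \<in> carrier H \<Longrightarrow> \<not> hyperbolic_mat (\<rho> h)" and hr: "higher_rank H \<rho>"
    using gph unfolding gph_higher_rank_nilpotent_action_def genuinely_partially_hyperbolic_def by auto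
  interpret group H using act by (simp add: toral_action_def)
  obtain l where l: "lower_central H l = {\<one>\<^bsub>H\<^esub>}" using nil unfolding nilpotent_group_def by blast
  have hm: "\<rho> (x \<otimes>\<^bsub>H\<^esub> y) = \<rho> x ** \<rho> y" if "x \<in> carrier H" "y \<in> carrier H" for x y
    using act that unfolding toral_action_def hom_def by auto
  obtain a b where ab: "a \<in> carrier H" "b \<in> carrier H"
    "\<And>(k1 :: int) (k2 :: int). (k1, k2) \<noteq> (0, 0) \<Longrightarrow>
        ergodic_mat ((\<rho> a [^]\<^bsub>GL_int\<^esub> k1) \<otimes>\<^bsub>GL_int\<^esub> (\<rho> b [^]\<^bsub>GL_int\<^esub> k2))"
    using hr unfolding higher_rank_def by blast
  define R where "R = (\<lambda>x. map_mat of_int (jmat (\<rho> x)) :: rat mat)"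
  have Rc: "R x \<in> carrier_mat CARD('n) CARD('n)" for x unfolding R_def by simp
  interpret int_nilpotent_rep H R "CARD('n)" l a b
  proof unfold_locales
    fix x assume x: "x \<in> carrier H"
    show "R x \<in> carrier_mat CARD('n) CARD('n)" by (rule Rc)
    show "\<exists>M :: int mat. R x = map_mat of_int M" unfolding R_def by blast
    show "\<exists>z. norm z = 1 \<and> poly (rat_poly (char_poly (R x))) z = 0"
      unfolding R_def by (rule hyperbolic_mat_char_poly[OF nh[OF x]])
    fix y assume y: "y \<in> carrier H"
    show "R (x \<otimes>\<^bsub>H\<^esub> y) = R x * R y" unfolding R_def hm[OF x y] jmat_mult
      by (rule of_int_hom.mat_hom_mult[OF jmat_carrier jmat_carrier])
  next
    show "R \<one>\<^bsub>H\<^esub> = 1\<^sub>m CARD('n)"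
      unfolding R_def toral_action_one[OF act] jmat_one by (rule of_int_hom.mat_hom_one)
  next
    fix k m :: int assume km: "(k, m) \<noteq> (0, 0)"
    let ?x = "a [^]\<^bsub>H\<^esub> k \<otimes>\<^bsub>H\<^esub> b [^]\<^bsub>H\<^esub> m"
    have "\<rho> ?x = (\<rho> a [^]\<^bsub>GL_int\<^esub> k) \<otimes>\<^bsub>GL_int\<^esub> (\<rho> b [^]\<^bsub>GL_int\<^esub> m)"
      using ab(1,2) by (simp add: hm toral_action_int_pow[OF act])
    then have erg: "ergodic_mat (\<rho> ?x)" using ab(3)[OF km] by simp
    show "poly (char_poly (R ?x)) 1 \<noteq> 0"
    proof
      assume z: "poly (char_poly (R ?x)) 1 = 0"
      \<comment> \<open>The transposed matrix shares the eigenvalue 1, which gives a rational fixed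
        covector and after scaling an integral one; this contradicts ergodicity.\<close>
      let ?T = "transpose_mat (R ?x)"
      have T: "?T \<in> carrier_mat CARD('n) CARD('n)" using Rc by simp
      have "poly (char_poly ?T) 1 = 0" using z char_poly_transpose_mat[OF Rc] by simp
      then have "eigenvalue ?T 1" using eigenvalue_root_char_poly[OF T] by simp
      then obtain v where v: "v \<in> carrier_vec CARD('n)" "v \<noteq> 0\<^sub>v CARD('n)" "?T *\<^sub>v v = 1 \<cdot>\<^sub>v v"
        using T unfolding eigenvalue_def eigenvector_def by auto
      let ?A = "Finite_Cartesian_Product.transpose (\<rho> ?x)"
      have "jmat (map_matrix of_int ?A) = ?T"
        unfolding jmat_map jmat_transpose R_def by (rule eq_matI) auto
      then have "jvec (map_matrix of_int ?A *v hvec v) = jvec (hvec v :: rat ^ 'n)"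
        using v unfolding jvec_mult by simp
      then have "map_matrix of_int ?A *v (hvec v :: rat ^ 'n) = hvec v" by (simp add: jvec_inj)
      moreover have "(hvec v :: rat ^ 'n) \<noteq> 0" using v jvec_hvec[OF v(1)] jvec_0 by metis
      ultimately obtain q where q: "q \<noteq> 0" "?A *v q = q" using rat_fixed_vector_int by blast
      have xG: "?x \<in> carrier H" using ab(1,2) by simp
      have "\<rho> ?x ** \<rho> (inv\<^bsub>H\<^esub> ?x) = Finite_Cartesian_Product.mat 1" "\<rho> (inv\<^bsub>H\<^esub> ?x) ** \<rho> ?x = Finite_Cartesian_Product.mat 1"
        using hm[OF xG inv_closed[OF xG]] hm[OF inv_closed[OF xG] xG] r_inv[OF xG] l_inv[OF xG] toral_action_one[OF act] by simp_all
      from ergodic_mat_no_fixed_covector[OF this erg q(2)] show False using q(1) by contradiction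
    qed
  qed (use l ab in auto)
  show "CARD('n) \<ge> 6" "CARD('n) \<noteq> 7" by (rule neutral_dimension)+
  show "even CARD('n)" if "irreducible_action H \<rho>"
    by (rule neutral_dimension(3)) (use irreducible_action_schur[OF that] in \<open>simp add: R_def\<close>)
qed

section \<open>Companion matrices and units\<close>

text \<open>Oriented so that \<open>(1, z, z^2, ...)\<close> is an eigenvector for every root
  \<open>z\<close> of \<open>P\<close>: the rows shift the coordinates by one place, and the last
  row expresses the leading power.\<close>

definition companion :: "int poly \<Rightarrow> int mat" where
  "companion P = mat (degree P) (degree P)
     (\<lambda>(i, j). if Suc i < degree P then (if j = Suc i then 1 else 0) else - Polynomial.coeff P j)"

lemma companion_carrier: "companion P \<in> carrier_mat (degree P) (degree P)"
  by (simp add: companion_def)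

lemma companion_mult_vec:
  assumes v: "v \<in> carrier_vec (degree P)" and i: "i < degree P"
  shows "vec_index (companion P *\<^sub>v v) i = (if Suc i < degree P then vec_index v (Suc i)
     else - (\<Sum>j<degree P. Polynomial.coeff P j * vec_index v j))"
proof (cases "Suc i < degree P")
  case True
  have "vec_index (companion P *\<^sub>v v) i = (\<Sum>j\<in>{0..<degree P}. (if j = Suc i then 1 else 0) * vec_index v j)"
    using i v True by (auto simp: companion_def scalar_prod_def intro!: sum.cong)
  also have "\<dots> = (\<Sum>j\<in>{0..<degree P}. if j = Suc i then vec_index v j else 0)"
    by (intro sum.cong) auto
  finally show ?thesis using True by simp
next
  case False
  have "vec_index (companion P *\<^sub>v v) i = (\<Sum>j\<in>{0..<degree P}. - Polynomial.coeff P j * vec_index v j)"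
    using i v False by (auto simp: companion_def scalar_prod_def intro!: sum.cong)
  then show ?thesis using False by (simp add: sum_negf atLeast0LessThan)
qed

text \<open>Each application of the companion matrix \<open>C\<close> moves the next coordinate into
  position 0, so \<open>C^j v\<close> has the first coordinate \<open>v_j\<close> as long as
  \<open>j\<close> is below the degree of \<open>P\<close>.\<close>

lemma companion_poly_0:
  assumes "v \<in> carrier_vec (degree P)" "degree p < degree P"
  shows "vec_index (mat_of_poly (degree P) (companion P) p *\<^sub>v v) 0 = (\<Sum>j<degree P. Polynomial.coeff p j * vec_index v j)"
  using assms
proof (induction p arbitrary: v)
  case 0
  then show ?case by (simp add: mat_of_poly_0[OF companion_carrier] scalar_prod_def)
next
  case (pCons a p)
  let ?n = "degree P" and ?C = "companion P"
  note C = companion_carrier[of P]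
  have n: "0 < ?n" using pCons.prems by simp
  have Cv: "?C *\<^sub>v v \<in> carrier_vec ?n" using C pCons.prems(1) by simp
  have e: "mat_of_poly ?n ?C (pCons a p) *\<^sub>v v = a \<cdot>\<^sub>v v + mat_of_poly ?n ?C p *\<^sub>v (?C *\<^sub>v v)"
  proof -
    have "mat_of_poly ?n ?C (pCons a p) *\<^sub>v v = (a \<cdot>\<^sub>m 1\<^sub>m ?n) *\<^sub>v v + (?C * mat_of_poly ?n ?C p) *\<^sub>v v"
      unfolding mat_of_poly_pCons[OF C]
      by (rule add_mult_distrib_mat_vec[of _ ?n ?n]) (use C pCons.prems(1) mat_of_poly_dim[OF C] in \<open>auto intro!: mult_carrier_dim\<close>)
    also have "(a \<cdot>\<^sub>m 1\<^sub>m ?n) *\<^sub>v v = a \<cdot>\<^sub>v v"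
      using pCons.prems(1) by (intro eq_vecI) (auto simp: scalar_prod_def if_distrib if_distribR sum.delta cong: if_cong)
    also have "?C * mat_of_poly ?n ?C p = mat_of_poly ?n ?C p * ?C" by (rule mat_of_poly_commute[OF C C refl, symmetric])
    also have "(mat_of_poly ?n ?C p * ?C) *\<^sub>v v = mat_of_poly ?n ?C p *\<^sub>v (?C *\<^sub>v v)"
      by (rule assoc_mult_mat_vec[OF mat_of_poly_closed[OF C] C pCons.prems(1)])
    finally show ?thesis .
  qed
  have "vec_index (mat_of_poly ?n ?C (pCons a p) *\<^sub>v v) 0 = a * vec_index v 0 + vec_index (mat_of_poly ?n ?C p *\<^sub>v (?C *\<^sub>v v)) 0"
    unfolding e using n pCons.prems(1) mat_of_poly_dim[OF C] by simp
  also have "vec_index (mat_of_poly ?n ?C p *\<^sub>v (?C *\<^sub>v v)) 0 = (\<Sum>j<?n. Polynomial.coeff p j * vec_index (?C *\<^sub>v v) j)"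
    by (rule pCons.IH[OF Cv]) (use pCons.prems(2) in \<open>auto split: if_splits\<close>)
  also have "\<dots> = (\<Sum>j<?n - 1. Polynomial.coeff p j * vec_index v (Suc j))"
  proof -
    have z: "Polynomial.coeff p (?n - 1) = 0"
    proof (cases "p = 0")
      case False
      then have "degree p < ?n - 1" using pCons.prems(2) by simp
      then show ?thesis by (rule coeff_eq_0)
    qed simp
    have "(\<Sum>j<?n. Polynomial.coeff p j * vec_index (?C *\<^sub>v v) j) = (\<Sum>j<Suc (?n - 1). Polynomial.coeff p j * vec_index (?C *\<^sub>v v) j)"
      using n by simp
    also have "\<dots> = (\<Sum>j<?n - 1. Polynomial.coeff p j * vec_index (?C *\<^sub>v v) j)" using z by simp
    also have "\<dots> = (\<Sum>j<?n - 1. Polynomial.coeff p j * vec_index v (Suc j))"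
      by (intro sum.cong refl) (simp add: companion_mult_vec[OF pCons.prems(1)])
    finally show ?thesis .
  qed
  also have "a * vec_index v 0 + \<dots> = (\<Sum>j<Suc (?n - 1). Polynomial.coeff (pCons a p) j * vec_index v j)"
    by (subst sum.lessThan_Suc_shift) simp
  finally show ?case using n by simp
qed

text \<open>Coordinate 0 of \<open>P(C) v\<close> vanishes by the last row of \<open>C\<close>.
  Coordinate \<open>i + 1\<close> of a vector \<open>w\<close> is coordinate \<open>i\<close> of
  \<open>C w\<close>, and \<open>C\<close> commutes with \<open>P(C)\<close>, so the other
  coordinates follow by induction.\<close>

lemma companion_annihilates:
  assumes P: "monic P" and n: "degree P > 0"
  shows "mat_of_poly (degree P) (companion P) P = 0\<^sub>m (degree P) (degree P)"
proof -
  let ?n = "degree P" and ?C = "companion P"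
  let ?ev = "\<lambda>p. mat_of_poly ?n ?C p"
  note C = companion_carrier[of P]
  have mc: "?ev p \<in> carrier_mat ?n ?n" for p by (rule mat_of_poly_closed[OF C])
  have X: "?ev [:0, 1:] = ?C"
    using C mat_of_poly_1[OF C] by (auto simp: mat_of_poly_pCons[OF C] mat_of_poly_0[OF C] one_pCons[symmetric])
  have mv: "?ev (p * q) *\<^sub>v v = ?ev p *\<^sub>v (?ev q *\<^sub>v v)" if "v \<in> carrier_vec ?n" for p q v
    unfolding mat_of_poly_mult[OF C] by (rule assoc_mult_mat_vec[OF mc mc that])
  have z0: "vec_index (?ev P *\<^sub>v v) 0 = 0" if v: "v \<in> carrier_vec ?n" for v
  proof -
    \<comment> \<open>\<open>companion_poly_0\<close> requires degree below \<open>degree P\<close>.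
      The leading monomial is therefore split off and written as a lower monomial times
      \<open>X\<close>, with \<open>X\<close> applied to \<open>v\<close> first.\<close>
    define q where "q = P - Polynomial.monom 1 ?n"
    have coeff_q: "Polynomial.coeff q j = (if j = ?n then 0 else Polynomial.coeff P j)" for j
      unfolding q_def using P by simp
    have dq: "degree q < ?n"
    proof -
      have "degree q \<le> ?n" unfolding q_def by (rule degree_diff_le) (simp_all add: degree_monom_eq)
      moreover have "degree q \<noteq> ?n"
        using coeff_q[of ?n] n by (metis degree_0 leading_coeff_0_iff less_irrefl)
      ultimately show ?thesis by simp
    qed
    have m: "Polynomial.monom 1 ?n = Polynomial.monom 1 (?n - 1) * [:0, 1 :: int:]"
      using n by (simp add: monom_altdef power_Suc[symmetric] mult.commute del: power_Suc)
    have Pq: "P = q + Polynomial.monom 1 (?n - 1) * [:0, 1:]" unfolding q_def m by simp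
    have Cv: "?C *\<^sub>v v \<in> carrier_vec ?n" using C v by simp
    have "?ev P *\<^sub>v v = ?ev q *\<^sub>v v + ?ev (Polynomial.monom 1 (?n - 1) * [:0, 1:]) *\<^sub>v v"
      by (subst Pq, subst mat_of_poly_add[OF C]) (rule add_mult_distrib_mat_vec[OF mc mc v])
    also have "?ev (Polynomial.monom 1 (?n - 1) * [:0, 1:]) *\<^sub>v v = ?ev (Polynomial.monom 1 (?n - 1)) *\<^sub>v (?C *\<^sub>v v)"
      unfolding mv[OF v] X ..
    finally have "vec_index (?ev P *\<^sub>v v) 0 = vec_index (?ev q *\<^sub>v v) 0 + vec_index (?ev (Polynomial.monom 1 (?n - 1)) *\<^sub>v (?C *\<^sub>v v)) 0"
      using n mat_of_poly_dim[OF C] by simp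
    also have "vec_index (?ev q *\<^sub>v v) 0 = (\<Sum>j<?n. Polynomial.coeff q j * vec_index v j)"
      by (rule companion_poly_0[OF v dq])
    also have "\<dots> = (\<Sum>j<?n. Polynomial.coeff P j * vec_index v j)" by (intro sum.cong) (auto simp: coeff_q)
    also have "vec_index (?ev (Polynomial.monom 1 (?n - 1)) *\<^sub>v (?C *\<^sub>v v)) 0 = (\<Sum>j<?n. Polynomial.coeff (Polynomial.monom 1 (?n - 1)) j * vec_index (?C *\<^sub>v v) j)"
      by (rule companion_poly_0[OF Cv]) (use n in \<open>simp add: degree_monom_eq\<close>)
    also have "\<dots> = (\<Sum>j<?n. if j = ?n - 1 then vec_index (?C *\<^sub>v v) j else 0)" by (intro sum.cong) auto
    also have "\<dots> = vec_index (?C *\<^sub>v v) (?n - 1)" using n by simp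
    also have "\<dots> = - (\<Sum>j<?n. Polynomial.coeff P j * vec_index v j)" using n by (simp add: companion_mult_vec[OF v])
    finally show ?thesis by simp
  qed
  have zi: "vec_index (?ev P *\<^sub>v v) i = 0" if "i < ?n" "v \<in> carrier_vec ?n" for i v
    using that
  proof (induction i arbitrary: v)
    case 0
    show ?case by (rule z0[OF 0(2)])
  next
    case (Suc i)
    have Pv: "?ev P *\<^sub>v v \<in> carrier_vec ?n" by (rule mult_mat_vec_carrier[OF mc Suc.prems(2)])
    have Cv: "?C *\<^sub>v v \<in> carrier_vec ?n" using C Suc.prems(2) by simp
    have "vec_index (?ev P *\<^sub>v v) (Suc i) = vec_index (?C *\<^sub>v (?ev P *\<^sub>v v)) i"
      using companion_mult_vec[OF Pv, of i] Suc.prems(1) by simp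
    also have "?C *\<^sub>v (?ev P *\<^sub>v v) = (?C * ?ev P) *\<^sub>v v" by (rule assoc_mult_mat_vec[OF C mc Suc.prems(2), symmetric])
    also have "?C * ?ev P = ?ev P * ?C" by (rule mat_of_poly_commute[OF C C refl, symmetric])
    also have "(?ev P * ?C) *\<^sub>v v = ?ev P *\<^sub>v (?C *\<^sub>v v)" by (rule assoc_mult_mat_vec[OF mc C Suc.prems(2)])
    also have "vec_index \<dots> i = 0" by (rule Suc.IH) (use Suc.prems(1) Cv in auto)
    finally show ?case .
  qed
  show ?thesis
  proof (rule eq_matI)
    fix i j assume "i < dim_row (0\<^sub>m ?n ?n :: int mat)" "j < dim_col (0\<^sub>m ?n ?n :: int mat)"
    then have ij: "i < ?n" "j < ?n" by auto
    have "vec_index (?ev P *\<^sub>v unit_vec ?n j) i = ?ev P $$ (i, j)"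
      using ij mat_of_poly_dim[OF C] by (simp add: scalar_prod_right_unit)
    then show "?ev P $$ (i, j) = (0\<^sub>m ?n ?n :: int mat) $$ (i, j)" using zi[OF ij(1), of "unit_vec ?n j"] ij by simp
  qed (use mat_of_poly_dim[OF C] in auto)
qed

lemma companion_eigenvector:
  fixes z :: complex
  assumes P: "monic P" "degree P > 0" and z: "poly (map_poly of_int P) z = 0"
  defines "v \<equiv> Matrix.vec (degree P) (\<lambda>i. z ^ i)"
  shows "v \<in> carrier_vec (degree P)" "v \<noteq> 0\<^sub>v (degree P)"
    "map_mat of_int (companion P) *\<^sub>v v = z \<cdot>\<^sub>v v"
proof -
  show "v \<in> carrier_vec (degree P)" by (simp add: v_def)
  have "vec_index v 0 \<noteq> 0" using P(2) by (simp add: v_def)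
  then show "v \<noteq> 0\<^sub>v (degree P)" using P(2) by auto
  have d: "degree (map_poly of_int P :: complex poly) = degree P" by (simp add: of_int_hom.degree_map_poly_hom)
  have "(\<Sum>i\<le>degree P. of_int (Polynomial.coeff P i) * z ^ i) = 0"
    using z unfolding poly_altdef d by (simp add: coeff_map_poly)
  then have sm: "(\<Sum>i<degree P. of_int (Polynomial.coeff P i) * z ^ i) = - (z ^ degree P)"
    using P(1) unfolding lessThan_Suc_atMost[symmetric] sum.lessThan_Suc by (simp add: eq_neg_iff_add_eq_0)
  show "map_mat of_int (companion P) *\<^sub>v v = z \<cdot>\<^sub>v v"
  proof (rule eq_vecI)
    fix i assume "i < dim_vec (z \<cdot>\<^sub>v v)"
    then have i: "i < degree P" by (simp add: v_def)
    show "vec_index (map_mat of_int (companion P) *\<^sub>v v) i = vec_index (z \<cdot>\<^sub>v v) i"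
    proof (cases "Suc i < degree P")
      case True
      have "vec_index (map_mat of_int (companion P) *\<^sub>v v) i = (\<Sum>j\<in>{0..<degree P}. of_int (if j = Suc i then 1 else 0) * z ^ j)"
        using i True by (simp add: companion_def v_def scalar_prod_def)
      also have "\<dots> = (\<Sum>j\<in>{0..<degree P}. if j = Suc i then z ^ j else 0)" by (intro sum.cong) auto
      finally show ?thesis using True i by (simp add: v_def)
    next
      case False
      then have e: "degree P = Suc i" using i by simp
      have "vec_index (map_mat of_int (companion P) *\<^sub>v v) i = (\<Sum>j\<in>{0..<degree P}. - (of_int (Polynomial.coeff P j) * z ^ j))"
        using i False by (auto simp: companion_def v_def scalar_prod_def intro!: sum.cong)
      also have "\<dots> = z ^ degree P" using sm by (simp add: sum_negf atLeast0LessThan)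
      finally show ?thesis using i by (simp add: v_def e)
    qed
  qed (simp add: companion_def v_def)
qed

abbreviation int_rat_poly :: "int poly \<Rightarrow> rat poly" where "int_rat_poly \<equiv> map_poly of_int"

text \<open>Modulo the irreducible \<open>P\<close> the polynomial \<open>f\<close> has an inverse
  over the rationals, and the Bezout identity evaluated at the companion matrix inverts
  \<open>f(C)\<close>.\<close>

lemma companion_poly_det:
  assumes P: "monic P" and irr: "irreducible\<^sub>d P" and f: "\<not> int_rat_poly P dvd int_rat_poly f"
  shows "det (mat_of_poly (degree P) (companion P) f) \<noteq> 0"
proof
  let ?n = "degree P" and ?C = "companion P"
  let ?Cq = "map_mat rat_of_int ?C"
  note C = companion_carrier[of P]
  have n: "degree P > 0" using irr by (simp add: irreducible\<^sub>d_def)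
  have Cq: "?Cq \<in> carrier_mat ?n ?n" using C by simp
  assume "det (mat_of_poly ?n ?C f) = 0"
  then have "det (mat_of_poly ?n ?Cq (int_rat_poly f)) = 0"
    unfolding of_int_hom.mat_of_poly_hom[OF C] by simp
  then obtain v where v: "v \<in> carrier_vec ?n" "v \<noteq> 0\<^sub>v ?n" "mat_of_poly ?n ?Cq (int_rat_poly f) *\<^sub>v v = 0\<^sub>v ?n"
    using det_0_iff_vec_prod_zero[OF mat_of_poly_closed[OF Cq]] by blast
  have "irreducible (int_rat_poly P)"
    using irreducible\<^sub>d_int_rat[OF irr] by (simp add: irreducible_connect_field)
  then obtain s t where st: "s * int_rat_poly P + t * int_rat_poly f = 1"
    using irreducible_bezout f by blast
  have Pz: "mat_of_poly ?n ?Cq (int_rat_poly P) = 0\<^sub>m ?n ?n"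
    unfolding of_int_hom.mat_of_poly_hom[OF C] companion_annihilates[OF P n] by (rule eq_matI) auto
  let ?ev = "mat_of_poly ?n ?Cq"
  have mc: "?ev p \<in> carrier_mat ?n ?n" for p by (rule mat_of_poly_closed[OF Cq])
  have "1\<^sub>m ?n = ?ev s * ?ev (int_rat_poly P) + ?ev t * ?ev (int_rat_poly f)"
    unfolding mat_of_poly_mult[OF Cq, symmetric] mat_of_poly_add[OF Cq, symmetric] st mat_of_poly_1[OF Cq] ..
  also have "?ev s * ?ev (int_rat_poly P) = 0\<^sub>m ?n ?n" unfolding Pz by (rule right_mult_zero_mat[OF mc])
  also have "0\<^sub>m ?n ?n + ?ev t * ?ev (int_rat_poly f) = ?ev t * ?ev (int_rat_poly f)"
    by (rule left_add_zero_mat[OF mult_carrier_mat[OF mc mc]])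
  finally have "1\<^sub>m ?n *\<^sub>v v = ?ev t *\<^sub>v (?ev (int_rat_poly f) *\<^sub>v v)"
    using assoc_mult_mat_vec[OF mc mc v(1)] by simp
  also have "\<dots> = 0\<^sub>v ?n" unfolding v(3) using mc[of t] by (intro eq_vecI) auto
  finally show False using v(1,2) by simp
qed

text \<open>Two independent units: \<open>A'\<close> and \<open>B'\<close> are the inverses, and the
  last clause says that no \<open>A^k B^l\<close> with integers \<open>(k, l)\<close> other than
  \<open>(0, 0)\<close> has the eigenvalue 1. It is written with natural exponents on both sides
  because matrix powers have these.\<close>

definition unit_pair :: "nat \<Rightarrow> int mat \<Rightarrow> int mat \<Rightarrow> int mat \<Rightarrow> int mat \<Rightarrow> bool" where
  "unit_pair n A A' B B' \<longleftrightarrow>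
     A \<in> carrier_mat n n \<and> A' \<in> carrier_mat n n \<and> B \<in> carrier_mat n n \<and> B' \<in> carrier_mat n n \<and>
     A * A' = 1\<^sub>m n \<and> A' * A = 1\<^sub>m n \<and> B * B' = 1\<^sub>m n \<and> B' * B = 1\<^sub>m n \<and> A * B = B * A \<and>
     (\<forall>a b c d. (a, b) \<noteq> (c, d) \<longrightarrow> det (A ^\<^sub>m a * B ^\<^sub>m b - A ^\<^sub>m c * B ^\<^sub>m d) \<noteq> 0)"

text \<open>A joint eigenvector with eigenvalues of modulus one is an eigenvector of this kind for
  every \<open>A^k B^l\<close>, so none of these is hyperbolic.\<close>

definition neutral_pair :: "nat \<Rightarrow> int mat \<Rightarrow> int mat \<Rightarrow> bool" where
  "neutral_pair n A B \<longleftrightarrow>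
     (\<exists>(v :: complex Matrix.vec) \<alpha> \<beta>. v \<in> carrier_vec n \<and> v \<noteq> 0\<^sub>v n \<and> norm \<alpha> = 1 \<and> norm \<beta> = 1 \<and>
       map_mat of_int A *\<^sub>v v = \<alpha> \<cdot>\<^sub>v v \<and> map_mat of_int B *\<^sub>v v = \<beta> \<cdot>\<^sub>v v)"

lemma mat_of_poly_power:
  assumes "A \<in> carrier_mat n n"
  shows "mat_of_poly n A (p ^ k) = mat_of_poly n A p ^\<^sub>m k"
proof (induction k)
  case 0
  then show ?case using mat_of_poly_1[OF assms] mat_of_poly_dim[OF assms] by simp
next
  case (Suc k)
  then show ?case by (simp add: mult.commute[of p] mat_of_poly_mult[OF assms] power_Suc2 del: power_Suc)
qed

lemma mat_of_poly_minus:
  assumes A: "A \<in> carrier_mat n n"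
  shows "mat_of_poly n A (p - q) = mat_of_poly n A p - mat_of_poly n A q"
proof -
  have "p - q = p + Polynomial.smult (- 1) q" by simp
  then have "mat_of_poly n A (p - q) = mat_of_poly n A p + (- 1) \<cdot>\<^sub>m mat_of_poly n A q"
    by (simp only: mat_of_poly_add[OF A] mat_of_poly_smult[OF A])
  also have "\<dots> = mat_of_poly n A p - mat_of_poly n A q"
    by (rule eq_matI) (auto simp: mat_of_poly_dim[OF A])
  finally show ?thesis .
qed

lemma real_root_dvd:
  fixes P f :: "int poly" and x :: "'a :: {field_char_0}"
  assumes "int_rat_poly P dvd int_rat_poly f" "poly (map_poly of_int P) x = 0"
  shows "poly (map_poly of_int f) x = 0"
proof -
  obtain g where g: "int_rat_poly f = int_rat_poly P * g" using assms(1) by (auto elim: dvdE)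
  have r: "map_poly of_rat (int_rat_poly h) = (map_poly of_int h :: 'a poly)" for h
    by (rule poly_eqI) (simp add: coeff_map_poly)
  interpret h: map_poly_comm_ring_hom "of_rat :: rat \<Rightarrow> 'a" ..
  have "map_poly of_int f = (map_poly of_int P * map_poly of_rat g :: 'a poly)"
    unfolding r[symmetric] g h.hom_mult ..
  then show ?thesis using assms(2) by simp
qed

text \<open>A relation between powers of \<open>f1\<close> and \<open>f2\<close> modulo
  \<open>P\<close> holds at every real root. Logarithms at \<open>x1\<close> and \<open>x2\<close>
  turn it into two linear equations for the differences of the exponents, whose determinant is
  nonzero by assumption.\<close>

lemma companion_unit_pair:
  fixes x1 x2 :: real
  assumes P: "monic P" and irr: "irreducible\<^sub>d P"
    and f: "P dvd f1 * g1 - 1" "P dvd f2 * g2 - 1"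
    and x: "poly (map_poly of_int P) x1 = 0" "poly (map_poly of_int P) x2 = 0"
    and ln: "ln \<bar>poly (map_poly of_int f1) x1\<bar> * ln \<bar>poly (map_poly of_int f2) x2\<bar> \<noteq>
             ln \<bar>poly (map_poly of_int f2) x1\<bar> * ln \<bar>poly (map_poly of_int f1) x2\<bar>"
  defines "ev \<equiv> mat_of_poly (degree P) (companion P)"
  shows "unit_pair (degree P) (ev f1) (ev g1) (ev f2) (ev g2)"
proof -
  let ?n = "degree P" and ?C = "companion P"
  note C = companion_carrier[of P]
  have n: "degree P > 0" using irr by (simp add: irreducible\<^sub>d_def)
  have mc: "ev p \<in> carrier_mat ?n ?n" for p unfolding ev_def by (rule mat_of_poly_closed[OF C])
  have one: "ev f * ev g = 1\<^sub>m ?n" if fg: "P dvd f * g - 1" for f g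
  proof -
    obtain h where h: "f * g - 1 = P * h" using fg by (auto elim: dvdE)
    then have "f * g = 1 + P * h" by (simp add: algebra_simps)
    then have "ev f * ev g = 1\<^sub>m ?n + 0\<^sub>m ?n ?n * ev h"
      unfolding ev_def mat_of_poly_mult[OF C, symmetric]
      by (simp add: mat_of_poly_add[OF C] mat_of_poly_1[OF C] mat_of_poly_mult[OF C] companion_annihilates[OF P n])
    then show ?thesis using left_mult_zero_mat[OF mc[of h]] by simp
  qed
  have comm: "ev f * ev g = ev g * ev f" for f g
    unfolding ev_def mat_of_poly_mult[OF C, symmetric] by (simp add: mult.commute)
  have nz: "poly (map_poly of_int f) r \<noteq> (0 :: real)" if fg: "P dvd f * g - 1" "poly (map_poly of_int P) r = 0" for f g and r :: real
  proof
    assume z: "poly (map_poly of_int f) r = 0"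
    obtain h where h: "f * g - 1 = P * h" using fg(1) by (auto elim: dvdE)
    then have "f * g = 1 + P * h" by (simp add: algebra_simps)
    then have "map_poly of_int f * map_poly of_int g = (1 + map_poly of_int P * map_poly of_int h :: real poly)"
      by (metis of_int_poly_hom.hom_add of_int_poly_hom.hom_mult of_int_poly_hom.hom_one)
    then have "poly (map_poly of_int f * map_poly of_int g) r = poly (1 + map_poly of_int P * map_poly of_int h) r" by simp
    then show False using z fg(2) by simp
  qed
  have E: "det (ev f1 ^\<^sub>m a * ev f2 ^\<^sub>m b - ev f1 ^\<^sub>m c * ev f2 ^\<^sub>m d) \<noteq> 0" if ne: "(a, b) \<noteq> (c, d)" for a b c d
  proof -
    define h where "h = f1 ^ a * f2 ^ b - f1 ^ c * f2 ^ d"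
    have "\<not> int_rat_poly P dvd int_rat_poly h"
    proof
      assume dv: "int_rat_poly P dvd int_rat_poly h"
      have lin: "(real a - real c) * ln \<bar>poly (map_poly of_int f1) r\<bar> + (real b - real d) * ln \<bar>poly (map_poly of_int f2) r\<bar> = 0"
        if r: "poly (map_poly of_int P) r = 0" for r :: real
      proof -
        let ?u = "poly (map_poly of_int f1) r" and ?v = "poly (map_poly of_int f2) r"
        have uv: "\<bar>?u\<bar> > 0" "\<bar>?v\<bar> > 0" using nz[OF f(1) r] nz[OF f(2) r] by auto
        have "poly (map_poly of_int h) r = 0" by (rule real_root_dvd[OF dv r])
        then have "?u ^ a * ?v ^ b = ?u ^ c * ?v ^ d"
          unfolding h_def of_int_poly_hom.hom_minus of_int_poly_hom.hom_mult of_int_poly_hom.hom_power by simp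
        then have "\<bar>?u\<bar> ^ a * \<bar>?v\<bar> ^ b = \<bar>?u\<bar> ^ c * \<bar>?v\<bar> ^ d" by (metis abs_mult power_abs)
        then have "ln (\<bar>?u\<bar> ^ a * \<bar>?v\<bar> ^ b) = ln (\<bar>?u\<bar> ^ c * \<bar>?v\<bar> ^ d)" by simp
        then have "real a * ln \<bar>?u\<bar> + real b * ln \<bar>?v\<bar> = real c * ln \<bar>?u\<bar> + real d * ln \<bar>?v\<bar>"
          using uv by (simp add: ln_mult ln_realpow)
        then show ?thesis by (simp add: algebra_simps)
      qed
      define s t where "s = real a - real c" and "t = real b - real d"
      define p q p' q' where "p = ln \<bar>poly (map_poly of_int f1) x1\<bar>" and "q = ln \<bar>poly (map_poly of_int f2) x1\<bar>"
        and "p' = ln \<bar>poly (map_poly of_int f1) x2\<bar>" and "q' = ln \<bar>poly (map_poly of_int f2) x2\<bar>"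
      have l: "s * p + t * q = 0" "s * p' + t * q' = 0" "p * q' - q * p' \<noteq> 0"
        using lin[OF x(1)] lin[OF x(2)] ln unfolding s_def t_def p_def q_def p'_def q'_def by auto
      have "s * (p * q' - q * p') = q' * (s * p + t * q) - q * (s * p' + t * q')" by (simp add: algebra_simps)
      then have "s = 0" using l by simp
      have "t * (p * q' - q * p') = p * (s * p' + t * q') - p' * (s * p + t * q)" by (simp add: algebra_simps)
      then have "t = 0" using l by simp
      with \<open>s = 0\<close> show False using ne unfolding s_def t_def by simp
    qed
    then have "det (ev h) \<noteq> 0" unfolding ev_def by (rule companion_poly_det[OF P irr])
    then show ?thesis
      unfolding h_def ev_def mat_of_poly_minus[OF C] mat_of_poly_mult[OF C] mat_of_poly_power[OF C] .
  qed
  show ?thesis unfolding unit_pair_def using mc one[OF f(1)] one[OF f(2)] comm E by metis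
qed

lemma companion_neutral_pair:
  fixes z :: complex
  assumes P: "monic P" "degree P > 0" and z: "poly (map_poly of_int P) z = 0"
    and n1: "norm (poly (map_poly of_int f1) z) = 1" "norm (poly (map_poly of_int f2) z) = 1"
  shows "neutral_pair (degree P) (mat_of_poly (degree P) (companion P) f1) (mat_of_poly (degree P) (companion P) f2)"
proof -
  let ?C = "map_mat of_int (companion P) :: complex mat"
  note C = companion_carrier[of P]
  have Cc: "?C \<in> carrier_mat (degree P) (degree P)" using C by simp
  note v = companion_eigenvector[OF P z]
  note e = mat_of_poly_eigenvector[OF Cc v(1,3)]
  have "map_mat of_int (mat_of_poly (degree P) (companion P) f) *\<^sub>v Matrix.vec (degree P) (\<lambda>i. z ^ i) =
      poly (map_poly of_int f) z \<cdot>\<^sub>v Matrix.vec (degree P) (\<lambda>i. z ^ i)" for f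
    using e[of "map_poly of_int f"] unfolding of_int_hom.mat_of_poly_hom[OF C] .
  then show ?thesis unfolding neutral_pair_def using v n1 by blast
qed

section \<open>Block sums\<close>

definition block_diag :: "nat \<Rightarrow> nat \<Rightarrow> 'a :: comm_ring_1 mat \<Rightarrow> 'a mat \<Rightarrow> 'a mat" where
  "block_diag n m A1 A2 = four_block_mat A1 (0\<^sub>m n m) (0\<^sub>m m n) A2"

context
  fixes n m :: nat
begin

lemma block_diag_carrier:
  assumes "A1 \<in> carrier_mat n n" "A2 \<in> carrier_mat m m"
  shows "block_diag n m A1 A2 \<in> carrier_mat (n + m) (n + m)"
  unfolding block_diag_def by (rule four_block_carrier_mat[OF assms])

lemma block_diag_mult:
  assumes A: "A1 \<in> carrier_mat n n" "A2 \<in> carrier_mat m m" and B: "B1 \<in> carrier_mat n n" "B2 \<in> carrier_mat m m"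
  shows "block_diag n m A1 A2 * block_diag n m B1 B2 = block_diag n m (A1 * B1) (A2 * B2)"
proof -
  have "A1 * B1 + 0\<^sub>m n m * 0\<^sub>m m n = A1 * B1" "0\<^sub>m m n * 0\<^sub>m n m + A2 * B2 = A2 * B2"
    "A1 * 0\<^sub>m n m + 0\<^sub>m n m * B2 = 0\<^sub>m n m" "0\<^sub>m m n * B1 + A2 * 0\<^sub>m m n = 0\<^sub>m m n"
    using A B mult_carrier_mat[OF A(1) B(1)] mult_carrier_mat[OF A(2) B(2)] by simp_all
  then show ?thesis unfolding block_diag_def
    by (subst mult_four_block_mat[OF A(1) zero_carrier_mat zero_carrier_mat A(2) B(1) zero_carrier_mat zero_carrier_mat B(2)]) simp
qed

lemma block_diag_one: "block_diag n m (1\<^sub>m n) (1\<^sub>m m) = 1\<^sub>m (n + m)"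
  unfolding block_diag_def by (rule four_block_one_mat)

lemma block_diag_pow:
  assumes A: "A1 \<in> carrier_mat n n" "A2 \<in> carrier_mat m m"
  shows "block_diag n m A1 A2 ^\<^sub>m k = block_diag n m (A1 ^\<^sub>m k) (A2 ^\<^sub>m k)"
proof (induction k)
  case 0
  then show ?case using block_diag_carrier[OF A] A by (simp add: block_diag_one)
next
  case (Suc k)
  show ?case unfolding pow_mat.simps Suc
    by (rule block_diag_mult) (use A in \<open>auto intro: pow_carrier_mat\<close>)
qed

lemma block_diag_minus:
  assumes "A1 \<in> carrier_mat n n" "A2 \<in> carrier_mat m m" "B1 \<in> carrier_mat n n" "B2 \<in> carrier_mat m m"
  shows "block_diag n m A1 A2 - block_diag n m B1 B2 = block_diag n m (A1 - B1) (A2 - B2)"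
  by (rule eq_matI) (use assms in \<open>auto simp: block_diag_def four_block_mat_def Let_def\<close>)

lemma det_block_diag:
  fixes A1 :: "'a :: idom mat"
  assumes "A1 \<in> carrier_mat n n" "A2 \<in> carrier_mat m m"
  shows "det (block_diag n m A1 A2) = det A1 * det A2"
  unfolding block_diag_def by (rule det_four_block_mat_lower_left_zero) (use assms in auto)

end

lemma unit_pair_block_diag:
  assumes U: "unit_pair n A A' B B'" and V: "unit_pair m C C' D D'"
  shows "unit_pair (n + m) (block_diag n m A C) (block_diag n m A' C') (block_diag n m B D) (block_diag n m B' D')"
proof -
  have c: "A \<in> carrier_mat n n" "A' \<in> carrier_mat n n" "B \<in> carrier_mat n n" "B' \<in> carrier_mat n n"
    "C \<in> carrier_mat m m" "C' \<in> carrier_mat m m" "D \<in> carrier_mat m m" "D' \<in> carrier_mat m m"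
    and e: "A * A' = 1\<^sub>m n" "A' * A = 1\<^sub>m n" "B * B' = 1\<^sub>m n" "B' * B = 1\<^sub>m n" "A * B = B * A"
    "C * C' = 1\<^sub>m m" "C' * C = 1\<^sub>m m" "D * D' = 1\<^sub>m m" "D' * D = 1\<^sub>m m" "C * D = D * C"
    and d1: "\<And>a b c d. (a, b) \<noteq> (c, d) \<Longrightarrow> det (A ^\<^sub>m a * B ^\<^sub>m b - A ^\<^sub>m c * B ^\<^sub>m d) \<noteq> 0"
    and d2: "\<And>a b c d. (a, b) \<noteq> (c, d) \<Longrightarrow> det (C ^\<^sub>m a * D ^\<^sub>m b - C ^\<^sub>m c * D ^\<^sub>m d) \<noteq> 0"
    using U V unfolding unit_pair_def by blast+
  have p: "A ^\<^sub>m k \<in> carrier_mat n n" "B ^\<^sub>m k \<in> carrier_mat n n" "C ^\<^sub>m k \<in> carrier_mat m m" "D ^\<^sub>m k \<in> carrier_mat m m" for k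
    using c by (simp_all add: pow_carrier_mat)
  have q: "A ^\<^sub>m k * B ^\<^sub>m l \<in> carrier_mat n n" "C ^\<^sub>m k * D ^\<^sub>m l \<in> carrier_mat m m" for k l
    using mult_carrier_mat[OF p(1) p(2)] mult_carrier_mat[OF p(3) p(4)] by auto
  have r: "A ^\<^sub>m k * B ^\<^sub>m l - A ^\<^sub>m k' * B ^\<^sub>m l' \<in> carrier_mat n n" "C ^\<^sub>m k * D ^\<^sub>m l - C ^\<^sub>m k' * D ^\<^sub>m l' \<in> carrier_mat m m" for k l k' l'
    using q by (auto intro: minus_carrier_mat)
  have dd: "det (block_diag n m A C ^\<^sub>m a * block_diag n m B D ^\<^sub>m b - block_diag n m A C ^\<^sub>m a' * block_diag n m B D ^\<^sub>m b') \<noteq> 0"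
    if ne: "(a, b) \<noteq> (a', b')" for a b a' b'
  proof -
    have "block_diag n m A C ^\<^sub>m a * block_diag n m B D ^\<^sub>m b - block_diag n m A C ^\<^sub>m a' * block_diag n m B D ^\<^sub>m b' =
      block_diag n m (A ^\<^sub>m a * B ^\<^sub>m b - A ^\<^sub>m a' * B ^\<^sub>m b') (C ^\<^sub>m a * D ^\<^sub>m b - C ^\<^sub>m a' * D ^\<^sub>m b')"
      by (simp only: block_diag_pow[OF c(1) c(5)] block_diag_pow[OF c(3) c(7)] block_diag_mult[OF p(1) p(3) p(2) p(4)]
        block_diag_minus[OF q q])
    then show ?thesis using det_block_diag[OF r] d1[OF ne] d2[OF ne] by simp
  qed
  show ?thesis unfolding unit_pair_def
    by (intro conjI allI impI dd block_diag_carrier c; (simp add: block_diag_mult c e block_diag_one)?)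
qed

text \<open>The eigenvector of the first block is extended by zeros, so the second block may well be
  hyperbolic.\<close>

lemma neutral_pair_block_diag:
  assumes N: "neutral_pair n A B" and c: "A \<in> carrier_mat n n" "B \<in> carrier_mat n n" "C \<in> carrier_mat m m" "D \<in> carrier_mat m m"
  shows "neutral_pair (n + m) (block_diag n m A C) (block_diag n m B D)"
proof -
  obtain v :: "complex Matrix.vec" and \<alpha> \<beta> where v: "v \<in> carrier_vec n" "v \<noteq> 0\<^sub>v n" "norm \<alpha> = 1" "norm \<beta> = 1"
    "map_mat of_int A *\<^sub>v v = \<alpha> \<cdot>\<^sub>v v" "map_mat of_int B *\<^sub>v v = \<beta> \<cdot>\<^sub>v v"
    using N unfolding neutral_pair_def by blast
  let ?v = "v @\<^sub>v 0\<^sub>v m"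
  have ev: "map_mat of_int (block_diag n m X Y) *\<^sub>v ?v = z \<cdot>\<^sub>v ?v"
    if X: "X \<in> carrier_mat n n" "Y \<in> carrier_mat m m" and e: "map_mat of_int X *\<^sub>v v = z \<cdot>\<^sub>v v" for X Y :: "int mat" and z :: complex
  proof -
    have "map_mat of_int (block_diag n m X Y) = four_block_mat (map_mat of_int X) (0\<^sub>m n m) (0\<^sub>m m n) (map_mat of_int Y :: complex mat)"
      by (rule eq_matI) (use X in \<open>auto simp: block_diag_def four_block_mat_def Let_def\<close>)
    then have "map_mat of_int (block_diag n m X Y) *\<^sub>v ?v =
        (map_mat of_int X *\<^sub>v v + 0\<^sub>m n m *\<^sub>v 0\<^sub>v m) @\<^sub>v (0\<^sub>m m n *\<^sub>v v + map_mat of_int Y *\<^sub>v 0\<^sub>v m)"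
      using X v(1) by (simp add: four_block_mat_mult_vec[of _ n n _ m _ m])
    also have "map_mat of_int X *\<^sub>v v + 0\<^sub>m n m *\<^sub>v 0\<^sub>v m = z \<cdot>\<^sub>v v" unfolding e using v(1) by (intro eq_vecI) auto
    also have "0\<^sub>m m n *\<^sub>v v + map_mat of_int Y *\<^sub>v 0\<^sub>v m = z \<cdot>\<^sub>v (0\<^sub>v m :: complex Matrix.vec)"
      using X v(1) by (intro eq_vecI) auto
    also have "(z \<cdot>\<^sub>v v) @\<^sub>v (z \<cdot>\<^sub>v 0\<^sub>v m) = z \<cdot>\<^sub>v ?v" by (intro eq_vecI) auto
    finally show ?thesis .
  qed
  have "?v \<noteq> 0\<^sub>v (n + m)"
  proof
    assume z: "?v = 0\<^sub>v (n + m)"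
    have "vec_index v i = 0" if "i < n" for i
      using arg_cong[OF z, of "\<lambda>w. vec_index w i"] that v(1) by simp
    then have "v = 0\<^sub>v n" using v(1) by (intro eq_vecI) auto
    then show False using v(2) by simp
  qed
  moreover have "?v \<in> carrier_vec (n + m)" using v(1) by simp
  ultimately show ?thesis unfolding neutral_pair_def using ev[OF c(1,3) v(5)] ev[OF c(2,4) v(6)] v(3,4) by blast
qed

section \<open>A cubic field\<close>

text \<open>In the field of \<open>x^3 - 3 x + 1\<close> the units \<open>x\<close> and
  \<open>x - 1\<close> have the inverses \<open>3 - x^2\<close> and \<open>x^2 + x - 2\<close>. For
  a root in (-2, -1) and one in (1, 2), three of the four logarithms are positive and only that of
  \<open>|x - 1|\<close> at the second root is negative, so the two products have different
  signs.\<close>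

lemma cubic_unit_pair: "\<exists>A A' B B'. unit_pair 3 A A' B B'"
proof -
  define R :: "int poly" where "R = [:1, - 3, 0, 1:]"
  have dR: "degree R = 3" "monic R" unfolding R_def by simp_all
  have irr: "irreducible\<^sub>d R"
  proof (rule irreducible\<^sub>dI)
    show "degree R > 0" using dR by simp
    fix F G :: "int poly" assume FG: "degree F > 0" "degree F < degree R" "degree G > 0" "degree G < degree R" "R = F * G"
    have "degree F + degree G = 3" using FG dR by (metis degree_0 degree_mult_eq less_irrefl)
    then have d: "degree F = 1 \<or> degree G = 1" using FG dR by linarith
    have "F * G = G * F" by simp
    then obtain L K where LK: "R = L * K" "degree L = 1" using d FG(5) by metis
    define a b where "a = Polynomial.coeff L 1" and "b = Polynomial.coeff L 0"
    have L: "L = [:b, a:]" using LK(2) unfolding a_def b_def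
      by (intro poly_eqI) (auto simp: coeff_pCons coeff_eq_0 split: nat.splits)
    have "lead_coeff L * lead_coeff K = 1" using dR(2) unfolding LK(1) lead_coeff_mult .
    then have "a * lead_coeff K = 1" unfolding LK(2) a_def .
    then have "a = 1 \<or> a = -1" by (simp add: zmult_eq_1_iff) blast
    then have a: "a * a = 1" by auto
    \<comment> \<open>As \<open>a\<close> is 1 or -1, it is its own inverse, so the linear factor
      has the integer root \<open>- a * b\<close>. Such a root divides 1.\<close>
    define t where "t = - a * b"
    have "poly L t = 0" unfolding L t_def using a by (simp add: algebra_simps)
    then have "poly R t = 0" unfolding LK(1) by simp
    then have z: "t * (3 - t * t) = 1" unfolding R_def by (simp add: algebra_simps)
    then have "t = 1 \<or> t = -1" using zmult_eq_1_iff by blast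
    then show False using z by auto
  qed
  have r: "poly (map_poly of_int R) x = x ^ 3 - 3 * x + 1" for x :: real
    unfolding R_def by (simp add: algebra_simps power3_eq_cube)
  have "\<exists>x. -2 \<le> x \<and> x \<le> -1 \<and> x ^ 3 - 3 * x + 1 = (0 :: real)"
    by (rule IVT') (auto intro!: continuous_intros)
  then obtain x1 where x1: "-2 \<le> x1" "x1 \<le> -1" "x1 ^ 3 - 3 * x1 + 1 = (0 :: real)" by blast
  have "x1 \<noteq> -1" using x1(3) by auto
  have "\<exists>x. 1 \<le> x \<and> x \<le> 2 \<and> x ^ 3 - 3 * x + 1 = (0 :: real)"
    by (rule IVT') (auto intro!: continuous_intros)
  then obtain x2 where x2: "1 \<le> x2" "x2 \<le> 2" "x2 ^ 3 - 3 * x2 + 1 = (0 :: real)" by blast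
  have n2: "x2 \<noteq> 1" "x2 \<noteq> 2" using x2(3) by auto
  have "unit_pair (degree R) (mat_of_poly (degree R) (companion R) [:0, 1:]) (mat_of_poly (degree R) (companion R) [:3, 0, -1:])
     (mat_of_poly (degree R) (companion R) [:-1, 1:]) (mat_of_poly (degree R) (companion R) [:-2, 1, 1:])"
  proof (rule companion_unit_pair[OF dR(2) irr, of _ _ _ _ x1 x2])
    have "[:0, 1:] * [:3, 0, -1:] - 1 = R * (- 1)" unfolding R_def by (rule poly_eqI) (simp add: coeff_pCons split: nat.splits)
    then show "R dvd [:0, 1:] * [:3, 0, -1:] - 1" by (metis dvd_triv_left)
    have "[:-1, 1:] * [:-2, 1, 1:] - 1 = R * 1" unfolding R_def by (rule poly_eqI) (simp add: coeff_pCons split: nat.splits)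
    then show "R dvd [:-1, 1:] * [:-2, 1, 1:] - 1" by (metis dvd_triv_left)
    show "poly (map_poly of_int R) x1 = 0" "poly (map_poly of_int R) x2 = 0" unfolding r using x1 x2 by auto
    have a: "ln \<bar>x1\<bar> > 0" "ln \<bar>x1 - 1\<bar> > 0" "ln \<bar>x2\<bar> > 0" using x1 x2 n2 \<open>x1 \<noteq> -1\<close> by auto
    have b: "ln \<bar>x2 - 1\<bar> < 0" using x2 n2 by (intro ln_less_zero) auto
    have "ln \<bar>x1\<bar> * ln \<bar>x2 - 1\<bar> < 0" "ln \<bar>x1 - 1\<bar> * ln \<bar>x2\<bar> > 0" using a b by (auto intro: mult_pos_neg mult_pos_pos)
    then show "ln \<bar>poly (map_poly of_int [:0, 1:]) x1\<bar> * ln \<bar>poly (map_poly of_int [:- 1, 1:]) x2\<bar> \<noteq>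
      ln \<bar>poly (map_poly of_int [:- 1, 1:]) x1\<bar> * ln \<bar>poly (map_poly of_int [:0, 1:]) x2\<bar>"
      by simp
  qed
  then show ?thesis unfolding dR by blast
qed

section \<open>A field of even degree\<close>

text \<open>All integers of absolute value below \<open>m\<close> are roots, and 0 is a double one.
  As a polynomial in \<open>x^2\<close> it is invariant under \<open>x -> - x\<close>.\<close>

definition even_W :: "nat \<Rightarrow> int poly" where
  "even_W m = [:0, 0, - 1:] * (\<Prod>i\<in>{1..<m}. [:int i ^ 2, 0, - 1:])"

text \<open>\<open>even_W\<close> as a function of \<open>y = x^2\<close>: a negative solution of
  \<open>even_u m y = 1\<close> gives imaginary roots, a positive one real roots.\<close>

definition even_u :: "nat \<Rightarrow> 'a :: comm_ring_1 \<Rightarrow> 'a" where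
  "even_u m y = - y * (\<Prod>i\<in>{1..<m}. of_nat i ^ 2 - y)"

lemma poly_even_W: "poly (map_poly of_int (even_W m)) x = even_u m (x ^ 2 :: 'a :: comm_ring_1)"
proof -
  have "poly (map_poly of_int (\<Prod>i\<in>I. [:int i ^ 2, 0, - 1:])) x = (\<Prod>i\<in>I. of_nat i ^ 2 - x ^ 2 :: 'a)" for I
    unfolding of_int_poly_hom.hom_prod poly_prod by (intro prod.cong) (simp_all add: power2_eq_square)
  then show ?thesis unfolding even_W_def even_u_def of_int_poly_hom.hom_mult poly_mult
    by (simp add: power2_eq_square)
qed

lemma poly_even_W_int: "poly (even_W m) t = even_u m (t ^ 2)"
  using poly_even_W[of m t] by simp

lemma even_W_degree:
  assumes "m \<ge> 1"
  shows "degree (even_W m) = 2 * m" "lead_coeff (even_W m) = (- 1) ^ m"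
proof -
  let ?f = "\<lambda>i. [:int i ^ 2, 0, - 1:]"
  have nz: "(\<Prod>i\<in>{1..<m}. ?f i) \<noteq> 0" by simp
  have "degree (\<Prod>i\<in>{1..<m}. ?f i) = (\<Sum>i\<in>{1..<m}. degree (?f i))" by (rule degree_prod_eq_sum_degree) auto
  then have d: "degree (\<Prod>i\<in>{1..<m}. ?f i) = 2 * (m - 1)" by simp
  show "degree (even_W m) = 2 * m" unfolding even_W_def
    by (subst degree_mult_eq) (use nz d assms in auto)
  have "lead_coeff (\<Prod>i\<in>{1..<m}. ?f i) = (\<Prod>i\<in>{1..<m}. lead_coeff (?f i))" by (rule lead_coeff_prod)
  then have "lead_coeff (\<Prod>i\<in>{1..<m}. ?f i) = (- 1) ^ (m - 1)" by simp
  then have "lead_coeff (even_W m) = - 1 * (- 1) ^ (m - 1)" unfolding even_W_def lead_coeff_mult by simp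
  also have "\<dots> = (- 1) ^ m" using assms by (cases m) auto
  finally show "lead_coeff (even_W m) = (- 1) ^ m" .
qed

definition even_P :: "nat \<Rightarrow> int poly" where
  "even_P m = Polynomial.smult ((- 1) ^ m) (even_W m - 1)"

lemma even_P_degree:
  assumes "m \<ge> 1"
  shows "degree (even_P m) = 2 * m" "monic (even_P m)"
proof -
  have d: "degree (even_W m - 1) = 2 * m"
    using degree_add_eq_left[of "- 1" "even_W m"] even_W_degree[OF assms] assms by simp
  then show dP: "degree (even_P m) = 2 * m" unfolding even_P_def by simp
  have "Polynomial.coeff (even_W m - 1) (2 * m) = (- 1) ^ m" using even_W_degree[OF assms] assms by simp
  then show "monic (even_P m)" unfolding even_P_def lead_coeff_smult d by (simp flip: power_add mult_2)
qed

lemma even_P_W: "even_W m - 1 = even_P m * [:(- 1) ^ m:]"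
  unfolding even_P_def by (simp flip: power_add mult_2)

lemma poly_even_P: "poly (map_poly of_int (even_P m)) x = (- 1) ^ m * (even_u m (x ^ 2) - 1 :: 'a :: comm_ring_1)"
proof -
  have "map_poly of_int (even_P m) = Polynomial.smult ((- 1) ^ m) (map_poly of_int (even_W m) - 1 :: 'a poly)"
    unfolding even_P_def by (simp add: of_int_poly_hom.hom_minus of_int_hom.map_poly_hom_smult)
  then show ?thesis by (simp add: poly_even_W)
qed

text \<open>By these values the level 1 is attained in (-1, 0), (1, 2) and (2, 4). The bound
  \<open>m \<ge> 3\<close> makes 4 a zero.\<close>

lemma even_u_values:
  assumes m: "m \<ge> 3"
  shows "even_u m (0 :: real) = 0" "even_u m (1 :: real) = 0" "even_u m (4 :: real) = 0"
    "even_u m (- 1 :: real) > 1" "even_u m (2 :: real) > 1"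
proof -
  show "even_u m (0 :: real) = 0" by (simp add: even_u_def)
  have z: "even_u m (real i ^ 2) = 0" if "i \<in> {1..<m}" for i
  proof -
    have "(\<Prod>j\<in>{1..<m}. real j ^ 2 - real i ^ 2) = 0" using that by (intro prod_zero) auto
    then show ?thesis by (simp add: even_u_def)
  qed
  show "even_u m (1 :: real) = 0" "even_u m (4 :: real) = 0" using z[of 1] z[of 2] m by auto
  have i1: "{1..<m} = insert 1 {2..<m}" using m by auto
  have "(\<Prod>j\<in>{2..<m}. real j ^ 2 + 1) \<ge> 1" by (rule prod_ge_1) auto
  then show "even_u m (- 1 :: real) > 1" unfolding even_u_def i1 by (simp add: add.commute)
  have i2: "{1..<m} = insert 1 (insert 2 {3..<m})" using m by auto
  have "(\<Prod>j\<in>{3..<m}. real j ^ 2 - 2) \<ge> 1"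
  proof (rule prod_ge_1)
    fix j assume "j \<in> {3..<m}"
    then have "real j ^ 2 \<ge> 3 ^ 2" by (intro power_mono) auto
    then show "real j ^ 2 - 2 \<ge> 1" by simp
  qed
  then show "even_u m (2 :: real) > 1" unfolding even_u_def i2 by simp
qed

lemma poly_eq_0_of_many_roots:
  fixes p :: "int poly"
  assumes "finite T" "\<And>t. t \<in> T \<Longrightarrow> poly p t = 0" "degree p < card T"
  shows "p = 0"
proof (rule ccontr)
  assume "p \<noteq> 0"
  then have "card {x. poly p x = 0} \<le> degree p" "finite {x. poly p x = 0}"
    by (simp_all add: card_poly_roots_bound poly_roots_finite)
  moreover have "T \<subseteq> {x. poly p x = 0}" using assms(2) by auto
  ultimately show False using card_mono[of "{x. poly p x = 0}" T] assms(3) by linarith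
qed

text \<open>At the \<open>2 m - 1\<close> integers of absolute value below \<open>m\<close> the
  polynomial has one constant value 1 or -1. Hence both factors are 1 or -1 there, and one is a
  fixed sign times the other. Their degrees are small enough to make this an identity, so
  \<open>even_P\<close> would be a square up to sign; one sign is refuted by the leading
  coefficient, the other by the value at \<open>sqrt 2\<close>.\<close>

lemma irreducible_even_P:
  assumes m: "m \<ge> 3"
  shows "irreducible\<^sub>d (even_P m)"
proof (rule irreducible\<^sub>dI)
  have dP: "degree (even_P m) = 2 * m" and mP: "monic (even_P m)" using even_P_degree[of m] m by auto
  show "degree (even_P m) > 0" using dP m by simp
  fix F G :: "int poly" assume FG: "degree F > 0" "degree F < degree (even_P m)" "degree G > 0" "degree G < degree (even_P m)" "even_P m = F * G"
  define e :: int where "e = (- 1) ^ m"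
  have e: "e * e = 1" "e = 1 \<or> e = -1" unfolding e_def by (cases "even m"; simp)+
  define T where "T = {- (int m - 1)..int m - 1}"
  have T: "finite T" "card T = 2 * m - 1" unfolding T_def using m by auto
  have FGt: "poly F t * poly G t = - e" if "t \<in> T" for t
  proof -
    have "poly (even_W m) t = 0"
    proof (cases "t = 0")
      case True
      then show ?thesis by (simp add: poly_even_W_int even_u_def)
    next
      case False
      then have i: "nat \<bar>t\<bar> \<in> {1..<m}" using that m unfolding T_def by auto
      have "(\<Prod>i\<in>{1..<m}. of_nat i ^ 2 - t ^ 2) = 0"
        by (rule prod_zero) (use i in \<open>auto intro!: bexI[of _ "nat \<bar>t\<bar>"]\<close>)
      then show ?thesis unfolding poly_even_W_int even_u_def by (simp only: mult_zero_right)
    qed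
    then have "poly (even_P m) t = - e" unfolding even_P_def e_def poly_smult poly_diff by (simp only: poly_1 diff_0 mult_minus_right mult_1_right)
    then show ?thesis unfolding FG(5) by simp
  qed
  have one: "poly F t * poly F t = 1 \<and> poly G t * poly G t = 1" if "t \<in> T" for t
  proof -
    have "\<bar>poly F t * poly G t\<bar> = 1" using FGt[OF that] e(2) by auto
    then have "\<bar>poly F t\<bar> = 1" "\<bar>poly G t\<bar> = 1" using abs_zmult_eq_1 by (auto simp: mult.commute)
    then show ?thesis by (metis abs_mult_self_eq mult_1_right)
  qed
  have nz: "F \<noteq> 0" "G \<noteq> 0" using FG(1,3) by auto
  have dFG: "degree F + degree G = 2 * m" using dP degree_mult_eq[OF nz] unfolding FG(5) by simp
  \<comment> \<open>Excluding linear factors brings both degrees down to \<open>2 m - 2\<close>. For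
    a linear \<open>H\<close> the quadratic polynomial \<open>H * H - 1\<close> would have
    \<open>2 m - 1\<close>, hence at least 5, zeros.\<close>
  have no1: "degree H \<noteq> 1" if "\<And>t. t \<in> T \<Longrightarrow> poly H t * poly H t = 1" for H
  proof
    assume d1: "degree H = 1"
    then have "H \<noteq> 0" by auto
    then have "degree (H * H) = 2" using d1 by (simp add: degree_mult_eq)
    then have d2: "degree (H * H - 1) = 2" using degree_add_eq_left[of "- 1" "H * H"] by simp
    moreover have "H * H - 1 = 0" by (rule poly_eq_0_of_many_roots[OF T(1)]) (use that d2 T(2) m in auto)
    ultimately show False by simp
  qed
  have "degree F \<noteq> 1" "degree G \<noteq> 1" using no1 one by blast+
  then have d: "degree F \<le> 2 * m - 2" "degree G \<le> 2 * m - 2" using dFG FG(1,3) by linarith+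
  define K where "K = G + Polynomial.smult e F"
  have "K = 0"
  proof (rule poly_eq_0_of_many_roots[OF T(1)])
    fix t assume t: "t \<in> T"
    have "poly G t = poly F t * poly F t * poly G t" using one[OF t] by simp
    also have "\<dots> = poly F t * (- e)" using FGt[OF t] by (simp add: mult.assoc)
    finally show "poly K t = 0" unfolding K_def by (simp add: mult.commute)
  next
    have "degree K \<le> 2 * m - 2" unfolding K_def
      by (rule degree_add_le) (use d degree_smult_le[of e F] in auto)
    then show "degree K < card T" using T(2) m by linarith
  qed
  then have "G = Polynomial.smult (- e) F" unfolding K_def by (simp add: eq_neg_iff_add_eq_0)
  then have PF: "even_P m = Polynomial.smult (- e) (F * F)" unfolding FG(5) by simp
  have e1: "e = -1"
  proof (rule ccontr)
    assume "e \<noteq> -1"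
    then have "e = 1" using e(2) by simp
    then have "lead_coeff (F * F) = -1" using mP unfolding PF by simp
    then have "lead_coeff F * lead_coeff F = -1" unfolding lead_coeff_mult .
    then show False using zero_le_square[of "lead_coeff F"] by linarith
  qed
  \<comment> \<open>At \<open>x^2 = 2\<close> the function \<open>even_u\<close> exceeds 1, so
    \<open>even_P\<close> is negative there for odd \<open>m\<close>.\<close>
  let ?x = "sqrt 2 :: real"
  have "poly (map_poly of_int (even_P m)) ?x = poly (map_poly of_int F) ?x * poly (map_poly of_int F) ?x"
    unfolding PF e1 by (simp add: of_int_poly_hom.hom_mult)
  then have "poly (map_poly of_int (even_P m)) ?x \<ge> 0" by simp
  moreover have "(- 1 :: real) ^ m = real_of_int e" unfolding e_def by simp
  then have "poly (map_poly of_int (even_P m)) ?x = - (even_u m 2 - 1)" unfolding poly_even_P e1 by simp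
  ultimately show False using even_u_values(5)[OF m] by simp
qed

lemma mat_of_poly_pcompose:
  assumes A: "A \<in> carrier_mat n n"
  shows "mat_of_poly n A (pcompose f g) = mat_of_poly n (mat_of_poly n A g) f"
proof (induction f)
  case 0
  then show ?case by (simp add: mat_of_poly_0[OF A] mat_of_poly_0[OF mat_of_poly_closed[OF A]])
next
  case (pCons a f)
  have "mat_of_poly n A [:a:] = a \<cdot>\<^sub>m 1\<^sub>m n"
    unfolding mat_of_poly_pCons[OF A] mat_of_poly_0[OF A] right_mult_zero_mat[OF A] by (rule eq_matI) auto
  then show ?case
    unfolding pcompose_pCons mat_of_poly_add[OF A] mat_of_poly_mult[OF A] pCons.IH
      mat_of_poly_pCons[OF mat_of_poly_closed[OF A]] by simp
qed

text \<open>A root of \<open>f((1 - x) / (1 + x))\<close> is a root of a polynomial of degree at most \<open>degree f\<close>,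
  so that it cannot be a root of an irreducible polynomial of larger degree.\<close>

lemma no_root_of_small_degree:
  fixes x :: real and f :: "int poly"
  assumes P: "irreducible\<^sub>d P" "poly (map_poly of_int P) x = 0"
    and f: "f \<noteq> 0" "degree f < degree P" and x: "x \<noteq> -1"
  shows "poly (map_poly of_int f) ((1 - x) / (1 + x)) \<noteq> 0"
proof
  assume z: "poly (map_poly of_int f) ((1 - x) / (1 + x)) = 0"
  \<comment> \<open>The numerator of \<open>f((1 - x) / (1 + x))\<close> after multiplication by
    \<open>(1 + x) ^ degree f\<close>.\<close>
  define g where "g = (\<Sum>i\<le>degree f. Polynomial.smult (Polynomial.coeff f i) ([:1, -1:] ^ i * [:1, 1:] ^ (degree f - i)))"
  have pg: "poly (map_poly of_int g) t = (1 + t) ^ degree f * poly (map_poly of_int f) ((1 - t) / (1 + t))"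
    if t: "t \<noteq> -1" for t :: real
  proof -
    have nz: "1 + t \<noteq> 0" using t by linarith
    have "poly (map_poly of_int g) t = (\<Sum>i\<le>degree f. of_int (Polynomial.coeff f i) * ((1 - t) ^ i * (1 + t) ^ (degree f - i)))"
      unfolding g_def of_int_poly_hom.hom_sum poly_sum of_int_hom.map_poly_hom_smult of_int_poly_hom.hom_mult of_int_poly_hom.hom_power
      by simp
    also have "\<dots> = (\<Sum>i\<le>degree f. (1 + t) ^ degree f * (of_int (Polynomial.coeff f i) * ((1 - t) / (1 + t)) ^ i))"
    proof (rule sum.cong[OF refl])
      fix i assume "i \<in> {..degree f}"
      then have "(1 + t) ^ degree f = (1 + t) ^ i * (1 + t) ^ (degree f - i)" by (simp flip: power_add)
      then show "of_int (Polynomial.coeff f i) * ((1 - t) ^ i * (1 + t) ^ (degree f - i)) =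
          (1 + t) ^ degree f * (of_int (Polynomial.coeff f i) * ((1 - t) / (1 + t)) ^ i)"
        using nz by (simp add: power_divide)
    qed
    also have "\<dots> = (1 + t) ^ degree f * poly (map_poly of_int f) ((1 - t) / (1 + t))"
      unfolding poly_altdef by (simp add: sum_distrib_left of_int_hom.degree_map_poly_hom coeff_map_poly)
    finally show ?thesis .
  qed
  have dg: "degree g \<le> degree f" unfolding g_def
  proof (rule degree_sum_le)
    fix i assume i: "i \<in> {..degree f}"
    have "degree ([:1, -1:] ^ i * [:1, 1:] ^ (degree f - i) :: int poly) \<le> i + (degree f - i)"
      using degree_mult_le[of "[:1, -1:] ^ i :: int poly" "[:1, 1:] ^ (degree f - i)"]
        degree_power_le[of "[:1, -1:] :: int poly" i] degree_power_le[of "[:1, 1:] :: int poly" "degree f - i"] by simp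
    then have "degree ([:1, -1:] ^ i * [:1, 1:] ^ (degree f - i) :: int poly) \<le> degree f" using i by simp
    then show "degree (Polynomial.smult (Polynomial.coeff f i) ([:1, -1:] ^ i * [:1, 1:] ^ (degree f - i))) \<le> degree f"
      using degree_smult_le order_trans by blast
  qed simp
  have c: "poly (rat_poly (int_rat_poly h)) (complex_of_real t) = of_real (poly (map_poly of_int h) t)" for h t
  proof -
    have "rat_poly (int_rat_poly h) = map_poly of_real (map_poly of_int h)"
      by (rule poly_eqI) (simp add: coeff_map_poly)
    then show ?thesis by (simp add: of_real_hom.poly_map_poly)
  qed
  have "int_rat_poly P dvd int_rat_poly g"
  proof (rule irreducible_dvd_common_root)
    show "irreducible (int_rat_poly P)" using irreducible\<^sub>d_int_rat[OF P(1)] by (simp add: irreducible_connect_field)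
    show "poly (rat_poly (int_rat_poly P)) (complex_of_real x) = 0" unfolding c P(2) by simp
    show "poly (rat_poly (int_rat_poly g)) (complex_of_real x) = 0" unfolding c pg[OF x] z by simp
  qed
  then have "degree (int_rat_poly P) \<le> degree (int_rat_poly g)" if "g \<noteq> 0"
    using that by (intro dvd_imp_degree_le) auto
  then have g0: "g = 0" using dg f(2) by (auto simp: of_int_hom.degree_map_poly_hom)
  \<comment> \<open>The map \<open>t -> (1 - t) / (1 + t)\<close> is an involution, so
    \<open>g = 0\<close> makes \<open>f\<close> vanish wherever the map is defined; the interval (0,
    1) avoids the pole -1.\<close>
  have "poly (map_poly of_int f) t = 0" if t: "t \<in> {0<..<1}" for t :: real
  proof -
    have nz: "1 + t \<noteq> 0" using t by auto
    let ?x = "(1 - t) / (1 + t)"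
    have e: "1 - ?x = 2 * t / (1 + t)" "1 + ?x = 2 / (1 + t)" using nz by (simp_all add: field_simps)
    then have "?x \<noteq> -1" using nz by (metis add.right_inverse divide_eq_0_iff zero_neq_numeral)
    from pg[OF this] have "poly (map_poly of_int f) ((1 - ?x) / (1 + ?x)) = 0"
      unfolding g0 e using nz by simp
    also have "(1 - ?x) / (1 + ?x) = t" unfolding e using nz by simp
    finally show ?thesis .
  qed
  then have "{0<..<1 :: real} \<subseteq> {t. poly (map_poly of_int f) t = 0}" by auto
  then have "infinite {t :: real. poly (map_poly of_int f) t = 0}"
    using infinite_super[of "{0<..<1 :: real}"] infinite_Ioo[of 0 "1 :: real"] by auto
  then have "map_poly of_int f = (0 :: real poly)" using poly_roots_finite by blast
  then show False using f(1) by simp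
qed

lemma even_W_factor:
  assumes m: "m \<ge> 3"
  shows "\<exists>S. even_W m = [:- 1, 1:] * S" "\<exists>S. even_W m = [:1, 1:] * S"
    "\<exists>S. even_W m = [:- 2, 1:] * S" "\<exists>S. even_W m = [:2, 1:] * S"
proof -
  have "\<exists>S. even_W m = [:- t, 1:] * S" if i: "t ^ 2 = int i ^ 2" "i \<in> {1..<m}" for t i
  proof -
    have "(\<Prod>i\<in>{1..<m}. of_nat i ^ 2 - t ^ 2) = 0"
      by (rule prod_zero) (use i in \<open>auto intro!: bexI[of _ i]\<close>)
    then have "poly (even_W m) t = 0" unfolding poly_even_W_int even_u_def by (simp only: mult_zero_right)
    then have "[:- t, 1:] dvd even_W m" by (simp only: poly_eq_0_iff_dvd)
    then show ?thesis unfolding dvd_def .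
  qed
  from this[of 1 1] this[of "-1" 1] this[of 2 2] this[of "-2" 2] m show
    "\<exists>S. even_W m = [:- 1, 1:] * S" "\<exists>S. even_W m = [:1, 1:] * S"
    "\<exists>S. even_W m = [:- 2, 1:] * S" "\<exists>S. even_W m = [:2, 1:] * S" by simp_all
qed

lemma even_u_roots:
  assumes m: "m \<ge> 3"
  obtains y0 y1 y2 :: real where "even_u m y0 = 1" "even_u m y1 = 1" "even_u m y2 = 1"
    "- 1 < y0" "y0 < 0" "1 < y1" "y1 < 2" "2 < y2" "y2 < 4"
proof -
  note v = even_u_values[OF m]
  have ct: "continuous_on S (even_u m :: real \<Rightarrow> real)" for S
    unfolding even_u_def[abs_def] by (intro continuous_intros)
  have "\<exists>y \<ge> - 1. y \<le> 0 \<and> even_u m y = (1 :: real)" by (rule IVT2') (use v ct in auto)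
  then obtain y0 :: real where y0: "- 1 \<le> y0" "y0 \<le> 0" "even_u m y0 = 1" by blast
  have "\<exists>y \<ge> 1. y \<le> 2 \<and> even_u m y = (1 :: real)" by (rule IVT') (use v ct in auto)
  then obtain y1 :: real where y1: "1 \<le> y1" "y1 \<le> 2" "even_u m y1 = 1" by blast
  have "\<exists>y \<ge> 2. y \<le> 4 \<and> even_u m y = (1 :: real)" by (rule IVT2') (use v ct in auto)
  then obtain y2 :: real where y2: "2 \<le> y2" "y2 \<le> 4" "even_u m y2 = 1" by blast
  have "y0 \<noteq> - 1" "y0 \<noteq> 0" "y1 \<noteq> 1" "y1 \<noteq> 2" "y2 \<noteq> 2" "y2 \<noteq> 4" using v y0(3) y1(3) y2(3) by auto
  then show thesis using that[of y0 y1 y2] y0 y1 y2 by linarith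
qed

text \<open>\<open>b\<close> and \<open>c\<close> are closer to 1 than \<open>a\<close> and
  \<open>d\<close>, so their negative logarithms are smaller in absolute value.\<close>

lemma ln_ratio_det:
  fixes a b c d :: real
  assumes "0 < a" "a < b" "b < 1" "0 < d" "d < c" "c < 1"
  shows "ln a * ln d \<noteq> ln b * ln c"
proof -
  have "ln a < ln b" "ln b < 0" "ln d < ln c" "ln c < 0" using assms by (auto intro: ln_less_zero)
  then have "- ln b * - ln c < - ln a * - ln d" by (intro mult_strict_mono) auto
  then show ?thesis by simp
qed

text \<open>In the field \<open>even_W\<close> has the value 1, so its cofactor of
  \<open>1 + x\<close> is the inverse of \<open>1 + x\<close>. The clause on \<open>det\<close>
  serves the irreducibility of the action.\<close>

lemma even_unit_pair:
  assumes m: "m \<ge> 3"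
  shows "\<exists>A A' B B'. unit_pair (2 * m) A A' B B' \<and> neutral_pair (2 * m) A B \<and>
    (\<forall>f. f \<noteq> 0 \<longrightarrow> degree f < 2 * m \<longrightarrow> det (mat_of_poly (2 * m) A f) \<noteq> 0)"
proof -
  let ?P = "even_P m"
  have dP: "degree ?P = 2 * m" and mP: "monic ?P" using even_P_degree[of m] m by auto
  note irr = irreducible_even_P[OF m]
  obtain Sa Sb Sc Sd where S: "even_W m = [:- 1, 1:] * Sa" "even_W m = [:1, 1:] * Sb"
    "even_W m = [:- 2, 1:] * Sc" "even_W m = [:2, 1:] * Sd"
    using even_W_factor[OF m] by blast
  \<comment> \<open>Integral polynomials that represent \<open>(1 - x) / (1 + x)\<close>,
    \<open>(2 - x) / (2 + x)\<close> and their inverses in the field. The products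
    \<open>f1 * g1\<close> and \<open>f2 * g2\<close> are the square of \<open>even_W\<close>, which
    is 1 modulo \<open>even_P\<close>.\<close>
  define f1 g1 f2 g2 where "f1 = [:1, -1:] * Sb" and "g1 = [:1, 1:] * (- Sa)"
    and "f2 = [:2, -1:] * Sd" and "g2 = [:2, 1:] * (- Sc)"
  have neg: "[:1, -1:] = - ([:- 1, 1:] :: int poly)" "[:2, -1:] = - ([:- 2, 1:] :: int poly)"
    by (rule poly_eqI, simp add: coeff_pCons split: nat.splits)+
  have "f1 * g1 = ([:- 1, 1:] * Sa) * ([:1, 1:] * Sb)"
    unfolding f1_def g1_def neg by (simp only: mult_minus_left mult_minus_right minus_minus ac_simps)
  then have fg1: "f1 * g1 = even_W m * even_W m" unfolding S(1)[symmetric] S(2)[symmetric] .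
  have "f2 * g2 = ([:- 2, 1:] * Sc) * ([:2, 1:] * Sd)"
    unfolding f2_def g2_def neg by (simp only: mult_minus_left mult_minus_right minus_minus ac_simps)
  then have fg2: "f2 * g2 = even_W m * even_W m" unfolding S(3)[symmetric] S(4)[symmetric] .
  have "even_W m * even_W m - 1 = (even_W m - 1) * (even_W m + 1)" by (simp add: algebra_simps)
  then have W: "?P dvd even_W m * even_W m - 1" unfolding even_P_W by (simp only: mult.assoc dvd_triv_left)
  have val: "poly (map_poly of_int f1) z = (1 - z) / (1 + z)" "poly (map_poly of_int f2) z = (2 - z) / (2 + z)"
    if z: "even_u m (z ^ 2) = 1" "z \<noteq> -1" "z \<noteq> -2" for z :: "'a :: field_char_0"
  proof -
    have nz: "1 + z \<noteq> 0" "2 + z \<noteq> 0" using z(2,3) by (metis add_eq_0_iff)+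
    have "poly (map_poly of_int (even_W m)) z = 1" unfolding poly_even_W using z(1) .
    then have "poly (map_poly of_int ([:1, 1:] * Sb)) z = 1" "poly (map_poly of_int ([:2, 1:] * Sd)) z = 1"
      unfolding S(2)[symmetric] S(4)[symmetric] by -
    then have "(1 + z) * poly (map_poly of_int Sb) z = 1" "(2 + z) * poly (map_poly of_int Sd) z = 1"
      unfolding of_int_poly_hom.hom_mult poly_mult by simp_all
    then have "poly (map_poly of_int Sb) z = 1 / (1 + z)" "poly (map_poly of_int Sd) z = 1 / (2 + z)"
      using nz by (simp_all add: field_simps)
    then show "poly (map_poly of_int f1) z = (1 - z) / (1 + z)" "poly (map_poly of_int f2) z = (2 - z) / (2 + z)"
      unfolding f1_def f2_def of_int_poly_hom.hom_mult poly_mult by simp_all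
  qed
  have Pz: "poly (map_poly of_int ?P) z = 0" if "even_u m (z ^ 2) = 1" for z :: "'a :: comm_ring_1"
    unfolding poly_even_P that by simp
  obtain y0 y1 y2 :: real where y: "even_u m y0 = 1" "even_u m y1 = 1" "even_u m y2 = 1"
    "- 1 < y0" "y0 < 0" "1 < y1" "y1 < 2" "2 < y2" "y2 < 4" by (rule even_u_roots[OF m])
  \<comment> \<open>The two real roots lie on different sides of \<open>sqrt 2\<close>, the point
    where \<open>(x - 1) / (1 + x)\<close> and \<open>(2 - x) / (2 + x)\<close> are equal.\<close>
  define x1 x2 where "x1 = sqrt y1" and "x2 = sqrt y2"
  have xs: "x1 ^ 2 = y1" "x2 ^ 2 = y2" using y unfolding x1_def x2_def by simp_all
  have xb: "1 < x1" "x1 < 2" "1 < x2" "x2 < 2"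
    using y unfolding x1_def x2_def by (auto intro!: real_less_rsqrt real_less_lsqrt)
  have xu: "even_u m (x1 ^ 2) = 1" "even_u m (x2 ^ 2) = 1" unfolding xs using y by auto
  have x1v: "\<bar>poly (map_poly of_int f1) x1\<bar> = (x1 - 1) / (1 + x1)" "\<bar>poly (map_poly of_int f2) x1\<bar> = (2 - x1) / (2 + x1)"
    using val[OF xu(1)] xb by auto
  have x2v: "\<bar>poly (map_poly of_int f1) x2\<bar> = (x2 - 1) / (1 + x2)" "\<bar>poly (map_poly of_int f2) x2\<bar> = (2 - x2) / (2 + x2)"
    using val[OF xu(2)] xb by auto
  have U: "unit_pair (2 * m) (mat_of_poly (2 * m) (companion ?P) f1) (mat_of_poly (2 * m) (companion ?P) g1)
      (mat_of_poly (2 * m) (companion ?P) f2) (mat_of_poly (2 * m) (companion ?P) g2)"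
    unfolding dP[symmetric]
  proof (rule companion_unit_pair[OF mP irr, of _ _ _ _ x1 x2])
    show "?P dvd f1 * g1 - 1" "?P dvd f2 * g2 - 1" unfolding fg1 fg2 by (rule W)+
    show "poly (map_poly of_int ?P) x1 = 0" "poly (map_poly of_int ?P) x2 = 0" by (rule Pz, rule xu)+
    show "ln \<bar>poly (map_poly of_int f1) x1\<bar> * ln \<bar>poly (map_poly of_int f2) x2\<bar> \<noteq>
      ln \<bar>poly (map_poly of_int f2) x1\<bar> * ln \<bar>poly (map_poly of_int f1) x2\<bar>"
      unfolding x1v x2v
    proof (rule ln_ratio_det)
      have "(x1 - 1) * (2 + x1) < (2 - x1) * (1 + x1)" using xs(1) y by (simp add: algebra_simps power2_eq_square)
      then show "(x1 - 1) / (1 + x1) < (2 - x1) / (2 + x1)" using xb by (simp add: divide_less_eq less_divide_eq mult.commute) (simp add: field_simps)?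
      have "(2 - x2) * (1 + x2) < (x2 - 1) * (2 + x2)" using xs(2) y by (simp add: algebra_simps power2_eq_square)
      then show "(2 - x2) / (2 + x2) < (x2 - 1) / (1 + x2)" using xb by (simp add: divide_less_eq less_divide_eq mult.commute) (simp add: field_simps)?
    qed (use xb in auto)
  qed
  \<comment> \<open>At an imaginary root \<open>1 - z\<close> is the conjugate of
    \<open>1 + z\<close>, and \<open>2 - z\<close> that of \<open>2 + z\<close>.\<close>
  define z where "z = \<i> * complex_of_real (sqrt (- y0))"
  have "z ^ 2 = complex_of_real y0" using y(5) unfolding z_def by (simp add: power_mult_distrib flip: of_real_power)
  moreover have "even_u m (complex_of_real y0) = complex_of_real (even_u m y0)" unfolding even_u_def by simp
  ultimately have zu: "even_u m (z ^ 2) = 1" using y(1) by simp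
  have zn: "z \<noteq> -1" "z \<noteq> -2" unfolding z_def by (auto simp: complex_eq_iff)
  have "norm (1 - z) = norm (1 + z)" "norm (2 - z) = norm (2 + z)" unfolding z_def by (simp_all add: cmod_def)
  moreover have "1 + z \<noteq> 0" "2 + z \<noteq> 0" using zn by (metis add_eq_0_iff)+
  ultimately have "norm (poly (map_poly of_int f1) z) = 1" "norm (poly (map_poly of_int f2) z) = 1"
    unfolding val[OF zu zn] norm_divide by simp_all
  then have N: "neutral_pair (2 * m) (mat_of_poly (2 * m) (companion ?P) f1) (mat_of_poly (2 * m) (companion ?P) f2)"
    using companion_neutral_pair[OF mP _ Pz[OF zu], of f1 f2] m unfolding dP by simp
  note C = companion_carrier[of ?P, unfolded dP]
  \<comment> \<open>If this matrix were singular, \<open>even_P\<close> would divide the composition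
    of \<open>f\<close> with \<open>f1\<close>, and \<open>f\<close> would have the root
    \<open>(1 - x1) / (1 + x1)\<close>.\<close>
  have D: "det (mat_of_poly (2 * m) (mat_of_poly (2 * m) (companion ?P) f1) f) \<noteq> 0" if f: "f \<noteq> 0" "degree f < 2 * m" for f
  proof -
    have "\<not> int_rat_poly ?P dvd int_rat_poly (pcompose f f1)"
    proof
      assume "int_rat_poly ?P dvd int_rat_poly (pcompose f f1)"
      from real_root_dvd[OF this Pz[OF xu(1)]]
      have "poly (map_poly of_int f) (poly (map_poly of_int f1) x1) = 0"
        by (simp add: of_int_hom.map_poly_pcompose poly_pcompose)
      also have "poly (map_poly of_int f1) x1 = (1 - x1) / (1 + x1)" using val(1)[OF xu(1)] xb by simp
      finally show False using no_root_of_small_degree[OF irr Pz[OF xu(1)] f(1)] f(2) xb dP by simp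
    qed
    from companion_poly_det[OF mP irr this] show ?thesis
      unfolding dP mat_of_poly_pcompose[OF C] .
  qed
  from U N D show ?thesis by blast
qed

section \<open>Actions of the free abelian group of rank two\<close>

text \<open>The acting group is Z^2, coded on the natural numbers because existence is asserted for
  groups with this carrier type.\<close>

definition int2 :: "nat \<Rightarrow> int \<times> int" where
  "int2 x = map_prod int_decode int_decode (prod_decode x)"

definition nat_of_int2 :: "int \<times> int \<Rightarrow> nat" where
  "nat_of_int2 p = prod_encode (map_prod int_encode int_encode p)"

lemma int2_inverse [simp]: "int2 (nat_of_int2 p) = p" "nat_of_int2 (int2 x) = x"
  by (simp_all add: int2_def nat_of_int2_def prod.map_comp o_def map_prod.id[unfolded id_def] prod.map_ident)

definition int2_group :: "nat monoid" where
  "int2_group = \<lparr>carrier = UNIV, mult = (\<lambda>x y. nat_of_int2 (int2 x + int2 y)), one = nat_of_int2 0\<rparr>"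

lemma int2_group_simps [simp]:
  "carrier int2_group = UNIV" "mult int2_group x y = nat_of_int2 (int2 x + int2 y)" "one int2_group = nat_of_int2 0"
  by (simp_all add: int2_group_def)

lemma int2_eq: "int2 x = int2 y \<Longrightarrow> x = y"
  by (metis int2_inverse(2))

interpretation int2_group: comm_group int2_group
proof (rule comm_groupI)
  fix x assume "x \<in> carrier int2_group"
  have "nat_of_int2 (- int2 x) \<otimes>\<^bsub>int2_group\<^esub> x = \<one>\<^bsub>int2_group\<^esub>" by simp
  then show "\<exists>y\<in>carrier int2_group. y \<otimes>\<^bsub>int2_group\<^esub> x = \<one>\<^bsub>int2_group\<^esub>" by (metis UNIV_I int2_group_simps(1))
qed (auto simp: ac_simps)

lemma int2_pow: "int2 (x [^]\<^bsub>int2_group\<^esub> (k :: int)) = (k * fst (int2 x), k * snd (int2 x))"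
proof -
  have n: "int2 (x [^]\<^bsub>int2_group\<^esub> m) = (int m * fst (int2 x), int m * snd (int2 x))" for m :: nat
    by (induction m) (auto simp: zero_prod_def plus_prod_def algebra_simps)
  have i: "int2 (inv\<^bsub>int2_group\<^esub> y) = - int2 y" for y
  proof -
    have "int2 (inv\<^bsub>int2_group\<^esub> y \<otimes>\<^bsub>int2_group\<^esub> y) = int2 \<one>\<^bsub>int2_group\<^esub>" by (subst int2_group.l_inv) auto
    then show ?thesis by (simp add: eq_neg_iff_add_eq_0)
  qed
  show ?thesis
  proof (cases k rule: int_cases2)
    case (nonneg m)
    then show ?thesis using n by (simp add: int_pow_int)
  next
    case (nonpos m)
    then show ?thesis using n[of m] by (simp add: int2_group.int_pow_neg_int i uminus_prod_def)
  qed
qed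

lemma finitely_generated_int2_group: "finitely_generated_group int2_group"
proof -
  define x y where "x = nat_of_int2 (1, 0)" and "y = nat_of_int2 (0, 1)"
  let ?S = "{x, y}"
  have sg: "subgroup (generate int2_group ?S) int2_group" by (rule int2_group.generate_is_subgroup) simp
  have g: "x \<in> generate int2_group ?S" "y \<in> generate int2_group ?S" by (auto intro: generate.incl)
  have "z \<in> generate int2_group ?S" for z
  proof -
    have "z = x [^]\<^bsub>int2_group\<^esub> fst (int2 z) \<otimes>\<^bsub>int2_group\<^esub> y [^]\<^bsub>int2_group\<^esub> snd (int2 z)"
      by (rule int2_eq) (simp add: int2_pow x_def y_def)
    then show ?thesis
      using subgroup.m_closed[OF sg int2_group.subgroup_int_pow_closed[OF sg g(1)] int2_group.subgroup_int_pow_closed[OF sg g(2)]]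
      by metis
  qed
  then have "generate int2_group ?S = carrier int2_group" by auto
  then show ?thesis unfolding finitely_generated_group_def
    using int2_group.group_axioms by (intro conjI exI[of _ ?S]) auto
qed

lemma (in comm_group) nilpotent: "nilpotent_group G"
proof -
  have c: "x \<otimes> y \<otimes> inv x \<otimes> inv y = \<one>" if "x \<in> carrier G" "y \<in> carrier G" for x y
  proof -
    have "x \<otimes> y \<otimes> inv x \<otimes> inv y = (x \<otimes> y) \<otimes> inv (x \<otimes> y)" using that by (simp add: m_assoc inv_mult)
    then show ?thesis using that by simp
  qed
  have "{x \<otimes> y \<otimes> inv x \<otimes> inv y | x y. x \<in> carrier G \<and> y \<in> carrier G} = {\<one>}"
    using c by (auto intro!: exI[of _ \<one>])
  then have "lower_central G (Suc 0) = {\<one>}" by (simp add: generate_one)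
  then show ?thesis unfolding nilpotent_group_def using group_axioms by blast
qed

lemma (in group) int_pow_commute:
  assumes xy: "x \<otimes> y = y \<otimes> x" and c: "x \<in> carrier G" "y \<in> carrier G"
  shows "x [^] (i :: int) \<otimes> y [^] (j :: int) = y [^] j \<otimes> x [^] i"
proof -
  have iv: "inv u \<otimes> w = w \<otimes> inv u" if u: "u \<otimes> w = w \<otimes> u" "u \<in> carrier G" "w \<in> carrier G" for u w
  proof -
    have "inv u \<otimes> w = inv u \<otimes> (w \<otimes> u) \<otimes> inv u" using u(2,3) by (simp add: m_assoc)
    also have "\<dots> = w \<otimes> inv u" unfolding u(1)[symmetric] using u(2,3) by (simp add: inv_solve_left')
    finally show ?thesis .
  qed
  have s: "u [^] (k :: int) \<otimes> w = w \<otimes> u [^] k" if u: "u \<otimes> w = w \<otimes> u" "u \<in> carrier G" "w \<in> carrier G" for u w k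
  proof (cases k rule: int_cases2)
    case (nonneg m)
    then show ?thesis using group_commutes_pow[OF u] by (simp add: int_pow_int)
  next
    case (nonpos m)
    then show ?thesis using iv[OF group_commutes_pow[OF u]] u by (simp add: int_pow_neg_int)
  qed
  show ?thesis using s[OF s[OF xy c, symmetric] c(2) int_pow_closed[OF c(1)]] by simp
qed

definition mat_monoid :: "('a :: comm_ring_1 ^ 'n :: finite ^ 'n) monoid" where
  "mat_monoid = \<lparr>carrier = UNIV, mult = (**), one = Finite_Cartesian_Product.mat 1\<rparr>"

text \<open>The unit group of the matrix monoid, which provides the group laws for integer
  exponents.\<close>

abbreviation mat_units :: "('a :: comm_ring_1 ^ 'n :: finite ^ 'n) monoid" where
  "mat_units \<equiv> units_of mat_monoid"

lemma mat_units_simps [simp]: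
  "mult mat_units = (**)" "one mat_units = Finite_Cartesian_Product.mat 1"
  "carrier mat_units = {A. \<exists>B. B ** A = Finite_Cartesian_Product.mat 1 \<and> A ** B = Finite_Cartesian_Product.mat 1}"
  by (auto simp: units_of_def mat_monoid_def Units_def)

lemma monoid_mat_monoid: "monoid mat_monoid"
  by (rule monoidI) (auto simp: mat_monoid_def matrix_mul_assoc)

interpretation mat_units: group mat_units
  by (rule monoid.units_group[OF monoid_mat_monoid])

lemma mat_units_det:
  assumes "A \<in> carrier (mat_units :: (int ^ 'n :: finite ^ 'n) monoid)"
  shows "Determinants.det A = 1 \<or> Determinants.det A = -1"
proof -
  obtain B where "A ** B = Finite_Cartesian_Product.mat 1" using assms by auto
  then have "Determinants.det A * Determinants.det B = 1" using det_mul[of A B] det_mat_1_int by metis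
  then show ?thesis by (simp only: zmult_eq_1_iff) blast
qed

definition int2_rep :: "int ^ 'n ^ 'n \<Rightarrow> int ^ 'n ^ 'n \<Rightarrow> nat \<Rightarrow> int ^ 'n :: finite ^ 'n" where
  "int2_rep A B x = A [^]\<^bsub>mat_units\<^esub> fst (int2 x) ** B [^]\<^bsub>mat_units\<^esub> snd (int2 x)"

locale commuting_units =
  fixes A B :: "int ^ 'n :: finite ^ 'n"
  assumes A: "A \<in> carrier mat_units" and B: "B \<in> carrier mat_units" and AB: "A ** B = B ** A"
begin

lemma int2_rep_closed: "int2_rep A B x \<in> carrier mat_units"
  unfolding int2_rep_def
  using mat_units.m_closed[OF mat_units.int_pow_closed[OF A] mat_units.int_pow_closed[OF B]]
  by (simp only: mat_units_simps(1))

lemma int2_rep_mult: "int2_rep A B (x \<otimes>\<^bsub>int2_group\<^esub> y) = int2_rep A B x ** int2_rep A B y"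
proof -
  let ?a = "\<lambda>k :: int. A [^]\<^bsub>mat_units\<^esub> k" and ?b = "\<lambda>k :: int. B [^]\<^bsub>mat_units\<^esub> k"
  have m: "?a (i + j) = ?a i ** ?a j" "?b (i + j) = ?b i ** ?b j" for i j
    using mat_units.int_pow_mult[OF A] mat_units.int_pow_mult[OF B] by (simp_all only: mat_units_simps(1))
  have c: "?b i ** ?a j = ?a j ** ?b i" for i j
    using mat_units.int_pow_commute[of A B, OF _ A B] AB by (simp only: mat_units_simps(1))
  obtain k l k' l' where x: "int2 x = (k, l)" and y: "int2 y = (k', l')" by (metis surj_pair)
  have "int2_rep A B (x \<otimes>\<^bsub>int2_group\<^esub> y) = ?a (k + k') ** ?b (l + l')" unfolding int2_rep_def by (simp add: x y)
  also have "\<dots> = ?a k ** (?a k' ** ?b l) ** ?b l'" unfolding m by (simp only: matrix_mul_assoc)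
  also have "?a k' ** ?b l = ?b l ** ?a k'" by (rule c[symmetric])
  also have "?a k ** (?b l ** ?a k') ** ?b l' = int2_rep A B x ** int2_rep A B y"
    unfolding int2_rep_def x y by (simp add: matrix_mul_assoc)
  finally show ?thesis .
qed

lemma toral_action_int2: "toral_action int2_group (int2_rep A B)"
  unfolding toral_action_def
proof (intro conjI homI)
  show "int2_rep A B x \<in> carrier GL_int" for x
    using mat_units_det[OF int2_rep_closed] by simp
  show "int2_rep A B (x \<otimes>\<^bsub>int2_group\<^esub> y) = int2_rep A B x \<otimes>\<^bsub>GL_int\<^esub> int2_rep A B y" for x y
    unfolding int2_rep_mult by simp
qed (rule int2_group.group_axioms)

lemma int2_rep_nat: "int2_rep A B (nat_of_int2 (int a, int b)) = A [^]\<^bsub>mat_units\<^esub> a ** B [^]\<^bsub>mat_units\<^esub> b"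
  unfolding int2_rep_def by (simp add: int_pow_int)

lemma int2_rep_generators: "int2_rep A B (nat_of_int2 (1, 0)) = A" "int2_rep A B (nat_of_int2 (0, 1)) = B"
  using int2_rep_nat[of 1 0] int2_rep_nat[of 0 1] mat_units.nat_pow_eone[OF A] mat_units.nat_pow_eone[OF B] by simp_all

text \<open>The iterates of the matrix at \<open>x\<close> are the matrices at the multiples of
  \<open>x\<close>, so a covector periodic under it is fixed by a nontrivial element of the
  group.\<close>

lemma ergodic_int2_rep:
  assumes free: "\<And>a b c d q. (a, b) \<noteq> (c, d) \<Longrightarrow>
      Finite_Cartesian_Product.transpose (int2_rep A B (nat_of_int2 (int a, int b))) *v q =
      Finite_Cartesian_Product.transpose (int2_rep A B (nat_of_int2 (int c, int d))) *v q \<Longrightarrow> q = 0"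
    and x: "int2 x \<noteq> 0"
  shows "ergodic_mat (int2_rep A B x)"
proof -
  obtain Y where Y: "int2_rep A B x ** Y = Finite_Cartesian_Product.mat 1" "Y ** int2_rep A B x = Finite_Cartesian_Product.mat 1"
    using int2_rep_closed[of x] by auto
  show ?thesis
  proof (rule ergodic_matI[OF Y])
    fix j :: nat and q
    assume j: "j > 0" and q: "((\<lambda>q. Finite_Cartesian_Product.transpose (int2_rep A B x) *v q) ^^ j) q = q"
    let ?T = "\<lambda>x. Finite_Cartesian_Product.transpose (int2_rep A B x)"
    have pw: "((\<lambda>q. ?T x *v q) ^^ i) q = ?T (x [^]\<^bsub>int2_group\<^esub> i) *v q" for i
    proof (induction i)
      case 0
      have "int2_rep A B (\<one>\<^bsub>int2_group\<^esub>) = Finite_Cartesian_Product.mat 1" by (rule toral_action_one[OF toral_action_int2])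
      then show ?case by (simp add: transpose_mat)
    next
      case (Suc i)
      have "((\<lambda>q. ?T x *v q) ^^ Suc i) q = ?T x *v (?T (x [^]\<^bsub>int2_group\<^esub> i) *v q)" unfolding funpow.simps o_def Suc ..
      also have "\<dots> = ?T (x [^]\<^bsub>int2_group\<^esub> i \<otimes>\<^bsub>int2_group\<^esub> x) *v q"
        unfolding int2_rep_mult matrix_transpose_mul matrix_vector_mul_assoc ..
      finally show ?case unfolding int2_group.nat_pow_Suc .
    qed
    obtain k l where kl: "int2 (x [^]\<^bsub>int2_group\<^esub> j) = (k, l)" by (metis surj_pair)
    have "int2 (x [^]\<^bsub>int2_group\<^esub> j) = (int j * fst (int2 x), int j * snd (int2 x))"
      using int2_pow[of x "int j"] by (simp add: int_pow_int)
    then have kl0: "(k, l) \<noteq> (0, 0)" using kl j x by (auto simp: zero_prod_def prod_eq_iff)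
    \<comment> \<open>The exponents are split into positive and negative parts. A covector fixed by
      the element \<open>(k, l)\<close> has equal images under the two parts, which is the form of
      \<open>free\<close> with natural exponents.\<close>
    let ?p = "nat_of_int2 (int (nat k), int (nat l))" and ?m = "nat_of_int2 (int (nat (- k)), int (nat (- l)))"
    have "?p = x [^]\<^bsub>int2_group\<^esub> j \<otimes>\<^bsub>int2_group\<^esub> ?m" by (rule int2_eq) (simp add: kl)
    then have "int2_rep A B ?p = int2_rep A B (x [^]\<^bsub>int2_group\<^esub> j) ** int2_rep A B ?m" by (simp only: int2_rep_mult)
    then have "?T ?p *v q = ?T ?m *v (?T (x [^]\<^bsub>int2_group\<^esub> j) *v q)"
      by (simp only: matrix_transpose_mul matrix_vector_mul_assoc)
    also have "?T (x [^]\<^bsub>int2_group\<^esub> j) *v q = q" unfolding pw[symmetric] by (rule q)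
    finally show "q = 0" by (rule free[rotated]) (use kl0 in auto)
  qed
qed

text \<open>The invertible matrices that have \<open>v\<close> as an eigenvector with an eigenvalue
  of modulus one are closed under products and inverses.\<close>

lemma int2_rep_eigenvector:
  fixes v :: "complex ^ 'n"
  assumes v: "map_matrix of_int A *v v = \<alpha> *s v" "norm \<alpha> = 1" "map_matrix of_int B *v v = \<beta> *s v" "norm \<beta> = 1"
  shows "\<exists>z. norm z = 1 \<and> map_matrix of_int (int2_rep A B x) *v v = z *s v"
proof -
  let ?c = "map_matrix of_int :: int ^ 'n ^ 'n \<Rightarrow> complex ^ 'n ^ 'n"
  let ?P = "\<lambda>X. \<exists>z. norm z = 1 \<and> ?c X *v v = z *s v"
  have mm: "?c (X ** Y) = ?c X ** ?c Y" for X Y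
    by (simp add: map_matrix_def matrix_matrix_mult_def Finite_Cartesian_Product.vec_eq_iff)
  have c1: "?c (Finite_Cartesian_Product.mat 1) = Finite_Cartesian_Product.mat 1"
    by (simp add: map_matrix_def Finite_Cartesian_Product.mat_def Finite_Cartesian_Product.vec_eq_iff)
  have P1: "?P (Finite_Cartesian_Product.mat 1)" unfolding c1 by (intro exI[of _ 1]) simp
  have Pm: "?P (X ** Y)" if "?P X" "?P Y" for X Y
  proof -
    obtain z w where zw: "norm z = 1" "?c X *v v = z *s v" "norm w = 1" "?c Y *v v = w *s v" using \<open>?P X\<close> \<open>?P Y\<close> by blast
    have "?c (X ** Y) *v v = ?c X *v (?c Y *v v)" unfolding mm by (simp only: matrix_vector_mul_assoc)
    also have "\<dots> = (w * z) *s v" unfolding zw vec.scale zw(2) by (simp add: vector_smult_assoc)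
    finally show ?thesis using zw by (intro exI[of _ "w * z"]) (simp add: norm_mult)
  qed
  have Pi: "?P Y" if XY: "?P X" "Y ** X = Finite_Cartesian_Product.mat 1" for X Y
  proof -
    obtain z where z: "norm z = 1" "?c X *v v = z *s v" using XY(1) by blast
    have z0: "z \<noteq> 0" using z(1) by auto
    have "v = ?c (Y ** X) *v v" unfolding XY(2) c1 by simp
    also have "\<dots> = ?c Y *v (?c X *v v)" unfolding mm by (simp only: matrix_vector_mul_assoc)
    also have "\<dots> = z *s (?c Y *v v)" unfolding z(2) by (rule vec.scale)
    finally have "inverse z *s v = inverse z *s (z *s (?c Y *v v))" by (rule arg_cong)
    also have "\<dots> = ?c Y *v v" using z0 by (simp add: vector_smult_assoc)
    finally show ?thesis using z(1) by (intro exI[of _ "inverse z"]) (simp add: norm_inverse)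
  qed
  have Pn: "?P (X [^]\<^bsub>mat_units\<^esub> m)" if "?P X" for X and m :: nat
    by (induction m) (use P1 Pm[OF _ that] in \<open>simp_all\<close>)
  have Pz: "?P (X [^]\<^bsub>mat_units\<^esub> k)" if X: "?P X" "X \<in> carrier mat_units" for X and k :: int
  proof (cases k rule: int_cases2)
    case (nonneg m)
    then show ?thesis using Pn[OF X(1)] by (simp add: int_pow_int)
  next
    case (nonpos m)
    have "inv\<^bsub>mat_units\<^esub> (X [^]\<^bsub>mat_units\<^esub> m) ** (X [^]\<^bsub>mat_units\<^esub> m) = Finite_Cartesian_Product.mat 1"
      using mat_units.l_inv[OF mat_units.nat_pow_closed[OF X(2), of m]] by (simp only: mat_units_simps(1,2))
    from Pi[OF Pn[OF X(1)] this] show ?thesis unfolding nonpos mat_units.int_pow_neg_int[OF X(2)] .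
  qed
  have "?P A" "?P B" using v by blast+
  then show ?thesis unfolding int2_rep_def by (intro Pm Pz A B)
qed

end

lemma hmat_mult:
  fixes X Y :: "'a :: semiring_1 mat"
  assumes "X \<in> carrier_mat CARD('n) CARD('n)" "Y \<in> carrier_mat CARD('n) CARD('n)"
  shows "hmat (X * Y) = hmat X ** (hmat Y :: 'a ^ 'n :: finite ^ 'n)"
  using assms by (simp add: jmat_inj[symmetric] jmat_mult mult_carrier_mat[OF assms])

lemma hmat_one: "hmat (1\<^sub>m CARD('n)) = (Finite_Cartesian_Product.mat 1 :: 'a :: semiring_1 ^ 'n :: finite ^ 'n)"
  by (simp add: jmat_inj[symmetric] jmat_one)

lemma hmat_pow:
  assumes A: "A \<in> carrier_mat CARD('n) CARD('n)"
  shows "(hmat A :: int ^ 'n :: finite ^ 'n) [^]\<^bsub>mat_units\<^esub> k = hmat (A ^\<^sub>m k)"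
proof (induction k)
  case 0
  then show ?case using A by (simp add: hmat_one)
next
  case (Suc k)
  then show ?case using hmat_mult[OF pow_carrier_mat[OF A] A, of k] by simp
qed

lemma transpose_mult_vec_eq_imp_0:
  fixes X Y :: "int mat" and q :: "int ^ 'n :: finite"
  assumes c: "X \<in> carrier_mat CARD('n) CARD('n)" "Y \<in> carrier_mat CARD('n) CARD('n)"
    and d: "Determinant.det (X - Y) \<noteq> 0"
    and q: "Finite_Cartesian_Product.transpose (hmat X) *v q = Finite_Cartesian_Product.transpose (hmat Y) *v q"
  shows "q = 0"
proof (rule ccontr)
  assume q0: "q \<noteq> 0"
  have M: "X - Y \<in> carrier_mat CARD('n) CARD('n)" by (rule minus_carrier_mat[OF c(2)])
  then have D: "transpose_mat (X - Y) \<in> carrier_mat CARD('n) CARD('n)" by simp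
  have "transpose_mat X *\<^sub>v jvec q = transpose_mat Y *\<^sub>v jvec q"
    using arg_cong[OF q, of jvec] unfolding jvec_mult jmat_transpose jmat_hmat[OF c(1)] jmat_hmat[OF c(2)] .
  moreover have "transpose_mat (X - Y) = transpose_mat X - transpose_mat Y" by (rule eq_matI) (use c in auto)
  ultimately have "transpose_mat (X - Y) *\<^sub>v jvec q = transpose_mat Y *\<^sub>v jvec q - transpose_mat Y *\<^sub>v jvec q"
    using minus_mult_distrib_mat_vec[of "transpose_mat X" "CARD('n)" "CARD('n)" "transpose_mat Y" "jvec q"] c by simp
  also have "\<dots> = 0\<^sub>v CARD('n)" using c by (intro eq_vecI) auto
  finally have "transpose_mat (X - Y) *\<^sub>v jvec q = 0\<^sub>v CARD('n)" .
  moreover have "jvec q \<noteq> 0\<^sub>v CARD('n)" using q0 jvec_inj[of q 0] by (simp add: jvec_0)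
  ultimately have "Determinant.det (transpose_mat (X - Y)) = 0"
    unfolding det_0_iff_vec_prod_zero[OF D] using jvec_carrier[of q] by blast
  then show False using d det_transpose[OF M] by simp
qed

text \<open>More maps leave fewer invariant sets; thus a single ergodic element makes the action
  ergodic.\<close>

lemma ergodic_family_mono:
  assumes "ergodic_family M F" "F \<subseteq> F'"
  shows "ergodic_family M F'"
  unfolding ergodic_family_def
proof (intro ballI impI)
  fix E assume E: "E \<in> sets M" "\<forall>T\<in>F'. T -` E \<inter> space M = E"
  then have "\<forall>T\<in>F. T -` E \<inter> space M = E" using assms(2) by (auto dest: subsetD)
  then show "emeasure M E = 0 \<or> emeasure M (space M - E) = 0"
    using assms(1) E(1) unfolding ergodic_family_def by simp
qed

lemma unit_pair_commuting_units:
  assumes "unit_pair CARD('n) A A' B B'"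
  shows "commuting_units (hmat A) (hmat B :: int ^ 'n :: finite ^ 'n)"
proof
  have c: "A \<in> carrier_mat CARD('n) CARD('n)" "A' \<in> carrier_mat CARD('n) CARD('n)"
    "B \<in> carrier_mat CARD('n) CARD('n)" "B' \<in> carrier_mat CARD('n) CARD('n)"
    and e: "A * A' = 1\<^sub>m CARD('n)" "A' * A = 1\<^sub>m CARD('n)" "B * B' = 1\<^sub>m CARD('n)" "B' * B = 1\<^sub>m CARD('n)" "A * B = B * A"
    using assms unfolding unit_pair_def by blast+
  show "(hmat A :: int ^ 'n ^ 'n) \<in> carrier mat_units" unfolding mat_units_simps
    using hmat_mult[OF c(1,2)] hmat_mult[OF c(2,1)] unfolding e hmat_one by auto
  show "(hmat B :: int ^ 'n ^ 'n) \<in> carrier mat_units" unfolding mat_units_simps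
    using hmat_mult[OF c(3,4)] hmat_mult[OF c(4,3)] unfolding e hmat_one by auto
  show "hmat A ** (hmat B :: int ^ 'n ^ 'n) = hmat B ** hmat A"
    unfolding hmat_mult[OF c(1,3), symmetric] hmat_mult[OF c(3,1), symmetric] e(5) ..
qed

lemma gph_int2_rep:
  assumes U: "unit_pair CARD('n) A A' B B'" and N: "neutral_pair CARD('n) A B"
  shows "gph_higher_rank_nilpotent_action int2_group (int2_rep (hmat A) (hmat B :: int ^ 'n :: finite ^ 'n))"
proof -
  interpret commuting_units "hmat A :: int ^ 'n ^ 'n" "hmat B" by (rule unit_pair_commuting_units[OF U])
  let ?\<rho> = "int2_rep (hmat A) (hmat B :: int ^ 'n ^ 'n)"
  have c: "A \<in> carrier_mat CARD('n) CARD('n)" "B \<in> carrier_mat CARD('n) CARD('n)"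
    and ne: "\<And>a b c d. (a, b) \<noteq> (c, d) \<Longrightarrow> Determinant.det (A ^\<^sub>m a * B ^\<^sub>m b - A ^\<^sub>m c * B ^\<^sub>m d) \<noteq> 0"
    using U unfolding unit_pair_def by blast+
  have pc: "A ^\<^sub>m a * B ^\<^sub>m b \<in> carrier_mat CARD('n) CARD('n)" for a b
    by (rule mult_carrier_mat[OF pow_carrier_mat[OF c(1)] pow_carrier_mat[OF c(2)]])
  have nat: "?\<rho> (nat_of_int2 (int a, int b)) = hmat (A ^\<^sub>m a * B ^\<^sub>m b)" for a b
    unfolding int2_rep_nat hmat_pow[OF c(1)] hmat_pow[OF c(2)]
    by (rule hmat_mult[OF pow_carrier_mat[OF c(1)] pow_carrier_mat[OF c(2)], symmetric])
  have erg: "ergodic_mat (?\<rho> x)" if "int2 x \<noteq> 0" for x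
  proof (rule ergodic_int2_rep[OF _ that])
    fix a b c d :: nat and q :: "int ^ 'n"
    assume n: "(a, b) \<noteq> (c, d)"
      and q: "Finite_Cartesian_Product.transpose (?\<rho> (nat_of_int2 (int a, int b))) *v q =
        Finite_Cartesian_Product.transpose (?\<rho> (nat_of_int2 (int c, int d))) *v q"
    show "q = 0" by (rule transpose_mult_vec_eq_imp_0[OF pc pc ne[OF n] q[unfolded nat]])
  qed
  have "ergodic_family torus_measure {toral_aut (?\<rho> (nat_of_int2 (1, 0)))}"
    using erg[of "nat_of_int2 (1, 0)"] unfolding ergodic_mat_def by (simp add: zero_prod_def)
  then have e: "ergodic_family torus_measure ((\<lambda>h. toral_aut (?\<rho> h)) ` carrier int2_group)"
    by (rule ergodic_family_mono) simp
  obtain v :: "complex Matrix.vec" and \<alpha> \<beta> where v: "v \<in> carrier_vec CARD('n)" "v \<noteq> 0\<^sub>v CARD('n)" "norm \<alpha> = 1" "norm \<beta> = 1"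
    "map_mat of_int A *\<^sub>v v = \<alpha> \<cdot>\<^sub>v v" "map_mat of_int B *\<^sub>v v = \<beta> \<cdot>\<^sub>v v"
    using N unfolding neutral_pair_def by blast
  define w :: "complex ^ 'n" where "w = hvec v"
  have w0: "w \<noteq> 0" using v(1,2) jvec_hvec[OF v(1)] jvec_0 unfolding w_def by metis
  have ev: "map_matrix of_int (hmat X) *v w = z *s w"
    if "X \<in> carrier_mat CARD('n) CARD('n)" "map_mat of_int X *\<^sub>v v = z \<cdot>\<^sub>v v" for X z
  proof -
    have "jvec (map_matrix of_int (hmat X) *v w) = jvec (z *s w)"
      unfolding jvec_mult jmat_map jmat_hmat[OF that(1)] jvec_smult w_def jvec_hvec[OF v(1)] by (rule that(2))
    then show ?thesis by (simp only: jvec_inj)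
  qed
  have nh: "\<not> hyperbolic_mat (?\<rho> x)" for x
    using int2_rep_eigenvector[OF ev[OF c(1) v(5)] v(3) ev[OF c(2) v(6)] v(4), of x] w0
    unfolding hyperbolic_mat_def int_mat_eigenvalue_def by blast
  have hr: "higher_rank int2_group ?\<rho>" unfolding higher_rank_def
  proof (rule bexI[of _ "?\<rho> (nat_of_int2 (1, 0))"], rule bexI[of _ "?\<rho> (nat_of_int2 (0, 1))"], intro allI impI)
    let ?x = "nat_of_int2 (1, 0)" and ?y = "nat_of_int2 (0, 1)"
    fix k l :: int assume kl: "(k, l) \<noteq> (0, 0)"
    let ?z = "?x [^]\<^bsub>int2_group\<^esub> k \<otimes>\<^bsub>int2_group\<^esub> ?y [^]\<^bsub>int2_group\<^esub> l"
    have "int2 ?z = (k, l)" by (simp add: int2_pow)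
    then have "ergodic_mat (?\<rho> ?z)" using kl by (intro erg) (auto simp: zero_prod_def)
    moreover have "?\<rho> ?x [^]\<^bsub>GL_int\<^esub> k = ?\<rho> (?x [^]\<^bsub>int2_group\<^esub> k)" "?\<rho> ?y [^]\<^bsub>GL_int\<^esub> l = ?\<rho> (?y [^]\<^bsub>int2_group\<^esub> l)"
      by (rule toral_action_int_pow[OF toral_action_int2, symmetric], simp)+
    ultimately show "ergodic_mat (?\<rho> ?x [^]\<^bsub>GL_int\<^esub> k \<otimes>\<^bsub>GL_int\<^esub> ?\<rho> ?y [^]\<^bsub>GL_int\<^esub> l)"
      by (simp only: int2_rep_mult GL_int_simps(1))
  qed simp_all
  show ?thesis
    unfolding gph_higher_rank_nilpotent_action_def genuinely_partially_hyperbolic_def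
    using finitely_generated_int2_group int2_group.nilpotent toral_action_int2 e nh hr by blast
qed

text \<open>If no nonzero polynomial in \<open>A\<close> of degree below the dimension is singular, then the iterates
  of a nonzero rational vector under \<open>A\<close> span the whole space.\<close>

lemma irreducible_int2_rep:
  assumes U: "unit_pair CARD('n) A A' B B'"
    and f: "\<And>f. f \<noteq> 0 \<Longrightarrow> degree f < CARD('n) \<Longrightarrow> Determinant.det (mat_of_poly CARD('n) A f) \<noteq> 0"
  shows "irreducible_action int2_group (int2_rep (hmat A) (hmat B :: int ^ 'n :: finite ^ 'n))"
  unfolding irreducible_action_def
proof (intro allI impI, elim conjE)
  interpret commuting_units "hmat A :: int ^ 'n ^ 'n" "hmat B" by (rule unit_pair_commuting_units[OF U])
  fix V :: "(real ^ 'n) set"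
  assume V: "rational_subspace V"
    and inv: "\<forall>h\<in>carrier int2_group. (\<lambda>x. map_matrix of_int (int2_rep (hmat A) (hmat B :: int ^ 'n ^ 'n) h) *v x) ` V \<subseteq> V"
  let ?N = "CARD('n)"
  have A: "A \<in> carrier_mat ?N ?N" using U unfolding unit_pair_def by blast
  let ?Aq = "map_mat rat_of_int A"
  have Aq: "?Aq \<in> carrier_mat ?N ?N" using A by simp
  note mc = mat_of_poly_closed[OF Aq]
  obtain S where S: "\<And>v i. v \<in> S \<Longrightarrow> vec_nth v i \<in> \<rat>" "V = Real_Vector_Spaces.span S"
    using V unfolding rational_subspace_def by blast
  have sV: "subspace V" unfolding S(2) by simp
  show "V = {0} \<or> V = UNIV"
  proof (cases "S \<subseteq> {0}")
    case True
    then have "V \<subseteq> {0}" unfolding S(2) by (simp add: span_minimal)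
    then show ?thesis using subspace_0[OF sV] by blast
  next
    case False
    then obtain s where s: "s \<in> S" "s \<noteq> 0" by blast
    have "\<forall>i. \<exists>r :: rat. vec_nth s i = of_rat r" using S(1)[OF s(1)] unfolding Rats_def by blast
    then obtain r :: "'n \<Rightarrow> rat" where r: "\<And>i. vec_nth s i = of_rat (r i)" by metis
    define t :: "rat ^ 'n" where "t = vec_lambda r"
    define re :: "rat ^ 'n \<Rightarrow> real ^ 'n" where "re v = vec_lambda (\<lambda>i. of_rat (vec_nth v i))" for v
    have rt: "re t = s" unfolding re_def t_def by (simp add: Finite_Cartesian_Product.vec_eq_iff r)
    have "re 0 = 0" unfolding re_def by (simp add: Finite_Cartesian_Product.vec_eq_iff)
    then have "t \<noteq> 0" using s(2) rt by auto
    then have t0: "jvec t \<noteq> 0\<^sub>v ?N" using jvec_inj[of t 0] by (simp add: jvec_0)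
    \<comment> \<open>\<open>ev p\<close> is \<open>p(A) t\<close> for a nonzero rational vector
      \<open>t\<close> whose real image lies in \<open>V\<close>.\<close>
    define ev :: "rat poly \<Rightarrow> rat ^ 'n" where "ev p = hvec (mat_of_poly ?N ?Aq p *\<^sub>v jvec t)" for p
    have je: "jvec (ev p) = mat_of_poly ?N ?Aq p *\<^sub>v jvec t" for p
      unfolding ev_def by (rule jvec_hvec[OF mult_mat_vec_carrier[OF mc jvec_carrier]])
    have ev_add: "ev (p + q) = ev p + ev q" for p q
    proof -
      have "mat_of_poly ?N ?Aq (p + q) *\<^sub>v jvec t = mat_of_poly ?N ?Aq p *\<^sub>v jvec t + mat_of_poly ?N ?Aq q *\<^sub>v jvec t"
        unfolding mat_of_poly_add[OF Aq] by (rule add_mult_distrib_mat_vec[OF mc mc jvec_carrier])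
      then show ?thesis unfolding ev_def
        using mat_of_poly_dim[OF Aq] by (simp add: hvec_def Finite_Cartesian_Product.vec_eq_iff)
    qed
    have ev_smult: "ev (Polynomial.smult k p) = k *s ev p" for k p
    proof -
      have "Matrix.row (mat_of_poly ?N ?Aq p) i \<in> carrier_vec ?N" for i
        using mat_of_poly_dim[OF Aq] by (intro carrier_vecI) simp
      note smult_scalar_prod_distrib[OF this jvec_carrier]
      then show ?thesis unfolding ev_def mat_of_poly_smult[OF Aq]
        using mat_of_poly_dim[OF Aq] by (simp add: hvec_def Finite_Cartesian_Product.vec_eq_iff)
    qed
    have ev0: "ev 0 = 0" using ev_smult[of 0 0] by simp
    have ev_sum: "ev (sum g I) = (\<Sum>i\<in>I. ev (g i))" if "finite I" for g :: "'n \<Rightarrow> rat poly" and I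
      using that by (induction I) (simp_all add: ev0 ev_add)
    let ?X = "\<lambda>i. Polynomial.monom (1 :: rat) i"
    have inV: "re (ev (?X i)) \<in> V" for i
    proof (induction i)
      case 0
      have "ev (?X 0) = t" unfolding ev_def monom_0 one_pCons[symmetric] mat_of_poly_1[OF Aq] by simp
      then show ?case using s(1) rt unfolding S(2) by (simp add: span_base)
    next
      case (Suc i)
      have "mat_of_poly ?N ?Aq (?X (Suc i)) = ?Aq * mat_of_poly ?N ?Aq (?X i)"
        unfolding monom_Suc mat_of_poly_pCons[OF Aq]
        by (rule eq_matI) (use A mat_of_poly_dim[OF Aq] in auto)
      then have "jvec (ev (?X (Suc i))) = ?Aq *\<^sub>v jvec (ev (?X i))"
        unfolding je using assoc_mult_mat_vec[OF Aq mc jvec_carrier] by simp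
      also have "\<dots> = jvec (map_matrix of_int (hmat A) *v ev (?X i))"
        unfolding jvec_mult jmat_map jmat_hmat[OF A] ..
      finally have "ev (?X (Suc i)) = map_matrix of_int (hmat A) *v ev (?X i)" by (simp only: jvec_inj)
      then have "re (ev (?X (Suc i))) = map_matrix of_int (hmat A) *v re (ev (?X i))"
        unfolding re_def
        by (simp add: map_matrix_def matrix_vector_mult_def Finite_Cartesian_Product.vec_eq_iff of_rat_sum of_rat_mult)
      also have "\<dots> = map_matrix of_int (int2_rep (hmat A) (hmat B :: int ^ 'n ^ 'n) (nat_of_int2 (1, 0))) *v re (ev (?X i))"
        unfolding int2_rep_generators ..
      also have "\<dots> \<in> V" using inv Suc by auto
      finally show ?case .
    qed
    \<comment> \<open>The columns of \<open>K\<close> are the vectors \<open>A^i t\<close> for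
      \<open>i\<close> below the dimension. All of them lie in \<open>V\<close>, and they span the
      whole space once \<open>K\<close> is invertible.\<close>
    define K :: "rat ^ 'n ^ 'n" where "K = vec_lambda (\<lambda>j. vec_lambda (\<lambda>i. vec_nth (ev (?X (xi i))) j))"
    have ker: "c = 0" if Kc: "K *v c = 0" for c
    proof (rule ccontr)
      assume c0: "c \<noteq> 0"
      \<comment> \<open>A rational relation between the columns is cleared of denominators, because
        \<open>f\<close> speaks of integer polynomials.\<close>
      obtain D :: int where D: "D > 0" "\<forall>x\<in>range (vec_nth c). \<exists>k :: int. of_int D * x = of_int k"
        using common_denominator[of "range (vec_nth c)"] by auto
      then have "\<forall>i. \<exists>k :: int. of_int D * vec_nth c i = of_int k" by blast
      then obtain d where d: "\<And>i. of_int D * vec_nth c i = of_int (d i)" by metis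
      obtain i0 where "vec_nth c i0 \<noteq> 0" using c0 by (auto simp: Finite_Cartesian_Product.vec_eq_iff)
      then have d0: "d i0 \<noteq> 0" using d[of i0] D(1) by auto
      define p where "p = (\<Sum>i\<in>UNIV. Polynomial.monom (d i) (xi (i :: 'n)))"
      have xi: "xi i = xi j \<longleftrightarrow> i = j" for i j :: 'n by (metis ix_xi)
      have "Polynomial.coeff p (xi i0) = d i0" unfolding p_def coeff_sum by (simp add: xi)
      then have p0: "p \<noteq> 0" using d0 by auto
      have dp: "degree p < ?N" unfolding p_def
        by (rule degree_sum_less) (auto intro: le_less_trans[OF degree_monom_le])
      have "int_rat_poly p = (\<Sum>i\<in>UNIV. Polynomial.smult (of_int D * vec_nth c i) (?X (xi i)))"
        unfolding p_def of_int_poly_hom.hom_sum d by (simp add: of_int_hom.map_poly_hom_monom smult_monom)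
      then have "ev (int_rat_poly p) = (\<Sum>i\<in>UNIV. (of_int D * vec_nth c i) *s ev (?X (xi i)))"
        by (simp only: ev_sum[OF finite] ev_smult)
      also have "\<dots> = of_int D *s (K *v c)"
        unfolding K_def by (simp add: Finite_Cartesian_Product.vec_eq_iff matrix_vector_mult_def sum_distrib_left mult_ac)
      also have "\<dots> = 0" unfolding Kc by simp
      finally have z: "mat_of_poly ?N ?Aq (int_rat_poly p) *\<^sub>v jvec t = 0\<^sub>v ?N"
        unfolding je[symmetric] by (simp only: jvec_0)
      have "Determinant.det (mat_of_poly ?N ?Aq (int_rat_poly p)) = 0"
        using det_0_iff_vec_prod_zero[OF mc] z t0 jvec_carrier by blast
      then have "Determinant.det (mat_of_poly ?N A p) = 0"
        unfolding of_int_hom.mat_of_poly_hom[OF A] by simp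
      then show False using f[OF p0 dp] by contradiction
    qed
    have "\<exists>L. L ** K = Finite_Cartesian_Product.mat 1"
      unfolding matrix_left_invertible_ker by (intro allI impI) (rule ker)
    then obtain L where LK: "L ** K = Finite_Cartesian_Product.mat 1" ..
    have KL: "K ** L = Finite_Cartesian_Product.mat 1" by (rule iffD1[OF matrix_left_right_inverse LK])
    let ?r = "map_matrix of_rat :: rat ^ 'n ^ 'n \<Rightarrow> real ^ 'n ^ 'n"
    have rKL: "?r K ** ?r L = Finite_Cartesian_Product.mat 1"
    proof -
      have "?r K ** ?r L = ?r (K ** L)"
        by (simp add: map_matrix_def matrix_matrix_mult_def Finite_Cartesian_Product.vec_eq_iff of_rat_sum of_rat_mult)
      moreover have "?r (Finite_Cartesian_Product.mat 1) = Finite_Cartesian_Product.mat 1"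
        by (simp add: map_matrix_def Finite_Cartesian_Product.mat_def Finite_Cartesian_Product.vec_eq_iff)
      ultimately show ?thesis unfolding KL by (rule trans)
    qed
    have "y \<in> V" for y
    proof -
      have "y = ?r K *v (?r L *v y)" unfolding matrix_vector_mul_assoc rKL by simp
      also have "\<dots> \<in> V" unfolding matrix_mult_sum scalar_mult_eq_scaleR
      proof (intro subspace_sum[OF sV] subspace_scale[OF sV])
        fix i :: 'n
        have "column i (?r K) = re (ev (?X (xi i)))"
          unfolding column_def K_def re_def by (simp add: map_matrix_def Finite_Cartesian_Product.vec_eq_iff)
        then show "column i (?r K) \<in> V" using inV by simp
      qed
      finally show ?thesis .
    qed
    then show ?thesis by blast
  qed
qed

theorem theorem1p6:
  shows "(even CARD('n::finite) \<and> CARD('n) \<ge> 6 \<longrightarrow>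
            (\<exists>(H :: nat monoid) (\<rho> :: nat \<Rightarrow> int ^ 'n ^ 'n).
               gph_higher_rank_nilpotent_action H \<rho> \<and> irreducible_action H \<rho>)) \<and>
         (odd CARD('n) \<and> CARD('n) \<ge> 9 \<longrightarrow>
            (\<exists>(H :: nat monoid) (\<rho> :: nat \<Rightarrow> int ^ 'n ^ 'n).
               gph_higher_rank_nilpotent_action H \<rho>) \<and>
            (\<forall>(H :: 'h monoid) (\<rho> :: 'h \<Rightarrow> int ^ 'n ^ 'n).
               gph_higher_rank_nilpotent_action H \<rho> \<longrightarrow> \<not> irreducible_action H \<rho>)) \<and>
         (CARD('n) \<le> 5 \<or> CARD('n) = 7 \<longrightarrow>
            \<not> (\<exists>(H :: 'h monoid) (\<rho> :: 'h \<Rightarrow> int ^ 'n ^ 'n).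
               gph_higher_rank_nilpotent_action H \<rho>))"
proof (intro conjI impI allI)
  assume n: "even CARD('n) \<and> CARD('n) \<ge> 6"
  define m where "m = CARD('n) div 2"
  have m: "m \<ge> 3" "2 * m = CARD('n)" using n unfolding m_def by auto
  obtain A A' B B' where AB: "unit_pair CARD('n) A A' B B'" "neutral_pair CARD('n) A B"
    "\<And>f. f \<noteq> 0 \<Longrightarrow> degree f < CARD('n) \<Longrightarrow> Determinant.det (mat_of_poly CARD('n) A f) \<noteq> 0"
    using even_unit_pair[OF m(1)] unfolding m(2) by blast
  show "\<exists>(H :: nat monoid) (\<rho> :: nat \<Rightarrow> int ^ 'n ^ 'n). gph_higher_rank_nilpotent_action H \<rho> \<and> irreducible_action H \<rho>"
    using gph_int2_rep[OF AB(1,2)] irreducible_int2_rep[OF AB(1,3)] by blast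
next
  assume n: "odd CARD('n) \<and> CARD('n) \<ge> 9"
  \<comment> \<open>A block of even size \<open>2 * m\<close>, at least 6, which is neutral, is
    joined to the cubic block of size 3.\<close>
  define m where "m = (CARD('n) - 3) div 2"
  have m: "m \<ge> 3" "2 * m + 3 = CARD('n)" using n unfolding m_def by presburger+
  obtain A A' B B' where AB: "unit_pair (2 * m) A A' B B'" "neutral_pair (2 * m) A B"
    using even_unit_pair[OF m(1)] by blast
  obtain C C' D D' where CD: "unit_pair 3 C C' D D'" using cubic_unit_pair by blast
  have c: "A \<in> carrier_mat (2 * m) (2 * m)" "B \<in> carrier_mat (2 * m) (2 * m)"
    "C \<in> carrier_mat 3 3" "D \<in> carrier_mat 3 3"
    using AB(1) CD unfolding unit_pair_def by blast+
  show "\<exists>(H :: nat monoid) (\<rho> :: nat \<Rightarrow> int ^ 'n ^ 'n). gph_higher_rank_nilpotent_action H \<rho>"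
    using gph_int2_rep[where 'n = 'n, OF unit_pair_block_diag[OF AB(1) CD, unfolded m(2)]
      neutral_pair_block_diag[OF AB(2) c, unfolded m(2)]] by blast
next
  fix H :: "'h monoid" and \<rho> :: "'h \<Rightarrow> int ^ 'n ^ 'n"
  assume "odd CARD('n) \<and> CARD('n) \<ge> 9" "gph_higher_rank_nilpotent_action H \<rho>"
  then show "\<not> irreducible_action H \<rho>" using gph_action_dimension(3) by blast
next
  assume n: "CARD('n) \<le> 5 \<or> CARD('n) = 7"
  show "\<not> (\<exists>(H :: 'h monoid) (\<rho> :: 'h \<Rightarrow> int ^ 'n ^ 'n). gph_higher_rank_nilpotent_action H \<rho>)"
  proof
    assume "\<exists>(H :: 'h monoid) (\<rho> :: 'h \<Rightarrow> int ^ 'n ^ 'n). gph_higher_rank_nilpotent_action H \<rho>"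
    then obtain H :: "'h monoid" and \<rho> :: "'h \<Rightarrow> int ^ 'n ^ 'n" where "gph_higher_rank_nilpotent_action H \<rho>" by blast
    from gph_action_dimension(1,2)[OF this] show False using n by linarith
  qed
qed

end
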